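(* Let $G$ be a cactus graph with $\operatorname{rad}(G)=2$ and $\operatorname{diam}(G)=3$. Then $G$ is $\chi_\rho$-critical if and only if it is isomorphic to one of the following graphs: (i) $P_4$; (ii) $\mathcal{G}_{1}^{(5)}(0,m_1)$ with $m_1\ge 2$; (iii) $\mathcal{G}_{2}^{(4)}(1,0;1,0)$; (iv) $\mathcal{G}_{2}^{(4)}(0,m_1;0,m_2)$ with $m_1,m_2\ge 1$; (v) $\mathcal{G}_{3}^{(3)}(1,0;1,0;1,0)$; (vi) $\mathcal{G}_{3}^{(3)}(2,0;2,0;0,1)$; (vii) $\mathcal{G}_{3}^{(3)}(0,m_1;0,m_2;0,m_3)$ with $m_1,m_2,m_3\ge 2$; (viii) $\mathcal{G}_{3}^{(3)}(0,m_1;0,m_2;2,0)$ with $m_1,m_2\ge 2$; (ix) $\mathcal{G}_{3}^{(3)}(0,m_1;2,0;2,0)$ with $m_1\ge 2$; (x) $\mathcal{H}(2,0;0,1)$; (xi) $\mathcal{H}(0,m_1;0,m_2)$ with $m_1,m_2\ge 2$; (xii) $\mathcal{H}(0,m_1;2,0)$ with $m_1\ge 2$.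
   Context: All graphs are finite and simple. $\operatorname{rad}(G)$ and $\operatorname{diam}(G)$ are the minimum and maximum eccentricity of a vertex of $G$. A cactus graph is a connected graph in which every block is either a cycle or a $K_2$. $P_n$ and $C_n$ are the path and cycle on $n$ vertices. For a positive integer $i$, an $i$-packing in $G$ is a set $X\subseteq V(G)$ with $d_G(x,y)>i$ for all distinct $x,y\in X$. The packing chromatic number $\chi_\rho(G)$ is the smallest positive integer $k$ such that $V(G)$ has a partition $X_1,\dots,X_k$ with $X_i$ an $i$-packing in $G$ for every $i\in\{1,\dots,k\}$ (vertices in different components are at infinite distance; classes may be empty). $G$ is $\chi_\rho$-critical if $\chi_\rho(H)<\chi_\rho(G)$ for every proper subgraph $H$ of $G$. Definition of $\mathcal{G}_{q}^{(r)}$: for $1\le q\le r$ and non-negative integers $k_i,m_i$ with $k_i+m_i\ge 1$ for all $1\le i\le q$, $\mathcal{G}_{q}^{(r)}(k_1,m_1;\dots;k_q,m_q)$ denotes the (unique up to isomorphism) cactus graph obtained from a cycle $C_r=(x_1,x_2,\dots,x_r)$ (consecutive vertices adjacent, $x_r$ adjacent to $x_1$) by attaching, at each of the consecutive vertices $x_i$ with $1\le i\le q$, exactly $k_i$ pendant edges (blocks $K_2$) and exactly $m_i$ triangles $C_3=(x_i,u_{ij},v_{ij})$, $1\le j\le m_i$, where all attached blocks use new vertices apart from $x_i$; nothing is attached at $x_{q+1},\dots,x_r$. Definition of $\mathcal{H}$: for non-negative integers $k_i,m_i$ with $k_i+m_i\ge1$ for $i=1,2$, $\mathcal{H}(k_1,m_1;k_2,m_2)$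 denotes the graph obtained from two adjacent vertices $u_1,u_2$ by attaching to each $u_i$ exactly $k_i$ pendant edges and exactly $m_i$ triangles, where all attached blocks use new vertices apart from $u_i$. *)

theory Defs
  imports "Graph_Theory.Graph_Theory"
begin

text \<open>
  A finite simple graph is a \<^locale>\<open>pair_graph\<close> (or, for arbitrary arc types, a \<^locale>\<open>graph\<close>):
  every edge is represented by its two opposite arcs.
\<close>

section \<open>Distances\<close>

text \<open>\<^term>\<open>wf_digraph.\<mu> G (\<lambda>_. 1)\<close> is the minimum number of arcs of a walk, and \<open>\<infinity>\<close> if there is none.\<close>

definition graph_dist :: "('a, 'b) pre_digraph \<Rightarrow> 'a \<Rightarrow> 'a \<Rightarrow> ereal" where
  "graph_dist G u v = wf_digraph.\<mu> G (\<lambda>_. 1) u v"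

definition eccentricity :: "('a, 'b) pre_digraph \<Rightarrow> 'a \<Rightarrow> ereal" where
  "eccentricity G u = Max (graph_dist G u ` verts G)"

definition rad :: "('a, 'b) pre_digraph \<Rightarrow> ereal" where
  "rad G = Min (eccentricity G ` verts G)"

definition diam :: "('a, 'b) pre_digraph \<Rightarrow> ereal" where
  "diam G = Max (eccentricity G ` verts G)"


section \<open>Packing colourings\<close>

definition packing :: "('a, 'b) pre_digraph \<Rightarrow> nat \<Rightarrow> 'a set \<Rightarrow> bool" where
  "packing G i X \<longleftrightarrow> X \<subseteq> verts G \<and> (\<forall>x\<in>X. \<forall>y\<in>X. x \<noteq> y \<longrightarrow> graph_dist G x y > ereal (real i))"

definition packing_colourable :: "('a, 'b) pre_digraph \<Rightarrow> nat \<Rightarrow> bool" where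
  "packing_colourable G k \<longleftrightarrow>
     (\<exists>X. (\<Union>i\<in>{1..k}. X i) = verts G \<and> disjoint_family_on X {1..k} \<and> (\<forall>i\<in>{1..k}. packing G i (X i)))"

definition packing_chromatic_number :: "('a, 'b) pre_digraph \<Rightarrow> nat" where
  "packing_chromatic_number G = (LEAST k. k \<ge> 1 \<and> packing_colourable G k)"

definition packing_critical :: "('a, 'b) pre_digraph \<Rightarrow> bool" where
  "packing_critical G \<longleftrightarrow>
     (\<forall>H. graph H \<and> subgraph H G \<and> H \<noteq> G \<longrightarrow>
        packing_chromatic_number H < packing_chromatic_number G)"


section \<open>Cactus graphs\<close>

definition path_graph :: "nat \<Rightarrow> nat pair_pre_digraph" where
  "path_graph n = \<lparr> pverts = {1..n}, parcs = symcl {(i, i + 1) | i. 1 \<le> i \<and> i < n} \<rparr>"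

text \<open>A cycle only for \<open>r \<ge> 3\<close>.\<close>

definition cycle_graph :: "nat \<Rightarrow> nat pair_pre_digraph" where
  "cycle_graph r =
     \<lparr> pverts = {1..r}, parcs = symcl ({(i, i + 1) | i. 1 \<le> i \<and> i < r} \<union> {(r, 1)}) \<rparr>"

definition cut_vertex :: "('a, 'b) pre_digraph \<Rightarrow> 'a \<Rightarrow> bool" where
  "cut_vertex G v \<longleftrightarrow> v \<in> verts G \<and>
     (\<exists>u\<in>verts G - {v}. \<exists>w\<in>verts G - {v}.
        u \<rightarrow>\<^sup>*\<^bsub>G\<^esub> w \<and> \<not> u \<rightarrow>\<^sup>*\<^bsub>pre_digraph.del_vert G v\<^esub> w)"

text \<open>
  The restriction to graphs \<open>H\<close> is needed because a subgraph in the sense of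
  \<^const>\<open>subgraph\<close> may contain only one of the two arcs of an edge.
\<close>

definition block :: "('a, 'b) pre_digraph \<Rightarrow> ('a, 'b) pre_digraph \<Rightarrow> bool" where
  "block G B \<longleftrightarrow>
     pre_digraph.max_subgraph G
       (\<lambda>H. graph H \<and> Digraph_Component.connected H \<and> (\<forall>v. \<not> cut_vertex H v)) B"

definition cactus :: "('a, 'b) pre_digraph \<Rightarrow> bool" where
  "cactus G \<longleftrightarrow> graph G \<and> Digraph_Component.connected G \<and>
     (\<forall>B. block G B \<longrightarrow> (\<exists>r\<ge>3. digraph_iso B (cycle_graph r)) \<or> K\<^bsub>2\<^esub> B)"


section \<open>The graph families\<close>

datatype cactus_vertex = Core nat | Leaf nat nat | TriU nat nat | TriV nat nat

text \<open>
  The \<open>i\<close>-th entry \<open>(k, m)\<close> of \<open>ps\<close>, counted from 1, is the number \<open>k\<close> of pendant edges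
  \<open>Core i \<midarrow> Leaf i j\<close> and the number \<open>m\<close> of triangles \<open>(Core i, TriU i j, TriV i j)\<close>
  attached at the vertex \<open>i\<close> of the base graph.
\<close>

definition attach_blocks ::
  "nat pair_pre_digraph \<Rightarrow> (nat \<times> nat) list \<Rightarrow> cactus_vertex pair_pre_digraph" where
  "attach_blocks B ps =
     (let L = {(i, j). i \<in> {1..length ps} \<and> j \<in> {1..fst (ps ! (i - 1))}};
          T = {(i, j). i \<in> {1..length ps} \<and> j \<in> {1..snd (ps ! (i - 1))}}
      in \<lparr> pverts = Core ` pverts B \<union> (\<lambda>(i, j). Leaf i j) ` L
                    \<union> (\<lambda>(i, j). TriU i j) ` T \<union> (\<lambda>(i, j). TriV i j) ` T,
           parcs = symcl (map_prod Core Core ` parcs B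
                    \<union> (\<lambda>(i, j). (Core i, Leaf i j)) ` L
                    \<union> (\<lambda>(i, j). (Core i, TriU i j)) ` T
                    \<union> (\<lambda>(i, j). (Core i, TriV i j)) ` T
                    \<union> (\<lambda>(i, j). (TriU i j, TriV i j)) ` T) \<rparr>)"

text \<open>
  \<open>cactus_G r [(k\<^sub>1, m\<^sub>1), \<dots>, (k\<^sub>q, m\<^sub>q)]\<close> is \<open>\<G>\<^sub>q\<^sup>(\<^sup>r\<^sup>)(k\<^sub>1, m\<^sub>1; \<dots>; k\<^sub>q, m\<^sub>q)\<close>; it is meant for
  \<open>r \<ge> 3\<close>, \<open>1 \<le> q \<le> r\<close> and \<open>k\<^sub>i + m\<^sub>i \<ge> 1\<close>.
\<close>

definition cactus_G :: "nat \<Rightarrow> (nat \<times> nat) list \<Rightarrow> cactus_vertex pair_pre_digraph" where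
  "cactus_G r ps = attach_blocks (cycle_graph r) ps"

definition cactus_H :: "nat \<times> nat \<Rightarrow> nat \<times> nat \<Rightarrow> cactus_vertex pair_pre_digraph" where
  "cactus_H p\<^sub>1 p\<^sub>2 = attach_blocks (path_graph 2) [p\<^sub>1, p\<^sub>2]"

lemma pair_graph_path_graph: "pair_graph (path_graph n)"
proof -
  have "parcs (path_graph n) \<subseteq> pverts (path_graph n) \<times> pverts (path_graph n)"
    by (auto simp: path_graph_def symcl_def)
  moreover have "finite (pverts (path_graph n))"
    by (simp add: path_graph_def)
  ultimately have "finite (parcs (path_graph n))"
    by (meson finite_SigmaI finite_subset)
  then show ?thesis
    by unfold_locales (auto simp: path_graph_def symcl_def symmetric_def intro!: symI)
qed

lemma pair_graph_cycle_graph: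
  assumes "r \<ge> 3"
  shows "pair_graph (cycle_graph r)"
proof -
  have "parcs (cycle_graph r) \<subseteq> pverts (cycle_graph r) \<times> pverts (cycle_graph r)"
    using assms by (auto simp: cycle_graph_def symcl_def)
  moreover have "finite (pverts (cycle_graph r))"
    by (simp add: cycle_graph_def)
  ultimately have "finite (parcs (cycle_graph r))"
    by (meson finite_SigmaI finite_subset)
  then show ?thesis
    using assms
    by unfold_locales (auto simp: cycle_graph_def symcl_def symmetric_def intro!: symI)
qed

lemma pair_graph_attach_blocks:
  assumes "pair_graph B" "{1..length ps} \<subseteq> pverts B"
  shows "pair_graph (attach_blocks B ps)"
proof -
  interpret B: pair_graph B by fact
  let ?L = "Sigma {1..length ps} (\<lambda>i. {1..fst (ps ! (i - 1))})"
  let ?T = "Sigma {1..length ps} (\<lambda>i. {1..snd (ps ! (i - 1))})"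
  have L: "{(i, j). i \<in> {1..length ps} \<and> j \<in> {1..fst (ps ! (i - 1))}} = ?L" by auto
  have T: "{(i, j). i \<in> {1..length ps} \<and> j \<in> {1..snd (ps ! (i - 1))}} = ?T" by auto
  let ?A = "attach_blocks B ps"
  have sub: "parcs ?A \<subseteq> pverts ?A \<times> pverts ?A"
    unfolding attach_blocks_def L T Let_def
    using assms(2) B.wellformed' by (auto simp: symcl_def image_iff)
  have fin: "finite (pverts ?A)"
    unfolding attach_blocks_def L T Let_def by (simp add: B.pair_finite_verts)
  have fin': "finite (parcs ?A)"
    using sub fin by (meson finite_SigmaI finite_subset)
  have loop: "fst e \<noteq> snd e" if "e \<in> parcs ?A" for e
    using that B.pair_no_loops unfolding attach_blocks_def Let_def by (fastforce simp: symcl_def)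
  have sym: "sym (parcs ?A)"
    unfolding attach_blocks_def Let_def by (auto simp: symcl_def intro!: symI)
  show ?thesis
    using sub fin fin' loop sym by unfold_locales (auto simp: symmetric_def)
qed

end

theory Submission
  imports Defs
begin

text \<open>
  In a graph of diameter at most 3 a colour from 3 on can be used only once. So the packing chromatic number
  is 2 plus the least number of vertices that a 1-packing \<open>X1\<close> and a disjoint 2-packing \<open>X2\<close> leave over, as soon as
  they leave over anything (\<open>pchi_lower\<close>, \<open>pchi_upper2\<close>). All graphs in question have a small core with leaves and
  triangles attached to it, and the leftover can be counted at each core vertex separately: if there are triangles,
  it is at least their number, and if there are none, two leaves leave over one vertex, up to exceptions that are paid
  for at another core vertex (\<open>lower_complete\<close>, \<open>lower_cyc4_triangles\<close>, \<open>lower_cyc5\<close>).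

  The structure comes from the blocks. In a cactus no vertex \<open>u\<close> has three neighbours that are connected
  without \<open>u\<close>, for a cycle through \<open>u\<close> with an ear at \<open>u\<close> lies in one block, which is then neither a cycle nor an edge
  (\<open>cactus_three_neighbours\<close>). Look at a centre \<open>c\<close>. All vertices at distance 2 lie in one component of the graph
  without \<open>c\<close>, since they are at most 3 apart, and this component contains one or two neighbours
  of \<open>c\<close>. If one, the core is an edge. If two, they lie on a cycle through \<open>c\<close>, which has length 3, 4 or 5 by the bound on the distances; for lengths 4
  and 5 this bound also confines the attachments to two adjacent vertices (\<open>shapes\<close>).

  Each core is then treated on its own. To show that a graph is not critical, a proper subgraph with as many
  colours is exhibited; the upper bound for the graph and the lower bound for the subgraph agree
  (\<open>crit_surj\<close>, \<open>crit_sub_witness\<close>). For instance a core vertex with one leaf costs nothing when it takes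
  colour 1 and its leaf colour 2, and leaves next to a triangle or beyond the second do not change the number. What survives are
  the listed graphs. To show that these are critical, it suffices to delete single edges (\<open>critI\<close>, \<open>crit_att\<close>).
  Near the deleted edge the colours 1 and 2 then cover one vertex more, or the ends of a deleted core edge have moved so
  far apart that colour 3 can be used twice.
\<close>

section \<open>Distances and packing colourings of plain edge relations\<close>

text \<open>
  The distance from \<open>u\<close> to \<open>v\<close> is at most the given number. In concrete graphs the
  number is 1, 2 or 3, where this recursion unfolds to a first-order condition on edges.
\<close>

fun near :: "('a \<times> 'a) set \<Rightarrow> nat \<Rightarrow> 'a \<Rightarrow> 'a \<Rightarrow> bool" where
  "near E 0 u v \<longleftrightarrow> u = v"
| "near E (Suc n) u v \<longleftrightarrow> near E n u v \<or> (\<exists>w. (u, w) \<in> E \<and> near E n w v)"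

lemma near_refl [simp]: "near E n u u"
  by (induction n) auto

lemma near_1: "near E 1 u v \<longleftrightarrow> u = v \<or> (u, v) \<in> E"
  by (simp add: One_nat_def del: One_nat_def[symmetric])

lemma near_2: "near E 2 u v \<longleftrightarrow> u = v \<or> (u, v) \<in> E \<or> (\<exists>w. (u, w) \<in> E \<and> (w, v) \<in> E)"
  by (auto simp: numeral_2_eq_2)

lemma near_3: "near E 3 u v \<longleftrightarrow> near E 2 u v \<or> (\<exists>w. (u, w) \<in> E \<and> near E 2 w v)"
  by (simp add: numeral_3_eq_3 numeral_2_eq_2)

lemma near_mono: "near E n u v \<Longrightarrow> n \<le> n' \<Longrightarrow> near E n' u v"
proof (induction n' arbitrary: n)
  case (Suc n') then show ?case by (cases "n = Suc n'") auto
qed simp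

lemma near_hom:
  assumes "near E n u v" "\<And>x y. (x, y) \<in> E \<Longrightarrow> (f x, f y) \<in> E'"
  shows "near E' n (f u) (f v)"
  using assms(1) by (induction n arbitrary: u) (auto intro: assms(2))

lemma near_subset: "near E n u v \<Longrightarrow> E \<subseteq> E' \<Longrightarrow> near E' n u v"
  using near_hom[of E n u v id E'] by auto

lemma (in wf_digraph) near_iff_awalk:
  assumes "u \<in> verts G"
  shows "near (arcs_ends G) n u v \<longleftrightarrow> (\<exists>p. awalk u p v \<and> length p \<le> n)"
  using assms
proof (induction n arbitrary: u)
  case 0 then show ?case by (auto simp: awalk_Nil_iff)
next
  case (Suc n)
  show ?case
  proof
    assume "near (arcs_ends G) (Suc n) u v"
    then consider "near (arcs_ends G) n u v"
      | w where "(u, w) \<in> arcs_ends G" "near (arcs_ends G) n w v" by auto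
    then show "\<exists>p. awalk u p v \<and> length p \<le> Suc n"
    proof cases
      case 1 then show ?thesis using Suc by (auto intro: le_SucI)
    next
      case 2
      then obtain e where e: "e \<in> arcs G" "tail G e = u" "head G e = w" by auto
      then have "w \<in> verts G" by auto
      then obtain p where "awalk w p v" "length p \<le> n" using 2 Suc.IH by auto
      then have "awalk u (e # p) v \<and> length (e # p) \<le> Suc n" using e by (simp add: awalk_Cons_iff)
      then show ?thesis by blast
    qed
  next
    assume "\<exists>p. awalk u p v \<and> length p \<le> Suc n"
    then obtain p where p: "awalk u p v" "length p \<le> Suc n" by auto
    show "near (arcs_ends G) (Suc n) u v"
    proof (cases p)
      case Nil then show ?thesis using p by (auto simp: awalk_Nil_iff)
    next
      case (Cons e q)
      then have e: "e \<in> arcs G" "tail G e = u" "awalk (head G e) q v"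
        using p by (auto simp: awalk_Cons_iff)
      then have "near (arcs_ends G) n (head G e) v" using Suc.IH Cons p by auto
      moreover have "(u, head G e) \<in> arcs_ends G" using e by (auto simp: arcs_ends_conv)
      ultimately show ?thesis by auto
    qed
  qed
qed

text \<open>
  Every arc has cost 1, so the infimum of the costs of the walks lies below \<open>i + 1\<close> exactly if some walk
  has at most \<open>i\<close> arcs.
\<close>

lemma graph_dist_greater_iff:
  assumes "wf_digraph G" "u \<in> verts G"
  shows "graph_dist G u v > ereal (real i) \<longleftrightarrow> \<not> near (arcs_ends G) i u v"
proof -
  interpret wf_digraph G by fact
  have cost: "awalk_cost (\<lambda>_. 1) p = real (length p)" for p :: "'b awalk"
    by (induction p) auto
  have 1: "graph_dist G u v \<le> ereal (real i)" if N: "near (arcs_ends G) i u v"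
  proof -
    obtain p where p: "awalk u p v" "length p \<le> i"
      using N unfolding near_iff_awalk[OF assms(2)] by blast
    have "graph_dist G u v \<le> ereal (awalk_cost (\<lambda>_. 1) p)"
      unfolding graph_dist_def by (rule min_cost_le_walk_cost[OF p(1)])
    also have "\<dots> \<le> ereal (real i)" using p(2) unfolding cost ereal_less_eq of_nat_le_iff .
    finally show ?thesis .
  qed
  have 2: "near (arcs_ends G) i u v" if "graph_dist G u v \<le> ereal (real i)"
  proof -
    have "ereal (real i) < ereal (real (Suc i))" unfolding less_ereal.simps of_nat_less_iff by (rule lessI)
    with that have "graph_dist G u v < ereal (real (Suc i))" by (rule order.strict_trans1)
    then have "\<exists>p\<in>{p. awalk u p v}. ereal (awalk_cost (\<lambda>_. 1) p) < ereal (real (Suc i))"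
      unfolding graph_dist_def \<mu>_def INF_less_iff .
    then obtain p where p: "awalk u p v" "ereal (awalk_cost (\<lambda>_. 1) p) < ereal (real (Suc i))"
      by (elim bexE CollectE)
    from p(2) have "length p \<le> i" unfolding cost less_ereal.simps of_nat_less_iff less_Suc_eq_le .
    with p(1) show ?thesis unfolding near_iff_awalk[OF assms(2)] by (intro exI conjI)
  qed
  show ?thesis
  proof (intro iffI notI)
    assume "graph_dist G u v > ereal (real i)" "near (arcs_ends G) i u v"
    then show False using leD[OF 1] by blast
  next
    assume "\<not> near (arcs_ends G) i u v"
    then show "graph_dist G u v > ereal (real i)" by (rule contrapos_np) (rule 2, rule leI)
  qed
qed

definition pack :: "('a \<times> 'a) set \<Rightarrow> nat \<Rightarrow> 'a set \<Rightarrow> bool" where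
  "pack E i X \<longleftrightarrow> (\<forall>x\<in>X. \<forall>y\<in>X. x \<noteq> y \<longrightarrow> \<not> near E i x y)"

lemma packD: "pack E i X \<Longrightarrow> x \<in> X \<Longrightarrow> y \<in> X \<Longrightarrow> near E i x y \<Longrightarrow> x = y"
  unfolding pack_def by blast

lemma packI: "(\<And>x y. x \<in> X \<Longrightarrow> y \<in> X \<Longrightarrow> near E i x y \<Longrightarrow> x = y) \<Longrightarrow> pack E i X"
  unfolding pack_def by blast

lemma pack_mono: "pack E' i X' \<Longrightarrow> E \<subseteq> E' \<Longrightarrow> X \<subseteq> X' \<Longrightarrow> pack E i X"
  unfolding pack_def by (meson near_subset subsetD)

text \<open>
  Demanding a packing for every number \<open>i\<close> is harmless: the classes outside \<open>{1..k}\<close> are empty.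
\<close>

definition colouring :: "'a set \<Rightarrow> ('a \<times> 'a) set \<Rightarrow> nat \<Rightarrow> ('a \<Rightarrow> nat) \<Rightarrow> bool" where
  "colouring V E k c \<longleftrightarrow> c ` V \<subseteq> {1..k} \<and> (\<forall>i. pack E i {v \<in> V. c v = i})"

lemma colouring_pack: "colouring V E k c \<Longrightarrow> pack E i {v \<in> V. c v = i}"
  unfolding colouring_def by (elim conjE allE)

lemma colouring_range: "colouring V E k c \<Longrightarrow> v \<in> V \<Longrightarrow> c v \<in> {1..k}"
  unfolding colouring_def by (elim conjE) (erule subsetD, rule imageI)

lemma colouringD:
  "colouring V E k c \<Longrightarrow> x \<in> V \<Longrightarrow> y \<in> V \<Longrightarrow> c x = c y \<Longrightarrow> near E (c x) x y \<Longrightarrow> x = y"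
  by (rule packD[OF colouring_pack[of V E k c "c x"]]) simp_all

lemma colouringI:
  assumes "c ` V \<subseteq> {1..k}"
    "\<And>x y. x \<in> V \<Longrightarrow> y \<in> V \<Longrightarrow> c x = c y \<Longrightarrow> near E (c x) x y \<Longrightarrow> x = y"
  shows "colouring V E k c"
  unfolding colouring_def
proof (intro conjI allI packI)
  fix i x y
  assume *: "x \<in> {v \<in> V. c v = i}" "y \<in> {v \<in> V. c v = i}" "near E i x y"
  show "x = y" by (rule assms(2)) (use * in simp_all)
qed (rule assms(1))

definition pchi :: "'a set \<Rightarrow> ('a \<times> 'a) set \<Rightarrow> nat" where
  "pchi V E = (LEAST k. k \<ge> 1 \<and> (\<exists>c. colouring V E k c))"

text \<open>
  An edge is a pair of opposite arcs, so the subgraphs that count are those with a symmetric relation.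
\<close>

definition crit :: "'a set \<Rightarrow> ('a \<times> 'a) set \<Rightarrow> bool" where
  "crit V E \<longleftrightarrow> (\<forall>V' E'. V' \<subseteq> V \<and> E' \<subseteq> E \<and> E' \<subseteq> V' \<times> V' \<and> sym E' \<and> (V' \<noteq> V \<or> E' \<noteq> E)
     \<longrightarrow> pchi V' E' < pchi V E)"

lemma packing_iff_pack:
  assumes "wf_digraph G"
  shows "packing G i X \<longleftrightarrow> X \<subseteq> verts G \<and> pack (arcs_ends G) i X"
  using graph_dist_greater_iff[OF assms] unfolding packing_def pack_def by blast

lemma packing_colourable_iff:
  assumes "wf_digraph G"
  shows "packing_colourable G k \<longleftrightarrow> (\<exists>c. colouring (verts G) (arcs_ends G) k c)"
proof
  assume "packing_colourable G k"
  then obtain X where X: "(\<Union>i\<in>{1..k}. X i) = verts G" "disjoint_family_on X {1..k}"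
    and P: "\<forall>i\<in>{1..k}. packing G i (X i)"
    unfolding packing_colourable_def by blast
  have "\<forall>v\<in>verts G. \<exists>i. i \<in> {1..k} \<and> v \<in> X i" using X(1) by blast
  from bchoice[OF this] obtain c where c: "\<forall>v\<in>verts G. c v \<in> {1..k} \<and> v \<in> X (c v)" by blast
  have "colouring (verts G) (arcs_ends G) k c"
  proof (rule colouringI)
    show "c ` verts G \<subseteq> {1..k}" using c by blast
  next
    fix x y
    assume *: "x \<in> verts G" "y \<in> verts G" "c x = c y" "near (arcs_ends G) (c x) x y"
    have cx: "x \<in> X (c x)" "c x \<in> {1..k}" using c *(1) by blast+
    have "y \<in> X (c x)" using c *(2,3) by auto
    moreover have "pack (arcs_ends G) (c x) (X (c x))"
      using P cx(2) unfolding packing_iff_pack[OF assms] by (elim ballE conjE) auto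
    ultimately show "x = y" using packD[of "arcs_ends G" "c x" "X (c x)" x y] *(4) cx(1) by simp
  qed
  then show "\<exists>c. colouring (verts G) (arcs_ends G) k c" by blast
next
  assume "\<exists>c. colouring (verts G) (arcs_ends G) k c"
  then obtain c where c: "colouring (verts G) (arcs_ends G) k c" by blast
  define X where "X i = {v \<in> verts G. c v = i}" for i
  have "(\<Union>i\<in>{1..k}. X i) = verts G" "disjoint_family_on X {1..k}"
    using colouring_range[OF c] unfolding X_def disjoint_family_on_def by auto
  moreover have "\<forall>i\<in>{1..k}. packing G i (X i)"
    using colouring_pack[OF c] unfolding packing_iff_pack[OF assms] X_def by auto
  ultimately show "packing_colourable G k" unfolding packing_colourable_def by blast
qed

lemma packing_chromatic_number_eq_pchi:
  "wf_digraph G \<Longrightarrow> packing_chromatic_number G = pchi (verts G) (arcs_ends G)"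
  unfolding packing_chromatic_number_def pchi_def by (simp add: packing_colourable_iff)

text \<open>
  A subgraph of \<open>G\<close> in the sense of digraphs inherits the end maps of \<open>G\<close>, so it is determined by its
  sets of vertices and arcs.
\<close>

lemma packing_critical_iff_crit:
  assumes "pair_graph G"
  shows "packing_critical (with_proj G) \<longleftrightarrow> crit (pverts G) (parcs G)"
proof -
  interpret pair_graph G by fact
  have chiG: "packing_chromatic_number (with_proj G) = pchi (pverts G) (parcs G)"
    using packing_chromatic_number_eq_pchi[of "with_proj G"] wf_digraph by simp
  show ?thesis
  proof
    assume crit: "packing_critical (with_proj G)"
    show "crit (pverts G) (parcs G)"
      unfolding crit_def
    proof (intro allI impI)
      fix V E
      assume *: "V \<subseteq> pverts G \<and> E \<subseteq> parcs G \<and> E \<subseteq> V \<times> V \<and> sym E \<and> (V \<noteq> pverts G \<or> E \<noteq> parcs G)"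
      define H where "H = \<lparr>pverts = V, parcs = E\<rparr>"
      have "finite V" "finite E"
        using * pair_finite_verts pair_finite_arcs by (meson finite_subset)+
      then interpret H: pair_graph H
        using * no_loops unfolding H_def
        by unfold_locales (auto simp: symmetric_def)
      have "graph (with_proj H)" by (rule H.pair_graphD_graph)
      moreover have "subgraph (with_proj H) (with_proj G)"
        using * wf_digraph H.wf_digraph unfolding H_def subgraph_def compatible_def by simp
      moreover have "with_proj H \<noteq> with_proj G"
        using * unfolding H_def with_proj_def by auto
      ultimately have "packing_chromatic_number (with_proj H) < packing_chromatic_number (with_proj G)"
        using crit unfolding packing_critical_def by blast
      then show "pchi V E < pchi (pverts G) (parcs G)"
        using packing_chromatic_number_eq_pchi[OF H.wf_digraph] chiG by (simp add: H_def)
    qed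
  next
    assume crit: "crit (pverts G) (parcs G)"
    show "packing_critical (with_proj G)"
      unfolding packing_critical_def
    proof (intro allI impI)
      fix H :: "('a, 'a \<times> 'a) pre_digraph"
      assume *: "graph H \<and> subgraph H (with_proj G) \<and> H \<noteq> with_proj G"
      then interpret H: graph H by blast
      have th: "tail H = fst" "head H = snd"
        using * by (auto simp: subgraph_def compatible_def)
      have ends: "arcs_ends H = arcs H"
        by (simp add: arcs_ends_conv th)
      have "verts H \<noteq> pverts G \<or> arcs H \<noteq> parcs G"
        using * th by (auto simp: with_proj_def)
      moreover have "verts H \<subseteq> pverts G" "arcs H \<subseteq> parcs G"
        using * by (auto simp: subgraph_def)
      moreover have "arcs H \<subseteq> verts H \<times> verts H"
        using H.wellformed th by (auto simp: mem_Times_iff)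
      moreover have "sym (arcs H)"
        using H.sym_arcs unfolding symmetric_def ends .
      ultimately have "pchi (verts H) (arcs H) < pchi (pverts G) (parcs G)"
        using crit unfolding crit_def by blast
      then show "packing_chromatic_number H < packing_chromatic_number (with_proj G)"
        using packing_chromatic_number_eq_pchi[OF H.wf_digraph] chiG ends by simp
    qed
  qed
qed

lemma pchi_le: "colouring V E k c \<Longrightarrow> k \<ge> 1 \<Longrightarrow> pchi V E \<le> k"
  unfolding pchi_def by (rule Least_le) blast

text \<open>
  Vertices outside the given packings receive private colours above \<open>n\<close>: a singleton is a packing
  whatever distance is asked for.
\<close>

lemma pchi_upper:
  assumes "V \<subseteq> (\<Union>i\<in>{1..n}. X i) \<union> R" "finite R" "n \<ge> 1"
    and "\<And>i. i \<in> {1..n} \<Longrightarrow> pack E i (X i)"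
  shows "pchi V E \<le> n + card R" "\<exists>c. colouring V E (n + card R) c"
proof -
  obtain h where h: "bij_betw h R {0..<card R}" using ex_bij_betw_finite_nat[OF assms(2)] by blast
  define P where "P v i \<longleftrightarrow> i \<in> {1..n} \<and> v \<in> X i" for v i
  define c where "c v = (if \<exists>i. P v i then SOME i. P v i else n + 1 + h v)" for v
  have c1: "P v (c v)" if "\<exists>i. P v i" for v
    using someI_ex[OF that] that unfolding c_def by auto
  have c2: "v \<in> R" "h v < card R" "c v = n + 1 + h v" if "v \<in> V" "\<not> (\<exists>i. P v i)" for v
  proof -
    show "v \<in> R" using assms(1) that unfolding P_def by blast
    then show "h v < card R" using h bij_betwE by fastforce
    show "c v = n + 1 + h v" using that(2) unfolding c_def by (simp only: if_False)
  qed
  have "colouring V E (n + card R) c"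
  proof (rule colouringI)
    show "c ` V \<subseteq> {1..n + card R}"
    proof
      fix i assume "i \<in> c ` V"
      then obtain v where v: "v \<in> V" "i = c v" by blast
      show "i \<in> {1..n + card R}"
      proof (cases "\<exists>i. P v i")
        case True
        then have "c v \<in> {1..n}" using c1 unfolding P_def by blast
        then show ?thesis using v(2) by simp
      next
        case False
        then show ?thesis using c2[OF v(1)] v(2) by simp
      qed
    qed
  next
    fix x y assume *: "x \<in> V" "y \<in> V" "c x = c y" "near E (c x) x y"
    show "x = y"
    proof (cases "\<exists>i. P x i")
      case True
      have "\<exists>i. P y i"
      proof (rule ccontr)
        assume "\<not> (\<exists>i. P y i)"
        then have "c y > n" using c2(3)[OF *(2)] by simp
        then show False using c1[OF True] *(3) unfolding P_def by simp
      qed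
      then have "P x (c x)" "P y (c x)" using c1[OF True] c1[of y] *(3) by auto
      then show ?thesis using packD[OF assms(4), of "c x" x y] *(4) unfolding P_def by simp
    next
      case False
      have nF: "\<not> (\<exists>i. P y i)"
      proof
        assume "\<exists>i. P y i"
        then have "c y \<le> n" using c1[of y] unfolding P_def by simp
        then show False using c2(3)[OF *(1) False] *(3) by simp
      qed
      have "h x = h y" using c2(3)[OF *(1) False] c2(3)[OF *(2) nF] *(3) by simp
      then show ?thesis
        using h c2(1)[OF *(1) False] c2(1)[OF *(2) nF] unfolding bij_betw_def by (auto dest: inj_onD)
    qed
  qed
  then show "\<exists>c. colouring V E (n + card R) c" by blast
  then show "pchi V E \<le> n + card R" using pchi_le assms(3) by force
qed

lemma pchi_upper2:
  assumes "V \<subseteq> X1 \<union> X2 \<union> R" "finite R" "pack E 1 X1" "pack E 2 X2"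
  shows "pchi V E \<le> 2 + card R"
proof (rule pchi_upper(1)[where X = "\<lambda>i. if i = 1 then X1 else X2"])
  have *: "{1..2} = {1, 2::nat}" by auto
  show "V \<subseteq> (\<Union>i\<in>{1..2::nat}. if i = 1 then X1 else X2) \<union> R" using assms(1) unfolding * by auto
  show "pack E i (if i = 1 then X1 else X2)" if "i \<in> {1..2}" for i :: nat
    using that assms unfolding * by auto
qed (use assms in auto)

lemma pchi_upper3:
  assumes "V \<subseteq> X1 \<union> X2 \<union> X3 \<union> R" "finite R" "pack E 1 X1" "pack E 2 X2" "pack E 3 X3"
  shows "pchi V E \<le> 3 + card R"
proof (rule pchi_upper(1)[where X = "\<lambda>i. if i = 1 then X1 else if i = 2 then X2 else X3"])
  have *: "{1..3} = {1, 2, 3::nat}" by auto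
  show "V \<subseteq> (\<Union>i\<in>{1..3::nat}. if i = 1 then X1 else if i = 2 then X2 else X3) \<union> R"
    using assms(1) unfolding * by auto
  show "pack E i (if i = 1 then X1 else if i = 2 then X2 else X3)" if "i \<in> {1..3}" for i :: nat
    using that assms unfolding * by auto
qed (use assms in auto)

lemma pchi_colouring:
  assumes "finite V"
  shows "pchi V E \<ge> 1" "\<exists>c. colouring V E (pchi V E) c"
proof -
  have "pack E i {}" for i by (simp add: pack_def)
  then have "\<exists>c. colouring V E (1 + card V) c"
    using assms by (intro pchi_upper(2)[where X = "\<lambda>_. {}"]) auto
  then have "\<exists>k. k \<ge> 1 \<and> (\<exists>c. colouring V E k c)" using le_add1 by blast
  from LeastI_ex[OF this] show "pchi V E \<ge> 1" "\<exists>c. colouring V E (pchi V E) c"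
    unfolding pchi_def by blast+
qed

text \<open>
  Distances do not grow along \<open>f\<close>, so a colouring of the target pulls back to one of the source.
\<close>

lemma pchi_hom:
  assumes "finite V'" "inj_on f V" "f ` V \<subseteq> V'" "\<And>x y. (x, y) \<in> E \<Longrightarrow> (f x, f y) \<in> E'"
  shows "pchi V E \<le> pchi V' E'"
proof -
  obtain c where c: "colouring V' E' (pchi V' E') c" using pchi_colouring(2)[OF assms(1)] by blast
  have "colouring V E (pchi V' E') (c \<circ> f)"
  proof (rule colouringI)
    show "(c \<circ> f) ` V \<subseteq> {1..pchi V' E'}" using colouring_range[OF c] assms(3) by auto
  next
    fix x y
    assume *: "x \<in> V" "y \<in> V" "(c \<circ> f) x = (c \<circ> f) y" "near E ((c \<circ> f) x) x y"
    have "near E' (c (f x)) (f x) (f y)" using near_hom[OF *(4), of f E'] assms(4) by simp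
    moreover have "f x \<in> V'" "f y \<in> V'" "c (f x) = c (f y)" using * assms(3) by auto
    ultimately have "f x = f y" using colouringD[OF c] by simp
    then show "x = y" using * assms(2) by (auto dest: inj_onD)
  qed
  then show ?thesis using pchi_le pchi_colouring(1)[OF assms(1)] by blast
qed

text \<open>
  The source of all lower bounds. If no two vertices are further apart than 3, every colour from 3 on
  occurs at most once, so only the colours 1 and 2 can save anything.
\<close>

lemma pchi_lower:
  assumes "finite V" "\<And>x y. x \<in> V \<Longrightarrow> y \<in> V \<Longrightarrow> near E 3 x y" "r \<ge> 1"
    and "\<And>X1 X2. X1 \<subseteq> V \<Longrightarrow> X2 \<subseteq> V \<Longrightarrow> X1 \<inter> X2 = {} \<Longrightarrow> pack E 1 X1 \<Longrightarrow> pack E 2 X2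
           \<Longrightarrow> r \<le> card (V - X1 - X2)"
  shows "r + 2 \<le> pchi V E"
proof -
  define k where "k = pchi V E"
  obtain c where c: "colouring V E k c" using pchi_colouring(2)[OF assms(1)] unfolding k_def by blast
  define X where "X i = {v \<in> V. c v = i}" for i
  have "pack E i (X i)" for i unfolding X_def by (rule colouring_pack[OF c])
  then have r: "r \<le> card (V - X 1 - X 2)" by (intro assms(4)) (auto simp: X_def)
  have "card (V - X 1 - X 2) \<le> card {3..k}"
  proof (rule card_inj_on_le[where f = c])
    show "inj_on c (V - X 1 - X 2)"
    proof (rule inj_onI, rule ccontr)
      fix x y assume *: "x \<in> V - X 1 - X 2" "y \<in> V - X 1 - X 2" "c x = c y" "x \<noteq> y"
      have xy: "x \<in> V" "y \<in> V" "c x \<noteq> 1" "c x \<noteq> 2" using * unfolding X_def by simp_all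
      then have "c x \<ge> 3" using colouring_range[OF c xy(1)] by auto
      then have "near E (c x) x y" using near_mono[OF assms(2)[OF xy(1,2)]] by simp
      then show False using colouringD[OF c xy(1,2) *(3)] *(4) by simp
    qed
    show "c ` (V - X 1 - X 2) \<subseteq> {3..k}"
    proof
      fix i assume "i \<in> c ` (V - X 1 - X 2)"
      then obtain x where "x \<in> V - X 1 - X 2" "i = c x" by (rule imageE)
      then have "x \<in> V" "c x \<noteq> 1" "c x \<noteq> 2" "i = c x" unfolding X_def by simp_all
      then show "i \<in> {3..k}" using colouring_range[OF c, of x] by auto
    qed
  qed simp
  then show ?thesis using r assms(3) unfolding k_def[symmetric] by simp
qed

text \<open>
  Without isolated vertices every proper subgraph misses an edge, and then it lies in the graph without
  that edge.
\<close>

lemma critI: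
  assumes "finite V" "E \<subseteq> V \<times> V" "\<And>v. v \<in> V \<Longrightarrow> \<exists>w. (v, w) \<in> E"
    and "\<And>a b. (a, b) \<in> E \<Longrightarrow> pchi V (E - {(a, b), (b, a)}) < pchi V E"
  shows "crit V E"
  unfolding crit_def
proof (intro allI impI)
  fix V' E' assume "V' \<subseteq> V \<and> E' \<subseteq> E \<and> E' \<subseteq> V' \<times> V' \<and> sym E' \<and> (V' \<noteq> V \<or> E' \<noteq> E)"
  then have sub: "V' \<subseteq> V" "E' \<subseteq> E" "E' \<subseteq> V' \<times> V'" and sym: "sym E'"
    and ne: "V' \<noteq> V \<or> E' \<noteq> E" by auto
  have "E' \<noteq> E"
  proof
    assume "E' = E"
    then have "V' \<noteq> V" using ne by simp
    then obtain v where v: "v \<in> V" "v \<notin> V'" using sub(1) by blast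
    obtain w where "(v, w) \<in> E" using assms(3)[OF v(1)] by (rule exE)
    then show False using sub(3) v(2) \<open>E' = E\<close> by blast
  qed
  then obtain e where e: "e \<in> E" "e \<notin> E'" using sub(2) by blast
  obtain a b where "e = (a, b)" by (rule prod.exhaust)
  with e have ab: "(a, b) \<in> E" "(a, b) \<notin> E'" by simp_all
  have ba: "(b, a) \<notin> E'" using ab(2) symD[OF sym, of b a] by blast
  have "pchi V' E' \<le> pchi V (E - {(a, b), (b, a)})"
  proof (rule pchi_hom[where f = id, OF assms(1)])
    show "id ` V' \<subseteq> V" using sub(1) by simp
    show "(id x, id y) \<in> E - {(a, b), (b, a)}" if xy: "(x, y) \<in> E'" for x y
    proof -
      have "(x, y) \<in> E" using sub(2) xy by (rule subsetD)
      moreover have "(x, y) \<noteq> (a, b)" "(x, y) \<noteq> (b, a)" using xy ab(2) ba by metis+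
      ultimately show ?thesis by simp
    qed
  qed simp
  then show "pchi V' E' < pchi V E" using assms(4)[OF ab(1)] by simp
qed

text \<open>
  The way in which criticality is exploited: a copy inside the graph of something that needs as many
  colours is already the whole graph.
\<close>

lemma crit_surj:
  assumes "crit V E" "finite V" "inj_on f W" "f ` W \<subseteq> V" "\<And>x y. (x, y) \<in> F \<Longrightarrow> (f x, f y) \<in> E"
    and "F \<subseteq> W \<times> W" "sym F" "pchi V E \<le> pchi W F"
  shows "f ` W = V" "map_prod f f ` F = E"
proof -
  have "\<not> (f ` W \<noteq> V \<or> map_prod f f ` F \<noteq> E)"
  proof
    assume *: "f ` W \<noteq> V \<or> map_prod f f ` F \<noteq> E"
    have "sym (map_prod f f ` F)" using assms(7) by (auto simp: sym_def)
    moreover have "map_prod f f ` F \<subseteq> f ` W \<times> f ` W" using assms(6) by auto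
    moreover have "map_prod f f ` F \<subseteq> E" using assms(5) by auto
    ultimately have "pchi (f ` W) (map_prod f f ` F) < pchi V E"
      using assms(1,4) * unfolding crit_def by blast
    moreover have "pchi W F \<le> pchi (f ` W) (map_prod f f ` F)"
    proof (rule pchi_hom[OF _ assms(3)])
      show "finite (f ` W)" using assms(2,4) finite_subset by blast
    qed auto
    ultimately show False using assms(8) by simp
  qed
  then show "f ` W = V" "map_prod f f ` F = E" by blast+
qed

lemma crit_bij:
  assumes "crit V E" "finite V" "inj_on f V" "E \<subseteq> V \<times> V"
  shows "crit (f ` V) (map_prod f f ` E)"
  unfolding crit_def
proof (intro allI impI)
  fix V' E' assume "V' \<subseteq> f ` V \<and> E' \<subseteq> map_prod f f ` E \<and> E' \<subseteq> V' \<times> V' \<and> sym E'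
    \<and> (V' \<noteq> f ` V \<or> E' \<noteq> map_prod f f ` E)"
  then have V': "V' \<subseteq> f ` V" and E': "E' \<subseteq> map_prod f f ` E" "E' \<subseteq> V' \<times> V'" and sym: "sym E'"
    and ne: "V' \<noteq> f ` V \<or> E' \<noteq> map_prod f f ` E" by auto
  define g where "g = the_inv_into V f"
  have gf: "g (f x) = x" if "x \<in> V" for x
    unfolding g_def using assms(3) that by (rule the_inv_into_f_f)
  have fg: "f (g y) = y" if "y \<in> f ` V" for y using that gf by auto
  have "inj_on g (f ` V)" using fg by (rule inj_on_inverseI)
  then have ginj: "inj_on g V'" using V' by (rule inj_on_subset)
  have "pchi (g ` V') (map_prod g g ` E') < pchi V E"
  proof -
    have "g ` V' \<subseteq> g ` f ` V" using V' by (rule image_mono)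
    also have "g ` f ` V = V" using gf by (simp add: image_image)
    finally have "g ` V' \<subseteq> V" .
    moreover have "map_prod g g ` E' \<subseteq> g ` V' \<times> g ` V'" using E'(2) by auto
    moreover have "map_prod g g ` E' \<subseteq> E"
    proof -
      have "map_prod g g (map_prod f f e) = e" if "e \<in> E" for e
        using that assms(4) gf by (cases e) auto
      then have "map_prod g g ` map_prod f f ` E = E" by (simp add: image_image)
      then show ?thesis using image_mono[OF E'(1), of "map_prod g g"] by simp
    qed
    moreover have "sym (map_prod g g ` E')"
    proof (rule symI)
      fix a b assume "(a, b) \<in> map_prod g g ` E'"
      then obtain x y where "(x, y) \<in> E'" "a = g x" "b = g y" by auto
      then show "(b, a) \<in> map_prod g g ` E'" using symD[OF sym, of x y] by force
    qed
    moreover have "g ` V' \<noteq> V \<or> map_prod g g ` E' \<noteq> E"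
    proof (rule ccontr)
      assume "\<not> (g ` V' \<noteq> V \<or> map_prod g g ` E' \<noteq> E)"
      then have 1: "g ` V' = V" "map_prod g g ` E' = E" by auto
      have "f (g y) = y" if "y \<in> V'" for y using fg V' that by blast
      then have "f ` g ` V' = V'" by (simp add: image_image)
      moreover have "map_prod f f ` map_prod g g ` E' = E'"
      proof -
        have "map_prod f f (map_prod g g e) = e" if "e \<in> E'" for e
        proof -
          have "e \<in> V' \<times> V'" using that E'(2) by blast
          then show ?thesis using fg V' by (cases e) auto
        qed
        then show ?thesis by (simp add: image_image)
      qed
      ultimately show False using 1 ne by simp
    qed
    ultimately show ?thesis using assms(1)[unfolded crit_def, rule_format, of "g ` V'" "map_prod g g ` E'"]
      by simp
  qed
  moreover have "pchi V' E' \<le> pchi (g ` V') (map_prod g g ` E')"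
  proof (rule pchi_hom[OF _ ginj])
    show "finite (g ` V')" using finite_subset[OF V'] assms(2) by simp
  qed auto
  moreover have "pchi V E \<le> pchi (f ` V) (map_prod f f ` E)"
    using assms by (intro pchi_hom[where f = f]) auto
  ultimately show "pchi V' E' < pchi (f ` V) (map_prod f f ` E)" by simp
qed

section \<open>Isomorphism invariance\<close>

text \<open>
  In a pair digraph an arc is the pair of its ends, so the map on the vertices determines the isomorphism.
\<close>

lemma digraph_iso_pair_iff:
  assumes "pair_graph G" "pair_graph H"
  shows "digraph_iso (with_proj G) (with_proj H) \<longleftrightarrow>
    (\<exists>f. inj_on f (pverts G) \<and> pverts H = f ` pverts G \<and> parcs H = map_prod f f ` parcs G)"
proof -
  interpret G: pair_graph G by fact
  interpret H: pair_graph H by fact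
  show ?thesis
  proof
    assume "digraph_iso (with_proj G) (with_proj H)"
    then obtain h where h: "pre_digraph.digraph_isomorphism (with_proj G) h"
      and H: "with_proj H = app_iso h (with_proj G)" unfolding digraph_iso_def by blast
    define f where "f = iso_verts h"
    have th: "iso_tail h = fst" "iso_head h = snd" "pverts H = iso_verts h ` pverts G"
      "parcs H = iso_arcs h ` parcs G"
      using arg_cong[OF H, of tail] arg_cong[OF H, of head] arg_cong[OF H, of verts]
        arg_cong[OF H, of arcs] by simp_all
    have "iso_arcs h a = map_prod f f a" if "a \<in> parcs G" for a
      using h that th unfolding pre_digraph.digraph_isomorphism_def f_def
      by (cases a) (auto simp: prod_eq_iff)
    then have "parcs H = map_prod f f ` parcs G" using th(4) by (simp cong: image_cong)
    then show "\<exists>f. inj_on f (pverts G) \<and> pverts H = f ` pverts G \<and> parcs H = map_prod f f ` parcs G"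
      using h th(3) unfolding pre_digraph.digraph_isomorphism_def f_def by auto
  next
    assume "\<exists>f. inj_on f (pverts G) \<and> pverts H = f ` pverts G \<and> parcs H = map_prod f f ` parcs G"
    then obtain f where f: "inj_on f (pverts G)" "pverts H = f ` pverts G"
      "parcs H = map_prod f f ` parcs G" by blast
    define h where "h = \<lparr>iso_verts = f, iso_arcs = map_prod f f, iso_head = snd, iso_tail = fst\<rparr>"
    have "inj_on (map_prod f f) (parcs G)"
    proof (rule inj_onI)
      fix a b assume "a \<in> parcs G" "b \<in> parcs G" "map_prod f f a = map_prod f f b"
      then show "a = b"
        using f(1) G.wellformed' by (cases a; cases b) (auto dest: inj_onD)
    qed
    then have "pre_digraph.digraph_isomorphism (with_proj G) h"
      using f G.wf_digraph unfolding pre_digraph.digraph_isomorphism_def h_def by auto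
    moreover have "with_proj H = app_iso h (with_proj G)"
      using f unfolding app_iso_def h_def by (simp add: with_proj_def)
    ultimately show "digraph_iso (with_proj G) (with_proj H)" unfolding digraph_iso_def by blast
  qed
qed

lemma packing_critical_iso_imp:
  assumes "pair_graph G" "pair_graph H" "digraph_iso (with_proj G) (with_proj H)"
    and "packing_critical (with_proj G)"
  shows "packing_critical (with_proj H)"
proof -
  interpret pair_graph G by fact
  have sub: "parcs G \<subseteq> pverts G \<times> pverts G" using wellformed' by auto
  obtain f where f: "inj_on f (pverts G)" "pverts H = f ` pverts G" "parcs H = map_prod f f ` parcs G"
    using assms(3) unfolding digraph_iso_pair_iff[OF assms(1,2)] by blast
  have "crit (f ` pverts G) (map_prod f f ` parcs G)"
    using crit_bij[OF _ pair_finite_verts f(1) sub] assms(4)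
    unfolding packing_critical_iff_crit[OF assms(1)] .
  then show ?thesis unfolding packing_critical_iff_crit[OF assms(2)] f(2,3) .
qed

lemma packing_critical_iso:
  assumes "pair_graph G" "pair_graph H" "digraph_iso (with_proj G) (with_proj H)"
  shows "packing_critical (with_proj G) \<longleftrightarrow> packing_critical (with_proj H)"
proof -
  interpret G: pair_graph G by fact
  have "digraph_iso (with_proj H) (with_proj G)"
    by (rule digraph_iso_swap[OF G.wf_digraph assms(3)])
  then show ?thesis
    using packing_critical_iso_imp[OF assms] packing_critical_iso_imp[OF assms(2,1)] by argo
qed

section \<open>Cores with attached leaves and triangles\<close>

text \<open>
  Adjacency in one infinite graph, in which every core vertex carries infinitely many leaves and triangles.
  The graphs of interest are its finite induced subgraphs. Distances only grow in subgraphs, so a packing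
  of the infinite graph serves for all numbers of leaves and triangles at once.
\<close>

fun adjp :: "(nat \<times> nat) set \<Rightarrow> cactus_vertex \<Rightarrow> cactus_vertex \<Rightarrow> bool" where
  "adjp B (Core i) (Core j) \<longleftrightarrow> (i, j) \<in> B"
| "adjp B (Core i) (Leaf i' j) \<longleftrightarrow> i = i'"
| "adjp B (Leaf i' j) (Core i) \<longleftrightarrow> i = i'"
| "adjp B (Core i) (TriU i' j) \<longleftrightarrow> i = i'"
| "adjp B (TriU i' j) (Core i) \<longleftrightarrow> i = i'"
| "adjp B (Core i) (TriV i' j) \<longleftrightarrow> i = i'"
| "adjp B (TriV i' j) (Core i) \<longleftrightarrow> i = i'"
| "adjp B (TriU i j) (TriV i' j') \<longleftrightarrow> i = i' \<and> j = j'"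
| "adjp B (TriV i j) (TriU i' j') \<longleftrightarrow> i = i' \<and> j = j'"
| "adjp B _ _ \<longleftrightarrow> False"

definition adjR :: "(nat \<times> nat) set \<Rightarrow> (cactus_vertex \<times> cactus_vertex) set" where
  "adjR B = {(x, y). adjp B x y}"

lemma in_adjR [simp]: "(x, y) \<in> adjR B \<longleftrightarrow> adjp B x y"
  by (simp add: adjR_def)

fun base :: "cactus_vertex \<Rightarrow> nat" where
  "base (Core i) = i" | "base (Leaf i j) = i" | "base (TriU i j) = i" | "base (TriV i j) = i"

fun attached :: "nat set \<Rightarrow> (nat \<Rightarrow> nat) \<Rightarrow> (nat \<Rightarrow> nat) \<Rightarrow> cactus_vertex \<Rightarrow> bool" where
  "attached C k m (Core i) \<longleftrightarrow> i \<in> C"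
| "attached C k m (Leaf i j) \<longleftrightarrow> i \<in> C \<and> 1 \<le> j \<and> j \<le> k i"
| "attached C k m (TriU i j) \<longleftrightarrow> i \<in> C \<and> 1 \<le> j \<and> j \<le> m i"
| "attached C k m (TriV i j) \<longleftrightarrow> i \<in> C \<and> 1 \<le> j \<and> j \<le> m i"

definition attV :: "nat set \<Rightarrow> (nat \<Rightarrow> nat) \<Rightarrow> (nat \<Rightarrow> nat) \<Rightarrow> cactus_vertex set" where
  "attV C k m = {v. attached C k m v}"

definition attE :: "(nat \<times> nat) set \<Rightarrow> nat set \<Rightarrow> (nat \<Rightarrow> nat) \<Rightarrow> (nat \<Rightarrow> nat) \<Rightarrow> (cactus_vertex \<times> cactus_vertex) set" where
  "attE B C k m = adjR B \<inter> (attV C k m \<times> attV C k m)"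

lemma in_attV [simp]: "v \<in> attV C k m \<longleftrightarrow> attached C k m v"
  by (simp add: attV_def)

lemma in_attE: "(x, y) \<in> attE B C k m \<longleftrightarrow> adjp B x y \<and> attached C k m x \<and> attached C k m y"
  by (simp add: attE_def)

lemma attE_sub: "attE B C k m \<subseteq> attV C k m \<times> attV C k m" "attE B C k m \<subseteq> adjR B"
  unfolding attE_def by blast+

lemma attached_base: "attached C k m v \<Longrightarrow> base v \<in> C"
  by (cases v) auto

lemma ex_cactus_vertex:
  "(\<exists>v. P v) \<longleftrightarrow> (\<exists>i. P (Core i)) \<or> (\<exists>i j. P (Leaf i j)) \<or> (\<exists>i j. P (TriU i j)) \<or> (\<exists>i j. P (TriV i j))"
  by (metis cactus_vertex.exhaust)

lemma finite_attV [simp]: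
  assumes "finite C" shows "finite (attV C k m)"
proof -
  have "attV C k m \<subseteq> Core ` C \<union> (\<lambda>(i, j). Leaf i j) ` (SIGMA i:C. {1..k i})
    \<union> (\<lambda>(i, j). TriU i j) ` (SIGMA i:C. {1..m i}) \<union> (\<lambda>(i, j). TriV i j) ` (SIGMA i:C. {1..m i})"
  proof
    fix v assume "v \<in> attV C k m"
    then show "v \<in> Core ` C \<union> (\<lambda>(i, j). Leaf i j) ` (SIGMA i:C. {1..k i})
      \<union> (\<lambda>(i, j). TriU i j) ` (SIGMA i:C. {1..m i}) \<union> (\<lambda>(i, j). TriV i j) ` (SIGMA i:C. {1..m i})"
      by (cases v) force+
  qed
  then show ?thesis by (rule finite_subset) (use assms in auto)
qed

lemma adjp_sym: "sym B \<Longrightarrow> adjp B x y \<Longrightarrow> adjp B y x"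
  by (cases x; cases y) (auto dest: symD)

lemma sym_attE: "sym B \<Longrightarrow> sym (attE B C k m)"
  by (rule symI) (simp add: in_attE adjp_sym)

lemma near_trans:
  assumes "near E a x y" "near E b y z" shows "near E (a + b) x z"
  using assms
proof (induction a arbitrary: x)
  case 0 then show ?case by simp
next
  case (Suc a)
  then consider "near E a x y" | w where "(x, w) \<in> E" "near E a w y" by auto
  then show ?case
  proof cases
    case 1
    then have "near E (a + b) x z" using Suc by simp
    then show ?thesis by simp
  next
    case 2
    then have "near E (a + b) w z" using Suc by simp
    then show ?thesis using 2 by auto
  qed
qed

lemma near_core:
  assumes "attached C k m x"
  shows "near (attE B C k m) 1 x (Core (base x))" "near (attE B C k m) 1 (Core (base x)) x"
  using assms unfolding near_1 by (cases x; simp add: in_attE)+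

lemma near_same_base:
  assumes "attached C k m x" "attached C k m y" "base x = base y"
  shows "near (attE B C k m) 2 x y"
  using near_trans[OF near_core(1)[OF assms(1), of B] near_core(2)[OF assms(2), of B, folded assms(3)]]
  unfolding one_add_one .

text \<open>
  From an attached vertex to its core vertex, along a core edge, and back out: three steps.
\<close>

lemma near_adj_base:
  assumes "attached C k m x" "attached C k m y" "base x = base y \<or> (base x, base y) \<in> B"
  shows "near (attE B C k m) 3 x y"
proof -
  have "near (attE B C k m) 1 (Core (base x)) (Core (base y))"
    using assms attached_base unfolding near_1 by (auto simp: in_attE)
  from near_trans[OF near_trans[OF near_core(1)[OF assms(1), of B] this] near_core(2)[OF assms(2)]]
  show ?thesis by (simp add: eval_nat_numeral del: near.simps)
qed

lemma near_core_two:
  assumes "i \<in> C" "l \<in> C" "attached C k m y" "(i, l) \<in> B" "(l, base y) \<in> B"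
  shows "near (attE B C k m) 3 (Core i) y"
proof -
  have "near (attE B C k m) 1 (Core i) (Core l)" "near (attE B C k m) 1 (Core l) (Core (base y))"
    using assms attached_base unfolding near_1 by (auto simp: in_attE)
  from near_trans[OF near_trans[OF this] near_core(2)[OF assms(3)]]
  show ?thesis by (simp add: eval_nat_numeral del: near.simps)
qed

lemma near_sym: "sym E \<Longrightarrow> near E n x y \<Longrightarrow> near E n y x"
proof (induction n arbitrary: x)
  case (Suc n)
  from Suc.prems(2) consider "near E n x y" | w where "(x, w) \<in> E" "near E n w y" by auto
  then show ?case
  proof cases
    case 1
    then show ?thesis using Suc by simp
  next
    case 2
    then have "near E n y w" "near E 1 w x" using Suc symD[OF Suc.prems(1)] unfolding near_1 by auto
    from near_trans[OF this] show ?thesis by simp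
  qed
qed simp

section \<open>What the colours 1 and 2 leave over\<close>

text \<open>
  By \<open>pchi_lower\<close>, a lower bound is a bound on the number of vertices that a 1-packing and a 2-packing
  leave over. They are counted separately at each core vertex.
\<close>

locale partial_colouring =
  fixes B :: "(nat \<times> nat) set" and C k m and X1 X2 :: "cactus_vertex set"
  assumes finC: "finite C"
    and X1: "X1 \<subseteq> attV C k m" "pack (attE B C k m) 1 X1"
    and X2: "X2 \<subseteq> attV C k m" "pack (attE B C k m) 2 X2"
    and disj: "X1 \<inter> X2 = {}"
begin

definition rest :: "cactus_vertex set" where "rest = attV C k m - X1 - X2"

definition rest_at :: "nat \<Rightarrow> cactus_vertex set" where "rest_at i = {v \<in> rest. base v = i}"

lemma finite_rest: "finite rest" "finite (rest_at i)"
proof -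
  show "finite rest" unfolding rest_def using finite_attV[OF finC] by (intro finite_Diff)
  then show "finite (rest_at i)" unfolding rest_at_def by (rule finite_subset[rotated]) blast
qed

lemma X2_base: "x \<in> X2 \<Longrightarrow> y \<in> X2 \<Longrightarrow> base x = base y \<Longrightarrow> x = y"
  using X2 by (intro packD[OF X2(2)] near_same_base) auto

lemma X1_adj: "x \<in> X1 \<Longrightarrow> y \<in> X1 \<Longrightarrow> \<not> adjp B x y \<or> x = y"
  using subsetD[OF X1(1), of x] subsetD[OF X1(1), of y] packD[OF X1(2), of x y, unfolded near_1 in_attE]
  unfolding in_attV by blast

lemma X2_adj_base:
  assumes "Core i \<in> X2" "y \<in> X2" "(i, base y) \<in> B" shows "Core i = y"
proof (rule packD[OF X2(2) assms(1,2)])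
  have *: "attached C k m (Core i)" "attached C k m y" using assms X2 by auto
  then have "near (attE B C k m) 1 (Core i) (Core (base y))"
    using assms(3) attached_base unfolding near_1 by (auto simp: in_attE)
  from near_trans[OF this near_core(2)[OF *(2)]]
  show "near (attE B C k m) 2 (Core i) y" unfolding one_add_one .
qed

lemma card_rest: "card rest = (\<Sum>i\<in>C. card (rest_at i))"
proof -
  have "rest = (\<Union>i\<in>C. rest_at i)"
    unfolding rest_at_def using attached_base by (auto simp: rest_def)
  moreover have "card (\<Union>i\<in>C. rest_at i) = (\<Sum>i\<in>C. card (rest_at i))"
    using finC by (intro card_UN_disjoint) (auto simp: finite_rest rest_at_def)
  ultimately show ?thesis by simp
qed

text \<open>
  A triangle contains each of the colours 1 and 2 at most once. If the core vertex is coloured, every triangle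
  at it therefore keeps an uncoloured outer vertex. If it is not, colour 2 occurs at most once among the outer
  vertices, so all triangles but one keep an uncoloured outer vertex, and the core vertex replaces the missing one.
\<close>

lemma rest_at_triangles:
  assumes "i \<in> C" "m i \<ge> 1"
  shows "m i \<le> card (rest_at i)"
proof -
  define g where "g j = (if TriU i j \<in> rest then TriU i j else TriV i j)" for j
  have inj: "inj_on g A" for A by (auto simp: inj_on_def g_def split: if_splits)
  have g: "g j \<in> rest_at i" if "j \<in> {1..m i}" "TriU i j \<in> rest \<or> TriV i j \<in> rest" for j
    using that unfolding g_def rest_at_def by auto
  have V: "TriU i j \<in> attV C k m" "TriV i j \<in> attV C k m" if "j \<in> {1..m i}" for j
    using that assms by auto
  have core: "Core i \<in> attV C k m" using assms by simp
  show ?thesis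
  proof (cases "Core i \<in> rest")
    case False
    have "g j \<in> rest_at i" if j: "j \<in> {1..m i}" for j
    proof (rule g[OF j], rule ccontr)
      assume "\<not> (TriU i j \<in> rest \<or> TriV i j \<in> rest)"
      then have UV: "TriU i j \<in> X1 \<union> X2" "TriV i j \<in> X1 \<union> X2" using V[OF j] unfolding rest_def by auto
      from False have "Core i \<in> X1 \<or> Core i \<in> X2" using core unfolding rest_def by auto
      then show False
        using UV X1_adj[of "TriU i j" "TriV i j"] X1_adj[of "Core i" "TriV i j"] X1_adj[of "Core i" "TriU i j"]
          X2_base[of "Core i" "TriV i j"] X2_base[of "Core i" "TriU i j"] X2_base[of "TriU i j" "TriV i j"]
        by auto
    qed
    then have "card {1..m i} \<le> card (rest_at i)"
      by (intro card_inj_on_le[of g] finite_rest inj) auto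
    then show ?thesis by simp
  next
    case True
    have "\<exists>j0. \<forall>j\<in>{1..m i}. j \<noteq> j0 \<longrightarrow> TriU i j \<notin> X2 \<and> TriV i j \<notin> X2"
    proof (cases "\<exists>j0. TriU i j0 \<in> X2 \<or> TriV i j0 \<in> X2")
      case True
      then obtain j0 where *: "TriU i j0 \<in> X2 \<or> TriV i j0 \<in> X2" by blast
      have "TriU i j \<notin> X2 \<and> TriV i j \<notin> X2" if "j \<noteq> j0" for j
        using * that X2_base[of "TriU i j" "TriU i j0"] X2_base[of "TriU i j" "TriV i j0"]
          X2_base[of "TriV i j" "TriU i j0"] X2_base[of "TriV i j" "TriV i j0"] by auto
      then show ?thesis by blast
    qed blast
    then obtain j0 where j0: "\<And>j. j \<in> {1..m i} \<Longrightarrow> j \<noteq> j0 \<Longrightarrow> TriU i j \<notin> X2 \<and> TriV i j \<notin> X2"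
      by blast
    have "g j \<in> rest_at i" if j: "j \<in> {1..m i}" "j \<noteq> j0" for j
    proof (rule g[OF j(1)], rule ccontr)
      assume "\<not> (TriU i j \<in> rest \<or> TriV i j \<in> rest)"
      then have "TriU i j \<in> X1" "TriV i j \<in> X1" using V[OF j(1)] j0[OF j] unfolding rest_def by auto
      then show False using X1_adj[of "TriU i j" "TriV i j"] by simp
    qed
    then have "insert (Core i) (g ` ({1..m i} - {j0})) \<subseteq> rest_at i"
      using True unfolding rest_at_def by auto
    then have "card (insert (Core i) (g ` ({1..m i} - {j0}))) \<le> card (rest_at i)"
      by (rule card_mono[OF finite_rest(2)])
    moreover have "Core i \<notin> g ` ({1..m i} - {j0})" by (auto simp: g_def split: if_splits)
    moreover have "card (g ` ({1..m i} - {j0})) = card ({1..m i} - {j0})" by (rule card_image[OF inj])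
    moreover have "card ({1..m i} - {j0}) \<ge> m i - 1" by (cases "j0 \<in> {1..m i}") auto
    ultimately show ?thesis by simp
  qed
qed

text \<open>
  Without colour 2 each pair of adjacent outer vertices keeps an uncoloured one. One more is left: the core
  vertex, or, if that has colour 1, the second outer vertex of the first triangle.
\<close>

lemma rest_at_triangles_strict:
  assumes "i \<in> C" "m i \<ge> 1" and no2: "\<And>v. v \<in> X2 \<Longrightarrow> base v \<noteq> i"
  shows "m i + 1 \<le> card (rest_at i)"
proof -
  define g where "g j = (if TriU i j \<in> rest then TriU i j else TriV i j)" for j
  have inj: "inj_on g A" for A by (auto simp: inj_on_def g_def split: if_splits)
  have V: "TriU i j \<in> attV C k m" "TriV i j \<in> attV C k m" if "j \<in> {1..m i}" for j
    using that assms by auto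
  have g: "g j \<in> rest_at i" if j: "j \<in> {1..m i}" for j
  proof -
    have "TriU i j \<in> rest \<or> TriV i j \<in> rest"
      using V[OF j] X1_adj[of "TriU i j" "TriV i j"] no2[of "TriU i j"] no2[of "TriV i j"]
      unfolding rest_def by auto
    then show ?thesis unfolding g_def rest_at_def by auto
  qed
  define x where "x = (if Core i \<in> rest then Core i else TriV i 1)"
  have x: "x \<in> rest_at i \<and> x \<notin> g ` {1..m i}"
  proof (cases "Core i \<in> rest")
    case True
    then show ?thesis unfolding x_def g_def rest_at_def by auto
  next
    case False
    then have c: "Core i \<in> X1" using assms(1) no2[of "Core i"] unfolding rest_def by auto
    then have "TriU i j \<notin> X1" "TriV i j \<notin> X1" for j
      using X1_adj[of "Core i" "TriU i j"] X1_adj[of "Core i" "TriV i j"] by auto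
    then have "TriU i j \<in> rest" "TriV i j \<in> rest" if "j \<in> {1..m i}" for j
      using V[OF that] no2[of "TriU i j"] no2[of "TriV i j"] unfolding rest_def by auto
    then show ?thesis using False assms(2) unfolding x_def g_def rest_at_def by auto
  qed
  have "card (insert x (g ` {1..m i})) \<le> card (rest_at i)"
    using x g by (intro card_mono finite_rest) auto
  then show ?thesis using x card_image[OF inj, of "{1..m i}"] by simp
qed

text \<open>
  If the core vertex has colour 1, its leaves can only have colour 2, and two leaves are at distance 2.
\<close>

lemma rest_at_leaves:
  assumes "i \<in> C" "k i \<ge> 2" "Core i \<notin> X2"
  shows "1 \<le> card (rest_at i)"
proof -
  have "\<exists>v. v \<in> rest_at i"
  proof (cases "Core i \<in> rest")
    case True then show ?thesis unfolding rest_at_def by force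
  next
    case False
    then have c: "Core i \<in> X1" using assms unfolding rest_def by auto
    have "Leaf i 1 \<notin> X1" "Leaf i 2 \<notin> X1" using c X1_adj[of "Core i" "Leaf i 1"] X1_adj[of "Core i" "Leaf i 2"] by auto
    moreover have "\<not> (Leaf i 1 \<in> X2 \<and> Leaf i 2 \<in> X2)" using X2_base[of "Leaf i 1" "Leaf i 2"] by auto
    ultimately have "Leaf i 1 \<in> rest \<or> Leaf i 2 \<in> rest" using assms unfolding rest_def by auto
    then show ?thesis unfolding rest_at_def by force
  qed
  then show ?thesis using finite_rest(2)[of i] by (metis card_0_eq empty_iff less_one not_less)
qed

end

section \<open>Lower bounds on the packing chromatic number\<close>

text \<open>
  The complete graph on \<open>C\<close>. Two core vertices yield the family \<open>\<H>\<close>, three yield the family on a triangle.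
\<close>

definition compl :: "nat set \<Rightarrow> (nat \<times> nat) set" where
  "compl C = {(i, j). i \<in> C \<and> j \<in> C \<and> i \<noteq> j}"

lemma in_compl [simp]: "(i, j) \<in> compl C \<longleftrightarrow> i \<in> C \<and> j \<in> C \<and> i \<noteq> j"
  by (simp add: compl_def)

lemma sym_compl: "sym (compl C)" by (auto simp: sym_def)

lemma near_complete:
  assumes "attached C k m x" "attached C k m y"
  shows "near (attE (compl C) C k m) 3 x y"
  using assms attached_base[OF assms(1)] attached_base[OF assms(2)] by (intro near_adj_base) auto

text \<open>
  Each core vertex leaves over at least \<open>max 1 (m i)\<close> vertices, except for a core vertex without triangles that
  itself has colour 2. But then colour 2 occurs nowhere else, since every other vertex is within distance 2, and
  the core vertex with triangles, which exists by assumption, leaves over one vertex more.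
\<close>

lemma lower_complete:
  assumes C: "finite C"
    and types: "\<And>i. i \<in> C \<Longrightarrow> k i \<ge> 2 \<or> m i \<ge> 1"
    and ex: "i1 \<in> C" "m i1 \<ge> 1"
  shows "(\<Sum>i\<in>C. max 1 (m i)) + 2 \<le> pchi (attV C k m) (attE (compl C) C k m)"
proof (rule pchi_lower)
  show "finite (attV C k m)" using C by simp
  show "near (attE (compl C) C k m) 3 x y" if "x \<in> attV C k m" "y \<in> attV C k m" for x y
    using that by (intro near_complete) simp_all
  show "1 \<le> (\<Sum>i\<in>C. max 1 (m i))"
    using member_le_sum[of i1 C "\<lambda>i. max 1 (m i)"] ex C by simp
  fix X1 X2
  assume *: "X1 \<subseteq> attV C k m" "X2 \<subseteq> attV C k m" "X1 \<inter> X2 = {}"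
    "pack (attE (compl C) C k m) 1 X1" "pack (attE (compl C) C k m) 2 X2"
  interpret partial_colouring "compl C" C k m X1 X2 using * C by unfold_locales
  show "(\<Sum>i\<in>C. max 1 (m i)) \<le> card (attV C k m - X1 - X2)"
    unfolding rest_def[symmetric] card_rest
  proof (cases "\<exists>i0\<in>C. Core i0 \<in> X2 \<and> m i0 = 0")
    case False
    show "(\<Sum>i\<in>C. max 1 (m i)) \<le> (\<Sum>i\<in>C. card (rest_at i))"
    proof (rule sum_mono)
      fix i assume i: "i \<in> C"
      show "max 1 (m i) \<le> card (rest_at i)"
      proof (cases "m i = 0")
        case True
        then show ?thesis using rest_at_leaves[OF i] types[OF i] False i by auto
      qed (use rest_at_triangles[OF i] in simp)
    qed
  next
    case True
    then obtain i0 where i0: "i0 \<in> C" "Core i0 \<in> X2" "m i0 = 0" by blast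
    have "i1 \<noteq> i0" using i0 ex by auto
    have no2: "base v = i0" if "v \<in> X2" for v
    proof (rule ccontr)
      assume "base v \<noteq> i0"
      moreover have "base v \<in> C" using that *(2) attached_base by auto
      ultimately have "Core i0 = v" using X2_adj_base[OF i0(2) that] i0(1) by simp
      then show False using \<open>base v \<noteq> i0\<close> by auto
    qed
    define D where "D = C - {i0} - {i1}"
    have split: "(\<Sum>i\<in>C. f i) = f i0 + (f i1 + (\<Sum>i\<in>D. f i))" for f :: "nat \<Rightarrow> nat"
      using C i0 ex \<open>i1 \<noteq> i0\<close> unfolding D_def by (simp add: sum.remove[of C i0] sum.remove[of "C - {i0}" i1])
    have "(\<Sum>i\<in>D. max 1 (m i)) \<le> (\<Sum>i\<in>D. card (rest_at i))"
    proof (rule sum_mono)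
      fix i assume "i \<in> D"
      then have i: "i \<in> C" "i \<noteq> i0" unfolding D_def by auto
      have "Core i \<notin> X2" using no2[of "Core i"] i by auto
      then show "max 1 (m i) \<le> card (rest_at i)"
        using rest_at_leaves[OF i(1)] types[OF i(1)] rest_at_triangles[OF i(1)] by (cases "m i = 0") auto
    qed
    moreover have "m i1 + 1 \<le> card (rest_at i1)"
      using ex no2 \<open>i1 \<noteq> i0\<close> by (intro rest_at_triangles_strict) auto
    ultimately show "(\<Sum>i\<in>C. max 1 (m i)) \<le> (\<Sum>i\<in>C. card (rest_at i))"
      unfolding split using i0(3) ex(2) by simp
  qed
qed

definition cyc4 :: "(nat \<times> nat) set" where
  "cyc4 = {(1, 2), (2, 1), (2, 3), (3, 2), (3, 4), (4, 3), (4, 1), (1, 4)}"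

definition cyc5 :: "(nat \<times> nat) set" where
  "cyc5 = {(1, 2), (2, 1), (2, 3), (3, 2), (3, 4), (4, 3), (4, 5), (5, 4), (5, 1), (1, 5)}"

lemma sym_cyc4: "sym cyc4" and sym_cyc5: "sym cyc5"
  by (auto simp: sym_def cyc4_def cyc5_def)

context partial_colouring
begin

lemma X2_two_steps:
  assumes "x \<in> X2" "y \<in> X2" "adjp B x w" "adjp B w y" "attached C k m w"
  shows "x = y"
proof (rule packD[OF X2(2) assms(1,2)])
  show "near (attE B C k m) 2 x y"
    unfolding near_2 in_attE using assms X2(1) in_attV by blast
qed

lemma X2_adj: "x \<in> X2 \<Longrightarrow> y \<in> X2 \<Longrightarrow> adjp B x y \<Longrightarrow> x = y"
  using packD[OF X2(2), of x y, unfolded near_2 in_attE] X2(1) unfolding attV_def by blast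

lemma X1_nadj: "adjp B x y \<Longrightarrow> x \<noteq> y \<Longrightarrow> x \<notin> X1 \<or> y \<notin> X1"
  using X1_adj by blast

lemma X2_nadj: "adjp B x y \<Longrightarrow> x \<noteq> y \<Longrightarrow> x \<notin> X2 \<or> y \<notin> X2"
  using X2_adj by blast

lemma X2_nadj2: "adjp B x w \<Longrightarrow> adjp B w y \<Longrightarrow> attached C k m w \<Longrightarrow> x \<noteq> y \<Longrightarrow> x \<notin> X2 \<or> y \<notin> X2"
  using X2_two_steps by blast

lemma covered: "attached C k m v \<Longrightarrow> v \<notin> rest \<Longrightarrow> v \<in> X1 \<or> v \<in> X2"
  unfolding rest_def by simp

lemma rest_at_core: "Core i \<in> rest \<Longrightarrow> 1 \<le> card (rest_at i)"
proof -
  assume "Core i \<in> rest"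
  then have "rest_at i \<noteq> {}" unfolding rest_at_def by force
  then show ?thesis using finite_rest(2)[of i] by (simp add: Suc_leI card_gt_0_iff)
qed

lemma rest_two: "\<not> 2 \<le> card rest \<Longrightarrow> x \<in> rest \<Longrightarrow> y \<in> rest \<Longrightarrow> x = y"
proof (rule ccontr)
  assume "\<not> 2 \<le> card rest" "x \<in> rest" "y \<in> rest" "x \<noteq> y"
  then show False using card_mono[OF finite_rest(1), of "{x, y}"] by simp
qed

end

text \<open>
  A colouring with 1 and 2 would give one of the adjacent inner vertices the colour 2. All others are within
  distance 2 of it, and two of them are adjacent, so they cannot all have colour 1.
\<close>

lemma lower_path4:
  fixes a b :: nat
  assumes "a \<noteq> b"
  shows "3 \<le> pchi (attV {a, b} (\<lambda>_. 1) (\<lambda>_. 0)) (attE (compl {a, b}) {a, b} (\<lambda>_. 1) (\<lambda>_. 0))"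
  (is "_ \<le> pchi ?V ?E")
proof -
  have "1 + 2 \<le> pchi ?V ?E"
  proof (rule pchi_lower)
    show "finite ?V" by simp
    show "near ?E 3 x y" if "x \<in> ?V" "y \<in> ?V" for x y
      using that by (intro near_complete) simp_all
    fix X1 X2
    assume *: "X1 \<subseteq> ?V" "X2 \<subseteq> ?V" "X1 \<inter> X2 = {}" "pack ?E 1 X1" "pack ?E 2 X2"
    interpret partial_colouring "compl {a, b}" "{a, b}" "\<lambda>_. 1" "\<lambda>_. 0" X1 X2
      using * by unfold_locales auto
    have "rest \<noteq> {}"
    proof
      assume "rest = {}"
      then have cov: "v \<in> X1 \<or> v \<in> X2" if "v \<in> {Core a, Core b, Leaf a 1, Leaf b 1}" for v
        using covered[of v] that by auto
      show False
        using cov[of "Core a"] cov[of "Core b"] cov[of "Leaf a 1"] cov[of "Leaf b 1"]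
          X1_adj[of "Core a" "Core b"] X1_adj[of "Core a" "Leaf a 1"] X1_adj[of "Core b" "Leaf b 1"]
          X2_adj_base[of a "Core b"] X2_adj_base[of a "Leaf b 1"] X2_adj_base[of b "Leaf a 1"]
          X2_base[of "Core a" "Leaf a 1"] X2_base[of "Core b" "Leaf b 1"]
        assms by (simp; blast)
    qed
    then show "1 \<le> card (?V - X1 - X2)"
      unfolding rest_def[symmetric] using finite_rest(1) by (simp add: Suc_leI card_gt_0_iff)
  qed simp
  then show ?thesis by simp
qed

text \<open>
  If a core vertex has colour 2, then colour 2 does not occur at the other two, and each of these leaves over the
  core vertex or its leaf. If none has, then colour 1 occurs at most once on the core, which leaves over two vertices.
\<close>

lemma lower_net:
  "4 \<le> pchi (attV {1, 2, 3} (\<lambda>_. 1) (\<lambda>_. 0)) (attE (compl {1, 2, 3}) {1, 2, 3} (\<lambda>_. 1) (\<lambda>_. 0))"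
  (is "_ \<le> pchi ?V ?E")
proof -
  have "2 + 2 \<le> pchi ?V ?E"
  proof (rule pchi_lower)
    show "finite ?V" by simp
    show "near ?E 3 x y" if "x \<in> ?V" "y \<in> ?V" for x y
      using that by (intro near_complete) simp_all
    fix X1 X2
    assume *: "X1 \<subseteq> ?V" "X2 \<subseteq> ?V" "X1 \<inter> X2 = {}" "pack ?E 1 X1" "pack ?E 2 X2"
    interpret partial_colouring "compl {1, 2, 3}" "{1, 2, 3}" "\<lambda>_. 1" "\<lambda>_. 0" X1 X2
      using * by unfold_locales auto
    have cov: "v \<in> X1 \<or> v \<in> X2 \<or> v \<in> rest" if "base v \<in> {1, 2, 3}" "v = Core (base v) \<or> v = Leaf (base v) 1" for v
      using covered[of v] that by (cases v) auto
    show "2 \<le> card (?V - X1 - X2)"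
      unfolding rest_def[symmetric]
    proof (rule ccontr)
      assume n: "\<not> 2 \<le> card rest"
      have r: "x \<notin> rest \<or> y \<notin> rest" if "x \<noteq> y" for x y
        using rest_two[OF n] that by blast
      have c2: "v \<notin> X2" if "i \<in> {1, 2, 3}" "Core i \<in> X2" "base v \<in> {1, 2, 3}" "base v \<noteq> i" for i v
      proof
        assume "v \<in> X2"
        then have "Core i = v" using X2_adj_base[OF that(2), of v] that unfolding in_compl by blast
        then show False using that(4) by auto
      qed
      show False
      proof (cases "\<exists>i\<in>{1, 2, 3}. Core i \<in> X2")
        case True
        then obtain i where i: "i \<in> {1, 2, 3}" "Core i \<in> X2" by blast
        have p: "Core j \<in> rest \<or> Leaf j 1 \<in> rest" if j: "j \<in> {1, 2, 3}" "j \<noteq> i" for j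
        proof -
          have "Core j \<notin> X2" "Leaf j 1 \<notin> X2" using j by (intro c2[OF i]; simp)+
          moreover have "Core j \<in> X1 \<or> Core j \<in> X2 \<or> Core j \<in> rest"
            "Leaf j 1 \<in> X1 \<or> Leaf j 1 \<in> X2 \<or> Leaf j 1 \<in> rest"
            using j(1) by (intro cov; simp)+
          moreover have "Core j \<notin> X1 \<or> Leaf j 1 \<notin> X1" by (rule X1_nadj) simp_all
          ultimately show ?thesis by argo
        qed
        have "\<exists>j\<in>{1, 2, 3}. \<exists>l\<in>{1, 2, 3}. j \<noteq> i \<and> l \<noteq> i \<and> j \<noteq> l" using i(1) by auto
        then obtain j l where "j \<in> {1, 2, 3}" "j \<noteq> i" "l \<in> {1, 2, 3}" "l \<noteq> i" "j \<noteq> l"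
          by blast
        then show False
          using p[of j] p[of l] r[of "Core j" "Core l"] r[of "Core j" "Leaf l 1"]
            r[of "Leaf j 1" "Core l"] r[of "Leaf j 1" "Leaf l 1"] by auto
      next
        case False
        have c: "Core i \<in> X1 \<or> Core i \<in> rest" if "i \<in> {1, 2, 3}" for i
          using cov[of "Core i"] that False by fastforce
        have a: "Core i \<notin> X1 \<or> Core j \<notin> X1" if "i \<in> {1, 2, 3}" "j \<in> {1, 2, 3}" "i \<noteq> j" for i j
          using X1_nadj[of "Core i" "Core j"] that by simp
        have "Core 1 \<in> X1 \<or> Core 1 \<in> rest" "Core 2 \<in> X1 \<or> Core 2 \<in> rest" "Core 3 \<in> X1 \<or> Core 3 \<in> rest"
          by (rule c; simp)+
        moreover have "Core 1 \<notin> X1 \<or> Core 2 \<notin> X1" "Core 1 \<notin> X1 \<or> Core 3 \<notin> X1"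
          "Core 2 \<notin> X1 \<or> Core 3 \<notin> X1"
          by (rule a; simp)+
        moreover have "Core 1 \<notin> rest \<or> Core 2 \<notin> rest" "Core 1 \<notin> rest \<or> Core 3 \<notin> rest"
          "Core 2 \<notin> rest \<or> Core 3 \<notin> rest"
          by (rule r; simp)+
        ultimately show False by argo
      qed
    qed
  qed simp
  then show ?thesis by simp
qed

text \<open>
  Nonadjacent vertices of the 4-cycle have a common neighbour, and one of them is 3 or 4, to which
  nothing is attached.
\<close>

lemma cyc4_near:
  assumes "attached {1, 2, 3, 4} k m x" "attached {1, 2, 3, 4} k m y" "k 3 = 0" "k 4 = 0" "m 3 = 0" "m 4 = 0"
  shows "near (attE cyc4 {1, 2, 3, 4} k m) 3 x y"
proof -
  let ?E = "attE cyc4 {1, 2, 3, 4} k m"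
  have b: "base x \<in> {1, 2, 3, 4}" "base y \<in> {1, 2, 3, 4}" using assms(1,2) attached_base by blast+
  have core: "z = Core (base z)" if "attached {1, 2, 3, 4} k m z" "base z = 3 \<or> base z = 4" for z
    using that assms by (cases z) auto
  have step: "\<exists>l\<in>{1, 2, 3, 4}. (i, l) \<in> cyc4 \<and> (l, j) \<in> cyc4"
    if "i \<in> {1, 2, 3, 4}" "j \<in> {1, 2, 3, 4}" "i \<noteq> j" "(i, j) \<notin> cyc4" for i j
    using that by (auto simp: cyc4_def)
  show ?thesis
  proof (cases "base x = base y \<or> (base x, base y) \<in> cyc4")
    case True then show ?thesis using near_adj_base assms by blast
  next
    case False
    then consider "base x = 3 \<or> base x = 4" | "base y = 3 \<or> base y = 4"
      using b by (auto simp: cyc4_def)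
    then show ?thesis
    proof cases
      case 1
      obtain l where l: "l \<in> {1, 2, 3, 4}" "(base x, l) \<in> cyc4" "(l, base y) \<in> cyc4"
        using step[OF b] False by blast
      have "near ?E 3 (Core (base x)) y" using near_core_two[OF b(1) l(1) assms(2) l(2,3)] .
      then show ?thesis using core[OF assms(1) 1] by simp
    next
      case 2
      obtain l where l: "l \<in> {1, 2, 3, 4}" "(base x, l) \<in> cyc4" "(l, base y) \<in> cyc4"
        using step[OF b] False by blast
      then have "(base y, l) \<in> cyc4" "(l, base x) \<in> cyc4" using symD[OF sym_cyc4] by blast+
      then have "near ?E 3 (Core (base y)) x" using near_core_two[OF b(2) l(1) assms(1)] by blast
      then show ?thesis using core[OF assms(2) 2] near_sym[OF sym_attE[OF sym_cyc4]] by simp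
    qed
  qed
qed

lemma lower_cyc4_leaves:
  assumes "k 1 = 1" "k 2 = 1" "k 3 = 0" "k 4 = 0" "\<And>i. m i = 0"
  shows "4 \<le> pchi (attV {1, 2, 3, 4} k m) (attE cyc4 {1, 2, 3, 4} k m)"
  (is "_ \<le> pchi ?V ?E")
proof -
  have "2 + 2 \<le> pchi ?V ?E"
  proof (rule pchi_lower)
    show "finite ?V" by simp
    show "near ?E 3 x y" if "x \<in> ?V" "y \<in> ?V" for x y
      using that assms by (intro cyc4_near) auto
    fix X1 X2
    assume *: "X1 \<subseteq> ?V" "X2 \<subseteq> ?V" "X1 \<inter> X2 = {}" "pack ?E 1 X1" "pack ?E 2 X2"
    interpret partial_colouring cyc4 "{1, 2, 3, 4}" k m X1 X2
      using * by unfold_locales auto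
    show "2 \<le> card (?V - X1 - X2)"
      unfolding rest_def[symmetric]
    proof (rule ccontr)
      assume n: "\<not> 2 \<le> card rest"
      have cov: "v \<in> X1 \<or> v \<in> X2 \<or> v \<in> rest" if "attached {1, 2, 3, 4} k m v" for v
        using covered[OF that] by blast
      have r: "x \<notin> rest \<or> y \<notin> rest" if "x \<noteq> y" for x y
        using rest_two[OF n] that by blast
      \<comment> \<open>With at most one of six vertices uncoloured, what remains is a propositional contradiction.\<close>
      have c: "Core 1 \<in> X1 \<or> Core 1 \<in> X2 \<or> Core 1 \<in> rest" "Core 2 \<in> X1 \<or> Core 2 \<in> X2 \<or> Core 2 \<in> rest"
        "Core 3 \<in> X1 \<or> Core 3 \<in> X2 \<or> Core 3 \<in> rest" "Core 4 \<in> X1 \<or> Core 4 \<in> X2 \<or> Core 4 \<in> rest"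
          "Leaf 1 1 \<in> X1 \<or> Leaf 1 1 \<in> X2 \<or> Leaf 1 1 \<in> rest" "Leaf 2 1 \<in> X1 \<or> Leaf 2 1 \<in> X2 \<or> Leaf 2 1 \<in> rest"
        using assms(1,2) by (intro cov; simp)+
      have a: "Core 1 \<notin> X1 \<or> Core 2 \<notin> X1" "Core 2 \<notin> X1 \<or> Core 3 \<notin> X1"
        "Core 3 \<notin> X1 \<or> Core 4 \<notin> X1" "Core 4 \<notin> X1 \<or> Core 1 \<notin> X1" "Core 1 \<notin> X1 \<or> Leaf 1 1 \<notin> X1"
          "Core 2 \<notin> X1 \<or> Leaf 2 1 \<notin> X1"
        by (rule X1_nadj; simp add: cyc4_def)+
      have b: "Core 1 \<notin> X2 \<or> Core 2 \<notin> X2" "Core 2 \<notin> X2 \<or> Core 3 \<notin> X2"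
        "Core 3 \<notin> X2 \<or> Core 4 \<notin> X2" "Core 4 \<notin> X2 \<or> Core 1 \<notin> X2" "Core 1 \<notin> X2 \<or> Leaf 1 1 \<notin> X2"
          "Core 2 \<notin> X2 \<or> Leaf 2 1 \<notin> X2"
        by (rule X2_nadj; simp add: cyc4_def)+
      have d1: "Core 1 \<notin> X2 \<or> Core 3 \<notin> X2"
        by (rule X2_nadj2[of _ "Core 2"]) (simp_all add: cyc4_def assms)
      have d2: "Core 1 \<notin> X2 \<or> Leaf 2 1 \<notin> X2"
        by (rule X2_nadj2[of _ "Core 2"]) (simp_all add: cyc4_def assms)
      have d3: "Core 2 \<notin> X2 \<or> Core 4 \<notin> X2"
        by (rule X2_nadj2[of _ "Core 1"]) (simp_all add: cyc4_def assms)
      have d4: "Core 2 \<notin> X2 \<or> Leaf 1 1 \<notin> X2"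
        by (rule X2_nadj2[of _ "Core 1"]) (simp_all add: cyc4_def assms)
      have d5: "Core 3 \<notin> X2 \<or> Leaf 2 1 \<notin> X2"
        by (rule X2_nadj2[of _ "Core 2"]) (simp_all add: cyc4_def assms)
      have d6: "Core 4 \<notin> X2 \<or> Leaf 1 1 \<notin> X2"
        by (rule X2_nadj2[of _ "Core 1"]) (simp_all add: cyc4_def assms)
      have e: "Core 1 \<notin> rest \<or> Core 2 \<notin> rest" "Core 1 \<notin> rest \<or> Core 3 \<notin> rest"
        "Core 1 \<notin> rest \<or> Core 4 \<notin> rest" "Core 1 \<notin> rest \<or> Leaf 1 1 \<notin> rest"
          "Core 1 \<notin> rest \<or> Leaf 2 1 \<notin> rest" "Core 2 \<notin> rest \<or> Core 3 \<notin> rest"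
            "Core 2 \<notin> rest \<or> Core 4 \<notin> rest" "Core 2 \<notin> rest \<or> Leaf 1 1 \<notin> rest"
              "Core 2 \<notin> rest \<or> Leaf 2 1 \<notin> rest" "Core 3 \<notin> rest \<or> Core 4 \<notin> rest"
                "Core 3 \<notin> rest \<or> Leaf 1 1 \<notin> rest" "Core 3 \<notin> rest \<or> Leaf 2 1 \<notin> rest"
                  "Core 4 \<notin> rest \<or> Leaf 1 1 \<notin> rest" "Core 4 \<notin> rest \<or> Leaf 2 1 \<notin> rest"
                    "Leaf 1 1 \<notin> rest \<or> Leaf 2 1 \<notin> rest"
        by (rule r; simp)+
      show False using a b c d1 d2 d3 d4 d5 d6 e by argo
    qed
  qed simp
  then show ?thesis by simp
qed

text \<open>
  The vertices 3 and 4 are adjacent, so they do not both have colour 1. If one is uncoloured, it is the vertex left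
  over in addition to those of the triangles. If one has colour 2, its neighbour among 1 and 2 has no vertex of
  colour 2 attached and leaves over one more.
\<close>

lemma lower_cyc4_triangles:
  assumes "k 3 = 0" "k 4 = 0" "m 1 \<ge> 1" "m 2 \<ge> 1" "m 3 = 0" "m 4 = 0"
  shows "m 1 + m 2 + 3 \<le> pchi (attV {1, 2, 3, 4} k m) (attE cyc4 {1, 2, 3, 4} k m)"
  (is "_ \<le> pchi ?V ?E")
proof -
  have "(m 1 + m 2 + 1) + 2 \<le> pchi ?V ?E"
  proof (rule pchi_lower)
    show "finite ?V" by simp
    show "near ?E 3 x y" if "x \<in> ?V" "y \<in> ?V" for x y
      using that assms by (intro cyc4_near) auto
    fix X1 X2
    assume *: "X1 \<subseteq> ?V" "X2 \<subseteq> ?V" "X1 \<inter> X2 = {}" "pack ?E 1 X1" "pack ?E 2 X2"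
    interpret partial_colouring cyc4 "{1, 2, 3, 4}" k m X1 X2
      using * by unfold_locales auto
    have sum: "card rest = card (rest_at 1) + card (rest_at 2) + card (rest_at 3) + card (rest_at 4)"
      unfolding card_rest by simp
    have 12: "m 1 \<le> card (rest_at 1)" "m 2 \<le> card (rest_at 2)"
      using assms by (intro rest_at_triangles; simp)+
    consider "Core 3 \<in> rest" | "Core 4 \<in> rest" | "Core 4 \<in> X2" | "Core 3 \<in> X2"
      using covered[of "Core 3"] covered[of "Core 4"] X1_adj[of "Core 3" "Core 4"]
      by (auto simp: cyc4_def)
    then have "m 1 + m 2 + 1 \<le> card rest"
    proof cases
      case 1 then show ?thesis using rest_at_core[of 3] sum 12 by simp
    next
      case 2 then show ?thesis using rest_at_core[of 4] sum 12 by simp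
    next
      case 3
      have "m 1 + 1 \<le> card (rest_at 1)"
      proof (rule rest_at_triangles_strict)
        fix v assume "v \<in> X2"
        then show "base v \<noteq> 1" using X2_adj_base[OF 3, of v] by (fastforce simp: cyc4_def)
      qed (use assms in simp_all)
      then show ?thesis using sum 12 by simp
    next
      case 4
      have "m 2 + 1 \<le> card (rest_at 2)"
      proof (rule rest_at_triangles_strict)
        fix v assume "v \<in> X2"
        then show "base v \<noteq> 2" using X2_adj_base[OF 4, of v] by (fastforce simp: cyc4_def)
      qed (use assms in simp_all)
      then show ?thesis using sum 12 by simp
    qed
    then show "m 1 + m 2 + 1 \<le> card (?V - X1 - X2)" unfolding rest_def .
  qed simp
  then show ?thesis by simp
qed

lemma cyc5_near:
  assumes "attached {1, 2, 3, 4, 5} k m x" "attached {1, 2, 3, 4, 5} k m y" "\<And>i. i \<noteq> 1 \<Longrightarrow> k i = 0 \<and> m i = 0"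
  shows "near (attE cyc5 {1, 2, 3, 4, 5} k m) 3 x y"
proof -
  let ?E = "attE cyc5 {1, 2, 3, 4, 5} k m"
  have b: "base x \<in> {1, 2, 3, 4, 5}" "base y \<in> {1, 2, 3, 4, 5}" using assms(1,2) attached_base by blast+
  have core: "z = Core (base z)" if "attached {1, 2, 3, 4, 5} k m z" "base z \<noteq> 1" for z
    using that assms(3) by (cases z) (auto dest!: assms(3))
  have step: "\<exists>l\<in>{1, 2, 3, 4, 5}. (i, l) \<in> cyc5 \<and> (l, j) \<in> cyc5"
    if "i \<in> {1, 2, 3, 4, 5}" "j \<in> {1, 2, 3, 4, 5}" "i \<noteq> j" "(i, j) \<notin> cyc5" for i j
    using that by (auto simp: cyc5_def)
  show ?thesis
  proof (cases "base x = base y \<or> (base x, base y) \<in> cyc5")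
    case True then show ?thesis using near_adj_base assms by blast
  next
    case False
    obtain l where l: "l \<in> {1, 2, 3, 4, 5}" "(base x, l) \<in> cyc5" "(l, base y) \<in> cyc5"
      using step[OF b] False by blast
    consider "base x \<noteq> 1" | "base y \<noteq> 1" using False by fastforce
    then show ?thesis
    proof cases
      case 1
      have "near ?E 3 (Core (base x)) y" using near_core_two[OF b(1) l(1) assms(2) l(2,3)] .
      then show ?thesis using core[OF assms(1) 1] by simp
    next
      case 2
      from l have "(base y, l) \<in> cyc5" "(l, base x) \<in> cyc5" using symD[OF sym_cyc5] by blast+
      then have "near ?E 3 (Core (base y)) x" using near_core_two[OF b(2) l(1) assms(1)] by blast
      then show ?thesis using core[OF assms(2) 2] near_sym[OF sym_attE[OF sym_cyc5]] by simp
    qed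
  qed
qed

lemma (in partial_colouring) cyc5_X2:
  assumes "B = cyc5" "C = {1, 2, 3, 4, 5}" "i \<in> C" "j \<in> C" "Core i \<in> X2" "Core j \<in> X2"
  shows "i = j"
proof (rule ccontr)
  assume "i \<noteq> j"
  have "(i, j) \<in> cyc5 \<or> (\<exists>l\<in>C. (i, l) \<in> cyc5 \<and> (l, j) \<in> cyc5)"
    using assms(3,4) \<open>i \<noteq> j\<close> unfolding assms(2) by (auto simp: cyc5_def)
  then show False
  proof
    assume "(i, j) \<in> cyc5"
    then show False using X2_adj[OF assms(5,6)] \<open>i \<noteq> j\<close> unfolding assms(1) by simp
  next
    assume "\<exists>l\<in>C. (i, l) \<in> cyc5 \<and> (l, j) \<in> cyc5"
    then obtain l where "l \<in> C" "(i, l) \<in> cyc5" "(l, j) \<in> cyc5" by blast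
    then show False using X2_two_steps[OF assms(5,6), of "Core l"] \<open>i \<noteq> j\<close> unfolding assms(1) by simp
  qed
qed

text \<open>
  On the path 2, 3, 4, 5 colour 1 occurs at most twice. Colour 2 occurs at most once, as the 5-cycle has
  diameter 2. So one vertex is left over in addition to those of the triangles.
\<close>

lemma lower_cyc5:
  assumes "\<And>i. i \<noteq> 1 \<Longrightarrow> k i = 0 \<and> m i = 0" "m 1 \<ge> 1"
  shows "m 1 + 3 \<le> pchi (attV {1, 2, 3, 4, 5} k m) (attE cyc5 {1, 2, 3, 4, 5} k m)"
  (is "_ \<le> pchi ?V ?E")
proof -
  have "(m 1 + 1) + 2 \<le> pchi ?V ?E"
  proof (rule pchi_lower)
    show "finite ?V" by simp
    show "near ?E 3 x y" if "x \<in> ?V" "y \<in> ?V" for x y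
      using that assms by (intro cyc5_near) auto
    fix X1 X2
    assume *: "X1 \<subseteq> ?V" "X2 \<subseteq> ?V" "X1 \<inter> X2 = {}" "pack ?E 1 X1" "pack ?E 2 X2"
    interpret partial_colouring cyc5 "{1, 2, 3, 4, 5}" k m X1 X2
      using * by unfold_locales auto
    note x2 = cyc5_X2[OF refl refl]
    have sum: "card rest = card (rest_at 1) + card (rest_at 2) + card (rest_at 3) + card (rest_at 4) + card (rest_at 5)"
      unfolding card_rest by simp
    have 1: "m 1 \<le> card (rest_at 1)"
      using assms by (intro rest_at_triangles; simp)
    have x: "Core i \<notin> X2 \<or> Core j \<notin> X2" if "i \<in> {1, 2, 3, 4, 5}" "j \<in> {1, 2, 3, 4, 5}" "i \<noteq> j" for i j
      using x2[of i j] that by blast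
    have "Core 2 \<in> X1 \<or> Core 2 \<in> X2 \<or> Core 2 \<in> rest" "Core 3 \<in> X1 \<or> Core 3 \<in> X2 \<or> Core 3 \<in> rest"
      "Core 4 \<in> X1 \<or> Core 4 \<in> X2 \<or> Core 4 \<in> rest" "Core 5 \<in> X1 \<or> Core 5 \<in> X2 \<or> Core 5 \<in> rest"
      using covered by force+
    moreover have "Core 2 \<notin> X1 \<or> Core 3 \<notin> X1" "Core 3 \<notin> X1 \<or> Core 4 \<notin> X1"
      "Core 4 \<notin> X1 \<or> Core 5 \<notin> X1"
      by (rule X1_nadj; simp add: cyc5_def)+
    moreover have "Core 2 \<notin> X2 \<or> Core 3 \<notin> X2" "Core 2 \<notin> X2 \<or> Core 4 \<notin> X2"
      "Core 2 \<notin> X2 \<or> Core 5 \<notin> X2" "Core 3 \<notin> X2 \<or> Core 4 \<notin> X2" "Core 3 \<notin> X2 \<or> Core 5 \<notin> X2"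
        "Core 4 \<notin> X2 \<or> Core 5 \<notin> X2"
      by (rule x; simp)+
    ultimately have "Core 2 \<in> rest \<or> Core 3 \<in> rest \<or> Core 4 \<in> rest \<or> Core 5 \<in> rest"
      by argo
    then show "m 1 + 1 \<le> card (?V - X1 - X2)"
      unfolding rest_def[symmetric] sum
      using 1 rest_at_core[of 2] rest_at_core[of 3] rest_at_core[of 4] rest_at_core[of 5] by auto
  qed simp
  then show ?thesis by simp
qed

text \<open>
  Colour 1 occurs at most twice and colour 2 at most once.
\<close>

lemma lower_cyc5_bare:
  "4 \<le> pchi (attV {1, 2, 3, 4, 5} (\<lambda>_. 0) (\<lambda>_. 0)) (attE cyc5 {1, 2, 3, 4, 5} (\<lambda>_. 0) (\<lambda>_. 0))"
  (is "_ \<le> pchi ?V ?E")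
proof -
  have "2 + 2 \<le> pchi ?V ?E"
  proof (rule pchi_lower)
    show "finite ?V" by simp
    show "near ?E 3 x y" if "x \<in> ?V" "y \<in> ?V" for x y
      using that by (intro cyc5_near) auto
    fix X1 X2
    assume *: "X1 \<subseteq> ?V" "X2 \<subseteq> ?V" "X1 \<inter> X2 = {}" "pack ?E 1 X1" "pack ?E 2 X2"
    interpret partial_colouring cyc5 "{1, 2, 3, 4, 5}" "\<lambda>_. 0" "\<lambda>_. 0" X1 X2
      using * by unfold_locales auto
    note x2 = cyc5_X2[OF refl refl]
    show "2 \<le> card (?V - X1 - X2)"
      unfolding rest_def[symmetric]
    proof (rule ccontr)
      assume n: "\<not> 2 \<le> card rest"
      note two = rest_two[OF n]
      have t: "Core i \<notin> rest \<or> Core j \<notin> rest" if "i \<noteq> j" for i j using two that by blast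
      have x: "Core i \<notin> X2 \<or> Core j \<notin> X2" if "i \<in> {1, 2, 3, 4, 5}" "j \<in> {1, 2, 3, 4, 5}" "i \<noteq> j" for i j
        using x2[of i j] that by blast
      have a: "Core i \<notin> X1 \<or> Core j \<notin> X1" if "(i, j) \<in> cyc5" "i \<noteq> j" for i j
        using that by (intro X1_nadj) simp_all
      have c: "Core i \<in> X1 \<or> Core i \<in> X2 \<or> Core i \<in> rest" if "i \<in> {1, 2, 3, 4, 5}" for i
        using covered[of "Core i"] that by auto
      have a': "Core 1 \<notin> X1 \<or> Core 2 \<notin> X1" "Core 2 \<notin> X1 \<or> Core 3 \<notin> X1"
        "Core 3 \<notin> X1 \<or> Core 4 \<notin> X1"
        "Core 4 \<notin> X1 \<or> Core 5 \<notin> X1" "Core 5 \<notin> X1 \<or> Core 1 \<notin> X1"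
        by (rule a; simp add: cyc5_def)+
      have c': "Core 1 \<in> X1 \<or> Core 1 \<in> X2 \<or> Core 1 \<in> rest" "Core 2 \<in> X1 \<or> Core 2 \<in> X2 \<or> Core 2 \<in> rest"
        "Core 3 \<in> X1 \<or> Core 3 \<in> X2 \<or> Core 3 \<in> rest" "Core 4 \<in> X1 \<or> Core 4 \<in> X2 \<or> Core 4 \<in> rest"
        "Core 5 \<in> X1 \<or> Core 5 \<in> X2 \<or> Core 5 \<in> rest" by (rule c; simp)+
      show False
        using a' c' x[of 1 2] x[of 1 3] x[of 1 4] x[of 1 5] x[of 2 3] x[of 2 4] x[of 2 5] x[of 3 4] x[of 3 5] x[of 4 5]
          t[of 1 2] t[of 1 3] t[of 1 4] t[of 1 5] t[of 2 3] t[of 2 4] t[of 2 5] t[of 3 4] t[of 3 5] t[of 4 5]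
        by (simp; argo)
    qed
  qed simp
  then show ?thesis by simp
qed

section \<open>Upper bounds on the packing chromatic number\<close>

text \<open>
  The distance to the core.
\<close>

fun depth :: "cactus_vertex \<Rightarrow> nat" where
  "depth (Core i) = 0" | "depth (Leaf i j) = 1" | "depth (TriU i j) = 1" | "depth (TriV i j) = 1"

lemma adjp_base:
  "adjp B x y \<Longrightarrow> (base x = base y \<and> depth x \<le> Suc (depth y)) \<or> (x = Core (base x) \<and> y = Core (base y) \<and> (base x, base y) \<in> B)"
  by (cases x; cases y) auto

text \<open>
  A walk between vertices with different core vertices descends to the core and climbs out again, and in between
  walks in the core relation.
\<close>

lemma near_base:
  "near (adjR B) n x y \<Longrightarrow> base x = base y \<or> (\<exists>p. p + depth x + depth y \<le> n \<and> near B p (base x) (base y))"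
proof (induction n arbitrary: x)
  case (Suc n)
  from Suc.prems consider "near (adjR B) n x y" | w where "adjp B x w" "near (adjR B) n w y" by auto
  then show ?case
  proof cases
    case 1
    then show ?thesis using Suc.IH le_SucI by blast
  next
    case 2
    note IH = Suc.IH[OF 2(2)]
    from adjp_base[OF 2(1)] show ?thesis
    proof
      assume *: "base x = base w \<and> depth x \<le> Suc (depth w)"
      show ?thesis
      proof (cases "base x = base y")
        case False
        then obtain p where "p + depth w + depth y \<le> n" "near B p (base x) (base y)"
          using IH * by auto
        then have "p + depth x + depth y \<le> Suc n \<and> near B p (base x) (base y)" using * by simp
        then show ?thesis by blast
      qed simp
    next
      assume *: "x = Core (base x) \<and> w = Core (base w) \<and> (base x, base w) \<in> B"
      then have d: "depth x = 0" "depth w = 0" by (metis depth.simps(1))+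
      show ?thesis
      proof (cases "base w = base y")
        case True
        have "depth y \<le> n"
        proof (cases n)
          case 0
          then show ?thesis using 2(2) d by simp
        next
          case (Suc n')
          have "depth y \<le> 1" by (cases y) auto
          then show ?thesis using Suc by simp
        qed
        then have "1 + depth x + depth y \<le> Suc n \<and> near B 1 (base x) (base y)"
          using d * True unfolding near_1 by simp
        then show ?thesis by blast
      next
        case False
        then obtain p where p: "p + depth w + depth y \<le> n" "near B p (base w) (base y)" using IH by auto
        have "near B (Suc p) (base x) (base y)" using * p(2) by auto
        then have "Suc p + depth x + depth y \<le> Suc n \<and> near B (Suc p) (base x) (base y)" using p(1) d by simp
        then show ?thesis by blast
      qed
    qed
  qed
qed simp

text \<open>
  For sets that meet every fibre of \<open>base\<close> at most once, packing is decided in the core relation, which is finite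
  in the applications.
\<close>

lemma pack_bases:
  assumes "F \<subseteq> adjR B"
    and "\<And>x y. x \<in> X \<Longrightarrow> y \<in> X \<Longrightarrow> base x = base y \<Longrightarrow> x = y"
    and "\<And>x y p. x \<in> X \<Longrightarrow> y \<in> X \<Longrightarrow> base x \<noteq> base y \<Longrightarrow> p + depth x + depth y \<le> n \<Longrightarrow> \<not> near B p (base x) (base y)"
  shows "pack F n X"
proof (rule packI)
  fix x y assume xy: "x \<in> X" "y \<in> X" "near F n x y"
  have "near (adjR B) n x y" by (rule near_subset[OF xy(3) assms(1)])
  from near_base[OF this] have "base x = base y"
  proof
    assume "\<exists>p. p + depth x + depth y \<le> n \<and> near B p (base x) (base y)"
    then obtain p where "p + depth x + depth y \<le> n" "near B p (base x) (base y)" by (elim exE conjE)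
    then show ?thesis using assms(3)[OF xy(1,2), of p] by (cases "base x = base y") simp_all
  qed
  then show "x = y" by (rule assms(2)[OF xy(1,2)])
qed

text \<open>
  Attached vertices with different core vertices are at distance at least 3.
\<close>

lemma pack_2_attached:
  assumes "F \<subseteq> adjR B" "\<And>x. x \<in> X \<Longrightarrow> depth x = 1"
    and "\<And>x y. x \<in> X \<Longrightarrow> y \<in> X \<Longrightarrow> base x = base y \<Longrightarrow> x = y"
  shows "pack F 2 X"
  by (rule pack_bases[OF assms(1,3)]) (use assms(2) in auto)

lemma pack1I:
  assumes "\<And>x y. x \<in> X \<Longrightarrow> y \<in> X \<Longrightarrow> (x, y) \<in> F \<Longrightarrow> x = y"
  shows "pack F 1 X"
  by (rule packI) (use assms in \<open>auto simp: near_1\<close>)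

lemma pack_single: "pack F n {x}"
  by (simp add: pack_def)

lemma pack_insert:
  assumes "pack F n X" "\<And>x. x \<in> X \<Longrightarrow> \<not> near F n u x" "\<And>x. x \<in> X \<Longrightarrow> \<not> near F n x u"
  shows "pack F n (insert u X)"
proof (rule packI)
  fix x y assume "x \<in> insert u X" "y \<in> insert u X" "near F n x y"
  then show "x = y" using packD[OF assms(1), of x y] assms(2)[of y] assms(3)[of x] by fast
qed

lemma card_cores_triangles:
  assumes "finite C" "finite S" "\<And>i. finite (J i)"
  shows "finite (Core ` S \<union> {TriV i j | i j. i \<in> C \<and> j \<in> J i})"
    and "card (Core ` S \<union> {TriV i j | i j. i \<in> C \<and> j \<in> J i}) \<le> card S + (\<Sum>i\<in>C. card (J i))"
proof -
  have eq: "{TriV i j | i j. i \<in> C \<and> j \<in> J i} = (\<Union>i\<in>C. TriV i ` J i)" by auto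
  show "finite (Core ` S \<union> {TriV i j | i j. i \<in> C \<and> j \<in> J i})"
    unfolding eq using assms by simp
  have "card (Core ` S \<union> {TriV i j | i j. i \<in> C \<and> j \<in> J i}) \<le> card (Core ` S) + card (\<Union>i\<in>C. TriV i ` J i)"
    unfolding eq by (rule card_Un_le)
  also have "card (Core ` S) \<le> card S" by (rule card_image_le[OF assms(2)])
  also have "card (\<Union>i\<in>C. TriV i ` J i) \<le> (\<Sum>i\<in>C. card (TriV i ` J i))" by (rule card_UN_le[OF assms(1)])
  also have "\<dots> \<le> (\<Sum>i\<in>C. card (J i))" using assms(3) by (intro sum_mono card_image_le) auto
  finally show "card (Core ` S \<union> {TriV i j | i j. i \<in> C \<and> j \<in> J i}) \<le> card S + (\<Sum>i\<in>C. card (J i))"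
    by simp
qed

text \<open>
  The common form of the upper bounds. The colours 1 and 2 are given in a larger relation \<open>F\<close>; privately
  coloured are the core vertices in \<open>S\<close> and, of the triangles with numbers in \<open>J i\<close>, one outer vertex.
\<close>

lemma upper_cores_triangles:
  assumes "finite C" "finite S" "\<And>i. finite (J i)" "E \<subseteq> F" "pack F 1 X1" "pack F 2 X2"
    and "attV C k m \<subseteq> X1 \<union> X2 \<union> (Core ` S \<union> {TriV i j | i j. i \<in> C \<and> j \<in> J i})"
    and "card S + (\<Sum>i\<in>C. card (J i)) \<le> r"
  shows "pchi (attV C k m) E \<le> 2 + r"
proof -
  have "pchi (attV C k m) E \<le> 2 + card (Core ` S \<union> {TriV i j | i j. i \<in> C \<and> j \<in> J i})"
    using assms pack_mono[OF assms(5,4) order.refl] pack_mono[OF assms(6,4) order.refl]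
    by (intro pchi_upper2[OF assms(7) card_cores_triangles(1)])
  then show ?thesis using card_cores_triangles(2)[of C S J] assms by (meson add_left_mono le_trans)
qed

lemma upper_cores_triangles3:
  assumes "finite C" "finite S" "\<And>i. finite (J i)" "E \<subseteq> F" "pack F 1 X1" "pack F 2 X2" "pack F 3 X3"
    and "attV C k m \<subseteq> X1 \<union> X2 \<union> X3 \<union> (Core ` S \<union> {TriV i j | i j. i \<in> C \<and> j \<in> J i})"
    and "card S + (\<Sum>i\<in>C. card (J i)) \<le> r"
  shows "pchi (attV C k m) E \<le> 3 + r"
proof -
  have "pchi (attV C k m) E \<le> 3 + card (Core ` S \<union> {TriV i j | i j. i \<in> C \<and> j \<in> J i})"
    using assms pack_mono[OF assms(5,4) order.refl] pack_mono[OF assms(6,4) order.refl]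
      pack_mono[OF assms(7,4) order.refl]
    by (intro pchi_upper3[OF assms(8) card_cores_triangles(1)])
  then show ?thesis using card_cores_triangles(2)[of C S J] assms by (meson add_left_mono le_trans)
qed

text \<open>
  The number of vertices that the colours 1 and 2 leave over if the core is complete, some triangle is attached, and
  every core vertex carries a triangle or two leaves.
\<close>

definition weight :: "nat set \<Rightarrow> (nat \<Rightarrow> nat) \<Rightarrow> nat" where
  "weight C m = (\<Sum>i\<in>C. max 1 (m i))"

lemma weight_eq: "weight C m = card C + (\<Sum>i\<in>C. m i - 1)"
proof -
  have "weight C m = (\<Sum>i\<in>C. 1 + (m i - 1))" unfolding weight_def by (rule sum.cong) auto
  also have "\<dots> = card C + (\<Sum>i\<in>C. m i - 1)"
    unfolding sum.distrib by (simp only: card_eq_sum)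
  finally show ?thesis .
qed

lemma weight_remove: "finite C \<Longrightarrow> i \<in> C \<Longrightarrow> weight C m = max 1 (m i) + weight (C - {i}) m"
  unfolding weight_def by (rule sum.remove)

text \<open>
  Colour 1 goes to all leaves and to one outer vertex of every triangle, colour 2 to the other outer vertex of
  the first triangle at each core vertex. The rest is coloured privately.
\<close>

lemma upper_default:
  assumes "finite C" "\<And>i. (i, i) \<notin> B"
  shows "pchi (attV C k m) (attE B C k m) \<le> 2 + weight C m"
proof (rule upper_cores_triangles[where S = C and J = "\<lambda>i. {2..m i}" and F = "adjR B"
      and ?X1.0 = "{Leaf i j | i j. True} \<union> {TriU i j | i j. True}" and ?X2.0 = "{TriV i 1 | i. True}"])
  show "pack (adjR B) 1 ({Leaf i j | i j. True} \<union> {TriU i j | i j. True})"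
    by (rule pack1I) auto
  show "pack (adjR B) 2 {TriV i 1 | i. True}"
    by (rule pack_2_attached[OF order.refl]) auto
  show "attV C k m \<subseteq> {Leaf i j | i j. True} \<union> {TriU i j | i j. True} \<union> {TriV i 1 | i. True}
    \<union> (Core ` C \<union> {TriV i j | i j. i \<in> C \<and> j \<in> {2..m i}})"
  proof
    fix v assume "v \<in> attV C k m"
    then show "v \<in> {Leaf i j | i j. True} \<union> {TriU i j | i j. True} \<union> {TriV i 1 | i. True}
      \<union> (Core ` C \<union> {TriV i j | i j. i \<in> C \<and> j \<in> {2..m i}})"
      by (cases v) auto
  qed
  show "card C + (\<Sum>i\<in>C. card {2..m i}) \<le> weight C m"
    unfolding weight_eq by simp
qed (use assms attE_sub in auto)

text \<open>
  A core vertex with at most one leaf and no triangle costs nothing: it takes colour 1 and its leaf colour 2.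
\<close>

lemma upper_gain:
  assumes "finite C" "\<And>i. (i, i) \<notin> B" "c \<in> C" "k c \<le> 1" "m c = 0"
  shows "pchi (attV C k m) (attE B C k m) \<le> 2 + weight (C - {c}) m"
proof (rule upper_cores_triangles[where S = "C - {c}" and J = "\<lambda>i. {2..m i}" and F = "adjR B"
      and ?X1.0 = "{Leaf i j | i j. i \<noteq> c} \<union> {TriU i j | i j. i \<noteq> c} \<union> {Core c}"
      and ?X2.0 = "{TriV i 1 | i. i \<noteq> c} \<union> {Leaf c 1}"])
  show "pack (adjR B) 1 ({Leaf i j | i j. i \<noteq> c} \<union> {TriU i j | i j. i \<noteq> c} \<union> {Core c})"
    by (rule pack1I) auto
  show "pack (adjR B) 2 ({TriV i 1 | i. i \<noteq> c} \<union> {Leaf c 1})"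
    by (rule pack_2_attached[OF order.refl]) auto
  show "attV C k m \<subseteq> {Leaf i j | i j. i \<noteq> c} \<union> {TriU i j | i j. i \<noteq> c} \<union> {Core c} \<union> ({TriV i 1 | i. i \<noteq> c} \<union> {Leaf c 1})
    \<union> (Core ` (C - {c}) \<union> {TriV i j | i j. i \<in> C \<and> j \<in> {2..m i}})"
  proof
    fix v assume "v \<in> attV C k m"
    then show "v \<in> {Leaf i j | i j. i \<noteq> c} \<union> {TriU i j | i j. i \<noteq> c} \<union> {Core c} \<union> ({TriV i 1 | i. i \<noteq> c} \<union> {Leaf c 1})
    \<union> (Core ` (C - {c}) \<union> {TriV i j | i j. i \<in> C \<and> j \<in> {2..m i}})"
      using assms(4,5) by (cases v) auto
  qed
  have "(\<Sum>i\<in>C. m i - 1) = (\<Sum>i\<in>C - {c}. m i - 1)"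
    using assms by (simp add: sum.remove[of C c])
  then show "card (C - {c}) + (\<Sum>i\<in>C. card {2..m i}) \<le> weight (C - {c}) m"
    unfolding weight_eq by simp
qed (use assms attE_sub in auto)

text \<open>
  All leaves have colour 1 and one core vertex has colour 2.
\<close>

lemma upper_leaves:
  assumes "finite C" "\<And>i. (i, i) \<notin> B" "c \<in> C" "\<And>i. i \<in> C \<Longrightarrow> m i = 0"
  shows "pchi (attV C k m) (attE B C k m) \<le> 1 + card C"
proof -
  have "pchi (attV C k m) (attE B C k m) \<le> 2 + (card C - 1)"
  proof (rule upper_cores_triangles[where S = "C - {c}" and J = "\<lambda>i. {}" and F = "adjR B"
        and ?X1.0 = "{Leaf i j | i j. True}" and ?X2.0 = "{Core c}"])
    show "pack (adjR B) 1 {Leaf i j | i j. True}" by (rule pack1I) auto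
    show "attV C k m \<subseteq> {Leaf i j | i j. True} \<union> {Core c} \<union> (Core ` (C - {c}) \<union> {TriV i j | i j. i \<in> C \<and> j \<in> {}})"
    proof
      fix v assume "v \<in> attV C k m"
      then show "v \<in> {Leaf i j | i j. True} \<union> {Core c} \<union> (Core ` (C - {c}) \<union> {TriV i j | i j. i \<in> C \<and> j \<in> {}})"
        using assms(4) by (cases v) auto
    qed
  qed (use assms attE_sub pack_single in auto)
  moreover have "card C \<ge> 1" using assms(1,3) by (metis One_nat_def Suc_leI card_gt_0_iff empty_iff)
  ultimately show ?thesis by simp
qed

text \<open>
  Colour 1 for the bare core vertex and all leaves, colour 2 for one of the other core vertices.
\<close>

lemma upper_triangle_two_attached:
  assumes "a \<noteq> b" "a \<noteq> c" "b \<noteq> c" "m a = 0" "m b = 0" "m c = 0" "k c = 0"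
  shows "pchi (attV {a, b, c} k m) (attE (compl {a, b, c}) {a, b, c} k m) \<le> 3"
proof -
  have "pchi (attV {a, b, c} k m) (attE (compl {a, b, c}) {a, b, c} k m) \<le> 2 + 1"
  proof (rule upper_cores_triangles[where S = "{b}" and J = "\<lambda>i. {}" and F = "adjR (compl {a, b, c})"
        and ?X1.0 = "{Leaf i j | i j. i \<noteq> c} \<union> {Core c}" and ?X2.0 = "{Core a}"])
    show "pack (adjR (compl {a, b, c})) 1 ({Leaf i j | i j. i \<noteq> c} \<union> {Core c})" by (rule pack1I) auto
    show "attV {a, b, c} k m \<subseteq> {Leaf i j | i j. i \<noteq> c} \<union> {Core c} \<union> {Core a} \<union> (Core ` {b} \<union> {TriV i j | i j. i \<in> {a, b, c} \<and> j \<in> {}})"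
    proof
      fix v assume "v \<in> attV {a, b, c} k m"
      then show "v \<in> {Leaf i j | i j. i \<noteq> c} \<union> {Core c} \<union> {Core a} \<union> (Core ` {b} \<union> {TriV i j | i j. i \<in> {a, b, c} \<and> j \<in> {}})"
        using assms by (cases v) auto
    qed
  qed (use attE_sub pack_single in auto)
  then show ?thesis by simp
qed

section \<open>Criticality of the listed graphs\<close>

text \<open>
  Only one edge of each kind has to be deleted. The two edges from a core vertex into a triangle are exchanged by
  the automorphism \<open>f\<close> that swaps the outer vertices of all triangles.
\<close>

lemma crit_att:
  assumes "finite C" "sym B" "B \<subseteq> C \<times> C"
    and "\<And>i. i \<in> C \<Longrightarrow> \<exists>j. (i, j) \<in> B"
    and irrefl: "\<And>i. (i, i) \<notin> B"
    and core: "\<And>c d. (c, d) \<in> B \<Longrightarrow> c < d \<Longrightarrow> pchi (attV C k m) (attE B C k m - {(Core c, Core d), (Core d, Core c)}) < pchi (attV C k m) (attE B C k m)"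
    and leaf: "\<And>i j. i \<in> C \<Longrightarrow> 1 \<le> j \<Longrightarrow> j \<le> k i \<Longrightarrow> pchi (attV C k m) (attE B C k m - {(Core i, Leaf i j), (Leaf i j, Core i)}) < pchi (attV C k m) (attE B C k m)"
    and spoke: "\<And>i j. i \<in> C \<Longrightarrow> 1 \<le> j \<Longrightarrow> j \<le> m i \<Longrightarrow> pchi (attV C k m) (attE B C k m - {(Core i, TriU i j), (TriU i j, Core i)}) < pchi (attV C k m) (attE B C k m)"
    and far: "\<And>i j. i \<in> C \<Longrightarrow> 1 \<le> j \<Longrightarrow> j \<le> m i \<Longrightarrow> pchi (attV C k m) (attE B C k m - {(TriU i j, TriV i j), (TriV i j, TriU i j)}) < pchi (attV C k m) (attE B C k m)"
  shows "crit (attV C k m) (attE B C k m)"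
proof (rule critI)
  let ?V = "attV C k m" and ?E = "attE B C k m"
  show "finite ?V" using assms(1) by simp
  show "?E \<subseteq> ?V \<times> ?V" by (rule attE_sub)
  show "\<exists>w. (v, w) \<in> ?E" if "v \<in> ?V" for v
  proof (cases v)
    case (Core i)
    then have i: "i \<in> C" using that by simp
    obtain j where j: "(i, j) \<in> B" using assms(4)[OF i] by (rule exE)
    then have "j \<in> C" using assms(3) by blast
    then show ?thesis using Core i j by (intro exI[of _ "Core j"]) (simp add: in_attE)
  qed (use that in \<open>auto simp: in_attE intro: exI[of _ "Core (base v)"]\<close>)
  have spoke': "pchi ?V (?E - {(Core i, TriV i j), (TriV i j, Core i)}) < pchi ?V ?E"
    if ij: "i \<in> C" "1 \<le> j" "j \<le> m i" for i j
  proof -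
    define f where "f v = (case v of TriU i j \<Rightarrow> TriV i j | TriV i j \<Rightarrow> TriU i j | _ \<Rightarrow> v)" for v
    have "pchi ?V (?E - {(Core i, TriV i j), (TriV i j, Core i)}) \<le> pchi ?V (?E - {(Core i, TriU i j), (TriU i j, Core i)})"
    proof (rule pchi_hom[where f = f])
      show "inj_on f ?V" by (rule inj_on_inverseI[of _ f]) (simp add: f_def split: cactus_vertex.split)
      show "f ` ?V \<subseteq> ?V"
      proof
        fix w assume "w \<in> f ` ?V"
        then obtain v where "v \<in> ?V" "w = f v" by blast
        then show "w \<in> ?V" by (cases v) (auto simp: f_def)
      qed
      fix x y assume "(x, y) \<in> ?E - {(Core i, TriV i j), (TriV i j, Core i)}"
      then show "(f x, f y) \<in> ?E - {(Core i, TriU i j), (TriU i j, Core i)}"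
        by (cases x; cases y) (auto simp: f_def in_attE)
    qed (use assms(1) in simp)
    then show ?thesis using spoke[OF ij] by simp
  qed
  have flip: "{(a, b), (b, a)} = {(b, a), (a, b)}" for a b :: cactus_vertex by (rule insert_commute)
  have core': "pchi ?V (?E - {(Core c, Core d), (Core d, Core c)}) < pchi ?V ?E" if "(c, d) \<in> B" for c d
  proof (cases "c < d")
    case False
    then have "d < c" using that irrefl by (cases "c = d") auto
    then show ?thesis unfolding flip[of "Core c"] using core symD[OF assms(2) that] by blast
  qed (use core that in blast)
  have leaf_flip: "pchi ?V (?E - {(Leaf i j, Core i), (Core i, Leaf i j)}) < pchi ?V ?E"
    if "i \<in> C" "1 \<le> j" "j \<le> k i" for i j
    unfolding flip[of "Leaf i j"] using that by (rule leaf)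
  have spoke_flip: "pchi ?V (?E - {(TriU i j, Core i), (Core i, TriU i j)}) < pchi ?V ?E"
    if "i \<in> C" "1 \<le> j" "j \<le> m i" for i j
    unfolding flip[of "TriU i j"] using that by (rule spoke)
  have spokeV_flip: "pchi ?V (?E - {(TriV i j, Core i), (Core i, TriV i j)}) < pchi ?V ?E"
    if "i \<in> C" "1 \<le> j" "j \<le> m i" for i j
    unfolding flip[of "TriV i j"] using that by (rule spoke')
  have far_flip: "pchi ?V (?E - {(TriV i j, TriU i j), (TriU i j, TriV i j)}) < pchi ?V ?E"
    if "i \<in> C" "1 \<le> j" "j \<le> m i" for i j
    unfolding flip[of "TriV i j"] using that by (rule far)
  fix a b assume "(a, b) \<in> ?E"
  then have "adjp B a b" "attached C k m a" "attached C k m b" by (simp_all add: in_attE)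
  then show "pchi ?V (?E - {(a, b), (b, a)}) < pchi ?V ?E"
    by (cases a; cases b)
      (simp_all add: core' leaf spoke spoke' far leaf_flip spoke_flip spokeV_flip far_flip)
qed

text \<open>
  The number of colours is \<open>weight C m + 2\<close>, so the deletion of any edge has to save one colour. Deleting an edge
  of an attached leaf or triangle lets the colours 1 and 2 cover one more vertex. Deleting a core edge \<open>cd\<close> moves what is
  attached at \<open>c\<close> and \<open>d\<close> to distance at least 4, so colour 3 can be used twice.
\<close>

lemma crit_complete_core:
  assumes "finite C" "card C \<ge> 2"
    and types: "\<And>i. i \<in> C \<Longrightarrow> k i = 2 \<and> m i = 0 \<or> k i = 0 \<and> m i \<ge> 1"
    and ex: "i1 \<in> C" "m i1 \<ge> 1"
    and one: "\<And>i i'. i \<in> C \<Longrightarrow> i' \<in> C \<Longrightarrow> m i = 1 \<Longrightarrow> m i' \<ge> 1 \<Longrightarrow> i = i'"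
  shows "crit (attV C k m) (attE (compl C) C k m)"
proof -
  let ?V = "attV C k m" and ?E = "attE (compl C) C k m"
  have chi: "weight C m + 2 \<le> pchi ?V ?E"
    unfolding weight_def
  proof (rule lower_complete[where ?i1.0 = i1])
    show "k i \<ge> 2 \<or> m i \<ge> 1" if "i \<in> C" for i using types[OF that] by auto
  qed (fact assms(1) ex)+
  have less: "pchi ?V E' < pchi ?V ?E" if "pchi ?V E' \<le> 2 + (weight C m - 1)" for E'
  proof -
    have "weight C m \<ge> 1" using weight_remove[OF assms(1) ex(1)] by simp
    then show ?thesis using that chi by simp
  qed
  have other: "\<exists>j\<in>C. j \<noteq> i" for i
  proof (rule ccontr)
    assume "\<not> (\<exists>j\<in>C. j \<noteq> i)"
    then have "C \<subseteq> {i}" by blast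
    then have "card C \<le> card {i}" by (intro card_mono) simp_all
    then show False using assms(2) by simp
  qed
  have w1: "card (C - {i}) = weight C m - 1" if "i \<in> C" "\<And>i'. i' \<in> C \<Longrightarrow> m i' \<le> 1" for i
  proof -
    have "(\<Sum>i\<in>C. m i - 1) = 0" using that(2) by simp
    then show ?thesis using that(1) assms(1) unfolding weight_eq by simp
  qed
  have w2: "card C + (\<Sum>i'\<in>C. card (if i' = i then {1..m i} - {a, b} else {2..m i'})) \<le> weight C m - 1"
    if "i \<in> C" "m i \<ge> 2" "a \<in> {1..m i}" "b \<in> {1..m i}" "a \<noteq> b" for i a b
  proof -
    have "card ({1..m i} - {a, b}) = m i - 2" using that by (simp add: card_Diff_subset)
    moreover have "(\<Sum>i'\<in>C - {i}. card (if i' = i then {1..m i} - {a, b} else {2..m i'})) = (\<Sum>i'\<in>C - {i}. m i' - 1)"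
      by (rule sum.cong) auto
    moreover have "card C \<ge> 1" using assms(2) by simp
    ultimately show ?thesis
      using that(1,2) assms(1) unfolding weight_eq by (simp add: sum.remove[of C i])
  qed
  show ?thesis
  proof (rule crit_att[OF assms(1) sym_compl])
    show "compl C \<subseteq> C \<times> C" by (auto simp: compl_def)
    show "\<exists>j. (i, j) \<in> compl C" if "i \<in> C" for i using other[of i] that by auto
    show "(i, i) \<notin> compl C" for i by simp
  next
    fix i j assume ij: "i \<in> C" "1 \<le> j" "j \<le> m i"
    let ?F = "adjR (compl C) - {(TriU i j, TriV i j), (TriV i j, TriU i j)}"
    have sub: "?E - {(TriU i j, TriV i j), (TriV i j, TriU i j)} \<subseteq> ?F" using attE_sub(2) by blast
    show "pchi ?V (?E - {(TriU i j, TriV i j), (TriV i j, TriU i j)}) < pchi ?V ?E"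
    proof (rule less, cases "m i = 1")
      case True
      then have m: "m i' = 0" if "i' \<in> C" "i' \<noteq> i" for i' using one[OF ij(1) that(1) True] that(2) by (cases "m i' = 0") auto
      show "pchi ?V (?E - {(TriU i j, TriV i j), (TriV i j, TriU i j)}) \<le> 2 + (weight C m - 1)"
      proof (rule upper_cores_triangles[where S = "C - {i}" and J = "\<lambda>_. {}", OF assms(1) _ _ sub])
        \<comment> \<open>The only attached triangle is opened. Its outer vertices take colour 1, and this frees colour 2
          for the core vertex.\<close>
        show "pack ?F 1 ({Leaf i j | i j. True} \<union> {TriU i j, TriV i j})" by (rule pack1I) auto
        show "pack ?F 2 {Core i}" by (rule pack_single)
        show "?V \<subseteq> {Leaf i j | i j. True} \<union> {TriU i j, TriV i j} \<union> {Core i} \<union> (Core ` (C - {i}) \<union> {TriV i j | i j. i \<in> C \<and> j \<in> {}})"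
        proof
          fix v assume "v \<in> ?V"
          then show "v \<in> {Leaf i j | i j. True} \<union> {TriU i j, TriV i j} \<union> {Core i} \<union> (Core ` (C - {i}) \<union> {TriV i j | i j. i \<in> C \<and> j \<in> {}})"
            using m[of "base v"] True ij by (cases v; cases "base v = i") auto
        qed
        have "m i' \<le> 1" if "i' \<in> C" for i' using m[OF that] True by (cases "i' = i") auto
        then show "card (C - {i}) + (\<Sum>i'\<in>C. card ({} :: nat set)) \<le> weight C m - 1"
          using w1[OF ij(1)] by simp
      qed (use assms(1) in auto)
    next
      case False
      then have m2: "m i \<ge> 2" using ij by simp
      \<comment> \<open>Another triangle at \<open>i\<close>, to which colour 2 moves.\<close>
      define d where "d = (if j = 1 then 2 else (1::nat))"
      have d: "d \<in> {1..m i}" "d \<noteq> j" "j \<in> {1..m i}" using m2 ij unfolding d_def by auto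
      show "pchi ?V (?E - {(TriU i j, TriV i j), (TriV i j, TriU i j)}) \<le> 2 + (weight C m - 1)"
      proof (rule upper_cores_triangles[where S = C and J = "\<lambda>i'. if i' = i then {1..m i} - {j, d} else {2..m i'}", OF assms(1) _ _ sub])
        \<comment> \<open>Both outer vertices of the opened triangle have colour 1.\<close>
        show "pack ?F 1 ({Leaf i j | i j. True} \<union> {TriU i j | i j. True} \<union> {TriV i j})" by (rule pack1I) auto
        show "pack ?F 2 ({TriV i' 1 | i'. i' \<noteq> i} \<union> {TriV i d})"
          by (rule pack_2_attached[where B = "compl C"]) auto
        show "?V \<subseteq> {Leaf i j | i j. True} \<union> {TriU i j | i j. True} \<union> {TriV i j} \<union> ({TriV i' 1 | i'. i' \<noteq> i} \<union> {TriV i d})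
          \<union> (Core ` C \<union> {TriV i' j' | i' j'. i' \<in> C \<and> j' \<in> (if i' = i then {1..m i} - {j, d} else {2..m i'})})"
        proof
          fix v assume "v \<in> ?V"
          then show "v \<in> {Leaf i j | i j. True} \<union> {TriU i j | i j. True} \<union> {TriV i j} \<union> ({TriV i' 1 | i'. i' \<noteq> i} \<union> {TriV i d})
          \<union> (Core ` C \<union> {TriV i' j' | i' j'. i' \<in> C \<and> j' \<in> (if i' = i then {1..m i} - {j, d} else {2..m i'})})"
            by (cases v) auto
        qed
        show "card C + (\<Sum>i'\<in>C. card (if i' = i then {1..m i} - {j, d} else {2..m i'})) \<le> weight C m - 1"
          using w2[OF ij(1) m2 d(3,1)] d(2) by simp
      qed (use assms(1) in auto)
    qed
  next
    fix i j assume ij: "i \<in> C" "1 \<le> j" "j \<le> m i"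
    let ?F = "adjR (compl C) - {(Core i, TriU i j), (TriU i j, Core i)}"
    have sub: "?E - {(Core i, TriU i j), (TriU i j, Core i)} \<subseteq> ?F" using attE_sub(2) by blast
    show "pchi ?V (?E - {(Core i, TriU i j), (TriU i j, Core i)}) < pchi ?V ?E"
    proof (rule less, cases "m i = 1")
      case True
      then have m: "m i' = 0" if "i' \<in> C" "i' \<noteq> i" for i' using one[OF ij(1) that(1) True] that(2) by (cases "m i' = 0") auto
      have ki: "k i = 0" using types[OF ij(1)] True by auto
      \<comment> \<open>The only attached triangle loses an edge at its core vertex \<open>i\<close>. Now \<open>i\<close> and \<open>TriU i j\<close> share
        colour 1, and colour 2 is spent on another core vertex.\<close>
      obtain c where c: "c \<in> C" "c \<noteq> i" using other by blast
      let ?R = "insert (TriV i 1) (Core ` (C - {i} - {c}))"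
      have "pchi ?V (?E - {(Core i, TriU i j), (TriU i j, Core i)}) \<le> 2 + card ?R"
      proof (rule pchi_upper2)
        show "pack (?E - {(Core i, TriU i j), (TriU i j, Core i)}) 1 ({Leaf i' j' | i' j'. i' \<noteq> i} \<union> {TriU i j, Core i})"
          by (rule pack_mono[OF _ sub order.refl], rule pack1I) auto
        show "pack (?E - {(Core i, TriU i j), (TriU i j, Core i)}) 2 {Core c}" by (rule pack_single)
        show "?V \<subseteq> {Leaf i' j' | i' j'. i' \<noteq> i} \<union> {TriU i j, Core i} \<union> {Core c} \<union> ?R"
        proof
          fix v assume "v \<in> ?V"
          then show "v \<in> {Leaf i' j' | i' j'. i' \<noteq> i} \<union> {TriU i j, Core i} \<union> {Core c} \<union> ?R"
            using m[of "base v"] True ij ki by (cases v; cases "base v = i") auto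
        qed
      qed (use assms(1) in auto)
      moreover have "card ?R \<le> Suc (card (C - {i} - {c}))"
        using card_image_le[of "C - {i} - {c}" Core] assms(1) by (intro order.trans[OF card_insert_le_m1]) auto
      moreover have "Suc (card (C - {i} - {c})) = card (C - {i})"
        using assms(1) c by (intro card.remove[symmetric]) auto
      moreover have "m i' \<le> 1" if "i' \<in> C" for i' using m[OF that] True by (cases "i' = i") auto
      ultimately show "pchi ?V (?E - {(Core i, TriU i j), (TriU i j, Core i)}) \<le> 2 + (weight C m - 1)"
        using w1[OF ij(1)] by simp
    next
      case False
      then have m2: "m i \<ge> 2" using ij by simp
      \<comment> \<open>Another triangle at \<open>i\<close>, to which colour 2 moves.\<close>
      define d where "d = (if j = 1 then 2 else (1::nat))"
      have d: "d \<in> {1..m i}" "d \<noteq> j" "j \<in> {1..m i}" using m2 ij unfolding d_def by auto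
      show "pchi ?V (?E - {(Core i, TriU i j), (TriU i j, Core i)}) \<le> 2 + (weight C m - 1)"
      proof (rule upper_cores_triangles[where S = C and J = "\<lambda>i'. if i' = i then {1..m i} - {j, d} else {2..m i'}", OF assms(1) _ _ sub])
        show "pack ?F 1 ({Leaf i j | i j. True} \<union> {TriU i' j' | i' j'. (i', j') \<noteq> (i, j)} \<union> {TriV i j})"
          by (rule pack1I) auto
        \<comment> \<open>Only through \<open>TriV i j\<close> is \<open>TriU i j\<close> still connected, so at \<open>i\<close> it can repeat colour 2.\<close>
        show "pack ?F 2 (insert (TriU i j) ({TriV i' 1 | i'. i' \<noteq> i} \<union> {TriV i d}))"
        proof (rule pack_insert)
          show "pack ?F 2 ({TriV i' 1 | i'. i' \<noteq> i} \<union> {TriV i d})"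
            by (rule pack_2_attached[where B = "compl C"]) auto
          fix x assume "x \<in> {TriV i' 1 | i'. i' \<noteq> i} \<union> {TriV i d}"
          then show "\<not> near ?F 2 (TriU i j) x" "\<not> near ?F 2 x (TriU i j)"
            using d(2) by (auto simp: near_2 ex_cactus_vertex)
        qed
        show "?V \<subseteq> {Leaf i j | i j. True} \<union> {TriU i' j' | i' j'. (i', j') \<noteq> (i, j)} \<union> {TriV i j}
          \<union> insert (TriU i j) ({TriV i' 1 | i'. i' \<noteq> i} \<union> {TriV i d})
          \<union> (Core ` C \<union> {TriV i' j' | i' j'. i' \<in> C \<and> j' \<in> (if i' = i then {1..m i} - {j, d} else {2..m i'})})"
        proof
          fix v assume "v \<in> ?V"
          then show "v \<in> {Leaf i j | i j. True} \<union> {TriU i' j' | i' j'. (i', j') \<noteq> (i, j)} \<union> {TriV i j}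
          \<union> insert (TriU i j) ({TriV i' 1 | i'. i' \<noteq> i} \<union> {TriV i d})
          \<union> (Core ` C \<union> {TriV i' j' | i' j'. i' \<in> C \<and> j' \<in> (if i' = i then {1..m i} - {j, d} else {2..m i'})})"
            by (cases v) auto
        qed
        show "card C + (\<Sum>i'\<in>C. card (if i' = i then {1..m i} - {j, d} else {2..m i'})) \<le> weight C m - 1"
          using w2[OF ij(1) m2 d(3,1)] d(2) by simp
      qed (use assms(1) in auto)
    qed
  next
    fix i j assume ij: "i \<in> C" "1 \<le> j" "j \<le> k i"
    then have t: "k i = 2" "m i = 0" using types[OF ij(1)] by auto
    \<comment> \<open>The other leaf at \<open>i\<close>, which takes colour 2, while \<open>i\<close> and the separated leaf take colour 1.\<close>
    define l where "l = (if j = 1 then 2 else (1::nat))"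
    have jl: "j' = j \<or> j' = l" if "1 \<le> j'" "j' \<le> 2" for j' using that ij t unfolding l_def by auto
    have "l \<noteq> j" using ij t unfolding l_def by auto
    let ?F = "adjR (compl C) - {(Core i, Leaf i j), (Leaf i j, Core i)}"
    have sub: "?E - {(Core i, Leaf i j), (Leaf i j, Core i)} \<subseteq> ?F" using attE_sub(2) by blast
    show "pchi ?V (?E - {(Core i, Leaf i j), (Leaf i j, Core i)}) < pchi ?V ?E"
    proof (rule less, rule upper_cores_triangles[where S = "C - {i}" and J = "\<lambda>i. {2..m i}", OF assms(1) _ _ sub])
      show "pack ?F 1 ({Leaf i' j' | i' j'. i' \<noteq> i} \<union> {TriU i' j' | i' j'. i' \<noteq> i} \<union> {Core i, Leaf i j})"
        by (rule pack1I) auto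
      show "pack ?F 2 ({TriV i' 1 | i'. i' \<noteq> i} \<union> {Leaf i l})"
        by (rule pack_2_attached[where B = "compl C"]) auto
      show "?V \<subseteq> {Leaf i' j' | i' j'. i' \<noteq> i} \<union> {TriU i' j' | i' j'. i' \<noteq> i} \<union> {Core i, Leaf i j}
        \<union> ({TriV i' 1 | i'. i' \<noteq> i} \<union> {Leaf i l}) \<union> (Core ` (C - {i}) \<union> {TriV i j | i j. i \<in> C \<and> j \<in> {2..m i}})"
      proof
        fix v assume "v \<in> ?V"
        then show "v \<in> {Leaf i' j' | i' j'. i' \<noteq> i} \<union> {TriU i' j' | i' j'. i' \<noteq> i} \<union> {Core i, Leaf i j}
        \<union> ({TriV i' 1 | i'. i' \<noteq> i} \<union> {Leaf i l}) \<union> (Core ` (C - {i}) \<union> {TriV i j | i j. i \<in> C \<and> j \<in> {2..m i}})"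
          using t jl[of "case v of Leaf _ j' \<Rightarrow> j' | _ \<Rightarrow> 1"] by (cases v) auto
      qed
      show "card (C - {i}) + (\<Sum>i\<in>C. card {2..m i}) \<le> weight C m - 1"
        using ij(1) assms(1,2) t unfolding weight_eq by simp
    qed (use assms(1) in auto)
  next
    fix c d assume "(c, d) \<in> compl C"
    then have cd: "c \<in> C" "d \<in> C" "c \<noteq> d" by auto
    define B' where "B' = compl C - {(c, d), (d, c)}"
    \<comment> \<open>An end of the deleted core edge with at most one triangle takes colour 1 itself. The vertex \<open>q\<close> is an attached vertex
      to which colour 3 is given.\<close>
    define alt where "alt i \<longleftrightarrow> (i = c \<or> i = d) \<and> m i \<le> 1" for i
    define q where "q i = (if m i = 0 then Leaf i 2 else if m i = 1 then TriU i 1 else TriV i 2)" for i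
    have base_q: "base (q i) = i" "depth (q i) = 1" for i unfolding q_def by auto
    define J where "J i = (if i = c \<or> i = d then {3..m i} else {2..m i})" for i
    define S where "S = {i \<in> C. \<not> alt i}"
    define X1 where "X1 = {Leaf i j | i j. \<not> alt i} \<union> {TriU i j | i j. \<not> alt i} \<union> {Core i | i. alt i}"
    define X2 where "X2 = {TriV i 1 | i. m i \<ge> 1} \<union> {Leaf i 1 | i. alt i \<and> m i = 0}"
    have sub: "?E - {(Core c, Core d), (Core d, Core c)} \<subseteq> adjR B'"
    proof
      fix e assume e: "e \<in> ?E - {(Core c, Core d), (Core d, Core c)}"
      obtain x y where xy: "e = (x, y)" by (rule prod.exhaust)
      have "adjp (compl C) x y" using e unfolding xy by (simp add: in_attE)
      then have "adjp B' x y" using e unfolding xy B'_def by (cases x; cases y) auto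
      then show "e \<in> adjR B'" unfolding xy by simp
    qed
    have ncd: "(c, d) \<notin> B'" "(d, c) \<notin> B'" "(i, i) \<notin> B'" for i unfolding B'_def by auto
    have "pchi ?V (?E - {(Core c, Core d), (Core d, Core c)}) \<le> 3 + (weight C m - 2)"
    proof (rule upper_cores_triangles3[where S = S and J = J, OF assms(1) _ _ sub])
      show "pack (adjR B') 1 X1"
        unfolding X1_def by (rule pack1I) (use ncd in \<open>auto simp: alt_def\<close>)
      show "pack (adjR B') 2 X2"
        unfolding X2_def by (rule pack_2_attached[OF order.refl]) auto
      show "pack (adjR B') 3 {q c, q d}"
      proof (rule pack_bases[OF order.refl])
        fix x y p assume *: "x \<in> {q c, q d}" "y \<in> {q c, q d}" "base x \<noteq> base y" "p + depth x + depth y \<le> 3"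
        then have "depth x = 1" "depth y = 1" using base_q by auto
        then have "near B' 1 (base x) (base y)" if "near B' p (base x) (base y)"
          using near_mono[OF that, of 1] *(4) by simp
        moreover have "\<not> near B' 1 (base x) (base y)"
          using * ncd base_q unfolding near_1 by auto
        ultimately show "\<not> near B' p (base x) (base y)" by blast
      qed (use base_q cd in auto)
      show "?V \<subseteq> X1 \<union> X2 \<union> {q c, q d} \<union> (Core ` S \<union> {TriV i j | i j. i \<in> C \<and> j \<in> J i})"
      proof
        fix v assume v: "v \<in> ?V"
        show "v \<in> X1 \<union> X2 \<union> {q c, q d} \<union> (Core ` S \<union> {TriV i j | i j. i \<in> C \<and> j \<in> J i})"
        proof (cases v)
          case (Core i)
          then show ?thesis using v unfolding X1_def S_def by auto
        next
          case (Leaf i j)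
          then have ij: "i \<in> C" "1 \<le> j" "j \<le> k i" using v by auto
          show ?thesis
          proof (cases "alt i")
            case True
            have "k i = 2" "m i = 0" using types[OF ij(1)] ij by auto
            then have "j = 1 \<or> j = 2" using ij by auto
            then show ?thesis using Leaf True \<open>m i = 0\<close> unfolding X2_def q_def alt_def by auto
          qed (use Leaf in \<open>simp add: X1_def\<close>)
        next
          case (TriU i j)
          then have ij: "i \<in> C" "1 \<le> j" "j \<le> m i" using v by auto
          show ?thesis
          proof (cases "alt i")
            case True
            then have "m i = 1" "j = 1" using ij unfolding alt_def by auto
            then show ?thesis using TriU True unfolding q_def alt_def by auto
          qed (use TriU in \<open>simp add: X1_def\<close>)
        next
          case (TriV i j)
          then have ij: "i \<in> C" "1 \<le> j" "j \<le> m i" using v by auto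
          consider "j = 1" | "j = 2" "i = c \<or> i = d" | "j \<ge> 2" "\<not> (i = c \<or> i = d)" | "j \<ge> 3" using ij by linarith
          then show ?thesis
          proof cases
            case 1
            then show ?thesis using TriV ij unfolding X2_def by auto
          next
            case 2
            then show ?thesis using TriV ij unfolding q_def by auto
          qed (use TriV ij in \<open>auto simp: J_def\<close>)
        qed
      qed
      show "card S + (\<Sum>i\<in>C. card (J i)) \<le> weight C m - 2"
      proof -
        have "card S = (\<Sum>i\<in>S. 1)" by simp
        also have "\<dots> = (\<Sum>i\<in>C. if \<not> alt i then 1 else 0)"
          unfolding S_def by (rule sum.inter_filter[OF assms(1)])
        finally have "card S = (\<Sum>i\<in>C. if \<not> alt i then 1 else 0)" .
        then have "card S + (\<Sum>i\<in>C. card (J i)) = (\<Sum>i\<in>C. (if \<not> alt i then 1 else 0) + card (J i))"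
          by (simp only: sum.distrib)
        also have "\<dots> \<le> (\<Sum>i\<in>C. max 1 (m i) - (if i = c \<or> i = d then 1 else 0))"
          by (rule sum_mono) (auto simp: alt_def J_def)
        also have "\<dots> = weight C m - 2"
          unfolding weight_def using cd assms(1)
          by (simp add: sum.remove[of C c] sum.remove[of "C - {c}" d])
        finally show ?thesis .
      qed
    qed (use assms(1) in \<open>auto simp: S_def J_def\<close>)
    moreover have "weight C m \<ge> 2"
      using assms(2) unfolding weight_eq by simp
    ultimately show "pchi ?V (?E - {(Core c, Core d), (Core d, Core c)}) < pchi ?V ?E" using chi by linarith
  qed
qed

lemma attV_cong:
  assumes "\<And>i. i \<in> C \<Longrightarrow> k i = k' i \<and> m i = m' i"
  shows "attV C k m = attV C k' m'" "attE B C k m = attE B C k' m'"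
proof -
  have "attached C k m v = attached C k' m' v" for v
    using assms by (cases v) auto
  then have "attached C k m = attached C k' m'" by (intro ext)
  then show "attV C k m = attV C k' m'" unfolding attV_def by simp
  then show "attE B C k m = attE B C k' m'" unfolding attE_def by simp
qed

lemma pack_bases':
  assumes "F \<subseteq> adjR B"
    and "\<And>x y. x \<in> X \<Longrightarrow> y \<in> X \<Longrightarrow> base x = base y \<Longrightarrow> x = y"
    and far: "\<And>x y. x \<in> X \<Longrightarrow> y \<in> X \<Longrightarrow> base x \<noteq> base y \<Longrightarrow> depth x + depth y \<le> n
      \<Longrightarrow> \<not> near B (n - depth x - depth y) (base x) (base y)"
  shows "pack F n X"
proof (rule pack_bases[OF assms(1,2)])
  fix x y p assume *: "x \<in> X" "y \<in> X" "base x \<noteq> base y" "p + depth x + depth y \<le> n"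
  show "\<not> near B p (base x) (base y)"
  proof
    assume "near B p (base x) (base y)"
    then have "near B (n - depth x - depth y) (base x) (base y)" by (rule near_mono) (use *(4) in simp)
    then show False using far[OF *(1-3)] *(4) by simp
  qed
qed

lemmas pack_Suc0I = pack1I[unfolded One_nat_def]

lemma attE_del_core:
  "attE B C k m - {(Core c, Core d), (Core d, Core c)} \<subseteq> adjR (B - {(c, d), (d, c)})"
proof
  fix e assume e: "e \<in> attE B C k m - {(Core c, Core d), (Core d, Core c)}"
  obtain x y where xy: "e = (x, y)" by (rule prod.exhaust)
  have "adjp B x y" using e unfolding xy by (simp add: in_attE)
  then have "adjp (B - {(c, d), (d, c)}) x y" using e unfolding xy by (cases x; cases y) auto
  then show "e \<in> adjR (B - {(c, d), (d, c)})" unfolding xy by simp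
qed

text \<open>
  Without the edge to its leaf, a core vertex can share colour 1 with all leaves. Without the edge \<open>cd\<close>, the core
  vertices \<open>c\<close> and \<open>d\<close> both take colour 1 and their leaves colour 2. Two and three core vertices give the path on four
  vertices and the net.
\<close>

lemma crit_complete_core_leaves:
  assumes C: "finite C" "card C \<ge> 2"
    and chi: "1 + card C \<le> pchi (attV C (\<lambda>_. 1) (\<lambda>_. 0)) (attE (compl C) C (\<lambda>_. 1) (\<lambda>_. 0))"
  shows "crit (attV C (\<lambda>_. 1) (\<lambda>_. 0)) (attE (compl C) C (\<lambda>_. 1) (\<lambda>_. 0))"
proof -
  let ?V = "attV C (\<lambda>_. 1) (\<lambda>_. 0)" and ?E = "attE (compl C) C (\<lambda>_. 1) (\<lambda>_. 0)"
  have less: "pchi ?V E' < pchi ?V ?E" if "pchi ?V E' \<le> 2 + (card C - 2)" for E'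
    using that chi C(2) by simp
  have other: "\<exists>j\<in>C. j \<noteq> i" for i
  proof (rule ccontr)
    assume "\<not> (\<exists>j\<in>C. j \<noteq> i)"
    then have "C \<subseteq> {i}" by blast
    then have "card C \<le> card {i}" by (intro card_mono) simp_all
    then show False using C(2) by simp
  qed
  show ?thesis
  proof (rule crit_att[OF C(1) sym_compl])
    show "compl C \<subseteq> C \<times> C" by (auto simp: compl_def)
    show "\<exists>j. (i, j) \<in> compl C" if "i \<in> C" for i using other[of i] that by auto
    show "(i, i) \<notin> compl C" for i by simp
  next
    fix i and j :: nat assume ij: "i \<in> C" "1 \<le> j" "j \<le> 1"
    let ?F = "adjR (compl C) - {(Core i, Leaf i j), (Leaf i j, Core i)}"
    have sub: "?E - {(Core i, Leaf i j), (Leaf i j, Core i)} \<subseteq> ?F" using attE_sub(2) by blast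
    obtain l where l: "l \<in> C" "l \<noteq> i" using other by blast
    show "pchi ?V (?E - {(Core i, Leaf i j), (Leaf i j, Core i)}) < pchi ?V ?E"
    proof (rule less, rule upper_cores_triangles[where S = "C - {i, l}" and J = "\<lambda>i. {}", OF C(1) _ _ sub])
      show "pack ?F 1 ({Leaf i j | i j. j = 1} \<union> {Core i})" by (rule pack1I) (use ij in auto)
      show "pack ?F 2 {Core l}" by (rule pack_single)
      show "?V \<subseteq> {Leaf i j | i j. j = 1} \<union> {Core i} \<union> {Core l} \<union> (Core ` (C - {i, l}) \<union> {TriV i j | i j. i \<in> C \<and> j \<in> {}})"
      proof
        fix v assume "v \<in> ?V"
        then show "v \<in> {Leaf i j | i j. j = 1} \<union> {Core i} \<union> {Core l} \<union> (Core ` (C - {i, l}) \<union> {TriV i j | i j. i \<in> C \<and> j \<in> {}})"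
          by (cases v) auto
      qed
      show "card (C - {i, l}) + (\<Sum>i\<in>C. card ({} :: nat set)) \<le> card C - 2"
        using C(1) ij l by (simp add: card_Diff_subset)
    qed (use C(1) in auto)
  next
    fix c d assume "(c, d) \<in> compl C"
    then have cd: "c \<in> C" "d \<in> C" "c \<noteq> d" by auto
    let ?F = "adjR (compl C - {(c, d), (d, c)})"
    show "pchi ?V (?E - {(Core c, Core d), (Core d, Core c)}) < pchi ?V ?E"
    proof (rule less, rule upper_cores_triangles[where S = "C - {c, d}" and J = "\<lambda>i. {}", OF C(1) _ _ attE_del_core])
      show "pack ?F 1 ({Leaf i j | i j. i \<noteq> c \<and> i \<noteq> d} \<union> {Core c, Core d})" by (rule pack1I) auto
      show "pack ?F 2 {Leaf c 1, Leaf d 1}" by (rule pack_2_attached[OF order.refl]) auto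
      show "?V \<subseteq> {Leaf i j | i j. i \<noteq> c \<and> i \<noteq> d} \<union> {Core c, Core d} \<union> {Leaf c 1, Leaf d 1}
        \<union> (Core ` (C - {c, d}) \<union> {TriV i j | i j. i \<in> C \<and> j \<in> {}})"
      proof
        fix v assume "v \<in> ?V"
        then show "v \<in> {Leaf i j | i j. i \<noteq> c \<and> i \<noteq> d} \<union> {Core c, Core d} \<union> {Leaf c 1, Leaf d 1}
        \<union> (Core ` (C - {c, d}) \<union> {TriV i j | i j. i \<in> C \<and> j \<in> {}})"
          by (cases v) auto
      qed
      show "card (C - {c, d}) + (\<Sum>i\<in>C. card ({} :: nat set)) \<le> card C - 2"
        using C(1) cd by (simp add: card_Diff_subset)
    qed (use C(1) in auto)
  qed simp_all
qed

lemma cyc4_core: "cyc4 \<subseteq> {1, 2, 3, 4} \<times> {1, 2, 3, 4}" "\<And>i. i \<in> {1, 2, 3, 4} \<Longrightarrow> \<exists>j. (i, j) \<in> cyc4"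
  "\<And>i. (i, i) \<notin> cyc4"
  by (auto simp: cyc4_def)

lemma cyc4_less: "(c, d) \<in> cyc4 \<Longrightarrow> c < d \<Longrightarrow> (c, d) \<in> {(1, 2), (2, 3), (3, 4), (1, 4)}"
  by (auto simp: cyc4_def)

text \<open>
  Four colours are needed. After the deletion of an edge the displayed 1-packing and 2-packing cover all vertices
  but one.
\<close>

lemma crit_cyc4_leaves:
  assumes k: "k 1 = 1" "k 2 = 1" "k 3 = 0" "k 4 = 0" and m: "\<And>i. m i = 0"
  shows "crit (attV {1, 2, 3, 4} k m) (attE cyc4 {1, 2, 3, 4} k m)"
proof -
  let ?C = "{1, 2, 3, 4} :: nat set"
  let ?V = "attV ?C k m" and ?E = "attE cyc4 ?C k m"
  have less: "pchi ?V E' < pchi ?V ?E"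
    if "E' \<subseteq> F" "pack F 1 X1" "pack F 2 X2"
      "{Core 1, Core 2, Core 3, Core 4, Leaf 1 1, Leaf 2 1} \<subseteq> X1 \<union> X2 \<union> {Core i}"
    for E' F X1 X2 i
  proof -
    have "pchi ?V E' \<le> 2 + 1"
    proof (rule upper_cores_triangles[where S = "{i}" and J = "\<lambda>i. {}", OF _ _ _ that(1-3)])
      show "?V \<subseteq> X1 \<union> X2 \<union> (Core ` {i} \<union> {TriV i j | i j. i \<in> ?C \<and> j \<in> {}})"
      proof
        fix v assume "v \<in> ?V"
        then have "v \<in> {Core 1, Core 2, Core 3, Core 4, Leaf 1 1, Leaf 2 1}"
          using k m by (cases v) auto
        then show "v \<in> X1 \<union> X2 \<union> (Core ` {i} \<union> {TriV i j | i j. i \<in> ?C \<and> j \<in> {}})" using that(4) by blast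
      qed
    qed auto
    then show ?thesis using lower_cyc4_leaves[of k m] k m by simp
  qed
  show ?thesis
  proof (rule crit_att[OF _ sym_cyc4 cyc4_core])
    fix i j assume ij: "i \<in> ?C" "1 \<le> j" "j \<le> k i"
    let ?F = "adjR cyc4 - {(Core i, Leaf i j), (Leaf i j, Core i)}"
    have sub: "?E - {(Core i, Leaf i j), (Leaf i j, Core i)} \<subseteq> ?F" using attE_sub(2) by blast
    have "(i = 1 \<or> i = 2) \<and> j = 1" using ij k by auto
    then consider "i = 1" "j = 1" | "i = 2" "j = 1" by blast
    then show "pchi ?V (?E - {(Core i, Leaf i j), (Leaf i j, Core i)}) < pchi ?V ?E"
    proof cases
      case 1
      show ?thesis
        by (rule less[of _ ?F "{Leaf 1 1, Leaf 2 1, Core 1, Core 3}" "{Core 4}" 2, OF sub])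
          (auto intro!: pack_Suc0I pack_single simp: 1 cyc4_def)
    next
      case 2
      show ?thesis
        by (rule less[of _ ?F "{Leaf 1 1, Leaf 2 1, Core 2, Core 4}" "{Core 3}" 1, OF sub])
          (auto intro!: pack_Suc0I pack_single simp: 2 cyc4_def)
    qed
  next
    fix c d assume "(c, d) \<in> cyc4" "c < d"
    from cyc4_less[OF this] consider "c = 1" "d = 2" | "c = 2" "d = 3" | "c = 3" "d = 4" | "c = 1" "d = 4" by blast
    then show "pchi ?V (?E - {(Core c, Core d), (Core d, Core c)}) < pchi ?V ?E"
    proof cases
      case 1
      show ?thesis
      proof (rule less[of _ _ "{Leaf 1 1, Core 4, Core 2}" "{Core 1, Leaf 2 1}" 3, OF attE_del_core])
        \<comment> \<open>Without the edge 12 the shortest way from 1 to the leaf at 2 leads around the cycle.\<close>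
        show "pack (adjR (cyc4 - {(c, d), (d, c)})) 2 {Core 1, Leaf 2 1}"
          by (rule pack_bases'[OF order.refl]) (auto simp: 1 cyc4_def)
      qed (auto intro!: pack_Suc0I simp: 1 cyc4_def)
    next
      case 2
      show ?thesis
      proof (rule less[of _ _ "{Leaf 1 1, Core 4, Core 2}" "{Core 3, Leaf 2 1}" 1, OF attE_del_core])
        show "pack (adjR (cyc4 - {(c, d), (d, c)})) 2 {Core 3, Leaf 2 1}"
          by (rule pack_bases'[OF order.refl]) (auto simp: 2 cyc4_def)
      qed (auto intro!: pack_Suc0I simp: 2 cyc4_def)
    next
      case 3
      show ?thesis
        by (rule less[of _ _ "{Leaf 1 1, Leaf 2 1, Core 3, Core 4}" "{Core 1}" 2, OF attE_del_core])
          (auto intro!: pack_Suc0I pack_single simp: 3 cyc4_def)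
    next
      case 4
      show ?thesis
      proof (rule less[of _ _ "{Leaf 2 1, Core 1, Core 3}" "{Core 4, Leaf 1 1}" 2, OF attE_del_core])
        show "pack (adjR (cyc4 - {(c, d), (d, c)})) 2 {Core 4, Leaf 1 1}"
          by (rule pack_bases'[OF order.refl]) (auto simp: 4 cyc4_def)
      qed (auto intro!: pack_Suc0I simp: 4 cyc4_def)
    qed
  qed (use m in auto)
qed

text \<open>
  Deleting the edge 12 allows colour 3 to be used at both core vertices that carry triangles. For every other
  edge the displayed 1-packing and 2-packing leave over one vertex less than in the undamaged graph.
\<close>

lemma crit_cyc4_triangles:
  assumes k: "\<And>i. k i = 0" and m: "m 1 \<ge> 1" "m 2 \<ge> 1" "m 3 = 0" "m 4 = 0"
  shows "crit (attV {1, 2, 3, 4} k m) (attE cyc4 {1, 2, 3, 4} k m)"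
proof -
  let ?C = "{1, 2, 3, 4} :: nat set"
  let ?V = "attV ?C k m" and ?E = "attE cyc4 ?C k m"
  have chi: "m 1 + m 2 + 3 \<le> pchi ?V ?E" using k m by (intro lower_cyc4_triangles) auto
  have less: "pchi ?V E' < pchi ?V ?E"
    if "E' \<subseteq> F" "pack F 1 X1" "pack F 2 X2"
      "\<And>v. v \<in> {Core 1, Core 2, Core 3, Core 4} \<Longrightarrow> v \<in> X1 \<union> X2 \<union> Core ` S"
      "\<And>i j. i \<in> {1, 2} \<Longrightarrow> 1 \<le> j \<Longrightarrow> j \<le> m i \<Longrightarrow> TriU i j \<in> X1 \<union> X2"
      "\<And>i j. i \<in> {1, 2} \<Longrightarrow> 1 \<le> j \<Longrightarrow> j \<le> m i \<Longrightarrow> TriV i j \<in> X1 \<union> X2 \<or> j \<in> J i"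
      "card S + card (J 1) + card (J 2) \<le> m 1 + m 2"
      "finite S" "finite (J 1)" "finite (J 2)"
    for E' F X1 X2 S J
  proof -
    define J' where "J' i = (if i = 1 \<or> i = 2 then J i else {})" for i
    have "pchi ?V E' \<le> 2 + (m 1 + m 2)"
    proof (rule upper_cores_triangles[where S = S and J = J', OF _ that(8) _ that(1-3)])
      show "?V \<subseteq> X1 \<union> X2 \<union> (Core ` S \<union> {TriV i j | i j. i \<in> ?C \<and> j \<in> J' i})"
      proof
        fix v assume v: "v \<in> ?V"
        show "v \<in> X1 \<union> X2 \<union> (Core ` S \<union> {TriV i j | i j. i \<in> ?C \<and> j \<in> J' i})"
        proof (cases v)
          case (Core i)
          then have "v \<in> X1 \<union> X2 \<union> Core ` S" using v by (intro that(4)) auto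
          then show ?thesis by blast
        next
          case (Leaf i j)
          then show ?thesis using v k by auto
        next
          case (TriU i j)
          then have "i \<in> {1, 2}" "1 \<le> j" "j \<le> m i" using v m by auto
          then show ?thesis using that(5) TriU by blast
        next
          case (TriV i j)
          then have ij: "i \<in> {1, 2}" "1 \<le> j" "j \<le> m i" using v m by auto
          then have "J' i = J i" "i \<in> ?C" unfolding J'_def by auto
          then show ?thesis using that(6)[OF ij] TriV by blast
        qed
      qed
      show "finite (J' i)" for i unfolding J'_def using that(9,10) by auto
      show "card S + (\<Sum>i\<in>?C. card (J' i)) \<le> m 1 + m 2" unfolding J'_def using that(7) by simp
    qed simp
    then show ?thesis using chi by simp
  qed
  show ?thesis
  proof (rule crit_att[OF _ sym_cyc4 cyc4_core])
    fix i j assume ij: "i \<in> ?C" "1 \<le> j" "j \<le> m i"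
    let ?F = "adjR cyc4 - {(TriU i j, TriV i j), (TriV i j, TriU i j)}"
    have sub: "?E - {(TriU i j, TriV i j), (TriV i j, TriU i j)} \<subseteq> ?F" using attE_sub(2) by blast
    have "i = 1 \<or> i = 2" using ij m by auto
    then show "pchi ?V (?E - {(TriU i j, TriV i j), (TriV i j, TriU i j)}) < pchi ?V ?E"
    proof
      assume i: "i = 1"
      show ?thesis
      proof (rule less[OF sub, of "{TriU i j | i j. i = 1 \<or> i = 2} \<union> {TriV 1 j, Core 3}" "{Core 4, TriV 2 1}" "{1, 2}"
            "\<lambda>i. if i = 1 then {1..m 1} - {j} else {2..m 2}"])
        show "pack ?F 2 {Core 4, TriV 2 1}"
          by (rule pack_bases'[where B = cyc4]) (auto simp: cyc4_def)
      qed (use ij i m in \<open>auto intro!: pack_Suc0I simp: cyc4_def\<close>)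
    next
      assume i: "i = 2"
      show ?thesis
      proof (rule less[OF sub, of "{TriU i j | i j. i = 1 \<or> i = 2} \<union> {TriV 2 j, Core 4}" "{Core 3, TriV 1 1}" "{1, 2}"
            "\<lambda>i. if i = 2 then {1..m 2} - {j} else {2..m 1}"])
        show "pack ?F 2 {Core 3, TriV 1 1}"
          by (rule pack_bases'[where B = cyc4]) (auto simp: cyc4_def)
      qed (use ij i m in \<open>auto intro!: pack_Suc0I simp: cyc4_def\<close>)
    qed
  next
    fix i j assume ij: "i \<in> ?C" "1 \<le> j" "j \<le> m i"
    let ?F = "adjR cyc4 - {(Core i, TriU i j), (TriU i j, Core i)}"
    have sub: "?E - {(Core i, TriU i j), (TriU i j, Core i)} \<subseteq> ?F" using attE_sub(2) by blast
    have "i = 1 \<or> i = 2" using ij m by auto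
    then show "pchi ?V (?E - {(Core i, TriU i j), (TriU i j, Core i)}) < pchi ?V ?E"
    proof
      assume i: "i = 1"
      show ?thesis
      proof (rule less[OF sub, of "{TriU i' j' | i' j'. (i' = 1 \<or> i' = 2) \<and> (i', j') \<noteq> (1, j)} \<union> {TriV 1 j, Core 3}"
            "insert (TriU 1 j) {Core 4, TriV 2 1}" "{1, 2}" "\<lambda>i. if i = 1 then {1..m 1} - {j} else {2..m 2}"])
        show "pack ?F 2 (insert (TriU 1 j) {Core 4, TriV 2 1})"
        proof (rule pack_insert)
          show "pack ?F 2 {Core 4, TriV 2 1}"
            by (rule pack_bases'[where B = cyc4]) (auto simp: cyc4_def)
        qed (auto simp: i near_2 ex_cactus_vertex cyc4_def)
      qed (use ij i m in \<open>auto intro!: pack_Suc0I simp: cyc4_def\<close>)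
    next
      assume i: "i = 2"
      show ?thesis
      proof (rule less[OF sub, of "{TriU i' j' | i' j'. (i' = 1 \<or> i' = 2) \<and> (i', j') \<noteq> (2, j)} \<union> {TriV 2 j, Core 4}"
            "insert (TriU 2 j) {Core 3, TriV 1 1}" "{1, 2}" "\<lambda>i. if i = 2 then {1..m 2} - {j} else {2..m 1}"])
        show "pack ?F 2 (insert (TriU 2 j) {Core 3, TriV 1 1})"
        proof (rule pack_insert)
          show "pack ?F 2 {Core 3, TriV 1 1}"
            by (rule pack_bases'[where B = cyc4]) (auto simp: cyc4_def)
        qed (auto simp: i near_2 ex_cactus_vertex cyc4_def)
      qed (use ij i m in \<open>auto intro!: pack_Suc0I simp: cyc4_def\<close>)
    qed
  next
    fix c d assume "(c, d) \<in> cyc4" "c < d"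
    from cyc4_less[OF this] consider "c = 1" "d = 2" | "c = 2" "d = 3" | "c = 3" "d = 4" | "c = 1" "d = 4" by blast
    then show "pchi ?V (?E - {(Core c, Core d), (Core d, Core c)}) < pchi ?V ?E"
    proof cases
      case 1
      let ?F = "adjR (cyc4 - {(c, d), (d, c)})"
      define J where "J i = (if i = 1 \<or> i = 2 then {2..m i} else {})" for i
      have "pchi ?V (?E - {(Core c, Core d), (Core d, Core c)}) \<le> 3 + (m 1 + m 2 - 1)"
      proof (rule upper_cores_triangles3[where S = "{4}" and J = J, OF _ _ _ attE_del_core])
        show "pack ?F 1 ({TriU i j | i j. i = 1 \<or> i = 2} \<union> {Core 3})"
          by (rule pack1I) (auto simp: cyc4_def)
        show "pack ?F 2 {Core 1, Core 2}"
          by (rule pack_bases'[OF order.refl]) (auto simp: 1 near_2 cyc4_def)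
        \<comment> \<open>The shortest way between them leads around the cycle and has length 5.\<close>
        show "pack ?F 3 {TriV 1 1, TriV 2 1}"
          by (rule pack_bases'[OF order.refl]) (auto simp: 1 near_2 cyc4_def)
        show "?V \<subseteq> {TriU i j | i j. i = 1 \<or> i = 2} \<union> {Core 3} \<union> {Core 1, Core 2} \<union> {TriV 1 1, TriV 2 1}
          \<union> (Core ` {4} \<union> {TriV i j | i j. i \<in> ?C \<and> j \<in> J i})"
        proof
          fix v assume v: "v \<in> ?V"
          show "v \<in> {TriU i j | i j. i = 1 \<or> i = 2} \<union> {Core 3} \<union> {Core 1, Core 2} \<union> {TriV 1 1, TriV 2 1}
          \<union> (Core ` {4} \<union> {TriV i j | i j. i \<in> ?C \<and> j \<in> J i})"
            using v k m by (cases v) (auto simp: J_def)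
        qed
        show "card {4 :: nat} + (\<Sum>i\<in>?C. card (J i)) \<le> m 1 + m 2 - 1" using m by (simp add: J_def)
      qed (auto simp: J_def)
      then show ?thesis using chi m by simp
    next
      case 2
      show ?thesis
      proof (rule less[of _ _ "{TriU i j | i j. i = 1 \<or> i = 2} \<union> {Core 4}" "{Core 3, TriV 1 1, TriV 2 1}" "{1, 2}"
            "\<lambda>i. {2..m i}", OF attE_del_core])
        show "pack (adjR (cyc4 - {(c, d), (d, c)})) 2 {Core 3, TriV 1 1, TriV 2 1}"
          by (rule pack_bases'[OF order.refl]) (auto simp: 2 cyc4_def)
      qed (use m in \<open>auto intro!: pack_Suc0I simp: 2 cyc4_def\<close>)
    next
      case 3
      show ?thesis
      proof (rule less[of _ _ "{TriU i j | i j. i = 1 \<or> i = 2} \<union> {Core 3, Core 4}" "{TriV 1 1, TriV 2 1}" "{1, 2}"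
            "\<lambda>i. {2..m i}", OF attE_del_core])
        show "pack (adjR (cyc4 - {(c, d), (d, c)})) 2 {TriV 1 1, TriV 2 1}"
          by (rule pack_bases'[OF order.refl]) (auto simp: 3 cyc4_def)
      qed (use m in \<open>auto intro!: pack_Suc0I simp: 3 cyc4_def\<close>)
    next
      case 4
      show ?thesis
      proof (rule less[of _ _ "{TriU i j | i j. i = 1 \<or> i = 2} \<union> {Core 3}" "{Core 4, TriV 1 1, TriV 2 1}" "{1, 2}"
            "\<lambda>i. {2..m i}", OF attE_del_core])
        show "pack (adjR (cyc4 - {(c, d), (d, c)})) 2 {Core 4, TriV 1 1, TriV 2 1}"
          by (rule pack_bases'[OF order.refl]) (auto simp: 4 cyc4_def)
      qed (use m in \<open>auto intro!: pack_Suc0I simp: 4 cyc4_def\<close>)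
    qed
  qed (use k in auto)
qed

lemma cyc5_core: "cyc5 \<subseteq> {1, 2, 3, 4, 5} \<times> {1, 2, 3, 4, 5}"
  "\<And>i. i \<in> {1, 2, 3, 4, 5} \<Longrightarrow> \<exists>j. (i, j) \<in> cyc5"
  "\<And>i. (i, i) \<notin> cyc5"
  by (auto simp: cyc5_def)

lemma cyc5_less: "(c, d) \<in> cyc5 \<Longrightarrow> c < d \<Longrightarrow> (c, d) \<in> {(1, 2), (2, 3), (3, 4), (4, 5), (1, 5)}"
  by (auto simp: cyc5_def)

text \<open>
  After the deletion of 12 or 15 the core is a path on five vertices, whose ends can share colour 3. For every
  other edge the displayed 1-packing and 2-packing leave over one vertex less than in the undamaged graph.
\<close>

lemma crit_cyc5_triangles:
  assumes k: "\<And>i. k i = 0" and m: "m 1 \<ge> 2" "\<And>i. i \<noteq> 1 \<Longrightarrow> m i = 0"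
  shows "crit (attV {1, 2, 3, 4, 5} k m) (attE cyc5 {1, 2, 3, 4, 5} k m)"
proof -
  let ?C = "{1, 2, 3, 4, 5} :: nat set"
  let ?V = "attV ?C k m" and ?E = "attE cyc5 ?C k m"
  have chi: "m 1 + 3 \<le> pchi ?V ?E" using k m by (intro lower_cyc5) auto
  have cover: "?V \<subseteq> Y" if "Core 1 \<in> Y" "Core 2 \<in> Y" "Core 3 \<in> Y" "Core 4 \<in> Y" "Core 5 \<in> Y"
    "\<And>j. 1 \<le> j \<Longrightarrow> j \<le> m 1 \<Longrightarrow> TriU 1 j \<in> Y"
      "\<And>j. 1 \<le> j \<Longrightarrow> j \<le> m 1 \<Longrightarrow> TriV 1 j \<in> Y" for Y
  proof
    fix v assume v: "v \<in> ?V"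
    have tri: "i = 1" if "1 \<le> j" "j \<le> m i" for i j using m(2)[of i] that by (cases "i = 1") auto
    show "v \<in> Y"
    proof (cases v)
      case (Core i) then show ?thesis using v that(1-5) by auto
    next
      case (Leaf i j) then show ?thesis using v k by auto
    next
      case (TriU i j) then show ?thesis using v that(6)[of j] tri[of j i] by auto
    next
      case (TriV i j) then show ?thesis using v that(7)[of j] tri[of j i] by auto
    qed
  qed
  have less: "pchi ?V E' < pchi ?V ?E"
    if "E' \<subseteq> F" "pack F 1 X1" "pack F 2 X2"
      "\<And>v. v \<in> {Core 1, Core 2, Core 3, Core 4, Core 5} \<Longrightarrow> v \<in> X1 \<union> X2 \<union> Core ` S"
      "\<And>j. 1 \<le> j \<Longrightarrow> j \<le> m 1 \<Longrightarrow> TriU 1 j \<in> X1 \<union> X2"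
      "\<And>j. 1 \<le> j \<Longrightarrow> j \<le> m 1 \<Longrightarrow> TriV 1 j \<in> X1 \<union> X2 \<or> j \<in> J"
      "card S + card J \<le> m 1" "finite S" "finite J"
    for E' F X1 X2 S J
  proof -
    have "pchi ?V E' \<le> 2 + m 1"
    proof (rule upper_cores_triangles[where S = S and J = "\<lambda>i. if i = 1 then J else {}", OF _ that(8) _ that(1-3)])
      show "?V \<subseteq> X1 \<union> X2 \<union> (Core ` S \<union> {TriV i j | i j. i \<in> ?C \<and> j \<in> (if i = 1 then J else {})})"
      proof (rule cover)
        fix j :: nat assume j: "1 \<le> j" "j \<le> m 1"
        show "TriU 1 j \<in> X1 \<union> X2 \<union> (Core ` S \<union> {TriV i j | i j. i \<in> ?C \<and> j \<in> (if i = 1 then J else {})})"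
          using that(5)[OF j] by blast
        show "TriV 1 j \<in> X1 \<union> X2 \<union> (Core ` S \<union> {TriV i j | i j. i \<in> ?C \<and> j \<in> (if i = 1 then J else {})})"
          using that(6)[OF j] by auto
      qed (use that(4) in blast)+
    qed (use that(7,9) in auto)
    then show ?thesis using chi by simp
  qed
  show ?thesis
  proof (rule crit_att[OF _ sym_cyc5 cyc5_core])
    fix i j assume ij: "i \<in> ?C" "1 \<le> j" "j \<le> m i"
    then have i: "i = 1" using m(2)[of i] by (cases "i = 1") auto
    define d where "d = (if j = 1 then 2 else (1::nat))"
    have d: "d \<in> {1..m 1}" "d \<noteq> j" "j \<in> {1..m 1}" using m ij unfolding d_def i by auto
    have cd: "card {1, 4 :: nat} + card ({1..m 1} - {j, d}) \<le> m 1"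
    proof -
      have "card ({1..m 1} - {j, d}) = m 1 - 2" using d by (simp add: card_Diff_subset)
      then show ?thesis using m(1) by simp
    qed
    show "pchi ?V (?E - {(TriU i j, TriV i j), (TriV i j, TriU i j)}) < pchi ?V ?E"
    proof -
      let ?F = "adjR cyc5 - {(TriU i j, TriV i j), (TriV i j, TriU i j)}"
      have sub: "?E - {(TriU i j, TriV i j), (TriV i j, TriU i j)} \<subseteq> ?F" using attE_sub(2) by blast
      show ?thesis
      proof (rule less[OF sub _ _ _ _ _ cd, of "{TriU 1 j | j. True} \<union> {TriV 1 j, Core 2, Core 5}" "{Core 3, TriV 1 d}"])
        show "pack ?F 2 {Core 3, TriV 1 d}"
          by (rule pack_bases'[where B = cyc5]) (auto simp: cyc5_def)
      qed (auto intro!: pack_Suc0I simp: i cyc5_def)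
    qed
    show "pchi ?V (?E - {(Core i, TriU i j), (TriU i j, Core i)}) < pchi ?V ?E"
    proof -
      let ?F = "adjR cyc5 - {(Core i, TriU i j), (TriU i j, Core i)}"
      have sub: "?E - {(Core i, TriU i j), (TriU i j, Core i)} \<subseteq> ?F" using attE_sub(2) by blast
      show ?thesis
      proof (rule less[OF sub _ _ _ _ _ cd, of "{TriU 1 j' | j'. j' \<noteq> j} \<union> {TriV 1 j, Core 2, Core 5}"
            "insert (TriU 1 j) {Core 3, TriV 1 d}"])
        show "pack ?F 2 (insert (TriU 1 j) {Core 3, TriV 1 d})"
        proof (rule pack_insert)
          show "pack ?F 2 {Core 3, TriV 1 d}"
            by (rule pack_bases'[where B = cyc5]) (auto simp: cyc5_def)
        qed (use d(2) in \<open>auto simp: i near_2 ex_cactus_vertex cyc5_def\<close>)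
      qed (auto intro!: pack_Suc0I simp: i cyc5_def)
    qed
  next
    fix c d assume "(c, d) \<in> cyc5" "c < d"
    from cyc5_less[OF this] consider "c = 1" "d = 2" | "c = 2" "d = 3" | "c = 3" "d = 4" | "c = 4" "d = 5" | "c = 1" "d = 5" by blast
    then show "pchi ?V (?E - {(Core c, Core d), (Core d, Core c)}) < pchi ?V ?E"
    proof cases
      case 1
      let ?F = "adjR (cyc5 - {(c, d), (d, c)})"
      have "pchi ?V (?E - {(Core c, Core d), (Core d, Core c)}) \<le> 3 + (m 1 - 1)"
      proof (rule upper_cores_triangles3[where S = "{}" and J = "\<lambda>i. if i = 1 then {2..m 1} else {}", OF _ _ _ attE_del_core])
        show "pack ?F 1 ({TriU 1 j | j. True} \<union> {Core 3, Core 5})"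
          by (rule pack1I) (auto simp: cyc5_def)
        show "pack ?F 2 {Core 4, TriV 1 1}"
          by (rule pack_bases'[OF order.refl]) (auto simp: 1 cyc5_def)
        show "pack ?F 3 {Core 1, Core 2}"
          by (rule pack_bases'[OF order.refl]) (auto simp: 1 near_2 near_3 cyc5_def)
        show "?V \<subseteq> {TriU 1 j | j. True} \<union> {Core 3, Core 5} \<union> {Core 4, TriV 1 1} \<union> {Core 1, Core 2}
          \<union> (Core ` {} \<union> {TriV i j | i j. i \<in> ?C \<and> j \<in> (if i = 1 then {2..m 1} else {})})"
          by (rule cover) auto
      qed auto
      then show ?thesis using chi m by simp
    next
      case 2
      show ?thesis
      proof (rule less[of _ _ "{TriU 1 j | j. True} \<union> {Core 2, Core 5, Core 3}" "{Core 4, TriV 1 1}" "{1}" "{2..m 1}", OF attE_del_core])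
        show "pack (adjR (cyc5 - {(c, d), (d, c)})) 2 {Core 4, TriV 1 1}"
          by (rule pack_bases'[OF order.refl]) (auto simp: 2 cyc5_def)
      qed (use m in \<open>auto intro!: pack_Suc0I simp: 2 cyc5_def\<close>)
    next
      case 3
      show ?thesis
      proof (rule less[of _ _ "{TriU 1 j | j. True} \<union> {Core 2, Core 5}" "{Core 3, Core 4, TriV 1 1}" "{1}" "{2..m 1}", OF attE_del_core])
        show "pack (adjR (cyc5 - {(c, d), (d, c)})) 2 {Core 3, Core 4, TriV 1 1}"
          by (rule pack_bases'[OF order.refl]) (auto simp: 3 near_2 cyc5_def)
      qed (use m in \<open>auto intro!: pack_Suc0I simp: 3 cyc5_def\<close>)
    next
      case 4
      show ?thesis
      proof (rule less[of _ _ "{TriU 1 j | j. True} \<union> {Core 2, Core 5, Core 4}" "{Core 3, TriV 1 1}" "{1}" "{2..m 1}", OF attE_del_core])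
        show "pack (adjR (cyc5 - {(c, d), (d, c)})) 2 {Core 3, TriV 1 1}"
          by (rule pack_bases'[OF order.refl]) (auto simp: 4 cyc5_def)
      qed (use m in \<open>auto intro!: pack_Suc0I simp: 4 cyc5_def\<close>)
    next
      case 5
      let ?F = "adjR (cyc5 - {(c, d), (d, c)})"
      have "pchi ?V (?E - {(Core c, Core d), (Core d, Core c)}) \<le> 3 + (m 1 - 1)"
      proof (rule upper_cores_triangles3[where S = "{}" and J = "\<lambda>i. if i = 1 then {2..m 1} else {}", OF _ _ _ attE_del_core])
        show "pack ?F 1 ({TriU 1 j | j. True} \<union> {Core 2, Core 4})"
          by (rule pack1I) (auto simp: cyc5_def)
        show "pack ?F 2 {Core 3, TriV 1 1}"
          by (rule pack_bases'[OF order.refl]) (auto simp: 5 cyc5_def)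
        show "pack ?F 3 {Core 1, Core 5}"
          by (rule pack_bases'[OF order.refl]) (auto simp: 5 near_2 near_3 cyc5_def)
        show "?V \<subseteq> {TriU 1 j | j. True} \<union> {Core 2, Core 4} \<union> {Core 3, TriV 1 1} \<union> {Core 1, Core 5}
          \<union> (Core ` {} \<union> {TriV i j | i j. i \<in> ?C \<and> j \<in> (if i = 1 then {2..m 1} else {})})"
          by (rule cover) auto
      qed auto
      then show ?thesis using chi m by simp
    qed
  qed (use k in auto)
qed

section \<open>Renaming core vertices and finding smaller subgraphs\<close>

text \<open>
  Symmetries of the core extend to the attached vertices.
\<close>

definition rename :: "(nat \<Rightarrow> nat) \<Rightarrow> cactus_vertex \<Rightarrow> cactus_vertex" where
  "rename p v = (case v of Core i \<Rightarrow> Core (p i) | Leaf i j \<Rightarrow> Leaf (p i) j | TriU i j \<Rightarrow> TriU (p i) j | TriV i j \<Rightarrow> TriV (p i) j)"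

lemma rename_simps [simp]:
  "rename p (Core i) = Core (p i)" "rename p (Leaf i j) = Leaf (p i) j"
  "rename p (TriU i j) = TriU (p i) j" "rename p (TriV i j) = TriV (p i) j"
  by (simp_all add: rename_def)

lemma rename_att:
  assumes inj: "inj_on p C"
  shows "inj_on (rename p) (attV C (k \<circ> p) (m \<circ> p))"
    and "rename p ` attV C (k \<circ> p) (m \<circ> p) = attV (p ` C) k m"
    and "B \<subseteq> C \<times> C \<Longrightarrow> map_prod (rename p) (rename p) ` attE B C (k \<circ> p) (m \<circ> p) = attE (map_prod p p ` B) (p ` C) k m"
proof -
  let ?V = "attV C (k \<circ> p) (m \<circ> p)"
  show i: "inj_on (rename p) ?V"
  proof (rule inj_onI)
    fix x y assume *: "x \<in> ?V" "y \<in> ?V" "rename p x = rename p y"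
    have "base x \<in> C" "base y \<in> C" using * attached_base by auto
    moreover have "p (base x) = p (base y)" using *(3) by (cases x; cases y) auto
    ultimately have "base x = base y" using inj by (auto dest: inj_onD)
    then show "x = y" using *(3) by (cases x; cases y) auto
  qed
  show V: "rename p ` ?V = attV (p ` C) k m"
  proof (intro subset_antisym subsetI)
    fix w assume "w \<in> rename p ` ?V"
    then obtain v where "v \<in> ?V" "w = rename p v" by blast
    then show "w \<in> attV (p ` C) k m" by (cases v) auto
  next
    fix w assume w: "w \<in> attV (p ` C) k m"
    then have "base w \<in> p ` C" using attached_base by auto
    then obtain i where i: "i \<in> C" "base w = p i" by blast
    show "w \<in> rename p ` ?V"
    proof (cases w)
      case (Core l)
      then show ?thesis using i w by (intro image_eqI[of _ _ "Core i"]) auto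
    next
      case (Leaf l j)
      then show ?thesis using i w by (intro image_eqI[of _ _ "Leaf i j"]) auto
    next
      case (TriU l j)
      then show ?thesis using i w by (intro image_eqI[of _ _ "TriU i j"]) auto
    next
      case (TriV l j)
      then show ?thesis using i w by (intro image_eqI[of _ _ "TriV i j"]) auto
    qed
  qed
  assume B: "B \<subseteq> C \<times> C"
  have adj: "adjp (map_prod p p ` B) (rename p x) (rename p y) \<longleftrightarrow> adjp B x y" if "x \<in> ?V" "y \<in> ?V" for x y
  proof -
    have b: "base x \<in> C" "base y \<in> C" using that attached_base by auto
    then have eq: "p (base x) = p (base y) \<longleftrightarrow> base x = base y" using inj by (auto dest: inj_onD)
    have "(p i, p j) \<in> map_prod p p ` B \<longleftrightarrow> (i, j) \<in> B" if "i \<in> C" "j \<in> C" for i j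
    proof
      assume "(p i, p j) \<in> map_prod p p ` B"
      then obtain i' j' where ij: "(i', j') \<in> B" "p i = p i'" "p j = p j'" by auto
      have "i' \<in> C" "j' \<in> C" using ij(1) B by auto
      then have "i = i'" "j = j'" using inj_onD[OF inj] ij(2,3) that by blast+
      then show "(i, j) \<in> B" using ij(1) by simp
    qed force
    then show ?thesis using b eq by (cases x; cases y) auto
  qed
  show "map_prod (rename p) (rename p) ` attE B C (k \<circ> p) (m \<circ> p) = attE (map_prod p p ` B) (p ` C) k m"
  proof (intro subset_antisym subsetI)
    fix e assume "e \<in> map_prod (rename p) (rename p) ` attE B C (k \<circ> p) (m \<circ> p)"
    then obtain x y where xy: "(x, y) \<in> attE B C (k \<circ> p) (m \<circ> p)" "e = (rename p x, rename p y)" by auto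
    then have "x \<in> ?V" "y \<in> ?V" "adjp B x y" by (auto simp: in_attE)
    moreover from this have "rename p x \<in> attV (p ` C) k m" "rename p y \<in> attV (p ` C) k m" using V by blast+
    ultimately show "e \<in> attE (map_prod p p ` B) (p ` C) k m" using adj[of x y] xy(2) by (simp add: in_attE)
  next
    fix e assume e: "e \<in> attE (map_prod p p ` B) (p ` C) k m"
    then have fs: "fst e \<in> rename p ` ?V" "snd e \<in> rename p ` ?V" unfolding V by (cases e; simp add: in_attE)+
    obtain x where x: "fst e = rename p x" "x \<in> ?V" using fs(1) by (rule imageE)
    obtain y where y: "snd e = rename p y" "y \<in> ?V" using fs(2) by (rule imageE)
    have xy: "x \<in> ?V" "y \<in> ?V" "e = (rename p x, rename p y)" using x y by (simp_all add: prod_eq_iff)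
    then have "adjp B x y" using e adj[of x y] by (simp add: in_attE)
    then have "(x, y) \<in> attE B C (k \<circ> p) (m \<circ> p)" using xy by (simp add: in_attE)
    then show "e \<in> map_prod (rename p) (rename p) ` attE B C (k \<circ> p) (m \<circ> p)" unfolding xy(3) by force
  qed
qed

lemma crit_rename:
  assumes "finite C" "inj_on p C" "p ` C = C" "B \<subseteq> C \<times> C" "map_prod p p ` B = B"
    and "crit (attV C (k \<circ> p) (m \<circ> p)) (attE B C (k \<circ> p) (m \<circ> p))"
  shows "crit (attV C k m) (attE B C k m)"
proof -
  let ?V = "attV C (k \<circ> p) (m \<circ> p)" and ?E = "attE B C (k \<circ> p) (m \<circ> p)"
  have "crit (rename p ` ?V) (map_prod (rename p) (rename p) ` ?E)"
    by (rule crit_bij[OF assms(6) _ rename_att(1)[OF assms(2)] attE_sub(1)]) (use assms(1) in simp)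
  then show ?thesis using rename_att(2)[OF assms(2), of k m] rename_att(3)[OF assms(2,4), of k m] assms(3,5) by simp
qed

lemma attE_mono_id:
  assumes "(x, y) \<in> attE B' C' k' m'" "attV C' k' m' \<subseteq> attV C k m" "B' \<subseteq> B"
  shows "(x, y) \<in> attE B C k m"
proof -
  have *: "adjp B' x y" "x \<in> attV C' k' m'" "y \<in> attV C' k' m'" using assms(1) by (simp_all add: in_attE)
  have "adjp B x y" using *(1) assms(3) by (cases x; cases y) auto
  moreover have "x \<in> attV C k m" "y \<in> attV C k m" using subsetD[OF assms(2)] *(2,3) by fast+
  ultimately show ?thesis by (simp add: in_attE)
qed

lemma attV_mono:
  assumes "C' \<subseteq> C" "\<And>i. i \<in> C' \<Longrightarrow> k' i \<le> k i \<and> m' i \<le> m i"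
  shows "attV C' k' m' \<subseteq> attV C k m"
proof
  fix v assume "v \<in> attV C' k' m'"
  then show "v \<in> attV C k m" using assms by (cases v) (auto intro: order.trans)
qed

text \<open>
  In a critical graph neither core vertices nor core edges, leaves or triangles can be dispensed with.
\<close>

lemma crit_sub_witness:
  assumes "crit (attV C k m) (attE B C k m)" "finite C" "sym B'" "B' \<subseteq> B"
    and "C' \<subseteq> C" "\<And>i. i \<in> C' \<Longrightarrow> k' i \<le> k i \<and> m' i \<le> m i"
    and "pchi (attV C k m) (attE B C k m) \<le> pchi (attV C' k' m') (attE B' C' k' m')"
  shows "C' = C" "\<And>i. i \<in> C \<Longrightarrow> k i = k' i \<and> m i = m' i"
proof -
  have sub: "attV C' k' m' \<subseteq> attV C k m" by (rule attV_mono[OF assms(5,6)])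
  have "id ` attV C' k' m' = attV C k m"
  proof (rule crit_surj(1)[OF assms(1) _ _ _ _ attE_sub(1) sym_attE[OF assms(3)] assms(7)])
    show "(id x, id y) \<in> attE B C k m" if "(x, y) \<in> attE B' C' k' m'" for x y
      using attE_mono_id[OF that sub assms(4)] by simp
  qed (use sub assms(2) in auto)
  then have eq: "v \<in> attV C' k' m' \<longleftrightarrow> v \<in> attV C k m" for v by auto
  show C: "C' = C" using eq[of "Core _"] by auto
  fix i assume i: "i \<in> C"
  show "k i = k' i \<and> m i = m' i"
    using eq[of "Leaf i (k i)"] eq[of "TriU i (m i)"] i C assms(6)[of i] by (cases "k i = 0"; cases "m i = 0") auto
qed

section \<open>Attachments of critical graphs with a complete core\<close>

text \<open>
  Deleting \<open>c\<close> and its leaf does not change the number of colours, since \<open>c\<close> costs nothing.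
\<close>

lemma complete_core_gain_not_crit:
  assumes "finite C" "c \<in> C" "k c \<le> 1" "m c = 0"
    and "\<And>i. i \<in> C - {c} \<Longrightarrow> k i \<ge> 2 \<or> m i \<ge> 1" "i1 \<in> C - {c}" "m i1 \<ge> 1"
  shows "\<not> crit (attV C k m) (attE (compl C) C k m)"
proof
  assume crit: "crit (attV C k m) (attE (compl C) C k m)"
  have "pchi (attV C k m) (attE (compl C) C k m) \<le> 2 + weight (C - {c}) m"
    using assms by (intro upper_gain) auto
  also have "\<dots> \<le> pchi (attV (C - {c}) k m) (attE (compl (C - {c})) (C - {c}) k m)"
    using lower_complete[of "C - {c}" k m i1] assms unfolding weight_def by simp
  finally have "C - {c} = C"
    by (intro crit_sub_witness(1)[OF crit assms(1) sym_compl]) auto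
  then show False using assms(2) by blast
qed

text \<open>
  The upper bound depends on the numbers of triangles alone, and the lower bound holds as soon as each core vertex
  has a triangle or two leaves; in a critical graph nothing beyond that can be present. Moreover, as long as another
  core vertex has a triangle, a single triangle can be replaced by two leaves, that is, its outer edge can be
  deleted.
\<close>

lemma complete_core_crit_types:
  assumes "finite C" "\<And>i. i \<in> C \<Longrightarrow> k i \<ge> 2 \<or> m i \<ge> 1" "i1 \<in> C" "m i1 \<ge> 1"
    and crit: "crit (attV C k m) (attE (compl C) C k m)"
  shows "\<And>i. i \<in> C \<Longrightarrow> k i = 2 \<and> m i = 0 \<or> k i = 0 \<and> m i \<ge> 1"
    and "\<And>i i'. i \<in> C \<Longrightarrow> i' \<in> C \<Longrightarrow> m i = 1 \<Longrightarrow> m i' \<ge> 1 \<Longrightarrow> i = i'"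
proof -
  have up: "pchi (attV C k m) (attE (compl C) C k m) \<le> 2 + weight C m"
    using assms(1) by (intro upper_default) auto
  define k' where "k' i = (if m i \<ge> 1 then 0 else 2 :: nat)" for i
  have "2 + weight C m \<le> pchi (attV C k' m) (attE (compl C) C k' m)"
    using lower_complete[of C k' m i1] assms unfolding weight_def k'_def by auto
  with up have le: "pchi (attV C k m) (attE (compl C) C k m) \<le> pchi (attV C k' m) (attE (compl C) C k' m)" by simp
  have "k i = k' i \<and> m i = m i" if "i \<in> C" for i
  proof (rule crit_sub_witness(2)[OF crit assms(1) sym_compl order.refl order.refl _ le that])
    fix i assume "i \<in> C"
    then show "k' i \<le> k i \<and> m i \<le> m i" using assms(2) unfolding k'_def by auto
  qed
  then have kk: "k i = k' i" if "i \<in> C" for i using that by blast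
  show "k i = 2 \<and> m i = 0 \<or> k i = 0 \<and> m i \<ge> 1" if "i \<in> C" for i
    using kk[OF that] unfolding k'_def by auto
  fix i i' assume i: "i \<in> C" "i' \<in> C" "m i = 1" "m i' \<ge> 1"
  show "i = i'"
  proof (rule ccontr)
    assume ne: "i \<noteq> i'"
    \<comment> \<open>The map \<open>f\<close> sends the two leaves at \<open>i\<close> to the outer vertices of the single triangle, so the edge between
      them is not in its image.\<close>
    define k2 m2 where "k2 = k(i := 2)" and "m2 = m(i := 0)"
    define f where "f v = (case v of Leaf l j \<Rightarrow> if l = i then if j = 1 then TriU i 1 else TriV i 1 else v | _ \<Rightarrow> v)" for v
    have "weight C m2 = weight C m"
      unfolding weight_def by (rule sum.cong) (auto simp: m2_def i)
    then have "2 + weight C m \<le> pchi (attV C k2 m2) (attE (compl C) C k2 m2)"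
      using lower_complete[of C k2 m2 i'] assms i ne unfolding weight_def k2_def m2_def by auto
    with up have le2: "pchi (attV C k m) (attE (compl C) C k m) \<le> pchi (attV C k2 m2) (attE (compl C) C k2 m2)" by simp
    have "map_prod f f ` attE (compl C) C k2 m2 = attE (compl C) C k m"
    proof (rule crit_surj(2)[OF crit _ _ _ _ attE_sub(1) sym_attE[OF sym_compl] le2])
      show "inj_on f (attV C k2 m2)"
      proof (rule inj_onI)
        fix x y assume "x \<in> attV C k2 m2" "y \<in> attV C k2 m2" "f x = f y"
        then show "x = y"
          by (cases x; cases y) (auto simp: f_def k2_def m2_def split: if_splits)
      qed
      show "f ` attV C k2 m2 \<subseteq> attV C k m"
      proof
        fix w assume "w \<in> f ` attV C k2 m2"
        then obtain v where "v \<in> attV C k2 m2" "w = f v" by blast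
        then show "w \<in> attV C k m" using i by (cases v) (auto simp: f_def k2_def m2_def split: if_splits)
      qed
      show "(f x, f y) \<in> attE (compl C) C k m" if "(x, y) \<in> attE (compl C) C k2 m2" for x y
        using that i by (cases x; cases y) (auto simp: in_attE f_def k2_def m2_def split: if_splits)
    qed (use assms(1) in simp)
    moreover have "(TriU i 1, TriV i 1) \<in> attE (compl C) C k m" using i by (simp add: in_attE)
    ultimately have "(TriU i 1, TriV i 1) \<in> map_prod f f ` attE (compl C) C k2 m2" by simp
    then obtain x y where "(x, y) \<in> attE (compl C) C k2 m2" "TriU i 1 = f x" "TriV i 1 = f y"
      by auto
    then show False
      by (cases x; cases y) (auto simp: in_attE f_def k2_def m2_def split: if_splits)
  qed
qed

text \<open>
  One leaf at each core vertex already forces the number of colours that any number of leaves needs.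
\<close>

lemma complete_core_leaves_crit:
  assumes "finite C" "card C \<ge> 1" "\<And>i. i \<in> C \<Longrightarrow> k i \<ge> 1 \<and> m i = 0"
    and chi: "1 + card C \<le> pchi (attV C (\<lambda>_. 1) (\<lambda>_. 0)) (attE (compl C) C (\<lambda>_. 1) (\<lambda>_. 0))"
    and crit: "crit (attV C k m) (attE (compl C) C k m)" and "i \<in> C"
  shows "k i = 1"
proof -
  have "pchi (attV C k m) (attE (compl C) C k m) \<le> 1 + card C"
    using assms by (intro upper_leaves[of _ _ i]) auto
  then have "pchi (attV C k m) (attE (compl C) C k m) \<le> pchi (attV C (\<lambda>_. 1) (\<lambda>_. 0)) (attE (compl C) C (\<lambda>_. 1) (\<lambda>_. 0))"
    using chi by simp
  from crit_sub_witness(2)[OF crit assms(1) sym_compl order.refl order.refl _ this assms(6)]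
  show ?thesis using assms(3) by simp
qed

text \<open>
  Three colours suffice, and a path on four vertices inside the graph needs them.
\<close>

lemma triangle_two_attached_not_crit:
  assumes "a \<noteq> b" "a \<noteq> c" "b \<noteq> c" "m a = 0" "m b = 0" "m c = 0" "k a \<ge> 1" "k b \<ge> 1" "k c = 0"
  shows "\<not> crit (attV {a, b, c} k m) (attE (compl {a, b, c}) {a, b, c} k m)"
proof
  assume crit: "crit (attV {a, b, c} k m) (attE (compl {a, b, c}) {a, b, c} k m)"
  have "pchi (attV {a, b, c} k m) (attE (compl {a, b, c}) {a, b, c} k m) \<le> 3"
    by (rule upper_triangle_two_attached) (fact assms)+
  also have "\<dots> \<le> pchi (attV {a, b} (\<lambda>_. 1) (\<lambda>_. 0)) (attE (compl {a, b}) {a, b} (\<lambda>_. 1) (\<lambda>_. 0))"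
    by (rule lower_path4[OF assms(1)])
  finally have "{a, b} = {a, b, c}"
    by (intro crit_sub_witness(1)[OF crit _ sym_compl]) (use assms in auto)
  then show False using assms by auto
qed

text \<open>
  Seen from \<open>a\<close>, the core is one more triangle. Already the \<open>m a + 1\<close> triangles that share \<open>a\<close> need as many colours as
  the whole graph, so the leaf at \<open>b\<close> or \<open>c\<close> is superfluous.
\<close>

lemma triangle_one_triangle_not_crit:
  assumes "a \<noteq> b" "a \<noteq> c" "b \<noteq> c" "m a \<ge> 1" "m b = 0" "m c = 0" "k b \<le> 1" "k c \<le> 1" "k b \<ge> 1 \<or> k c \<ge> 1"
  shows "\<not> crit (attV {a, b, c} k m) (attE (compl {a, b, c}) {a, b, c} k m)"
proof
  assume crit: "crit (attV {a, b, c} k m) (attE (compl {a, b, c}) {a, b, c} k m)"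
  \<comment> \<open>The map \<open>f\<close> sends the last triangle at \<open>a\<close> to the core.\<close>
  define M where "M = (\<lambda>_ :: nat. m a + 1)"
  define f where "f v = (case v of TriU l j \<Rightarrow> if j = m a + 1 then Core b else v | TriV l j \<Rightarrow> if j = m a + 1 then Core c else v | _ \<Rightarrow> v)" for v
  have "pchi (attV {a, b, c} k m) (attE (compl {a, b, c}) {a, b, c} k m) \<le> 2 + weight ({a, b, c} - {b}) m"
    using assms by (intro upper_gain) auto
  also have "weight ({a, b, c} - {b}) m = m a + 1"
    using assms unfolding weight_def by (simp add: insert_Diff_if)
  also have "2 + (m a + 1) \<le> pchi (attV {a} (\<lambda>_. 0) M) (attE (compl {a}) {a} (\<lambda>_. 0) M)"
    using lower_complete[of "{a}" "\<lambda>_. 0" M a] unfolding M_def by simp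
  finally have le: "pchi (attV {a, b, c} k m) (attE (compl {a, b, c}) {a, b, c} k m) \<le> pchi (attV {a} (\<lambda>_. 0) M) (attE (compl {a}) {a} (\<lambda>_. 0) M)" .
  have "f ` attV {a} (\<lambda>_. 0) M = attV {a, b, c} k m"
  proof (rule crit_surj(1)[OF crit _ _ _ _ attE_sub(1) sym_attE[OF sym_compl] le])
    show "inj_on f (attV {a} (\<lambda>_. 0) M)"
    proof (rule inj_onI)
      fix x y assume "x \<in> attV {a} (\<lambda>_. 0) M" "y \<in> attV {a} (\<lambda>_. 0) M" "f x = f y"
      then show "x = y" using assms by (cases x; cases y) (auto simp: f_def M_def split: if_splits)
    qed
    show "f ` attV {a} (\<lambda>_. 0) M \<subseteq> attV {a, b, c} k m"
    proof
      fix w assume "w \<in> f ` attV {a} (\<lambda>_. 0) M"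
      then obtain v where "v \<in> attV {a} (\<lambda>_. 0) M" "w = f v" by blast
      then show "w \<in> attV {a, b, c} k m" by (cases v) (auto simp: f_def M_def split: if_splits)
    qed
    show "(f x, f y) \<in> attE (compl {a, b, c}) {a, b, c} k m" if "(x, y) \<in> attE (compl {a}) {a} (\<lambda>_. 0) M" for x y
      using that assms by (cases x; cases y) (auto simp: in_attE f_def M_def split: if_splits)
  qed simp
  moreover have "Leaf b 1 \<in> attV {a, b, c} k m \<or> Leaf c 1 \<in> attV {a, b, c} k m" using assms by auto
  ultimately have "Leaf b 1 \<in> f ` attV {a} (\<lambda>_. 0) M \<or> Leaf c 1 \<in> f ` attV {a} (\<lambda>_. 0) M" by simp
  moreover have "Leaf i 1 \<notin> f ` attV {a} (\<lambda>_. 0) M" for i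
  proof
    assume "Leaf i 1 \<in> f ` attV {a} (\<lambda>_. 0) M"
    then obtain v where "v \<in> attV {a} (\<lambda>_. 0) M" "Leaf i 1 = f v" by blast
    then show False by (cases v) (auto simp: f_def split: if_splits)
  qed
  ultimately show False by blast
qed

section \<open>Attachments of critical graphs with a longer cycle\<close>

lemma upper_cyc4:
  assumes km: "k 3 = 0" "k 4 = 0" "m 3 = 0" "m 4 = 0"
    and "pack (adjR cyc4) 1 X1" "pack (adjR cyc4) 2 X2" "finite S"
    and cores: "\<And>v. v \<in> {Core 1, Core 2, Core 3, Core 4} \<Longrightarrow> v \<in> X1 \<union> X2 \<union> Core ` S"
    and leaves: "\<And>i j. i \<in> {1, 2} \<Longrightarrow> 1 \<le> j \<Longrightarrow> j \<le> k i \<Longrightarrow> Leaf i j \<in> X1 \<union> X2"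
    and U: "\<And>i j. i \<in> {1, 2} \<Longrightarrow> 1 \<le> j \<Longrightarrow> j \<le> m i \<Longrightarrow> TriU i j \<in> X1 \<union> X2"
    and V: "\<And>i. i \<in> {1, 2} \<Longrightarrow> 1 \<le> m i \<Longrightarrow> TriV i 1 \<in> X1 \<union> X2"
  shows "pchi (attV {1, 2, 3, 4} k m) (attE cyc4 {1, 2, 3, 4} k m) \<le> 2 + (card S + (m 1 - 1) + (m 2 - 1))"
proof (rule upper_cores_triangles[where S = S and J = "\<lambda>i. {2..m i}", OF _ assms(7) _ attE_sub(2) assms(5,6)])
  let ?Y = "X1 \<union> X2 \<union> (Core ` S \<union> {TriV i j | i j. i \<in> {1, 2, 3, 4} \<and> j \<in> {2..m i}})"
  show "attV {1, 2, 3, 4} k m \<subseteq> ?Y"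
  proof
    fix v assume v: "v \<in> attV {1, 2, 3, 4} k m"
    show "v \<in> ?Y"
    proof (cases v)
      case (Core i)
      then have "v \<in> X1 \<union> X2 \<union> Core ` S" using v by (intro cores) auto
      then show ?thesis by blast
    next
      case (Leaf i j)
      then have "v \<in> X1 \<union> X2" using v km unfolding Leaf by (intro leaves) auto
      then show ?thesis by blast
    next
      case (TriU i j)
      then have "v \<in> X1 \<union> X2" using v km unfolding TriU by (intro U) auto
      then show ?thesis by blast
    next
      case (TriV i j)
      then have ij: "i \<in> {1, 2}" "1 \<le> j" "j \<le> m i" using v km by auto
      show ?thesis
      proof (cases "j = 1")
        case True
        then have "v \<in> X1 \<union> X2" using V[OF ij(1)] ij TriV by simp
        then show ?thesis by blast
      next
        case False
        then show ?thesis using ij TriV by auto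
      qed
    qed
  qed
qed (use km in simp_all)

text \<open>
  If all attachments are at the vertex 2, the triangles at 2 alone need as many colours as the graph. If there are
  no triangles, then three colours suffice, and the path 4, 1, 2, 3 in the core needs them.
\<close>

lemma cyc4_crit_one_side:
  assumes km: "k 3 = 0" "k 4 = 0" "m 3 = 0" "m 4 = 0" and k1: "k 1 = 0" and m1: "m 1 = 0"
  shows "\<not> crit (attV {1, 2, 3, 4} k m) (attE cyc4 {1, 2, 3, 4} k m)"
proof
  let ?V = "attV {1, 2, 3, 4} k m" and ?E = "attE cyc4 {1, 2, 3, 4} k m"
  assume crit: "crit ?V ?E"
  have "pchi ?V ?E \<le> 2 + (card {2 :: nat} + (m 1 - 1) + (m 2 - 1))"
  proof (rule upper_cyc4[OF km, where ?X1.0 = "{Leaf 2 j | j. True} \<union> {TriU 2 j | j. True} \<union> {Core 1, Core 3}"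
        and ?X2.0 = "{Core 4, TriV 2 1}"])
    show "pack (adjR cyc4) 2 {Core 4, TriV 2 1}" by (rule pack_bases'[OF order.refl]) (auto simp: cyc4_def)
  qed (use k1 m1 in \<open>auto intro!: pack_Suc0I simp: cyc4_def\<close>)
  then have up: "pchi ?V ?E \<le> 3 + (m 2 - 1)" using m1 by simp
  show False
  proof (cases "m 2 \<ge> 1")
    case True
    have "m 2 + 2 \<le> pchi (attV {2} (\<lambda>_. 0) m) (attE (compl {2}) {2} (\<lambda>_. 0) m)"
      using lower_complete[of "{2}" "\<lambda>_. 0" m 2] True by simp
    with up True have "pchi ?V ?E \<le> pchi (attV {2} (\<lambda>_. 0) m) (attE (compl {2}) {2} (\<lambda>_. 0) m)" by simp
    from crit_sub_witness(1)[OF crit _ sym_compl _ _ _ this] have "{2} = {1, 2, 3, 4 :: nat}"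
      by (simp add: compl_def subset_iff)
    then show False by auto
  next
    case False
    \<comment> \<open>The path 4, 1, 2, 3: its inner vertices are the core, its ends the leaves of the model.\<close>
    define f where "f v = (case v of Leaf i j \<Rightarrow> if i = 1 then Core 4 else Core 3 | _ \<Rightarrow> v)" for v
    let ?W = "attV {1, 2} (\<lambda>_. 1) (\<lambda>_. 0)" and ?F = "attE (compl {1, 2}) {1, 2} (\<lambda>_. 1) (\<lambda>_. 0)"
    have "3 \<le> pchi ?W ?F" by (rule lower_path4) simp
    with up False have le: "pchi ?V ?E \<le> pchi ?W ?F" by simp
    have "map_prod f f ` ?F = ?E"
    proof (rule crit_surj(2)[OF crit _ _ _ _ attE_sub(1) sym_attE[OF sym_compl] le])
      show "inj_on f ?W"
      proof (rule inj_onI)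
        fix x y assume "x \<in> ?W" "y \<in> ?W" "f x = f y"
        then show "x = y" by (cases x; cases y) (auto simp: f_def split: if_splits)
      qed
      show "f ` ?W \<subseteq> ?V"
      proof
        fix w assume "w \<in> f ` ?W"
        then obtain v where "v \<in> ?W" "w = f v" by blast
        then show "w \<in> ?V" by (cases v) (auto simp: f_def split: if_splits)
      qed
      show "(f x, f y) \<in> ?E" if "(x, y) \<in> ?F" for x y
        using that by (cases x; cases y) (auto simp: in_attE f_def cyc4_def split: if_splits)
    qed simp
    moreover have "(Core 3, Core 4) \<in> ?E" by (simp add: in_attE cyc4_def)
    ultimately have "(Core 3, Core 4) \<in> map_prod f f ` ?F" by simp
    then obtain x y where "(x, y) \<in> ?F" "Core 3 = f x" "Core 4 = f y" by auto
    then show False by (cases x; cases y) (auto simp: in_attE f_def split: if_splits)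
  qed
qed

text \<open>
  The vertex 4 serves as a second leaf at 1. With it, the subgraph that consists of 1, 2, two leaves at 1 and the
  triangles at 2 has a complete core and needs as many colours as the graph, but it avoids the vertex 3.
\<close>

lemma cyc4_crit_mixed:
  assumes km: "k 3 = 0" "k 4 = 0" "m 3 = 0" "m 4 = 0" and k1: "k 1 \<ge> 1" and m1: "m 1 = 0" and m2: "m 2 \<ge> 1"
  shows "\<not> crit (attV {1, 2, 3, 4} k m) (attE cyc4 {1, 2, 3, 4} k m)"
proof
  let ?V = "attV {1, 2, 3, 4} k m" and ?E = "attE cyc4 {1, 2, 3, 4} k m"
  assume crit: "crit ?V ?E"
  have "pchi ?V ?E \<le> 2 + (card {1, 2 :: nat} + (m 1 - 1) + (m 2 - 1))"
  proof (rule upper_cyc4[OF km, where ?X1.0 = "{Leaf i j | i j. i = 1 \<or> i = 2} \<union> {TriU 2 j | j. True} \<union> {Core 3}"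
        and ?X2.0 = "{Core 4, TriV 2 1}"])
    show "pack (adjR cyc4) 2 {Core 4, TriV 2 1}" by (rule pack_bases'[OF order.refl]) (auto simp: cyc4_def)
  qed (use m1 in \<open>auto intro!: pack_Suc0I simp: cyc4_def\<close>)
  then have up: "pchi ?V ?E \<le> m 2 + 3" using m1 m2 by simp
  define k' m' where "k' i = (if i = 1 then 2 else 0 :: nat)" and "m' i = (if i = 1 then 0 else m i)" for i :: nat
  define f where "f v = (case v of Leaf i j \<Rightarrow> if j = 1 then v else Core 4 | _ \<Rightarrow> v)" for v
  let ?W = "attV {1, 2} k' m'" and ?F = "attE (compl {1, 2}) {1, 2} k' m'"
  have "(\<Sum>i\<in>{1, 2}. max 1 (m' i)) + 2 \<le> pchi ?W ?F"
    by (rule lower_complete[where ?i1.0 = 2]) (use m2 in \<open>auto simp: k'_def m'_def\<close>)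
  moreover have "(\<Sum>i\<in>{1, 2}. max 1 (m' i)) = m 2 + 1" using m2 by (simp add: m'_def)
  ultimately have "m 2 + 3 \<le> pchi ?W ?F" by simp
  with up have le: "pchi ?V ?E \<le> pchi ?W ?F" by simp
  have "f ` ?W = ?V"
  proof (rule crit_surj(1)[OF crit _ _ _ _ attE_sub(1) sym_attE[OF sym_compl] le])
    show "inj_on f ?W"
    proof (rule inj_onI)
      fix x y assume "x \<in> ?W" "y \<in> ?W" "f x = f y"
      then show "x = y" by (cases x; cases y) (auto simp: f_def k'_def split: if_splits)
    qed
    show "f ` ?W \<subseteq> ?V"
    proof
      fix w assume "w \<in> f ` ?W"
      then obtain v where "v \<in> ?W" "w = f v" by blast
      then show "w \<in> ?V" using k1 by (cases v) (auto simp: f_def k'_def m'_def split: if_splits)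
    qed
    show "(f x, f y) \<in> ?E" if "(x, y) \<in> ?F" for x y
      using that k1 by (cases x; cases y) (auto simp: in_attE f_def k'_def m'_def cyc4_def split: if_splits)
  qed simp
  moreover have "Core 3 \<in> ?V" by simp
  ultimately have "Core 3 \<in> f ` ?W" by simp
  then obtain v where "v \<in> ?W" "Core 3 = f v" by blast
  then show False by (cases v) (auto simp: f_def split: if_splits)
qed

lemma cyc4_swap:
  assumes "crit (attV {1, 2, 3, 4} k m) (attE cyc4 {1, 2, 3, 4} k m)"
  defines "p \<equiv> \<lambda>i :: nat. if i = 1 then 2 else if i = 2 then 1 else if i = 3 then 4 else 3"
  shows "crit (attV {1, 2, 3, 4} (k \<circ> p) (m \<circ> p)) (attE cyc4 {1, 2, 3, 4} (k \<circ> p) (m \<circ> p))"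
proof (rule crit_rename[where p = p])
  have "p (p i) = i" if "i \<in> {1, 2, 3, 4}" for i using that unfolding p_def by auto
  then have pp: "(k \<circ> p \<circ> p) i = k i \<and> (m \<circ> p \<circ> p) i = m i" if "i \<in> {1, 2, 3, 4}" for i
    using that by simp
  have "attV {1, 2, 3, 4} (k \<circ> p \<circ> p) (m \<circ> p \<circ> p) = attV {1, 2, 3, 4} k m"
    "attE cyc4 {1, 2, 3, 4} (k \<circ> p \<circ> p) (m \<circ> p \<circ> p) = attE cyc4 {1, 2, 3, 4} k m"
    by (rule attV_cong, rule pp, assumption)+
  then show "crit (attV {1, 2, 3, 4} (k \<circ> p \<circ> p) (m \<circ> p \<circ> p)) (attE cyc4 {1, 2, 3, 4} (k \<circ> p \<circ> p) (m \<circ> p \<circ> p))"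
    using assms(1) by (simp only:)
qed (auto simp: p_def cyc4_def inj_on_def)

lemma cyc4_crit_types:
  assumes km: "k 3 = 0" "k 4 = 0" "m 3 = 0" "m 4 = 0"
    and crit: "crit (attV {1, 2, 3, 4} k m) (attE cyc4 {1, 2, 3, 4} k m)"
  shows "k 1 = 1 \<and> k 2 = 1 \<and> m 1 = 0 \<and> m 2 = 0 \<or> k 1 = 0 \<and> k 2 = 0 \<and> m 1 \<ge> 1 \<and> m 2 \<ge> 1"
proof -
  let ?C = "{1, 2, 3, 4} :: nat set"
  let ?V = "attV ?C k m" and ?E = "attE cyc4 ?C k m"
  define p where "p i = (if i = 1 then 2 else if i = 2 then 1 else if i = 3 then 4 else 3 :: nat)" for i :: nat
  have sw: "crit (attV ?C (k \<circ> p) (m \<circ> p)) (attE cyc4 ?C (k \<circ> p) (m \<circ> p))"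
    using cyc4_swap[OF crit] unfolding p_def .
  have "\<not> (k 1 = 0 \<and> m 1 = 0)" using cyc4_crit_one_side[OF km] crit by blast
  moreover have "\<not> (k 2 = 0 \<and> m 2 = 0)"
  proof
    assume "k 2 = 0 \<and> m 2 = 0"
    then show False using cyc4_crit_one_side[of "k \<circ> p" "m \<circ> p"] sw km by (simp add: p_def)
  qed
  moreover have "\<not> (k 1 \<ge> 1 \<and> m 1 = 0 \<and> m 2 \<ge> 1)" using cyc4_crit_mixed[OF km] crit by blast
  moreover have "\<not> (k 2 \<ge> 1 \<and> m 2 = 0 \<and> m 1 \<ge> 1)"
  proof
    assume "k 2 \<ge> 1 \<and> m 2 = 0 \<and> m 1 \<ge> 1"
    then show False using cyc4_crit_mixed[of "k \<circ> p" "m \<circ> p"] sw km by (simp add: p_def)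
  qed
  ultimately consider "m 1 \<ge> 1" "m 2 \<ge> 1" | "m 1 = 0" "m 2 = 0" "k 1 \<ge> 1" "k 2 \<ge> 1"
    by linarith
  then show ?thesis
  proof cases
    case 1
    have "pchi ?V ?E \<le> 2 + (card {1, 2, 4 :: nat} + (m 1 - 1) + (m 2 - 1))"
    proof (rule upper_cyc4[OF km, where ?X1.0 = "{Leaf i j | i j. i = 1 \<or> i = 2} \<union> {TriU i j | i j. i = 1 \<or> i = 2} \<union> {Core 3}"
        and ?X2.0 = "{TriV 1 1, TriV 2 1}"])
      show "pack (adjR cyc4) 2 {TriV 1 1, TriV 2 1}" by (rule pack_bases'[OF order.refl]) (auto simp: cyc4_def)
    qed (auto intro!: pack_Suc0I simp: cyc4_def)
    also have "\<dots> = m 1 + m 2 + 3" using 1 by simp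
    also have "\<dots> \<le> pchi (attV ?C (\<lambda>_. 0) m) (attE cyc4 ?C (\<lambda>_. 0) m)"
      using 1 km by (intro lower_cyc4_triangles) auto
    finally have le: "pchi ?V ?E \<le> pchi (attV ?C (\<lambda>_. 0) m) (attE cyc4 ?C (\<lambda>_. 0) m)" .
    have "k i = 0 \<and> m i = m i" if "i \<in> ?C" for i
      by (rule crit_sub_witness(2)[OF crit _ sym_cyc4 order.refl order.refl _ le that]) auto
    then have "k 1 = 0" "k 2 = 0" by auto
    then show ?thesis using 1 by simp
  next
    case 2
    have "pchi ?V ?E \<le> 2 + (card {1, 2 :: nat} + (m 1 - 1) + (m 2 - 1))"
    proof (rule upper_cyc4[OF km, where ?X1.0 = "{Leaf i j | i j. i = 1 \<or> i = 2} \<union> {Core 3}" and ?X2.0 = "{Core 4}"])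
    qed (use 2 in \<open>auto intro!: pack_Suc0I pack_single simp: cyc4_def\<close>)
    also have "\<dots> = 4" using 2 by simp
    also define k' where "k' = (\<lambda>i :: nat. if i = 1 \<or> i = 2 then 1 else 0 :: nat)"
    have "4 \<le> pchi (attV ?C k' (\<lambda>_. 0)) (attE cyc4 ?C k' (\<lambda>_. 0))"
      by (intro lower_cyc4_leaves) (auto simp: k'_def)
    finally have le: "pchi ?V ?E \<le> pchi (attV ?C k' (\<lambda>_. 0)) (attE cyc4 ?C k' (\<lambda>_. 0))" .
    have "k i = k' i \<and> m i = 0" if "i \<in> ?C" for i
      by (rule crit_sub_witness(2)[OF crit _ sym_cyc4 order.refl order.refl _ le that]) (use 2 in \<open>auto simp: k'_def\<close>)
    then have "k 1 = 1" "k 2 = 1" by (simp_all add: k'_def)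
    then show ?thesis using 2 by simp
  qed
qed

lemma upper_cyc5:
  assumes "\<And>i. i \<notin> {1, 2} \<Longrightarrow> k i = 0 \<and> m i = 0"
  shows "pchi (attV {1, 2, 3, 4, 5} k m) (attE cyc5 {1, 2, 3, 4, 5} k m) \<le> 4 + (m 1 - 1) + (m 2 - 1)"
proof -
  let ?C = "{1, 2, 3, 4, 5} :: nat set"
  have z: "k 3 = 0" "k 4 = 0" "k 5 = 0" "m 3 = 0" "m 4 = 0" "m 5 = 0"
    using assms[of 3] assms[of 4] assms[of 5] by simp_all
  let ?X1 = "{Leaf i j | i j. i = 1 \<or> i = 2} \<union> {TriU i j | i j. i = 1 \<or> i = 2} \<union> {Core 3, Core 5}"
  let ?X2 = "{TriV 1 1, TriV 2 1, Core 4}"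
  have "pchi (attV ?C k m) (attE cyc5 ?C k m) \<le> 2 + (2 + (m 1 - 1) + (m 2 - 1))"
  proof (rule upper_cores_triangles[where S = "{1, 2}" and J = "\<lambda>i. {2..m i}", OF _ _ _ attE_sub(2)])
    show "pack (adjR cyc5) 1 ?X1" by (rule pack1I) (auto simp: cyc5_def)
    show "pack (adjR cyc5) 2 ?X2" by (rule pack_bases'[OF order.refl]) (auto simp: cyc5_def)
    show "attV ?C k m \<subseteq> ?X1 \<union> ?X2 \<union> (Core ` {1, 2} \<union> {TriV i j | i j. i \<in> ?C \<and> j \<in> {2..m i}})"
    proof
      fix v assume "v \<in> attV ?C k m"
      then show "v \<in> ?X1 \<union> ?X2 \<union> (Core ` {1, 2} \<union> {TriV i j | i j. i \<in> ?C \<and> j \<in> {2..m i}})"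
        using z by (cases v) auto
    qed
  qed (use z in auto)
  then show ?thesis by simp
qed

text \<open>
  If there are two triangles at 2 as well, the subgraph with core \<open>{1, 2}\<close> already needs all colours. Otherwise the
  5-cycle with only the triangles at 1 does.
\<close>

lemma cyc5_crit_types_aux:
  assumes km: "\<And>i. i \<notin> {1, 2} \<Longrightarrow> k i = 0 \<and> m i = 0" and m1: "m 1 \<ge> 2"
    and crit: "crit (attV {1, 2, 3, 4, 5} k m) (attE cyc5 {1, 2, 3, 4, 5} k m)"
  shows "k 1 = 0 \<and> k 2 = 0 \<and> m 2 = 0"
proof -
  let ?C = "{1, 2, 3, 4, 5} :: nat set"
  let ?V = "attV ?C k m" and ?E = "attE cyc5 ?C k m"
  have up: "pchi ?V ?E \<le> 4 + (m 1 - 1) + (m 2 - 1)" by (rule upper_cyc5) (rule km)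
  show ?thesis
  proof (cases "m 2 \<ge> 2")
    case True
    have "(\<Sum>i\<in>{1, 2}. max 1 (m i)) + 2 \<le> pchi (attV {1, 2} k m) (attE (compl {1, 2}) {1, 2} k m)"
      by (rule lower_complete[where ?i1.0 = 1]) (use True m1 in auto)
    moreover have "(\<Sum>i\<in>{1, 2}. max 1 (m i)) = m 1 + m 2" using True m1 by simp
    ultimately have "m 1 + m 2 + 2 \<le> pchi (attV {1, 2} k m) (attE (compl {1, 2}) {1, 2} k m)" by simp
    with up True m1 have le: "pchi ?V ?E \<le> pchi (attV {1, 2} k m) (attE (compl {1, 2}) {1, 2} k m)" by simp
    have "{1, 2} = ?C"
      by (rule crit_sub_witness(1)[OF crit _ sym_compl _ _ _ le]) (auto simp: compl_def cyc5_def)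
    then have False by auto
    then show ?thesis ..
  next
    case False
    define m' where "m' i = (if i = 1 then m 1 else 0)" for i :: nat
    have "m 1 + 3 \<le> pchi (attV ?C (\<lambda>_. 0) m') (attE cyc5 ?C (\<lambda>_. 0) m')"
      using lower_cyc5[of "\<lambda>_. 0" m'] m1 by (simp add: m'_def)
    with up False m1 have le: "pchi ?V ?E \<le> pchi (attV ?C (\<lambda>_. 0) m') (attE cyc5 ?C (\<lambda>_. 0) m')" by simp
    have "k i = 0 \<and> m i = m' i" if "i \<in> ?C" for i
      by (rule crit_sub_witness(2)[OF crit _ sym_cyc5 order.refl order.refl _ le that]) (auto simp: m'_def)
    then show ?thesis by (auto simp: m'_def)
  qed
qed

text \<open>
  The bare 5-cycle remains as a possibility. It has diameter 2, which \<open>shape_cyc5\<close> excludes.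
\<close>

lemma cyc5_crit_types:
  assumes km: "\<And>i. i \<notin> {1, 2} \<Longrightarrow> k i = 0 \<and> m i = 0"
    and crit: "crit (attV {1, 2, 3, 4, 5} k m) (attE cyc5 {1, 2, 3, 4, 5} k m)"
  shows "k 1 = 0 \<and> k 2 = 0 \<and> (m 1 \<ge> 2 \<and> m 2 = 0 \<or> m 2 \<ge> 2 \<and> m 1 = 0 \<or> m 1 = 0 \<and> m 2 = 0)"
proof -
  let ?C = "{1, 2, 3, 4, 5} :: nat set"
  let ?V = "attV ?C k m" and ?E = "attE cyc5 ?C k m"
  define p where "p i = (if i = 1 then 2 else if i = 2 then 1 else if i = 3 then 5 else if i = 5 then 3 else i)" for i :: nat
  have sw: "crit (attV ?C (k \<circ> p) (m \<circ> p)) (attE cyc5 ?C (k \<circ> p) (m \<circ> p))"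
  proof (rule crit_rename[where p = p])
    have "p (p i) = i" for i unfolding p_def by auto
    then show "crit (attV ?C (k \<circ> p \<circ> p) (m \<circ> p \<circ> p)) (attE cyc5 ?C (k \<circ> p \<circ> p) (m \<circ> p \<circ> p))"
      using crit by (simp add: comp_def)
  qed (auto simp: p_def cyc5_def inj_on_def)
  consider "m 1 \<ge> 2" | "m 2 \<ge> 2" | "m 1 \<le> 1" "m 2 \<le> 1" by linarith
  then show ?thesis
  proof cases
    case 1
    then show ?thesis using cyc5_crit_types_aux[OF km 1 crit] by simp
  next
    case 2
    have "(k \<circ> p) 1 = 0 \<and> (k \<circ> p) 2 = 0 \<and> (m \<circ> p) 2 = 0"
    proof (rule cyc5_crit_types_aux[OF _ _ sw])
      show "(k \<circ> p) i = 0 \<and> (m \<circ> p) i = 0" if "i \<notin> {1, 2}" for i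
        using that km[of "p i"] by (auto simp: p_def split: if_splits)
    qed (use 2 in \<open>simp add: p_def\<close>)
    then show ?thesis using 2 by (simp add: p_def)
  next
    case 3
    have "pchi ?V ?E \<le> 4 + (m 1 - 1) + (m 2 - 1)" by (rule upper_cyc5) (rule km)
    then have le: "pchi ?V ?E \<le> pchi (attV ?C (\<lambda>_. 0) (\<lambda>_. 0)) (attE cyc5 ?C (\<lambda>_. 0) (\<lambda>_. 0))"
      using lower_cyc5_bare 3 by simp
    have "k i = 0 \<and> m i = 0" if "i \<in> ?C" for i
      by (rule crit_sub_witness(2)[OF crit _ sym_cyc5 order.refl order.refl _ le that]) auto
    then show ?thesis by simp
  qed
qed

section \<open>Three neighbours of a vertex of a cactus\<close>

text \<open>
  Connected after the removal of any set \<open>A\<close> with at most one element. Both conditions on blocks, connectedness and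
  the absence of cut vertices, are thus instances of one condition.
\<close>

definition nonsep :: "'a set \<Rightarrow> ('a \<times> 'a) set \<Rightarrow> bool" where
  "nonsep S F \<longleftrightarrow> F \<subseteq> S \<times> S \<and> sym F \<and>
    (\<forall>A. (\<forall>v\<in>A. \<forall>w\<in>A. v = w) \<longrightarrow> (\<forall>a\<in>S - A. \<forall>b\<in>S - A. (a, b) \<in> rtrancl_on (S - A) F))"

lemma nonsepD:
  "nonsep S F \<Longrightarrow> (\<And>v w. v \<in> A \<Longrightarrow> w \<in> A \<Longrightarrow> v = w) \<Longrightarrow> a \<in> S - A \<Longrightarrow> b \<in> S - A
    \<Longrightarrow> (a, b) \<in> rtrancl_on (S - A) F"
  unfolding nonsep_def by blast

definition path_edges :: "'a list \<Rightarrow> ('a \<times> 'a) set" where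
  "path_edges xs = set (zip xs (tl xs))"

lemma path_edges_simps [simp]:
  "path_edges [] = {}" "path_edges [x] = {}"
  "path_edges (x # y # xs) = insert (x, y) (path_edges (y # xs))"
  by (simp_all add: path_edges_def)

lemma path_edges_append:
  "path_edges (xs @ y # ys) = path_edges (xs @ [y]) \<union> path_edges (y # ys)"
proof (induction xs)
  case (Cons x xs) then show ?case by (cases xs) auto
qed simp

lemma path_edges_sub: "path_edges xs \<subseteq> set xs \<times> set xs"
proof (induction xs)
  case (Cons x xs) then show ?case by (cases xs) auto
qed simp

lemma path_rtrancl_on:
  "path_edges (x # xs) \<subseteq> R \<Longrightarrow> set (x # xs) \<subseteq> T \<Longrightarrow> (x, last (x # xs)) \<in> rtrancl_on T R"
proof (induction xs arbitrary: x)
  case Nil then show ?case by (auto intro: rtrancl_on_refl)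
next
  case (Cons y xs)
  then have "(y, last (y # xs)) \<in> rtrancl_on T R" "(x, y) \<in> R" "x \<in> T" by auto
  then show ?case using converse_rtrancl_on_into_rtrancl_on[of x y R "last (y # xs)" T] by simp
qed

text \<open>
  Adding an ear, a path outside \<open>S\<close> between two different vertices of \<open>S\<close>, preserves nonseparability: whichever vertex
  of the ear is removed, the remaining ones still reach one of its ends.
\<close>

lemma nonsep_ear:
  assumes ns: "nonsep S F" and ut: "u \<in> S" "t \<in> S" "u \<noteq> t"
    and p: "distinct p" "set p \<inter> S = {}"
  defines "P \<equiv> path_edges (u # p @ [t])"
  shows "nonsep (S \<union> set p) (F \<union> (P \<union> P\<inverse>))"
proof -
  let ?S = "S \<union> set p" and ?F = "F \<union> (P \<union> P\<inverse>)"
  have Psub: "P \<subseteq> ?S \<times> ?S" using path_edges_sub[of "u # p @ [t]"] ut unfolding P_def by auto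
  have symF: "sym F" using ns unfolding nonsep_def by blast
  have sym': "sym ?F" using symF by (auto simp: sym_def)
  show ?thesis
    unfolding nonsep_def
  proof (intro conjI allI ballI impI)
    show "?F \<subseteq> ?S \<times> ?S" using ns Psub unfolding nonsep_def by blast
    show "sym ?F" by (rule sym')
    fix A a b assume A: "\<forall>v\<in>A. \<forall>w\<in>A. v = w" and ab: "a \<in> ?S - A" "b \<in> ?S - A"
    let ?T = "?S - A"
    have symT: "(y, x) \<in> rtrancl_on ?T ?F" if "(x, y) \<in> rtrancl_on ?T ?F" for x y
      using rtrancl_on_sym[OF sym', of ?T] that by (rule symD)
    have inS: "(x, y) \<in> rtrancl_on ?T ?F" if "x \<in> S - A" "y \<in> S - A" for x y
    proof -
      have "(x, y) \<in> rtrancl_on (S - A) F" by (rule nonsepD[OF ns _ that]) (use A in blast)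
      then show ?thesis by (rule rtrancl_on_mono[rotated 2]) auto
    qed
    have toS: "\<exists>s\<in>S - A. (x, s) \<in> rtrancl_on ?T ?F" if x: "x \<in> ?T" for x
    proof (cases "x \<in> S")
      case True
      then show ?thesis using inS[of x x] x by blast
    next
      case False
      then have "x \<in> set p" using x by blast
      then obtain p1 p2 where pp: "p = p1 @ x # p2" by (meson split_list)
      have P_eq: "P = path_edges ((u # p1) @ [x]) \<union> path_edges (x # p2 @ [t])"
        using path_edges_append[of "u # p1" x "p2 @ [t]"] unfolding P_def pp by simp
      show ?thesis
      proof (cases "A \<inter> insert u (set p1) = {}")
        case True
        have "(u, last (u # p1 @ [x])) \<in> rtrancl_on ?T ?F"
        proof (rule path_rtrancl_on)
          show "path_edges (u # p1 @ [x]) \<subseteq> ?F" unfolding P_eq by auto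
          show "set (u # p1 @ [x]) \<subseteq> ?T" using True ut x unfolding pp by auto
        qed
        then have "(x, u) \<in> rtrancl_on ?T ?F" using symT by simp
        then show ?thesis using True ut by blast
      next
        case False
        then obtain v where v: "v \<in> A" "v \<in> insert u (set p1)" by blast
        then have "v \<notin> set p2" "v \<noteq> t" using p ut unfolding pp by auto
        moreover have "w = v" if "w \<in> A" for w using A v(1) that by blast
        ultimately have nt: "A \<inter> set p2 = {}" "t \<notin> A" by blast+
        have "(x, last (x # p2 @ [t])) \<in> rtrancl_on ?T ?F"
        proof (rule path_rtrancl_on)
          show "path_edges (x # p2 @ [t]) \<subseteq> ?F" unfolding P_eq by auto
          show "set (x # p2 @ [t]) \<subseteq> ?T" using nt ut x unfolding pp by auto
        qed
        then show ?thesis using nt ut by auto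
      qed
    qed
    obtain s where s: "s \<in> S - A" "(a, s) \<in> rtrancl_on ?T ?F" using toS[OF ab(1)] by blast
    obtain s' where s': "s' \<in> S - A" "(b, s') \<in> rtrancl_on ?T ?F" using toS[OF ab(2)] by blast
    show "(a, b) \<in> rtrancl_on ?T ?F"
      by (rule rtrancl_on_trans[OF s(2) rtrancl_on_trans[OF inS[OF s(1) s'(1)] symT[OF s'(2)]]])
  qed
qed

lemma nonsep_edge:
  assumes "u \<noteq> x" shows "nonsep {u, x} {(u, x), (x, u)}"
proof -
  have "(a, b) \<in> rtrancl_on ({u, x} - A) {(u, x), (x, u)}"
    if ab: "a \<in> {u, x} - A" "b \<in> {u, x} - A" for a b A
  proof (cases "a = b")
    case True
    then show ?thesis using ab by (auto intro: rtrancl_on_refl)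
  next
    case False
    then have "(a, b) \<in> {(u, x), (x, u)}" using ab by auto
    then show ?thesis using ab by (meson rtrancl_on_refl rtrancl_on_into_rtrancl_on)
  qed
  then show ?thesis unfolding nonsep_def by (auto simp: sym_def)
qed

lemma rtrancl_on_path:
  assumes "(a, b) \<in> rtrancl_on T E"
  shows "\<exists>xs. xs \<noteq> [] \<and> hd xs = a \<and> last xs = b \<and> distinct xs \<and> set xs \<subseteq> T \<and> path_edges xs \<subseteq> E"
  using assms
proof (induction rule: converse_rtrancl_on_induct)
  case base
  then show ?case by (intro exI[of _ "[b]"]) simp
next
  case (step x y)
  then obtain xs where xs: "xs \<noteq> []" "hd xs = y" "last xs = b" "distinct xs" "set xs \<subseteq> T" "path_edges xs \<subseteq> E"
    by blast
  show ?case
  proof (cases "x \<in> set xs")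
    case False
    obtain zs where "xs = y # zs" using xs(1,2) by (cases xs) auto
    then show ?thesis using xs step False by (intro exI[of _ "x # xs"]) auto
  next
    case True
    then obtain p q where "xs = p @ x # q" by (meson split_list)
    then show ?thesis using xs path_edges_append[of p x q] by (intro exI[of _ "x # q"]) auto
  qed
qed

lemma cycle_graph_degree:
  assumes "r \<ge> 3" "(i, a) \<in> parcs (cycle_graph r)" "(i, b) \<in> parcs (cycle_graph r)" "(i, d) \<in> parcs (cycle_graph r)"
  shows "a = b \<or> a = d \<or> b = d"
proof -
  have *: "j = (if i < r then i + 1 else 1) \<or> j = (if i = 1 then r else i - 1)"
    if "(i, j) \<in> parcs (cycle_graph r)" for j
    using that assms(1) unfolding cycle_graph_def symcl_def by auto
  show ?thesis using *[OF assms(2)] *[OF assms(3)] *[OF assms(4)] by presburger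
qed

context
  fixes G :: "'a pair_pre_digraph"
  assumes pg: "pair_graph G" and cactus: "cactus (with_proj G)"
begin

interpretation pair_graph G by (rule pg)

text \<open>
  A subgraph with the required properties and with the largest number of vertices and arcs is a block.
\<close>

lemma nonsep_block:
  assumes "nonsep S F" "S \<noteq> {}" "S \<subseteq> pverts G" "F \<subseteq> parcs G"
  shows "\<exists>B. block (with_proj G) B \<and> S \<subseteq> verts B \<and> F \<subseteq> arcs B"
proof -
  define H where "H = \<lparr>pverts = S, parcs = F\<rparr>"
  have FS: "F \<subseteq> S \<times> S" and symF: "sym F" using assms(1) unfolding nonsep_def by blast+
  have "finite S" "finite F" using assms(3,4) pair_finite_verts pair_finite_arcs finite_subset by blast+
  then interpret H: pair_graph H
    using FS symF no_loops assms(4) unfolding H_def by unfold_locales (auto simp: symmetric_def)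
  have gH: "graph (with_proj H)" by (rule H.pair_graphD_graph)
  define P :: "('a, 'a \<times> 'a) pre_digraph \<Rightarrow> bool" where
    "P = (\<lambda>H. graph H \<and> Digraph_Component.connected H \<and> (\<forall>v. \<not> cut_vertex H v))"
  have conn: "(a, b) \<in> rtrancl_on S F" if "a \<in> S" "b \<in> S" for a b
    using nonsepD[OF assms(1), of "{}"] that by simp
  have "P (with_proj H)"
    unfolding P_def
  proof (intro conjI allI gH notI)
    show "Digraph_Component.connected (with_proj H)"
      unfolding connected_conv
    proof (intro conjI ballI)
      show "verts (with_proj H) \<noteq> {}" using assms(2) by (simp add: H_def)
      fix a b assume "a \<in> verts (with_proj H)" "b \<in> verts (with_proj H)"
      then have "(a, b) \<in> rtrancl_on S F" using conn by (simp add: H_def)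
      then show "(a, b) \<in> rtrancl_on (verts (with_proj H)) (symcl (arcs_ends (with_proj H)))"
        by (rule rtrancl_on_mono[rotated 2]) (auto simp: H_def symcl_def)
    qed
    fix v assume "cut_vertex (with_proj H) v"
    then obtain u w where uw: "u \<in> S - {v}" "w \<in> S - {v}"
      "\<not> u \<rightarrow>\<^sup>*\<^bsub>pre_digraph.del_vert (with_proj H) v\<^esub> w"
      unfolding cut_vertex_def by (auto simp: H_def)
    have "(u, w) \<in> rtrancl_on (S - {v}) F" using nonsepD[OF assms(1) _ uw(1,2)] by blast
    then have "(u, w) \<in> rtrancl_on (S - {v}) {e \<in> F. fst e \<noteq> v \<and> snd e \<noteq> v}"
    proof (induction rule: rtrancl_on_induct)
      case base then show ?case by (rule rtrancl_on_refl)
    next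
      case (step y z) then show ?case by (auto intro: rtrancl_on_into_rtrancl_on)
    qed
    moreover have "arcs_ends (pre_digraph.del_vert (with_proj H) v) = {e \<in> F. fst e \<noteq> v \<and> snd e \<noteq> v}"
      unfolding arcs_ends_conv pre_digraph.del_vert_def by (simp add: H_def)
    ultimately show False using uw(3)
      unfolding reachable_def pre_digraph.del_vert_def by (simp add: H_def)
  qed
  moreover have sHG: "subgraph (with_proj H) (with_proj G)"
    using assms(3,4) wf_digraph H.wf_digraph unfolding H_def subgraph_def compatible_def by simp
  moreover have sHH: "subgraph (with_proj H) (with_proj H)" by (rule H.subgraph_refl)
  define Q where "Q H' \<longleftrightarrow> subgraph (with_proj H) H' \<and> subgraph H' (with_proj G) \<and> P H'" for H'
  define f where "f H' = card (verts H') + card (arcs H')" for H' :: "('a, 'a \<times> 'a) pre_digraph"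
  have QH: "Q (with_proj H)" using calculation sHH unfolding Q_def by (intro conjI)
  have bound: "\<forall>H'. Q H' \<longrightarrow> f H' < card (pverts G) + card (parcs G) + 1"
  proof (intro allI impI)
    fix H' assume "Q H'"
    then have "verts H' \<subseteq> pverts G" "arcs H' \<subseteq> parcs G" unfolding Q_def subgraph_def by simp_all
    then have "f H' \<le> card (pverts G) + card (parcs G)"
      unfolding f_def using pair_finite_verts pair_finite_arcs by (intro add_mono card_mono)
    then show "f H' < card (pverts G) + card (parcs G) + 1" by simp
  qed
  obtain B where B: "Q B" "\<forall>H'. Q H' \<longrightarrow> f H' \<le> f B"
    using ex_has_greatest_nat[OF QH bound] by metis
  have "block (with_proj G) B"
    unfolding block_def pre_digraph.max_subgraph_def P_def[symmetric]
  proof (intro conjI allI impI notI)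
    show "subgraph B (with_proj G)" "P B" using B(1) unfolding Q_def by blast+
    fix H' assume H': "H' \<noteq> B \<and> subgraph B H'" "subgraph H' (with_proj G) \<and> P H'"
    then have "Q H'" using B(1) subgraph_trans[of _ B H'] unfolding Q_def by simp
    then have "f H' \<le> f B" using B(2) by (elim allE[of _ H']) simp
    have fin: "finite (verts H')" "finite (arcs H')"
      using H'(2) pair_finite_verts pair_finite_arcs unfolding subgraph_def by (auto intro: finite_subset)
    have sub: "verts B \<subseteq> verts H'" "arcs B \<subseteq> arcs H'" "tail B = tail H'" "head B = head H'"
      using H'(1) unfolding subgraph_def compatible_def by auto
    have "card (verts B) \<le> card (verts H')" "card (arcs B) \<le> card (arcs H')"
      using sub fin by (simp_all add: card_mono)
    then have "card (verts B) = card (verts H')" "card (arcs B) = card (arcs H')"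
      using \<open>f H' \<le> f B\<close> unfolding f_def by simp_all
    then have "verts B = verts H'" "arcs B = arcs H'" using sub fin by (simp_all add: card_subset_eq)
    then have "H' = B" using sub by (intro pre_digraph.equality) simp_all
    then show False using H'(1) by blast
  qed
  moreover have "S \<subseteq> verts B" "F \<subseteq> arcs B" using B(1) unfolding Q_def subgraph_def H_def by auto
  ultimately show ?thesis by blast
qed

text \<open>
  A nonseparable subgraph lies in a block, and in a cycle or a single edge no vertex has three neighbours.
\<close>

lemma nonsep_degree:
  assumes ns: "nonsep S F" "S \<subseteq> pverts G" "F \<subseteq> parcs G"
    and xyz: "(u, x) \<in> F" "(u, y) \<in> F" "(u, z) \<in> F" "x \<noteq> y" "x \<noteq> z" "y \<noteq> z"
  shows False
proof -
  have FS: "F \<subseteq> S \<times> S" using ns unfolding nonsep_def by blast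
  then have inS: "u \<in> S" "x \<in> S" "y \<in> S" "z \<in> S" using xyz by blast+
  then obtain B where B: "block (with_proj G) B" "S \<subseteq> verts B" "F \<subseteq> arcs B"
    using nonsep_block[OF ns(1) _ ns(2,3)] by blast
  have th: "tail B = fst" "head B = snd" and gB: "graph B"
    using B(1) unfolding block_def pre_digraph.max_subgraph_def subgraph_def compatible_def by auto
  interpret B: graph B by (rule gB)
  have "(\<exists>r\<ge>3. digraph_iso B (cycle_graph r)) \<or> K\<^bsub>2\<^esub> B"
    using cactus B(1) unfolding cactus_def by blast
  then show False
  proof
    assume "K\<^bsub>2\<^esub> B"
    then have "card (verts B) = 2" unfolding complete_digraph_def by blast
    moreover have "card {x, y, z} \<le> card (verts B)"
      using B(2) inS by (intro card_mono) auto
    ultimately show False using xyz by simp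
  next
    assume "\<exists>r\<ge>3. digraph_iso B (cycle_graph r)"
    then obtain r h where r: "r \<ge> 3" and h: "pre_digraph.digraph_isomorphism B h"
      and C: "with_proj (cycle_graph r) = app_iso h B" unfolding digraph_iso_def by blast
    have C': "parcs (cycle_graph r) = iso_arcs h ` arcs B" "iso_tail h = fst" "iso_head h = snd"
      using arg_cong[OF C, of arcs] arg_cong[OF C, of tail] arg_cong[OF C, of head] by simp_all
    have arc: "(iso_verts h a, iso_verts h b) \<in> parcs (cycle_graph r)" if "(a, b) \<in> F" for a b
    proof -
      have ab: "(a, b) \<in> arcs B" using that B(3) by blast
      then have "fst (iso_arcs h (a, b)) = iso_verts h a" "snd (iso_arcs h (a, b)) = iso_verts h b"
        using h th C' unfolding pre_digraph.digraph_isomorphism_def by force+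
      then have "iso_arcs h (a, b) = (iso_verts h a, iso_verts h b)" by (simp add: prod_eq_iff)
      then show ?thesis using ab C'(1) by (metis image_eqI)
    qed
    have inj: "inj_on (iso_verts h) (verts B)" using h unfolding pre_digraph.digraph_isomorphism_def by blast
    have "iso_verts h x \<noteq> iso_verts h y" "iso_verts h x \<noteq> iso_verts h z" "iso_verts h y \<noteq> iso_verts h z"
      using inj_onD[OF inj] B(2) inS xyz(4-6) by blast+
    then show False using cycle_graph_degree[OF r arc[OF xyz(1)] arc[OF xyz(2)] arc[OF xyz(3)]] by blast
  qed
qed

text \<open>
  A path from \<open>x\<close> to \<open>y\<close> that avoids \<open>u\<close> closes to a cycle through \<open>u\<close>. A path from \<open>z\<close> to \<open>x\<close> that avoids \<open>u\<close>, cut where it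
  first meets this cycle, is a further ear that starts in \<open>u\<close>. In the resulting nonseparable subgraph \<open>u\<close> has the
  three neighbours \<open>x\<close>, \<open>y\<close> and \<open>z\<close>.
\<close>

lemma cactus_three_neighbours:
  assumes xyz: "(u, x) \<in> parcs G" "(u, y) \<in> parcs G" "(u, z) \<in> parcs G" "x \<noteq> y" "x \<noteq> z" "y \<noteq> z"
    and xy: "(x, y) \<in> rtrancl_on (pverts G - {u}) (parcs G)"
    and xz: "(z, x) \<in> rtrancl_on (pverts G - {u}) (parcs G)"
  shows False
proof -
  have symE: "(b, a) \<in> parcs G" if "(a, b) \<in> parcs G" for a b using that by (rule arcs_symmetric)
  obtain xs where xs: "xs \<noteq> []" "hd xs = x" "last xs = y" "distinct xs" "set xs \<subseteq> pverts G - {u}" "path_edges xs \<subseteq> parcs G"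
    using rtrancl_on_path[OF xy] by blast
  then obtain p where p: "xs = x # p" by (cases xs) auto
  have "p \<noteq> []" "last p = y" using xs p xyz(4) by auto
  then obtain p' where p': "p = p' @ [y]" by (metis append_butlast_last_id)
  have u: "u \<in> pverts G" "x \<in> pverts G" "u \<noteq> x" using wellformed' xyz(1) xs p by auto
  define P1 where "P1 = path_edges (x # p @ [u])"
  define S1 where "S1 = {u, x} \<union> set p"
  define F1 where "F1 = {(u, x), (x, u)} \<union> (P1 \<union> P1\<inverse>)"
  have ns1: "nonsep S1 F1"
    unfolding S1_def F1_def P1_def using u(3) xs p by (intro nonsep_ear nonsep_edge) auto
  have P1: "P1 = path_edges xs \<union> {(y, u)}"
    using path_edges_append[of "x # p'" y "[u]"] unfolding P1_def p p' by simp
  then have yu: "(y, u) \<in> P1" by simp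
  have P1E: "P1 \<subseteq> parcs G" using P1 xs(6) symE[OF xyz(2)] by simp
  have S1V: "S1 \<subseteq> pverts G" using u xs(5) p unfolding S1_def by auto
  have F1E: "F1 \<subseteq> parcs G" using P1E symE xyz(1) unfolding F1_def by auto
  obtain zs where zs: "zs \<noteq> []" "hd zs = z" "last zs = x" "distinct zs" "set zs \<subseteq> pverts G - {u}" "path_edges zs \<subseteq> parcs G"
    using rtrancl_on_path[OF xz] by blast
  have "x \<in> set zs" "x \<in> S1" using zs(1,3) unfolding S1_def by auto
  then obtain q t r where qtr: "zs = q @ t # r" "t \<in> S1" "\<forall>w\<in>set q. w \<notin> S1"
    using split_list_first_prop[of zs "\<lambda>w. w \<in> S1"] by blast
  \<comment> \<open>The ear: from \<open>u\<close> over \<open>z\<close> to the first vertex \<open>t\<close> on the cycle.\<close>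
  define P2 where "P2 = path_edges (u # q @ [t])"
  have ns2: "nonsep (S1 \<union> set q) (F1 \<union> (P2 \<union> P2\<inverse>))"
    unfolding P2_def
  proof (rule nonsep_ear[OF ns1])
    show "u \<in> S1" unfolding S1_def by simp
    show "u \<noteq> t" using zs(5) qtr by auto
  qed (use qtr zs in auto)
  have "path_edges (q @ [t]) \<subseteq> parcs G" using zs(6) path_edges_append[of q t r] qtr(1) by auto
  moreover have P2: "P2 = insert (u, z) (path_edges (q @ [t]))"
    using zs(2) qtr(1) unfolding P2_def by (cases q) auto
  ultimately have P2E: "P2 \<subseteq> parcs G" using xyz(3) by simp
  show False
  proof (rule nonsep_degree[OF ns2])
    show "S1 \<union> set q \<subseteq> pverts G" using S1V zs(5) qtr(1) by auto
    show "F1 \<union> (P2 \<union> P2\<inverse>) \<subseteq> parcs G" using F1E P2E symE by auto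
    show "(u, x) \<in> F1 \<union> (P2 \<union> P2\<inverse>)" "(u, y) \<in> F1 \<union> (P2 \<union> P2\<inverse>)"
      "(u, z) \<in> F1 \<union> (P2 \<union> P2\<inverse>)"
      using yu P2 unfolding F1_def by auto
  qed (use xyz in auto)
qed

end

section \<open>Cactus graphs of radius 2 and diameter 3\<close>

text \<open>
  A core with vertices \<open>cs i\<close> and edges given by \<open>B\<close>, and sets \<open>A i\<close> of vertices attached at \<open>cs i\<close>. As every vertex of
  \<open>A i\<close> has at most one neighbour in \<open>A i\<close>, the set consists of leaves and of pairs that form triangles with \<open>cs i\<close>.
  The conditions on core edges, and those between different sets, are stated for \<open>i < j\<close> and extend by symmetry.
\<close>

definition shape :: "'a set \<Rightarrow> ('a \<times> 'a) set \<Rightarrow> (nat \<times> nat) set \<Rightarrow> nat set \<Rightarrow> (nat \<Rightarrow> 'a) \<Rightarrow> (nat \<Rightarrow> 'a set) \<Rightarrow> bool" where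
  "shape V E B C cs A \<longleftrightarrow> inj_on cs C \<and> V = cs ` C \<union> (\<Union>i\<in>C. A i)
    \<and> (\<forall>i\<in>C. \<forall>j\<in>C. cs j \<notin> A i)
    \<and> (\<forall>i\<in>C. \<forall>j\<in>C. i < j \<longrightarrow> ((cs i, cs j) \<in> E \<longleftrightarrow> (i, j) \<in> B))
    \<and> (\<forall>i\<in>C. \<forall>j\<in>C. \<forall>v\<in>A j. (cs i, v) \<in> E \<longleftrightarrow> i = j)
    \<and> (\<forall>i\<in>C. \<forall>j\<in>C. i < j \<longrightarrow> (\<forall>v\<in>A i. \<forall>w\<in>A j. (v, w) \<notin> E))
    \<and> (\<forall>i\<in>C. \<forall>v\<in>A i. \<forall>w\<in>A i. \<forall>w'\<in>A i. (v, w) \<in> E \<longrightarrow> (v, w') \<in> E \<longrightarrow> w = w')"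

text \<open>
  The assumption \<open>three\<close> is all that is used of the cactus property.
\<close>

locale center =
  fixes V :: "'a set" and E c
  assumes EV: "E \<subseteq> V \<times> V" and sym: "sym E" and irrefl: "\<And>v. (v, v) \<notin> E"
    and three: "\<And>u x y z. (u, x) \<in> E \<Longrightarrow> (u, y) \<in> E \<Longrightarrow> (u, z) \<in> E \<Longrightarrow> x \<noteq> y \<Longrightarrow> x \<noteq> z \<Longrightarrow> y \<noteq> z
      \<Longrightarrow> (x, y) \<in> rtrancl_on (V - {u}) E \<Longrightarrow> (x, z) \<in> rtrancl_on (V - {u}) E \<Longrightarrow> False"
    and cV: "c \<in> V" and near2: "\<And>v. v \<in> V \<Longrightarrow> near E 2 c v"
    and near3: "\<And>v w. v \<in> V \<Longrightarrow> w \<in> V \<Longrightarrow> near E 3 v w"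
begin

lemma symE: "(a, b) \<in> E \<Longrightarrow> (b, a) \<in> E"
  using sym by (rule symD)

lemma inV: "(a, b) \<in> E \<Longrightarrow> a \<in> V" "(a, b) \<in> E \<Longrightarrow> b \<in> V"
  using EV by blast+

lemma ne: "(a, b) \<in> E \<Longrightarrow> a \<noteq> b"
  using irrefl by blast

definition conn :: "'a \<Rightarrow> 'a \<Rightarrow> 'a \<Rightarrow> bool" where
  "conn u a b \<longleftrightarrow> (a, b) \<in> rtrancl_on (V - {u}) E"

lemma conn_edge: "(a, b) \<in> E \<Longrightarrow> a \<noteq> u \<Longrightarrow> b \<noteq> u \<Longrightarrow> conn u a b"
  unfolding conn_def using inV[of a b] by (auto intro: rtrancl_on_into_rtrancl_on rtrancl_on_refl)

lemma conn_trans: "conn u a b \<Longrightarrow> conn u b d \<Longrightarrow> conn u a d"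
  unfolding conn_def by (rule rtrancl_on_trans)

lemma conn_sym: "conn u a b \<Longrightarrow> conn u b a"
  unfolding conn_def using rtrancl_on_sym[OF sym] by (rule symD)

lemma conn_step: "conn u a b \<Longrightarrow> (b, d) \<in> E \<Longrightarrow> d \<noteq> u \<Longrightarrow> conn u a d"
  using conn_trans[OF _ conn_edge[of b d u]] unfolding conn_def
  by (metis Diff_iff in_rtrancl_on_in_F(2) insertI1)

lemma conn_inV: "conn u a b \<Longrightarrow> b \<in> V \<and> b \<noteq> u"
  unfolding conn_def using in_rtrancl_on_in_F(2) by fastforce

lemma threeE:
  assumes "(u, x) \<in> E" "(u, y) \<in> E" "(u, z) \<in> E" "x \<noteq> y" "x \<noteq> z" "y \<noteq> z" "conn u x y" "conn u x z"
  shows False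
  using three[OF assms(1-6)] assms(7,8) unfolding conn_def by blast

lemma no_diamond:
  assumes "(u, x) \<in> E" "(u, y) \<in> E" "(u, z) \<in> E" "y \<noteq> z" "(x, y) \<in> E" "(x, z) \<in> E"
  shows False
proof (rule threeE[OF assms(1-3)])
  show "x \<noteq> y" "x \<noteq> z" using ne assms(5,6) by blast+
  show "conn u x y" "conn u x z" using assms ne by (blast intro: conn_edge)+
qed (rule assms(4))

text \<open>
  Vertices at distance 2 from \<open>c\<close> are at most 3 apart, and a walk of length at most 3 between them has no room for \<open>c\<close>.
\<close>

lemma far_conn:
  assumes "v \<in> V" "w \<in> V" "v \<noteq> c" "w \<noteq> c" "(c, v) \<notin> E" "(c, w) \<notin> E"
  shows "conn c v w"
proof -
  have s: "(v, c) \<notin> E" "(w, c) \<notin> E" using assms(5,6) symE by blast+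
  have refl: "conn c v v" unfolding conn_def using assms by (auto intro: rtrancl_on_refl)
  from near3[OF assms(1,2)] consider "v = w" | "(v, w) \<in> E" | a where "(v, a) \<in> E" "(a, w) \<in> E"
    | a b where "(v, a) \<in> E" "(a, b) \<in> E" "(b, w) \<in> E"
    unfolding near_3 near_2 by blast
  then show ?thesis
  proof cases
    case 1 then show ?thesis using refl by simp
  next
    case 2 then show ?thesis using conn_step[OF refl] assms(4) by blast
  next
    case 3
    then have "a \<noteq> c" using s by blast
    then show ?thesis using conn_step[OF conn_step[OF refl 3(1)] 3(2)] assms(4) by blast
  next
    case 4
    then have "a \<noteq> c" "b \<noteq> c" using s assms(6) by blast+
    then show ?thesis using conn_step[OF conn_step[OF conn_step[OF refl 4(1)] _ ] 4(3)] 4(2) assms(4) by blast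
  qed
qed

end

text \<open>
  Take a vertex \<open>w0\<close> at distance 2 from \<open>c\<close> and the component \<open>D\<close> of \<open>w0\<close> in the graph without \<open>c\<close>. By \<open>far_conn\<close> it
  contains all vertices at distance 2, so what remains besides \<open>c\<close> and \<open>D\<close> are neighbours of \<open>c\<close>.
\<close>

locale branch = center +
  fixes d w0 D
  assumes cd: "(c, d) \<in> E" and dw0: "(d, w0) \<in> E" and w0: "w0 \<noteq> c" "(c, w0) \<notin> E"
    and D_def: "D = {v. conn c w0 v}"
begin

lemma D_V: "v \<in> D \<Longrightarrow> v \<in> V" "v \<in> D \<Longrightarrow> v \<noteq> c"
  unfolding D_def using conn_inV by blast+

lemma D_conn: "v \<in> D \<Longrightarrow> w \<in> D \<Longrightarrow> conn c v w"
  unfolding D_def using conn_trans conn_sym by blast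

lemma D_step: "v \<in> D \<Longrightarrow> (v, w) \<in> E \<Longrightarrow> w \<noteq> c \<Longrightarrow> w \<in> D"
  unfolding D_def using conn_step by blast

lemma far_D: "v \<in> V \<Longrightarrow> v \<noteq> c \<Longrightarrow> (c, v) \<notin> E \<Longrightarrow> v \<in> D"
  unfolding D_def using far_conn[of w0 v] w0 inV(2)[OF dw0] by blast

lemma dD: "d \<in> D"
  using D_step[OF far_D[of w0] symE[OF dw0]] inV(2)[OF dw0] w0 ne[OF cd] by blast

text \<open>
  Three neighbours of \<open>c\<close> in one component of the graph without \<open>c\<close> are impossible in a cactus.
\<close>

lemma D_three: "x \<in> D \<Longrightarrow> y \<in> D \<Longrightarrow> z \<in> D \<Longrightarrow> (c, x) \<in> E \<Longrightarrow> (c, y) \<in> E \<Longrightarrow> (c, z) \<in> E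
    \<Longrightarrow> x = y \<or> x = z \<or> y = z"
  using threeE[of c x y z] D_conn by blast

text \<open>
  The vertices attached at \<open>c\<close>.
\<close>

definition A1 :: "'a set" where "A1 = {v. (c, v) \<in> E \<and> v \<notin> D}"

definition N2 :: "'a set" where "N2 = {v \<in> D. (c, v) \<notin> E}"

lemma V_parts: "v \<in> V \<Longrightarrow> v = c \<or> v \<in> A1 \<or> v \<in> D"
  unfolding A1_def using far_D by blast

lemma V_split: "V = insert c (A1 \<union> D)"
proof (intro subset_antisym subsetI)
  fix v assume "v \<in> V"
  then show "v \<in> insert c (A1 \<union> D)" using V_parts[of v] by simp
next
  fix v assume "v \<in> insert c (A1 \<union> D)"
  then show "v \<in> V" using cV D_V(1)[of v] inV(2)[of c v] unfolding A1_def by auto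
qed

lemma A1_c: "v \<in> A1 \<Longrightarrow> (c, v) \<in> E"
  unfolding A1_def by blast

lemma A1_V: "v \<in> A1 \<Longrightarrow> v \<in> V" "v \<in> A1 \<Longrightarrow> v \<noteq> c" "v \<in> A1 \<Longrightarrow> v \<notin> D"
  unfolding A1_def using inV(2) ne by blast+

lemma A1_D: "v \<in> A1 \<Longrightarrow> w \<in> D \<Longrightarrow> (v, w) \<notin> E"
  "v \<in> A1 \<Longrightarrow> w \<in> D \<Longrightarrow> (w, v) \<notin> E"
  using A1_V D_step symE by blast+

lemma A1_deg: "v \<in> A1 \<Longrightarrow> w \<in> A1 \<Longrightarrow> w' \<in> A1 \<Longrightarrow> (v, w) \<in> E \<Longrightarrow> (v, w') \<in> E \<Longrightarrow> w = w'"
  using no_diamond[of c v w w'] A1_c by blast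

lemma N2_D: "v \<in> N2 \<Longrightarrow> v \<in> D" "v \<in> N2 \<Longrightarrow> (c, v) \<notin> E" "v \<in> N2 \<Longrightarrow> (v, c) \<notin> E"
  unfolding N2_def using symE by blast+

lemma N2_parent: "v \<in> N2 \<Longrightarrow> \<exists>p\<in>D. (c, p) \<in> E \<and> (p, v) \<in> E"
proof -
  assume v: "v \<in> N2"
  then have "near E 2 c v" using near2 D_V N2_D by blast
  then obtain p where p: "(c, p) \<in> E" "(p, v) \<in> E" using v D_V N2_D unfolding near_2 by blast
  then have "p \<in> D" using D_step[OF N2_D(1)[OF v] symE[OF p(2)]] ne[OF p(1)] by blast
  then show ?thesis using p by blast
qed

lemma w0_N2: "w0 \<in> N2"
  unfolding N2_def using far_D[of w0] w0 inV(2)[OF dw0] by blast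

text \<open>
  If \<open>d\<close> is the only neighbour of \<open>c\<close> in \<open>D\<close>, all vertices at distance 2 are attached at \<open>d\<close>. Something is attached at \<open>c\<close>,
  for otherwise \<open>d\<close> would be adjacent to all vertices.
\<close>

lemma shape_two:
  assumes only: "\<And>x. x \<in> D \<Longrightarrow> (c, x) \<in> E \<Longrightarrow> x = d" and A1: "\<exists>v\<in>V. \<not> near E 1 d v"
  shows "\<exists>cs A. shape V E (compl {1, 2}) {1, 2} cs A \<and> A 1 \<noteq> {} \<and> A 2 \<noteq> {}"
proof -
  define cs where "cs i = (if i = 1 then c else d)" for i :: nat
  define A where "A i = (if i = 1 then A1 else N2)" for i :: nat
  have deg2: "w = w'" if "v \<in> N2" "w \<in> N2" "w' \<in> N2" "(v, w) \<in> E" "(v, w') \<in> E" for v w w'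
    using no_diamond[of d v w w'] N2_parent only that by blast
  have dN2: "(d, v) \<in> E" if "v \<in> N2" for v using N2_parent[OF that] only by blast
  have D_eq: "v \<in> D \<longleftrightarrow> v = d \<or> v \<in> N2" for v using only dD N2_def by blast
  have "inj_on cs {1, 2}" using ne[OF cd] by (simp add: cs_def)
  moreover have "V = cs ` {1, 2} \<union> (\<Union>i\<in>{1, 2}. A i)"
  proof -
    have "D = insert d N2" using D_eq by blast
    then have "V = {c, d} \<union> (A1 \<union> N2)" using V_split by blast
    then show ?thesis by (auto simp: cs_def A_def)
  qed
  moreover have "\<forall>i\<in>{1, 2}. \<forall>j\<in>{1, 2}. cs j \<notin> A i"
    using A1_V dD N2_D D_V cd by (simp add: cs_def A_def) blast
  moreover have "\<forall>i\<in>{1, 2}. \<forall>j\<in>{1, 2}. i < j \<longrightarrow> ((cs i, cs j) \<in> E \<longleftrightarrow> (i, j) \<in> compl {1, 2})"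
    using cd by (simp add: cs_def)
  moreover have "\<forall>i\<in>{1, 2}. \<forall>j\<in>{1, 2}. \<forall>v\<in>A j. (cs i, v) \<in> E \<longleftrightarrow> i = j"
    using A1_c dN2 N2_D(2) A1_D(2)[OF _ dD] by (simp add: cs_def A_def)
  moreover have "\<forall>i\<in>{1, 2}. \<forall>j\<in>{1, 2}. i < j \<longrightarrow> (\<forall>v\<in>A i. \<forall>w\<in>A j. (v, w) \<notin> E)"
    using A1_D(1) N2_D(1) by (simp add: A_def)
  moreover have "\<forall>i\<in>{1, 2}. \<forall>v\<in>A i. \<forall>w\<in>A i. \<forall>w'\<in>A i. (v, w) \<in> E \<longrightarrow> (v, w') \<in> E \<longrightarrow> w = w'"
    using A1_deg deg2 unfolding A_def by simp
  ultimately have "shape V E (compl {1, 2}) {1, 2} cs A" unfolding shape_def by (intro conjI)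
  moreover have "A 2 \<noteq> {}" using w0_N2 by (auto simp: A_def)
  moreover have "A 1 \<noteq> {}"
  proof -
    obtain v where v: "v \<in> V" "v \<noteq> d" "(d, v) \<notin> E" using A1 unfolding near_1 by blast
    then have "v \<in> A1" using V_parts D_eq dN2 symE[OF cd] by blast
    then show ?thesis by (auto simp: A_def)
  qed
  ultimately show ?thesis by blast
qed

end

text \<open>
  Otherwise \<open>D\<close> contains exactly two neighbours \<open>d\<close> and \<open>e\<close> of \<open>c\<close>, and the vertices at distance 2 are adjacent to one
  of them or to both.
\<close>

locale two_branches = branch +
  fixes e
  assumes ce: "(c, e) \<in> E" and eD: "e \<in> D" and de: "d \<noteq> e"
begin

lemma only: "x \<in> D \<Longrightarrow> (c, x) \<in> E \<Longrightarrow> x = d \<or> x = e"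
  using D_three[OF dD eD] cd ce de by blast

definition Nd :: "'a set" where "Nd = {v \<in> N2. (d, v) \<in> E}"
definition Ne :: "'a set" where "Ne = {v \<in> N2. (e, v) \<in> E}"

lemma N2_eq: "N2 = Nd \<union> Ne"
  using N2_parent only unfolding Nd_def Ne_def by blast

lemma D_eq: "v \<in> D \<longleftrightarrow> v = d \<or> v = e \<or> v \<in> N2"
  using only dD eD unfolding N2_def by blast

lemma D_split: "D = {d, e} \<union> (Nd \<union> Ne)"
  using D_eq N2_eq by auto

lemma Nd: "v \<in> Nd \<Longrightarrow> (d, v) \<in> E" "v \<in> Nd \<Longrightarrow> (v, d) \<in> E" "v \<in> Nd \<Longrightarrow> v \<in> N2"
  "v \<in> Nd \<Longrightarrow> v \<noteq> d" "v \<in> Nd \<Longrightarrow> v \<noteq> e" "v \<in> Nd \<Longrightarrow> v \<noteq> c"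
  unfolding Nd_def using symE ne N2_D D_V cd ce by blast+

lemma Ne: "v \<in> Ne \<Longrightarrow> (e, v) \<in> E" "v \<in> Ne \<Longrightarrow> (v, e) \<in> E" "v \<in> Ne \<Longrightarrow> v \<in> N2"
  "v \<in> Ne \<Longrightarrow> v \<noteq> d" "v \<in> Ne \<Longrightarrow> v \<noteq> e" "v \<in> Ne \<Longrightarrow> v \<noteq> c"
  unfolding Ne_def using symE ne N2_D D_V cd ce by blast+

lemma Nd_deg: "v \<in> Nd \<Longrightarrow> w \<in> Nd \<Longrightarrow> w' \<in> Nd \<Longrightarrow> (v, w) \<in> E \<Longrightarrow> (v, w') \<in> E \<Longrightarrow> w = w'"
  using no_diamond[of d v w w'] Nd(1) by blast

lemma Ne_deg: "v \<in> Ne \<Longrightarrow> w \<in> Ne \<Longrightarrow> w' \<in> Ne \<Longrightarrow> (v, w) \<in> E \<Longrightarrow> (v, w') \<in> E \<Longrightarrow> w = w'"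
  using no_diamond[of e v w w'] Ne(1) by blast

lemma cde: "c \<noteq> d" "c \<noteq> e" "d \<noteq> c" "e \<noteq> c" "(d, c) \<in> E" "(e, c) \<in> E"
  using ne cd ce symE by blast+

text \<open>
  If \<open>d\<close> and \<open>e\<close> are adjacent, the core is the triangle \<open>c\<close>, \<open>d\<close>, \<open>e\<close>. No edge joins what is attached at \<open>d\<close> to what is
  attached at \<open>e\<close>, as otherwise \<open>d\<close> would have three neighbours in one component of the graph without \<open>d\<close>.
\<close>

lemma shape_triangle:
  assumes adj: "(d, e) \<in> E" and dom: "\<And>u. u \<in> V \<Longrightarrow> \<exists>v\<in>V. \<not> near E 1 u v"
  shows "\<exists>cs A. shape V E (compl {1, 2, 3}) {1, 2, 3} cs A \<and> (A 1 \<noteq> {} \<and> A 2 \<noteq> {} \<or> A 1 \<noteq> {} \<and> A 3 \<noteq> {} \<or> A 2 \<noteq> {} \<and> A 3 \<noteq> {})"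
proof -
  define cs where "cs i = (if i = 1 then c else if i = 2 then d else e)" for i :: nat
  define A where "A i = (if i = 1 then A1 else if i = 2 then Nd else Ne)" for i :: nat
  have ed: "(e, d) \<in> E" using symE[OF adj] .
  have disj: "v \<notin> Ne" if "v \<in> Nd" for v
  proof
    assume "v \<in> Ne"
    then show False using no_diamond[of d e c v] adj cde Nd[OF that] Ne by blast
  qed
  have NdNe: "(v, w) \<notin> E" if "v \<in> Nd" "w \<in> Ne" for v w
  proof
    assume vw: "(v, w) \<in> E"
    have "conn d v w" using conn_edge[OF vw] Nd[OF that(1)] Ne[OF that(2)] by blast
    then have ve: "conn d v e" using conn_step Ne(2)[OF that(2)] de by blast
    then have "conn d v c" using conn_step cde by blast
    then show False using threeE[OF Nd(1)[OF that(1)] adj cde(5)] Nd[OF that(1)] cde ve by blast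
  qed
  have "inj_on cs {1, 2, 3}" using cde de by (auto simp: cs_def inj_on_def)
  moreover have V_eq: "V = {c, d, e} \<union> (A1 \<union> Nd \<union> Ne)"
    using V_split D_split by blast
  then have "V = cs ` {1, 2, 3} \<union> (\<Union>i\<in>{1, 2, 3}. A i)" by (auto simp: cs_def A_def)
  moreover have "\<forall>i\<in>{1, 2, 3}. \<forall>j\<in>{1, 2, 3}. cs j \<notin> A i"
    using A1_V dD eD Nd(4-6) Ne(4-6) by (simp add: cs_def A_def) blast
  moreover have "\<forall>i\<in>{1, 2, 3}. \<forall>j\<in>{1, 2, 3}. i < j \<longrightarrow> ((cs i, cs j) \<in> E \<longleftrightarrow> (i, j) \<in> compl {1, 2, 3})"
    using cd ce adj by (simp add: cs_def)
  moreover have "\<forall>i\<in>{1, 2, 3}. \<forall>j\<in>{1, 2, 3}. \<forall>v\<in>A j. (cs i, v) \<in> E \<longleftrightarrow> i = j"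
  proof -
    have "(c, v) \<notin> E" if "v \<in> Nd \<or> v \<in> Ne" for v using that N2_D(2) Nd(3) Ne(3) by blast
    moreover have "(d, v) \<notin> E" if "v \<in> Ne" for v using that disj Ne(3) unfolding Nd_def by blast
    moreover have "(e, v) \<notin> E" if "v \<in> Nd" for v using that disj Nd(3) unfolding Ne_def by blast
    ultimately show ?thesis
      using A1_c Nd(1) Ne(1) A1_D(2)[OF _ dD] A1_D(2)[OF _ eD] by (simp add: cs_def A_def)
  qed
  moreover have "\<forall>i\<in>{1, 2, 3}. \<forall>j\<in>{1, 2, 3}. i < j \<longrightarrow> (\<forall>v\<in>A i. \<forall>w\<in>A j. (v, w) \<notin> E)"
    using A1_D(1)[OF _ N2_D(1)] NdNe Nd(3) Ne(3) by (simp add: A_def)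
  moreover have "\<forall>i\<in>{1, 2, 3}. \<forall>v\<in>A i. \<forall>w\<in>A i. \<forall>w'\<in>A i. (v, w) \<in> E \<longrightarrow> (v, w') \<in> E \<longrightarrow> w = w'"
    using A1_deg Nd_deg Ne_deg unfolding A_def by simp
  ultimately have "shape V E (compl {1, 2, 3}) {1, 2, 3} cs A" unfolding shape_def by (intro conjI)
  moreover have "\<not> (A1 = {} \<and> Nd = {})" using dom[of e] V_eq cde ed Ne(1) eD D_V unfolding near_1 by blast
  moreover have "\<not> (A1 = {} \<and> Ne = {})" using dom[of d] V_eq cde adj Nd(1) dD D_V unfolding near_1 by blast
  moreover have "\<not> (Nd = {} \<and> Ne = {})" using w0_N2 N2_eq by blast
  ultimately show ?thesis by (intro exI[of _ cs] exI[of _ A]) (auto simp: A_def)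
qed

text \<open>
  If \<open>d\<close> and \<open>e\<close> are not adjacent and have a common neighbour \<open>f\<close> besides \<open>c\<close>, then \<open>c\<close>, \<open>d\<close>, \<open>f\<close>, \<open>e\<close> is a 4-cycle. In the
  graph without \<open>d\<close> it connects \<open>f\<close> and \<open>c\<close>, so no further neighbour of \<open>d\<close> reaches it.
\<close>

lemma common_child:
  assumes nadj: "(d, e) \<notin> E" and f: "f \<in> Nd" "f \<in> Ne"
  shows "v \<in> Nd \<Longrightarrow> v \<in> Ne \<Longrightarrow> v = f"
    and "v \<in> Nd - {f} \<Longrightarrow> w \<in> Ne \<Longrightarrow> (v, w) \<notin> E"
    and "v \<in> Nd - {f} \<Longrightarrow> (v, f) \<notin> E"
proof -
  have fe: "conn d f c"
    by (rule conn_step[OF conn_edge[OF Ne(2)[OF f(2)]] cde(6)]) (use Nd[OF f(1)] de cde in blast)+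
  show "v \<in> Nd \<Longrightarrow> v \<in> Ne \<Longrightarrow> v = f"
  proof (rule ccontr)
    assume v: "v \<in> Nd" "v \<in> Ne" "v \<noteq> f"
    have "conn d f v"
      by (rule conn_step[OF conn_edge[OF Ne(2)[OF f(2)]] Ne(1)[OF v(2)]]) (use Nd[OF f(1)] Nd[OF v(1)] de in blast)+
    then show False using threeE[OF Nd(1)[OF f(1)] Nd(1)[OF v(1)] cde(5)] fe v(3) Nd(6)[OF f(1)] Nd(6)[OF v(1)] by blast
  qed
  have aux: "(v, w) \<notin> E" if v: "v \<in> Nd - {f}" and w: "w \<in> Ne" for v w
  proof
    assume vw: "(v, w) \<in> E"
    have v': "v \<in> Nd" "v \<noteq> f" using v by auto
    have "conn d v w" using conn_edge[OF vw] Nd[OF v'(1)] Ne[OF w] by blast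
    then have "conn d v e" using conn_step Ne(2)[OF w] de by blast
    then have "conn d v f" "conn d v c" using conn_step Ne(1)[OF f(2)] cde Nd(4)[OF f(1)] by blast+
    then show False using threeE[OF Nd(1)[OF v'(1)] Nd(1)[OF f(1)] cde(5)] v'(2) Nd(6)[OF f(1)] Nd(6)[OF v'(1)] by blast
  qed
  then show "v \<in> Nd - {f} \<Longrightarrow> w \<in> Ne \<Longrightarrow> (v, w) \<notin> E" .
  show "v \<in> Nd - {f} \<Longrightarrow> (v, f) \<notin> E" using aux f(2) by blast
qed

text \<open>
  Here the cycle is \<open>c\<close>, \<open>d\<close>, \<open>f\<close>, \<open>g\<close>, \<open>e\<close>, and the argument for \<open>d\<close> is the same.
\<close>

lemma no_common_child:
  assumes nadj: "(d, e) \<notin> E" and disj: "Nd \<inter> Ne = {}"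
    and f: "f \<in> Nd" and g: "g \<in> Ne" and fg: "(f, g) \<in> E"
  shows "v \<in> Nd - {f} \<Longrightarrow> w \<in> Ne \<Longrightarrow> (v, w) \<notin> E"
    and "v \<in> Nd - {f} \<Longrightarrow> (v, f) \<notin> E"
proof -
  have "conn d f g" using conn_edge[OF fg] Nd(4)[OF f] Ne(4)[OF g] by blast
  then have fe: "conn d f e" using conn_step Ne(2)[OF g] de by blast
  then have fc: "conn d f c" using conn_step cde by blast
  show "v \<in> Nd - {f} \<Longrightarrow> (v, f) \<notin> E"
  proof
    assume v: "v \<in> Nd - {f}" "(v, f) \<in> E"
    then have "conn d f v" using conn_edge[OF symE[OF v(2)]] Nd(4)[OF f] Nd(4)[of v] by blast
    then show False using threeE[OF Nd(1)[OF f] Nd(1)[of v] cde(5)] fc v Nd(6)[OF f] Nd(6)[of v] by blast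
  qed
  show "v \<in> Nd - {f} \<Longrightarrow> w \<in> Ne \<Longrightarrow> (v, w) \<notin> E"
  proof
    assume v: "v \<in> Nd - {f}" and w: "w \<in> Ne" and vw: "(v, w) \<in> E"
    have "conn d f w" using conn_step[OF fe Ne(1)[OF w] Ne(4)[OF w]] .
    then have "conn d f v" using conn_step symE[OF vw] Nd(4)[of v] v by blast
    then show False using threeE[OF Nd(1)[OF f] Nd(1)[of v] cde(5)] fc v Nd(6)[OF f] Nd(6)[of v] by blast
  qed
qed

text \<open>
  The vertices \<open>d\<close> and \<open>e\<close> are connected in \<open>D\<close>. Without an edge between their neighbourhoods, everything reachable
  from \<open>d\<close> without \<open>c\<close> would stay in \<open>d\<close> and its neighbours.
\<close>

lemma exists_link:
  assumes nadj: "(d, e) \<notin> E" and disj: "Nd \<inter> Ne = {}"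
  shows "\<exists>f\<in>Nd. \<exists>g\<in>Ne. (f, g) \<in> E"
proof (rule ccontr)
  assume no: "\<not> (\<exists>f\<in>Nd. \<exists>g\<in>Ne. (f, g) \<in> E)"
  have "(d, e) \<in> rtrancl_on (V - {c}) E" using D_conn[OF dD eD] unfolding conn_def .
  then have "e = d \<or> e \<in> Nd"
  proof (induction rule: rtrancl_on_induct)
    case base then show ?case by simp
  next
    case (step y z)
    then have "y \<in> D" using dD Nd(3) N2_D(1) by blast
    then have "z \<in> D" using D_step step by blast
    then have z: "z = d \<or> z = e \<or> z \<in> Nd \<or> z \<in> Ne" using D_eq N2_eq by blast
    have "z \<noteq> e"
    proof
      assume "z = e"
      then show False using step nadj disj symE Nd(3) unfolding Ne_def by blast
    qed
    moreover have "z \<notin> Ne"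
    proof
      assume "z \<in> Ne"
      then show False using step no disj Ne(3) unfolding Nd_def by blast
    qed
    ultimately show ?case using z by blast
  qed
  then show False using de Nd(5) by blast
qed

text \<open>
  Vertices attached at \<open>d\<close> and at \<open>e\<close> outside the cycle would be 4 apart, against the bound 3 on distances. Here \<open>X\<close> and \<open>Y\<close>
  are the two sets of such vertices, so one of them is empty.
\<close>

lemma one_sided:
  assumes nadj: "(d, e) \<notin> E"
    and X: "X \<subseteq> Nd" "\<And>v w. v \<in> X \<Longrightarrow> w \<in> Ne \<Longrightarrow> (v, w) \<notin> E"
      "\<And>v w. v \<in> X \<Longrightarrow> (v, w) \<in> E \<Longrightarrow> w \<in> Nd \<Longrightarrow> w \<in> X" "X \<inter> Ne = {}"
    and Y: "Y \<subseteq> Ne" "\<And>v w. v \<in> Y \<Longrightarrow> w \<in> Nd \<Longrightarrow> (v, w) \<notin> E"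
      "\<And>v w. v \<in> Y \<Longrightarrow> (v, w) \<in> E \<Longrightarrow> w \<in> Ne \<Longrightarrow> w \<in> Y" "Y \<inter> Nd = {}"
  shows "X = {} \<or> Y = {}"
proof (rule ccontr)
  assume "\<not> (X = {} \<or> Y = {})"
  then obtain v w where v: "v \<in> X" and w: "w \<in> Y" by blast
  have nv: "a = d \<or> a \<in> X" if "x \<in> X" "(x, a) \<in> E" for x a
  proof -
    have x: "x \<in> Nd" using X(1) that by blast
    have "a \<noteq> c" using that(2) N2_D(3)[OF Nd(3)[OF x]] by blast
    then have "a \<in> D" using D_step[OF N2_D(1)[OF Nd(3)[OF x]] that(2)] by blast
    moreover have "a \<noteq> e" using that symE X(4) Nd(3)[OF x] unfolding Ne_def by blast
    ultimately show ?thesis using D_eq N2_eq X(2,3) that by blast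
  qed
  have nw: "a = e \<or> a \<in> Y" if "x \<in> Y" "(x, a) \<in> E" for x a
  proof -
    have x: "x \<in> Ne" using Y(1) that by blast
    have "a \<noteq> c" using that(2) N2_D(3)[OF Ne(3)[OF x]] by blast
    then have "a \<in> D" using D_step[OF N2_D(1)[OF Ne(3)[OF x]] that(2)] by blast
    moreover have "a \<noteq> d" using that symE Y(4) Ne(3)[OF x] unfolding Nd_def by blast
    ultimately show ?thesis using D_eq N2_eq Y(2,3) that by blast
  qed
  have XY: "x \<noteq> y" "(x, y) \<notin> E" if "x = d \<or> x \<in> X" "y = e \<or> y \<in> Y" for x y
  proof -
    show "x \<noteq> y" using that de X(1,4) Y(1) Nd(5) Ne(4) by blast
    show "(x, y) \<notin> E"
    proof
      assume xy: "(x, y) \<in> E"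
      from that(1) show False
      proof
        assume "x = d"
        then show False using that(2) xy nadj nw[of y d] symE de Y(1) Ne(4) by blast
      next
        assume "x \<in> X"
        then have "y = d \<or> y \<in> X" using nv xy by blast
        then show False using that(2) de X(1,4) Y(1) Nd(5) Ne(4) by blast
      qed
    qed
  qed
  have "v \<in> V" "w \<in> V" using v w X(1) Y(1) Nd(3) Ne(3) N2_D(1) D_V(1) by blast+
  from near3[OF this] consider "v = w" | "(v, w) \<in> E" | a where "(v, a) \<in> E" "(a, w) \<in> E"
    | a b where "(v, a) \<in> E" "(a, b) \<in> E" "(b, w) \<in> E"
    unfolding near_3 near_2 by blast
  then show False
  proof cases
    case 1 then show ?thesis using XY(1) v w by blast
  next
    case 2 then show ?thesis using XY(2) v w by blast
  next
    case 3 then show ?thesis using XY(2)[of a w] nv[OF v] w by blast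
  next
    case 4 then show ?thesis using XY(2)[of a b] nv[OF v 4(1)] nw[OF w symE[OF 4(3)]] by blast
  qed
qed

lemma shape_cyc4:
  assumes nadj: "(d, e) \<notin> E" and f: "f \<in> Nd" and Ne_f: "Ne = {f}"
  shows "\<exists>cs A. shape V E cyc4 {1, 2, 3, 4} cs A \<and> A 3 = {} \<and> A 4 = {}"
proof -
  have fNe: "f \<in> Ne" using Ne_f by simp
  note cc = common_child[OF nadj f fNe]
  define cs where "cs i = (if i = 1 then c else if i = 2 then d else if i = 3 then f else e)" for i :: nat
  define A where "A i = (if i = 1 then A1 else if i = 2 then Nd - {f} else {})" for i :: nat
  note nf = Nd[OF f] and ef = Ne(1,2)[OF fNe]
  have "inj_on cs {1, 2, 3, 4}" using cde de nf by (auto simp: cs_def inj_on_def)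
  moreover have V_eq: "V = {c, d, f, e} \<union> (A1 \<union> (Nd - {f}))"
    using V_split D_split Ne_f f by blast
  then have "V = cs ` {1, 2, 3, 4} \<union> (\<Union>i\<in>{1, 2, 3, 4}. A i)" by (auto simp: cs_def A_def)
  moreover have "\<forall>i\<in>{1, 2, 3, 4}. \<forall>j\<in>{1, 2, 3, 4}. cs j \<notin> A i"
    using A1_V dD eD Nd(4-6) N2_D(1)[OF nf(3)] by (simp add: cs_def A_def) blast
  moreover have "\<forall>i\<in>{1, 2, 3, 4}. \<forall>j\<in>{1, 2, 3, 4}. i < j \<longrightarrow> ((cs i, cs j) \<in> E \<longleftrightarrow> (i, j) \<in> cyc4)"
    using cd ce nadj nf(1) ef N2_D(2)[OF nf(3)] by (simp add: cs_def cyc4_def)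
  moreover have "\<forall>i\<in>{1, 2, 3, 4}. \<forall>j\<in>{1, 2, 3, 4}. \<forall>v\<in>A j. (cs i, v) \<in> E \<longleftrightarrow> i = j"
  proof -
    have "(c, v) \<notin> E" if "v \<in> Nd" for v using that N2_D(2) Nd(3) by blast
    moreover have "(f, v) \<notin> E" if "v \<in> Nd - {f}" for v using cc(3)[OF that] symE by blast
    moreover have "(e, v) \<notin> E" if "v \<in> Nd - {f}" for v using that cc(1)[of v] Nd(3) unfolding Ne_def by blast
    ultimately show ?thesis
      using A1_c Nd(1) A1_D(2)[OF _ dD] A1_D(2)[OF _ eD] A1_D(2)[OF _ N2_D(1)[OF nf(3)]] by (simp add: cs_def A_def)
  qed
  moreover have "\<forall>i\<in>{1, 2, 3, 4}. \<forall>j\<in>{1, 2, 3, 4}. i < j \<longrightarrow> (\<forall>v\<in>A i. \<forall>w\<in>A j. (v, w) \<notin> E)"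
    using A1_D(1)[OF _ N2_D(1)] Nd(3) by (simp add: A_def)
  moreover have "\<forall>i\<in>{1, 2, 3, 4}. \<forall>v\<in>A i. \<forall>w\<in>A i. \<forall>w'\<in>A i. (v, w) \<in> E \<longrightarrow> (v, w') \<in> E \<longrightarrow> w = w'"
  proof (intro ballI impI)
    fix i v w w' assume *: "v \<in> A i" "w \<in> A i" "w' \<in> A i" "(v, w) \<in> E" "(v, w') \<in> E"
    consider "i = 1" | "i = 2" | "i \<noteq> 1" "i \<noteq> 2" by blast
    then show "w = w'"
    proof cases
      case 1 then show ?thesis using A1_deg[OF _ _ _ *(4,5)] *(1-3) by (simp add: A_def)
    next
      case 2 then show ?thesis using Nd_deg[OF _ _ _ *(4,5)] *(1-3) by (simp add: A_def)
    next
      case 3 then show ?thesis using *(1) by (simp add: A_def)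
    qed
  qed
  ultimately have "shape V E cyc4 {1, 2, 3, 4} cs A" unfolding shape_def by (intro conjI)
  then show ?thesis by (intro exI[of _ cs] exI[of _ A]) (auto simp: A_def)
qed

text \<open>
  The hypothesis on distance 2 excludes the bare 5-cycle.
\<close>

lemma shape_cyc5:
  assumes nadj: "(d, e) \<notin> E" and f: "f \<in> Nd" and Ne_g: "Ne = {g}" and disj: "Nd \<inter> Ne = {}" and fg: "(f, g) \<in> E"
    and far: "\<exists>v\<in>V. \<exists>w\<in>V. \<not> near E 2 v w"
  shows "\<exists>cs A. shape V E cyc5 {1, 2, 3, 4, 5} cs A \<and> A 3 = {} \<and> A 4 = {} \<and> A 5 = {} \<and> (A 1 \<noteq> {} \<or> A 2 \<noteq> {})"
proof -
  have g: "g \<in> Ne" using Ne_g by simp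
  note cc = no_common_child[OF nadj disj f g fg]
  define cs where "cs i = (if i = 1 then c else if i = 2 then d else if i = 3 then f else if i = 4 then g else e)" for i :: nat
  define A where "A i = (if i = 1 then A1 else if i = 2 then Nd - {f} else {})" for i :: nat
  note nf = Nd[OF f] and ng = Ne[OF g]
  have ef: "(e, f) \<notin> E" "f \<notin> Ne" using f disj nf(3) unfolding Ne_def by blast+
  have dg: "(d, g) \<notin> E" "g \<notin> Nd" using g disj ng(3) unfolding Nd_def by blast+
  have "f \<noteq> g" using ne[OF fg] .
  then have "inj_on cs {1, 2, 3, 4, 5}" using cde de nf ng by (auto simp: cs_def inj_on_def)
  moreover have V_eq: "V = {c, d, f, g, e} \<union> (A1 \<union> (Nd - {f}))"
    using V_split D_split Ne_g f by blast
  then have "V = cs ` {1, 2, 3, 4, 5} \<union> (\<Union>i\<in>{1, 2, 3, 4, 5}. A i)" by (auto simp: cs_def A_def)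
  moreover have "\<forall>i\<in>{1, 2, 3, 4, 5}. \<forall>j\<in>{1, 2, 3, 4, 5}. cs j \<notin> A i"
    using A1_V dD eD Nd(4-6) N2_D(1)[OF nf(3)] N2_D(1)[OF ng(3)] dg(2) by (simp add: cs_def A_def) blast
  moreover have "\<forall>i\<in>{1, 2, 3, 4, 5}. \<forall>j\<in>{1, 2, 3, 4, 5}. i < j \<longrightarrow> ((cs i, cs j) \<in> E \<longleftrightarrow> (i, j) \<in> cyc5)"
    using cd ce nadj nf(1) ng(2) N2_D(2)[OF nf(3)] N2_D(2)[OF ng(3)] fg dg(1) ef(1) symE[of f e] by (auto simp: cs_def cyc5_def)
  moreover have "\<forall>i\<in>{1, 2, 3, 4, 5}. \<forall>j\<in>{1, 2, 3, 4, 5}. \<forall>v\<in>A j. (cs i, v) \<in> E \<longleftrightarrow> i = j"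
  proof -
    have "(c, v) \<notin> E" if "v \<in> Nd" for v using that N2_D(2) Nd(3) by blast
    moreover have "(f, v) \<notin> E" if "v \<in> Nd - {f}" for v using cc(2)[OF that] symE by blast
    moreover have "(g, v) \<notin> E" if "v \<in> Nd - {f}" for v using cc(1)[OF that g] symE by blast
    moreover have "(e, v) \<notin> E" if "v \<in> Nd - {f}" for v using that disj Nd(3) unfolding Ne_def by blast
    ultimately show ?thesis
      using A1_c Nd(1) A1_D(2)[OF _ dD] A1_D(2)[OF _ eD] A1_D(2)[OF _ N2_D(1)[OF nf(3)]]
        A1_D(2)[OF _ N2_D(1)[OF ng(3)]] by (simp add: cs_def A_def)
  qed
  moreover have "\<forall>i\<in>{1, 2, 3, 4, 5}. \<forall>j\<in>{1, 2, 3, 4, 5}. i < j \<longrightarrow> (\<forall>v\<in>A i. \<forall>w\<in>A j. (v, w) \<notin> E)"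
    using A1_D(1)[OF _ N2_D(1)] Nd(3) by (simp add: A_def)
  moreover have "\<forall>i\<in>{1, 2, 3, 4, 5}. \<forall>v\<in>A i. \<forall>w\<in>A i. \<forall>w'\<in>A i. (v, w) \<in> E \<longrightarrow> (v, w') \<in> E \<longrightarrow> w = w'"
  proof (intro ballI impI)
    fix i v w w' assume *: "v \<in> A i" "w \<in> A i" "w' \<in> A i" "(v, w) \<in> E" "(v, w') \<in> E"
    consider "i = 1" | "i = 2" | "i \<noteq> 1" "i \<noteq> 2" by blast
    then show "w = w'"
    proof cases
      case 1 then show ?thesis using A1_deg[OF _ _ _ *(4,5)] *(1-3) by (simp add: A_def)
    next
      case 2 then show ?thesis using Nd_deg[OF _ _ _ *(4,5)] *(1-3) by (simp add: A_def)
    next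
      case 3 then show ?thesis using *(1) by (simp add: A_def)
    qed
  qed
  ultimately have "shape V E cyc5 {1, 2, 3, 4, 5} cs A" unfolding shape_def by (intro conjI)
  moreover have "A1 \<noteq> {} \<or> Nd - {f} \<noteq> {}"
  proof (rule ccontr)
    assume "\<not> (A1 \<noteq> {} \<or> Nd - {f} \<noteq> {})"
    then have "V = {c, d, f, g, e}" using V_eq by blast
    moreover have "(g, f) \<in> E" using symE[OF fg] .
    ultimately have "near E 2 v w" if "v \<in> V" "w \<in> V" for v w
    proof -
      have v: "v = c \<or> v = d \<or> v = f \<or> v = g \<or> v = e" and w: "w = c \<or> w = d \<or> w = f \<or> w = g \<or> w = e"
        using that \<open>V = {c, d, f, g, e}\<close> by simp_all
      have n1: "near E 2 a b" if "(a, b) \<in> E" for a b using that unfolding near_2 by blast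
      have n2: "near E 2 a b" if "(a, x) \<in> E" "(x, b) \<in> E" for a b x using that unfolding near_2 by blast
      from v w show ?thesis
        using n1[OF cd] n1[OF ce] n1[OF cde(5)] n1[OF cde(6)] n1[OF nf(1)] n1[OF nf(2)] n1[OF ng(1)] n1[OF ng(2)]
          n1[OF fg] n1[OF \<open>(g, f) \<in> E\<close>] n2[OF cd nf(1)] n2[OF ce ng(1)] n2[OF cde(5) ce] n2[OF nf(1) fg]
          n2[OF nf(2) cde(5)] n2[OF fg ng(2)] n2[OF \<open>(g, f) \<in> E\<close> nf(2)] n2[OF ng(2) cde(6)]
          n2[OF cde(6) cd] n2[OF ng(1) \<open>(g, f) \<in> E\<close>] near_refl[of E 2]
        by (elim disjE) simp_all
    qed
    then show False using far by blast
  qed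
  ultimately show ?thesis by (intro exI[of _ cs] exI[of _ A]) (auto simp: A_def)
qed

end

context two_branches
begin

text \<open>
  The locale is symmetric in \<open>d\<close> and \<open>e\<close>, with a neighbour of \<open>e\<close> in place of \<open>w0\<close>. By \<open>one_sided\<close> it may be assumed that
  nothing is attached at \<open>e\<close>.
\<close>

lemma shape_cycle:
  assumes nadj: "(d, e) \<notin> E" and far: "\<exists>v\<in>V. \<exists>w\<in>V. \<not> near E 2 v w"
  shows "(\<exists>cs A. shape V E cyc4 {1, 2, 3, 4} cs A \<and> A 3 = {} \<and> A 4 = {})
    \<or> (\<exists>cs A. shape V E cyc5 {1, 2, 3, 4, 5} cs A \<and> A 3 = {} \<and> A 4 = {} \<and> A 5 = {} \<and> (A 1 \<noteq> {} \<or> A 2 \<noteq> {}))"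
proof -
  have swap: "two_branches V E c e w D d" if w: "w \<in> Ne" for w
  proof unfold_locales
    have "conn c w0 w" using N2_D(1)[OF Ne(3)[OF w]] unfolding D_def by simp
    then show "D = {v. conn c w v}" unfolding D_def using conn_trans conn_sym by (intro Collect_cong) metis
    show "w \<noteq> c" by (rule Ne(6)[OF w])
    show "(c, w) \<notin> E" by (rule N2_D(2)[OF Ne(3)[OF w]])
    show "(e, w) \<in> E" by (rule Ne(1)[OF w])
  qed (use ce cd dD de in auto)
  have nadj': "(e, d) \<notin> E" using nadj symE by blast
  show ?thesis
  proof (cases "Nd \<inter> Ne = {}")
    case False
    then obtain f where f: "f \<in> Nd" "f \<in> Ne" by blast
    interpret sw: two_branches V E c e f D d by (rule swap[OF f(2)])
    have sw: "sw.Nd = Ne" "sw.Ne = Nd"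
      unfolding sw.Nd_def sw.Ne_def Nd_def Ne_def by simp_all
    note cc = common_child[OF nadj f]
    note cc' = sw.common_child[OF nadj', unfolded sw, OF f(2,1)]
    have "Nd - {f} = {} \<or> Ne - {f} = {}"
    proof (rule one_sided[OF nadj])
      show "(v, w) \<notin> E" if "v \<in> Nd - {f}" "w \<in> Ne" for v w by (rule cc(2)[OF that])
      show "(v, w) \<notin> E" if "v \<in> Ne - {f}" "w \<in> Nd" for v w by (rule cc'(2)[OF that])
      show "w \<in> Nd - {f}" if "v \<in> Nd - {f}" "(v, w) \<in> E" "w \<in> Nd" for v w
        using cc(3)[OF that(1)] that(2,3) by auto
      show "w \<in> Ne - {f}" if "v \<in> Ne - {f}" "(v, w) \<in> E" "w \<in> Ne" for v w
        using cc'(3)[OF that(1)] that(2,3) by auto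
      show "(Nd - {f}) \<inter> Ne = {}" "(Ne - {f}) \<inter> Nd = {}" using cc(1) by auto
    qed auto
    then have "Nd = {f} \<or> Ne = {f}" using f by auto
    then show ?thesis
    proof
      assume "Ne = {f}" then show ?thesis using shape_cyc4[OF nadj f(1)] by simp
    next
      assume "Nd = {f}" then show ?thesis using sw.shape_cyc4[OF nadj', unfolded sw, OF f(2)] by simp
    qed
  next
    case True
    then have disj': "Ne \<inter> Nd = {}" by auto
    obtain f g where f: "f \<in> Nd" and g: "g \<in> Ne" and fg: "(f, g) \<in> E" using exists_link[OF nadj True] by blast
    have gf: "(g, f) \<in> E" by (rule symE[OF fg])
    interpret sw: two_branches V E c e g D d by (rule swap[OF g])
    have sw: "sw.Nd = Ne" "sw.Ne = Nd"
      unfolding sw.Nd_def sw.Ne_def Nd_def Ne_def by simp_all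
    note cc = no_common_child[OF nadj True f g fg]
    note cc' = sw.no_common_child[OF nadj', unfolded sw, OF disj' g f gf]
    have "Nd - {f} = {} \<or> Ne - {g} = {}"
    proof (rule one_sided[OF nadj])
      show "(v, w) \<notin> E" if "v \<in> Nd - {f}" "w \<in> Ne" for v w by (rule cc(1)[OF that])
      show "(v, w) \<notin> E" if "v \<in> Ne - {g}" "w \<in> Nd" for v w by (rule cc'(1)[OF that])
      show "w \<in> Nd - {f}" if "v \<in> Nd - {f}" "(v, w) \<in> E" "w \<in> Nd" for v w
        using cc(2)[OF that(1)] that(2,3) by auto
      show "w \<in> Ne - {g}" if "v \<in> Ne - {g}" "(v, w) \<in> E" "w \<in> Ne" for v w
        using cc'(2)[OF that(1)] that(2,3) by auto
      show "(Nd - {f}) \<inter> Ne = {}" "(Ne - {g}) \<inter> Nd = {}" using True by auto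
    qed auto
    then have "Nd = {f} \<or> Ne = {g}" using f g by auto
    then show ?thesis
    proof
      assume "Ne = {g}" then show ?thesis using shape_cyc5[OF nadj f _ True fg far] by simp
    next
      assume "Nd = {f}" then show ?thesis using sw.shape_cyc5[OF nadj', unfolded sw, OF g _ disj' gf far] by simp
    qed
  qed
qed

end

lemma (in center) shapes:
  assumes dom: "\<And>u. u \<in> V \<Longrightarrow> \<exists>v\<in>V. \<not> near E 1 u v" and far: "\<exists>v\<in>V. \<exists>w\<in>V. \<not> near E 2 v w"
  obtains cs A where "shape V E (compl {1, 2}) {1, 2} cs A" "A 1 \<noteq> {}" "A 2 \<noteq> {}"
  | cs A where "shape V E (compl {1, 2, 3}) {1, 2, 3} cs A"
      "A 1 \<noteq> {} \<and> A 2 \<noteq> {} \<or> A 1 \<noteq> {} \<and> A 3 \<noteq> {} \<or> A 2 \<noteq> {} \<and> A 3 \<noteq> {}"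
  | cs A where "shape V E cyc4 {1, 2, 3, 4} cs A" "A 3 = {}" "A 4 = {}"
  | cs A where "shape V E cyc5 {1, 2, 3, 4, 5} cs A" "A 3 = {}" "A 4 = {}" "A 5 = {}" "A 1 \<noteq> {} \<or> A 2 \<noteq> {}"
proof -
  \<comment> \<open>As no vertex is adjacent to all others, there are vertices at distance 2 from the centre.\<close>
  obtain w0 where w0: "w0 \<in> V" "w0 \<noteq> c" "(c, w0) \<notin> E" using dom[OF cV] unfolding near_1 by blast
  then obtain d where d: "(c, d) \<in> E" "(d, w0) \<in> E" using near2[OF w0(1)] unfolding near_2 by blast
  define D where "D = {v. conn c w0 v}"
  interpret b: branch V E c d w0 D by unfold_locales (use w0 d D_def in auto)
  show ?thesis
  proof (cases "\<exists>e\<in>D. (c, e) \<in> E \<and> e \<noteq> d")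
    case False
    then show ?thesis using b.shape_two[OF _ dom[OF inV(2)[OF d(1)]]] that(1) by blast
  next
    case True
    then obtain e where e: "e \<in> D" "(c, e) \<in> E" "d \<noteq> e" by blast
    interpret t: two_branches V E c d w0 D e by unfold_locales (use e in auto)
    show ?thesis
    proof (cases "(d, e) \<in> E")
      case True
      then show ?thesis using t.shape_triangle[OF True dom] that(2) by blast
    next
      case False
      then show ?thesis using t.shape_cycle[OF False far] that(3,4) by blast
    qed
  qed
qed

section \<open>From a decomposition to leaf and triangle counts\<close>

text \<open>
  The functions \<open>l\<close>, \<open>u\<close> and \<open>t\<close> enumerate the leaves and the two sides of a matching.
\<close>

definition enumerated :: "('a \<times> 'a) set \<Rightarrow> 'a set \<Rightarrow> nat \<Rightarrow> nat \<Rightarrow> (nat \<Rightarrow> 'a) \<Rightarrow> (nat \<Rightarrow> 'a) \<Rightarrow> (nat \<Rightarrow> 'a) \<Rightarrow> bool" where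
  "enumerated E A k m l u t \<longleftrightarrow> inj_on l {1..k} \<and> inj_on u {1..m} \<and> inj_on t {1..m}
    \<and> l ` {1..k} \<inter> u ` {1..m} = {} \<and> l ` {1..k} \<inter> t ` {1..m} = {} \<and> u ` {1..m} \<inter> t ` {1..m} = {}
    \<and> A = l ` {1..k} \<union> u ` {1..m} \<union> t ` {1..m}
    \<and> (\<forall>a\<in>A. \<forall>b\<in>A. (a, b) \<in> E \<longleftrightarrow> (\<exists>j\<in>{1..m}. a = u j \<and> b = t j \<or> a = t j \<and> b = u j))"

lemma enumeratedD:
  assumes "enumerated E A k m l u t"
  shows "inj_on l {1..k}" "inj_on u {1..m}" "inj_on t {1..m}"
    "l ` {1..k} \<inter> u ` {1..m} = {}" "l ` {1..k} \<inter> t ` {1..m} = {}" "u ` {1..m} \<inter> t ` {1..m} = {}"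
    "A = l ` {1..k} \<union> u ` {1..m} \<union> t ` {1..m}"
    "\<forall>a\<in>A. \<forall>b\<in>A. (a, b) \<in> E \<longleftrightarrow> (\<exists>j\<in>{1..m}. a = u j \<and> b = t j \<or> a = t j \<and> b = u j)"
  using assms unfolding enumerated_def by - (elim conjE, assumption)+

text \<open>
  Induction by removing an isolated vertex or an edge of the matching.
\<close>

lemma enumerate_matching:
  assumes "finite A" "sym E" "\<And>v. (v, v) \<notin> E"
    and "\<And>v w w'. v \<in> A \<Longrightarrow> w \<in> A \<Longrightarrow> w' \<in> A \<Longrightarrow> (v, w) \<in> E \<Longrightarrow> (v, w') \<in> E \<Longrightarrow> w = w'"
  shows "\<exists>k m l u t. enumerated E A k m l u t"
  using assms(1,4)
proof (induction A rule: finite_psubset_induct)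
  case (psubset A)
  have symE: "(b, a) \<in> E" if "(a, b) \<in> E" for a b using assms(2) that by (rule symD)
  have suc: "{1..Suc n} = insert (Suc n) {1..n}" for n by auto
  show ?case
  proof (cases "A = {}")
    case True
    have "enumerated E A 0 0 l u t" for l u t unfolding enumerated_def True by simp
    then show ?thesis by blast
  next
    case False
    then obtain x where x: "x \<in> A" by blast
    show ?thesis
    proof (cases "\<exists>y\<in>A. (x, y) \<in> E")
      case False
      let ?A = "A - {x}"
      have "?A \<subset> A" using x by blast
      then have "\<exists>k m l u t. enumerated E ?A k m l u t"
        using psubset.prems by (intro psubset.IH) blast+
      then obtain k m l u t where "enumerated E ?A k m l u t" by (elim exE)
      note IH = enumeratedD[OF this]
      define l' where "l' = l(Suc k := x)"
      have l'k: "l' ` {1..k} = l ` {1..k}" unfolding l'_def by (rule image_cong) auto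
      have l'S: "l' ` {1..Suc k} = insert x (l ` {1..k})"
        unfolding suc image_insert l'k by (simp add: l'_def)
      have xn: "x \<notin> l ` {1..k}" "x \<notin> u ` {1..m}" "x \<notin> t ` {1..m}" using IH(7) by blast+
      have "inj_on l' {1..Suc k}"
      proof (rule inj_onI)
        fix a b assume ab: "a \<in> {1..Suc k}" "b \<in> {1..Suc k}" "l' a = l' b"
        show "a = b"
        proof (cases "a = Suc k \<or> b = Suc k")
          case True
          then show ?thesis using ab xn(1) unfolding l'_def by (auto split: if_splits)
        next
          case False
          then show ?thesis using ab inj_onD[OF IH(1), of a b] unfolding l'_def by auto
        qed
      qed
      moreover have "l' ` {1..Suc k} \<inter> u ` {1..m} = {}" "l' ` {1..Suc k} \<inter> t ` {1..m} = {}"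
        unfolding l'S using xn IH(4,5) by simp_all
      moreover have "A = l' ` {1..Suc k} \<union> u ` {1..m} \<union> t ` {1..m}"
        unfolding l'S using IH(7) x by blast
      moreover have "\<forall>a\<in>A. \<forall>b\<in>A. (a, b) \<in> E \<longleftrightarrow> (\<exists>j\<in>{1..m}. a = u j \<and> b = t j \<or> a = t j \<and> b = u j)"
      proof (intro ballI)
        fix a b assume ab: "a \<in> A" "b \<in> A"
        show "(a, b) \<in> E \<longleftrightarrow> (\<exists>j\<in>{1..m}. a = u j \<and> b = t j \<or> a = t j \<and> b = u j)"
        proof (cases "a = x \<or> b = x")
          case True
          then have "(a, b) \<notin> E" using False symE ab by blast
          then show ?thesis using True xn by blast
        next
          case False
          then show ?thesis using IH(8) ab by blast
        qed
      qed
      ultimately have "enumerated E A (Suc k) m l' u t"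
        unfolding enumerated_def using IH(2,3,6) by (intro conjI)
      then show ?thesis by blast
    next
      case True
      then obtain y where y: "y \<in> A" "(x, y) \<in> E" by blast
      have xy: "x \<noteq> y" using y(2) assms(3) by blast
      let ?A = "A - {x, y}"
      have "?A \<subset> A" using x by blast
      then have "\<exists>k m l u t. enumerated E ?A k m l u t"
        using psubset.prems by (intro psubset.IH) blast+
      then obtain k m l u t where "enumerated E ?A k m l u t" by (elim exE)
      note IH = enumeratedD[OF this]
      define u' t' where "u' = u(Suc m := x)" and "t' = t(Suc m := y)"
      have "u' ` {1..m} = u ` {1..m}" "t' ` {1..m} = t ` {1..m}" unfolding u'_def t'_def by (rule image_cong; auto)+
      note um = this
      have S: "u' ` {1..Suc m} = insert x (u ` {1..m})" "t' ` {1..Suc m} = insert y (t ` {1..m})"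
        unfolding suc image_insert um by (simp_all add: u'_def t'_def)
      have xn: "x \<notin> l ` {1..k}" "x \<notin> u ` {1..m}" "x \<notin> t ` {1..m}" and yn: "y \<notin> l ` {1..k}" "y \<notin> u ` {1..m}"
        "y \<notin> t ` {1..m}"
        using IH(7) by blast+
      have "inj_on u' {1..Suc m}"
      proof (rule inj_onI)
        fix a b assume ab: "a \<in> {1..Suc m}" "b \<in> {1..Suc m}" "u' a = u' b"
        show "a = b"
        proof (cases "a = Suc m \<or> b = Suc m")
          case True
          then show ?thesis using ab xn(2) unfolding u'_def by (auto split: if_splits)
        next
          case False
          then show ?thesis using ab inj_onD[OF IH(2), of a b] unfolding u'_def by auto
        qed
      qed
      moreover have "inj_on t' {1..Suc m}"
      proof (rule inj_onI)
        fix a b assume ab: "a \<in> {1..Suc m}" "b \<in> {1..Suc m}" "t' a = t' b"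
        show "a = b"
        proof (cases "a = Suc m \<or> b = Suc m")
          case True
          then show ?thesis using ab yn(3) unfolding t'_def by (auto split: if_splits)
        next
          case False
          then show ?thesis using ab inj_onD[OF IH(3), of a b] unfolding t'_def by auto
        qed
      qed
      moreover have "l ` {1..k} \<inter> u' ` {1..Suc m} = {}" "l ` {1..k} \<inter> t' ` {1..Suc m} = {}"
        "u' ` {1..Suc m} \<inter> t' ` {1..Suc m} = {}"
        unfolding S using xn yn xy IH(4-6) by simp_all
      moreover have "A = l ` {1..k} \<union> u' ` {1..Suc m} \<union> t' ` {1..Suc m}"
        unfolding S using IH(7) x y(1) by blast
      moreover have "\<forall>a\<in>A. \<forall>b\<in>A. (a, b) \<in> E \<longleftrightarrow> (\<exists>j\<in>{1..Suc m}. a = u' j \<and> b = t' j \<or> a = t' j \<and> b = u' j)"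
      proof (intro ballI)
        fix a b assume ab: "a \<in> A" "b \<in> A"
        have split: "(\<exists>j\<in>{1..Suc m}. a = u' j \<and> b = t' j \<or> a = t' j \<and> b = u' j) \<longleftrightarrow>
          (a = x \<and> b = y \<or> a = y \<and> b = x) \<or> (\<exists>j\<in>{1..m}. a = u j \<and> b = t j \<or> a = t j \<and> b = u j)"
          unfolding suc by (auto simp: u'_def t'_def)
        have px: "b = y" if "(x, b) \<in> E" using psubset.prems[OF x ab(2) y(1) that y(2)] .
        have py: "b = x" if "(y, b) \<in> E" using psubset.prems[OF y(1) ab(2) x that symE[OF y(2)]] .
        have qx: "a = y" if "(a, x) \<in> E" using psubset.prems[OF x ab(1) y(1) symE[OF that] y(2)] .
        have qy: "a = x" if "(a, y) \<in> E" using psubset.prems[OF y(1) ab(1) x symE[OF that] symE[OF y(2)]] .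
        show "(a, b) \<in> E \<longleftrightarrow> (\<exists>j\<in>{1..Suc m}. a = u' j \<and> b = t' j \<or> a = t' j \<and> b = u' j)"
        proof (cases "a \<in> {x, y} \<or> b \<in> {x, y}")
          case True
          then have "\<not> (\<exists>j\<in>{1..m}. a = u j \<and> b = t j \<or> a = t j \<and> b = u j)" using xn yn by blast
          moreover have "(a, b) \<in> E \<longleftrightarrow> (a = x \<and> b = y \<or> a = y \<and> b = x)"
            using True px py qx qy y(2) symE[OF y(2)] by blast
          ultimately show ?thesis unfolding split by blast
        next
          case False
          then show ?thesis unfolding split using IH(8) ab by blast
        qed
      qed
      ultimately have "enumerated E A k (Suc m) l u' t'"
        unfolding enumerated_def using IH(1) by (intro conjI)
      then show ?thesis by blast
    qed
  qed
qed

text \<open>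
  The enumerations of the sets \<open>A i\<close> are glued to an isomorphism from the model with these numbers of leaves and
  triangles.
\<close>

lemma shape_iso:
  assumes sh: "shape V E B C cs A" and C: "finite V" "sym E" "\<And>v. (v, v) \<notin> E" "sym B" "\<And>i. (i, i) \<notin> B"
    "E \<subseteq> V \<times> V"
  shows "\<exists>k m f. (\<forall>i. i \<notin> C \<longrightarrow> k i = 0 \<and> m i = 0) \<and> (\<forall>i\<in>C. A i = {} \<longleftrightarrow> k i = 0 \<and> m i = 0)
    \<and> inj_on f (attV C k m) \<and> V = f ` attV C k m \<and> E = map_prod f f ` attE B C k m"
proof -
  have symE: "(b, a) \<in> E" if "(a, b) \<in> E" for a b using C(2) that by (rule symD)
  have sh1: "inj_on cs C" and sh2: "V = cs ` C \<union> (\<Union>i\<in>C. A i)"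
    and sh3: "\<And>i j. i \<in> C \<Longrightarrow> j \<in> C \<Longrightarrow> cs j \<notin> A i"
    and sh4: "\<And>i j. i \<in> C \<Longrightarrow> j \<in> C \<Longrightarrow> i < j \<Longrightarrow> (cs i, cs j) \<in> E \<longleftrightarrow> (i, j) \<in> B"
    and sh5: "\<And>i j v. i \<in> C \<Longrightarrow> j \<in> C \<Longrightarrow> v \<in> A j \<Longrightarrow> (cs i, v) \<in> E \<longleftrightarrow> i = j"
    and sh6: "\<And>i j v w. i \<in> C \<Longrightarrow> j \<in> C \<Longrightarrow> i < j \<Longrightarrow> v \<in> A i \<Longrightarrow> w \<in> A j \<Longrightarrow> (v, w) \<notin> E"
    and sh7: "\<And>i v w w'. i \<in> C \<Longrightarrow> v \<in> A i \<Longrightarrow> w \<in> A i \<Longrightarrow> w' \<in> A i \<Longrightarrow> (v, w) \<in> E \<Longrightarrow> (v, w') \<in> E \<Longrightarrow> w = w'"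
    using sh unfolding shape_def by simp_all
  have core_adj: "(cs i, cs j) \<in> E \<longleftrightarrow> (i, j) \<in> B" if ij: "i \<in> C" "j \<in> C" for i j
  proof -
    consider "i < j" | "j < i" | "i = j" by linarith
    then show ?thesis
    proof cases
      case 1 then show ?thesis using sh4[OF ij] by simp
    next
      case 2
      have "(cs i, cs j) \<in> E \<longleftrightarrow> (cs j, cs i) \<in> E" using symE by blast
      also have "\<dots> \<longleftrightarrow> (j, i) \<in> B" using sh4[OF ij(2,1) 2] .
      also have "\<dots> \<longleftrightarrow> (i, j) \<in> B" using C(4) by (meson symD)
      finally show ?thesis .
    qed (use C(3,5) in simp)
  qed
  have att_adj: "i = j" if "i \<in> C" "j \<in> C" "v \<in> A i" "w \<in> A j" "(v, w) \<in> E" for i j v w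
  proof (rule ccontr)
    assume "i \<noteq> j"
    then consider "i < j" | "j < i" by linarith
    then show False
      using sh6[OF that(1,2) _ that(3,4)] sh6[OF that(2,1) _ that(4,3)] that(5) symE[OF that(5)] by cases simp_all
  qed
  have disj: "i = j" if "i \<in> C" "j \<in> C" "v \<in> A i" "v \<in> A j" for i j v
    using sh5[OF that(1,1,3)] sh5[OF that(1,2,4)] by simp
  have finA: "finite (A i)" if "i \<in> C" for i
    using that C(1) sh2 by (auto intro: finite_subset)
  have "\<forall>i\<in>C. \<exists>q. case q of (k, m, l, u, t) \<Rightarrow> enumerated E (A i) k m l u t"
  proof
    fix i assume i: "i \<in> C"
    have "\<exists>k m l u t. enumerated E (A i) k m l u t"
      by (rule enumerate_matching[OF finA[OF i] C(2,3)]) (rule sh7[OF i])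
    then obtain k m l u t where *: "enumerated E (A i) k m l u t" by (elim exE)
    show "\<exists>q. case q of (k, m, l, u, t) \<Rightarrow> enumerated E (A i) k m l u t"
      by (rule exI[of _ "(k, m, l, u, t)"]) (simp only: prod.case *)
  qed
  from bchoice[OF this] obtain q where q: "\<forall>i\<in>C. case q i of (k, m, l, u, t) \<Rightarrow> enumerated E (A i) k m l u t"
    by (elim exE)
  define k where "k i = (if i \<in> C then fst (q i) else 0)" for i
  define m where "m i = (if i \<in> C then fst (snd (q i)) else 0)" for i
  define l where "l i = fst (snd (snd (q i)))" for i
  define u where "u i = fst (snd (snd (snd (q i))))" for i
  define t where "t i = snd (snd (snd (snd (q i))))" for i
  have Q: "inj_on (l i) {1..k i}" "inj_on (u i) {1..m i}" "inj_on (t i) {1..m i}"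
    "l i ` {1..k i} \<inter> u i ` {1..m i} = {}" "l i ` {1..k i} \<inter> t i ` {1..m i} = {}" "u i ` {1..m i} \<inter> t i ` {1..m i} = {}"
    "A i = l i ` {1..k i} \<union> u i ` {1..m i} \<union> t i ` {1..m i}"
    "\<forall>a\<in>A i. \<forall>b\<in>A i. (a, b) \<in> E \<longleftrightarrow> (\<exists>j\<in>{1..m i}. a = u i j \<and> b = t i j \<or> a = t i j \<and> b = u i j)"
    if "i \<in> C" for i
  proof -
    have "enumerated E (A i) (k i) (m i) (l i) (u i) (t i)"
      using bspec[OF q that] that unfolding k_def m_def l_def u_def t_def by (simp add: case_prod_unfold)
    then show "inj_on (l i) {1..k i}" "inj_on (u i) {1..m i}" "inj_on (t i) {1..m i}"
      "l i ` {1..k i} \<inter> u i ` {1..m i} = {}" "l i ` {1..k i} \<inter> t i ` {1..m i} = {}" "u i ` {1..m i} \<inter> t i ` {1..m i} = {}"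
      "A i = l i ` {1..k i} \<union> u i ` {1..m i} \<union> t i ` {1..m i}"
      "\<forall>a\<in>A i. \<forall>b\<in>A i. (a, b) \<in> E \<longleftrightarrow> (\<exists>j\<in>{1..m i}. a = u i j \<and> b = t i j \<or> a = t i j \<and> b = u i j)"
      by (rule enumeratedD)+
  qed
  define f where "f v = (case v of Core i \<Rightarrow> cs i | Leaf i j \<Rightarrow> l i j | TriU i j \<Rightarrow> u i j | TriV i j \<Rightarrow> t i j)" for v
  have f [simp]: "f (Core i) = cs i" "f (Leaf i j) = l i j" "f (TriU i j) = u i j" "f (TriV i j) = t i j" for i j
    unfolding f_def by simp_all
  have fA: "f v \<in> A (base v)" if "v \<in> attV C k m" "depth v = 1" for v
    using that Q(7)[of "base v"] by (cases v) auto
  have fcore: "v = Core (base v)" if "depth v \<noteq> 1" for v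
    using that by (cases v) auto
  have inj1: "v = w" if "v \<in> attV C k m" "w \<in> attV C k m" "f v = f w" "base v = base w" "depth v = 1" "depth w = 1" for v w
  proof -
    define i where "i = base v"
    have i: "i \<in> C" "base w = i" using that attached_base unfolding i_def by auto
    note q = Q[OF i(1)]
    have d: "l i a \<noteq> u i b" "l i a \<noteq> t i b" "u i b \<noteq> l i a" "t i b \<noteq> l i a" if "a \<in> {1..k i}"
      "b \<in> {1..m i}" for a b
      using q(4,5) that by blast+
    have d': "u i a \<noteq> t i b" "t i b \<noteq> u i a" if "a \<in> {1..m i}" "b \<in> {1..m i}" for a b
      using q(6) that by blast+
    show ?thesis
      using that i(2) i_def d d' inj_onD[OF q(1)] inj_onD[OF q(2)] inj_onD[OF q(3)]
      by (cases v; cases w) auto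
  qed
  have bC: "base v \<in> C" if "v \<in> attV C k m" for v using that attached_base by auto
  have "inj_on f (attV C k m)"
  proof (rule inj_onI)
    fix v w assume vw: "v \<in> attV C k m" "w \<in> attV C k m" "f v = f w"
    consider "depth v = 1" "depth w = 1" | "depth v \<noteq> 1" "depth w = 1" | "depth v = 1" "depth w \<noteq> 1" | "depth v \<noteq> 1"
      "depth w \<noteq> 1"
      by blast
    then show "v = w"
    proof cases
      case 1
      have "base v = base w"
        using disj[OF bC[OF vw(1)] bC[OF vw(2)] fA[OF vw(1) 1(1)]] fA[OF vw(2) 1(2)] vw(3) by simp
      then show ?thesis using inj1[OF vw _ 1] by simp
    next
      case 2
      have "f v = cs (base v)" using fcore[OF 2(1)] f(1) by metis
      then show ?thesis using sh3[OF bC[OF vw(2)] bC[OF vw(1)]] fA[OF vw(2) 2(2)] vw(3) by simp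
    next
      case 3
      have "f w = cs (base w)" using fcore[OF 3(2)] f(1) by metis
      then show ?thesis using sh3[OF bC[OF vw(1)] bC[OF vw(2)]] fA[OF vw(1) 3(1)] vw(3) by simp
    next
      case 4
      have "f v = cs (base v)" "f w = cs (base w)" using fcore[OF 4(1)] fcore[OF 4(2)] f(1) by metis+
      then have "base v = base w" using inj_onD[OF sh1] bC vw by metis
      then show ?thesis using fcore[OF 4(1)] fcore[OF 4(2)] by simp
    qed
  qed
  moreover have Vf: "V = f ` attV C k m"
  proof (intro subset_antisym subsetI)
    fix x assume "x \<in> V"
    then consider i where "i \<in> C" "x = cs i" | i where "i \<in> C" "x \<in> A i" using sh2 by blast
    then show "x \<in> f ` attV C k m"
    proof cases
      case 1
      then show ?thesis by (intro image_eqI[of _ _ "Core i"]) simp_all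
    next
      case 2
      then consider j where "j \<in> {1..k i}" "x = l i j" | j where "j \<in> {1..m i}" "x = u i j" | j where "j \<in> {1..m i}" "x = t i j"
        using Q(7)[OF 2(1)] by blast
      then show ?thesis
      proof cases
        case 1
        then show ?thesis using 2(1) by (intro image_eqI[of _ _ "Leaf i j"]) simp_all
      next
        case 2
        then show ?thesis using \<open>i \<in> C\<close> by (intro image_eqI[of _ _ "TriU i j"]) simp_all
      next
        case 3
        then show ?thesis using 2(1) by (intro image_eqI[of _ _ "TriV i j"]) simp_all
      qed
    qed
  next
    fix x assume "x \<in> f ` attV C k m"
    then obtain v where v: "v \<in> attV C k m" "x = f v" by blast
    show "x \<in> V"
    proof (cases "depth v = 1")
      case True
      then show ?thesis using fA[OF v(1)] bC[OF v(1)] v(2) sh2 by blast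
    next
      case False
      then have "x = cs (base v)" using fcore[OF False] v(2) f(1) by metis
      then show ?thesis using bC[OF v(1)] sh2 by blast
    qed
  qed
  moreover have adj: "(f v, f w) \<in> E \<longleftrightarrow> adjp B v w" if vw: "v \<in> attV C k m" "w \<in> attV C k m" for v w
  proof -
    consider "depth v = 1" "depth w = 1" | "depth v \<noteq> 1" "depth w = 1" | "depth v = 1" "depth w \<noteq> 1" | "depth v \<noteq> 1"
      "depth w \<noteq> 1"
      by blast
    then show ?thesis
    proof cases
      case 1
      show ?thesis
      proof (cases "base v = base w")
        case False
        then have "(f v, f w) \<notin> E" using att_adj[OF bC[OF vw(1)] bC[OF vw(2)] fA[OF vw(1) 1(1)] fA[OF vw(2) 1(2)]] by blast
        moreover have "\<not> adjp B v w" using False 1 by (cases v; cases w) auto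
        ultimately show ?thesis by blast
      next
        case True
        define i where "i = base v"
        have i: "i \<in> C" "base w = i" using bC[OF vw(1)] True unfolding i_def by auto
        have "(f v, f w) \<in> E \<longleftrightarrow> (\<exists>j\<in>{1..m i}. f v = u i j \<and> f w = t i j \<or> f v = t i j \<and> f w = u i j)"
          using Q(8)[OF i(1)] fA[OF vw(1) 1(1)] fA[OF vw(2) 1(2)] i(2) unfolding i_def by simp
        also have "\<dots> \<longleftrightarrow> (\<exists>j\<in>{1..m i}. v = TriU i j \<and> w = TriV i j \<or> v = TriV i j \<and> w = TriU i j)"
        proof -
          have U: "f v' = u i j \<longleftrightarrow> v' = TriU i j" if "j \<in> {1..m i}" "v' \<in> attV C k m" "base v' = i" "depth v' = 1" for v' j
            using inj1[of v' "TriU i j"] that i(1) by (cases v') auto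
          have T: "f v' = t i j \<longleftrightarrow> v' = TriV i j" if "j \<in> {1..m i}" "v' \<in> attV C k m" "base v' = i" "depth v' = 1" for v' j
            using inj1[of v' "TriV i j"] that i(1) by (cases v') auto
          show ?thesis
            using U[OF _ vw(1) i_def[symmetric] 1(1)] U[OF _ vw(2) i(2) 1(2)] T[OF _ vw(1) i_def[symmetric] 1(1)] T[OF _ vw(2) i(2) 1(2)]
            by (intro bex_cong refl) simp
        qed
        also have "\<dots> \<longleftrightarrow> adjp B v w"
          using vw 1 i(2) i_def by (cases v; cases w) auto
        finally show ?thesis .
      qed
    next
      case 2
      have v: "v = Core (base v)" by (rule fcore[OF 2(1)])
      have "(f v, f w) \<in> E \<longleftrightarrow> base v = base w"
        using sh5[OF bC[OF vw(1)] bC[OF vw(2)] fA[OF vw(2) 2(2)]] v f(1) by metis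
      moreover have "adjp B (Core i) w \<longleftrightarrow> i = base w" for i using 2(2) by (cases w) auto
      ultimately show ?thesis using v by metis
    next
      case 3
      have w: "w = Core (base w)" by (rule fcore[OF 3(2)])
      have "(f v, f w) \<in> E \<longleftrightarrow> (f w, f v) \<in> E" using symE by blast
      also have "\<dots> \<longleftrightarrow> base w = base v"
        using sh5[OF bC[OF vw(2)] bC[OF vw(1)] fA[OF vw(1) 3(1)]] w f(1) by metis
      finally have "(f v, f w) \<in> E \<longleftrightarrow> base w = base v" .
      moreover have "adjp B v (Core i) \<longleftrightarrow> i = base v" for i using 3(1) by (cases v) auto
      ultimately show ?thesis using w by metis
    next
      case 4
      have v: "v = Core (base v)" "w = Core (base w)" by (rule fcore[OF 4(1)], rule fcore[OF 4(2)])
      have "(f (Core (base v)), f (Core (base w))) \<in> E \<longleftrightarrow> adjp B (Core (base v)) (Core (base w))"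
        using core_adj[OF bC[OF vw(1)] bC[OF vw(2)]] by simp
      then show ?thesis using v by metis
    qed
  qed
  have "E = map_prod f f ` attE B C k m"
  proof (intro subset_antisym subsetI)
    fix e assume e: "e \<in> E"
    obtain a b where ab: "e = (a, b)" by (rule prod.exhaust)
    have "a \<in> f ` attV C k m" "b \<in> f ` attV C k m" using e ab C(6) Vf by blast+
    then obtain v w where vw: "v \<in> attV C k m" "w \<in> attV C k m" "a = f v" "b = f w" by blast
    then have "(v, w) \<in> attE B C k m" using adj[OF vw(1,2)] e ab by (simp add: in_attE)
    then show "e \<in> map_prod f f ` attE B C k m" using ab vw by (intro image_eqI[of _ _ "(v, w)"]) simp_all
  next
    fix e assume "e \<in> map_prod f f ` attE B C k m"
    then obtain v w where vw: "(v, w) \<in> attE B C k m" "e = (f v, f w)" by auto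
    then have "v \<in> attV C k m" "w \<in> attV C k m" "adjp B v w" by (simp_all add: in_attE)
    then show "e \<in> E" using adj vw(2) by blast
  qed
  moreover have "\<forall>i. i \<notin> C \<longrightarrow> k i = 0 \<and> m i = 0" by (simp add: k_def m_def)
  moreover have "\<forall>i\<in>C. A i = {} \<longleftrightarrow> k i = 0 \<and> m i = 0"
  proof
    fix i assume "i \<in> C"
    then have "A i = {} \<longleftrightarrow> {1..k i} = {} \<and> {1..m i} = {}" using Q(7) by blast
    then show "A i = {} \<longleftrightarrow> k i = 0 \<and> m i = 0" by auto
  qed
  ultimately show ?thesis by blast
qed

section \<open>The models and the named families\<close>

text \<open>
  The \<open>i\<close>-th entry counted from 1, and 0 where the list has no entry, as nothing is attached there.
\<close>

definition leaf_count :: "(nat \<times> nat) list \<Rightarrow> nat \<Rightarrow> nat" where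
  "leaf_count ps i = (if 1 \<le> i \<and> i \<le> length ps then fst (ps ! (i - 1)) else 0)"

definition triangle_count :: "(nat \<times> nat) list \<Rightarrow> nat \<Rightarrow> nat" where
  "triangle_count ps i = (if 1 \<le> i \<and> i \<le> length ps then snd (ps ! (i - 1)) else 0)"

lemma pverts_attach_blocks:
  assumes "{1..length ps} \<subseteq> pverts B"
  shows "pverts (attach_blocks B ps) = attV (pverts B) (leaf_count ps) (triangle_count ps)"
proof (intro set_eqI)
  fix v show "v \<in> pverts (attach_blocks B ps) \<longleftrightarrow> v \<in> attV (pverts B) (leaf_count ps) (triangle_count ps)"
    using assms by (cases v) (auto simp: attach_blocks_def Let_def image_iff leaf_count_def triangle_count_def split: if_splits)
qed

lemma parcs_attach_blocks:
  assumes "{1..length ps} \<subseteq> pverts B" "parcs B \<subseteq> pverts B \<times> pverts B" "sym (parcs B)"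
  shows "parcs (attach_blocks B ps) = attE (parcs B) (pverts B) (leaf_count ps) (triangle_count ps)"
proof (intro set_eqI)
  fix e :: "cactus_vertex \<times> cactus_vertex"
  obtain v w where e: "e = (v, w)" by (rule prod.exhaust)
  have sym: "(i, j) \<in> parcs B \<or> (j, i) \<in> parcs B \<longleftrightarrow> (i, j) \<in> parcs B" for i j using assms(3) by (meson symD)
  have V: "i \<in> pverts B" "j \<in> pverts B" if "(i, j) \<in> parcs B" for i j using that assms(2) by blast+
  have aL: "attached (pverts B) (leaf_count ps) (triangle_count ps) (Leaf i j) \<longleftrightarrow> i \<in> {1..length ps} \<and> j \<in> {1..fst (ps ! (i - 1))}" for i j
    using assms(1) by (auto simp: leaf_count_def)
  have aT: "attached (pverts B) (leaf_count ps) (triangle_count ps) (TriU i j) \<longleftrightarrow> i \<in> {1..length ps} \<and> j \<in> {1..snd (ps ! (i - 1))}"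
    "attached (pverts B) (leaf_count ps) (triangle_count ps) (TriV i j) \<longleftrightarrow> i \<in> {1..length ps} \<and> j \<in> {1..snd (ps ! (i - 1))}" for i j
    using assms(1) by (auto simp: triangle_count_def)
  define R where "R x y \<longleftrightarrow> (\<exists>i j. x = Core i \<and> y = Core j \<and> (i, j) \<in> parcs B)
    \<or> (\<exists>i j. x = Core i \<and> y = Leaf i j \<and> i \<in> {1..length ps} \<and> j \<in> {1..fst (ps ! (i - 1))})
    \<or> (\<exists>i j. i \<in> {1..length ps} \<and> j \<in> {1..snd (ps ! (i - 1))}
        \<and> (x = Core i \<and> y = TriU i j \<or> x = Core i \<and> y = TriV i j \<or> x = TriU i j \<and> y = TriV i j))" for x y
  have "(v, w) \<in> parcs (attach_blocks B ps) \<longleftrightarrow> R v w \<or> R w v"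
  proof -
    have *: "(x, y) \<in> map_prod Core Core ` parcs B \<union> (\<lambda>(i, j). (Core i, Leaf i j)) ` {(i, j). i \<in> {1..length ps} \<and> j \<in> {1..fst (ps ! (i - 1))}}
        \<union> (\<lambda>(i, j). (Core i, TriU i j)) ` {(i, j). i \<in> {1..length ps} \<and> j \<in> {1..snd (ps ! (i - 1))}}
        \<union> (\<lambda>(i, j). (Core i, TriV i j)) ` {(i, j). i \<in> {1..length ps} \<and> j \<in> {1..snd (ps ! (i - 1))}}
        \<union> (\<lambda>(i, j). (TriU i j, TriV i j)) ` {(i, j). i \<in> {1..length ps} \<and> j \<in> {1..snd (ps ! (i - 1))}} \<longleftrightarrow> R x y" for x y
      unfolding R_def by (cases x; cases y) (auto simp: image_iff Bex_def simp del: atLeastAtMost_iff)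
    have "(x, y) \<in> symcl r \<longleftrightarrow> (x, y) \<in> r \<or> (y, x) \<in> r" for x y :: cactus_vertex and r by (auto simp: symcl_def)
    then show ?thesis unfolding attach_blocks_def Let_def pair_pre_digraph.simps by (simp only: *)
  qed
  then show "e \<in> parcs (attach_blocks B ps) \<longleftrightarrow> e \<in> attE (parcs B) (pverts B) (leaf_count ps) (triangle_count ps)"
    unfolding e in_attE R_def
    by (cases v; cases w) (use V in \<open>auto simp: aL aT sym simp del: attached.simps(2-4) atLeastAtMost_iff intro: subsetD[OF assms(1)]\<close>)
qed

definition modelled :: "'a pair_pre_digraph \<Rightarrow> nat set \<Rightarrow> (nat \<times> nat) set \<Rightarrow> (nat \<Rightarrow> nat) \<Rightarrow> (nat \<Rightarrow> nat) \<Rightarrow> bool" where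
  "modelled G C B k m \<longleftrightarrow> (\<exists>f. inj_on f (attV C k m) \<and> pverts G = f ` attV C k m \<and> parcs G = map_prod f f ` attE B C k m)"

lemma modelled_crit:
  assumes "modelled G C B k m" "crit (pverts G) (parcs G)" "finite C"
  shows "crit (attV C k m) (attE B C k m)"
proof -
  obtain f where f: "inj_on f (attV C k m)" "pverts G = f ` attV C k m" "parcs G = map_prod f f ` attE B C k m"
    using assms(1) unfolding modelled_def by blast
  define g where "g = inv_into (attV C k m) f"
  have gf: "g (f v) = v" if "v \<in> attV C k m" for v unfolding g_def using f(1) that by (rule inv_into_f_f)
  have gV: "g ` pverts G = attV C k m" unfolding f(2) image_image using image_cong[OF refl gf, of "attV C k m"] by simp
  have gE: "map_prod g g ` parcs G = attE B C k m"
  proof -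
    have "map_prod g g (map_prod f f e) = e" if "e \<in> attE B C k m" for e
      using that attE_sub(1)[of B C k m] gf by (cases e) auto
    then have "(\<lambda>e. map_prod g g (map_prod f f e)) ` attE B C k m = (\<lambda>e. e) ` attE B C k m" by (rule image_cong[OF refl])
    then show ?thesis unfolding f(3) image_image by simp
  qed
  have "crit (g ` pverts G) (map_prod g g ` parcs G)"
  proof (rule crit_bij[OF assms(2)])
    show "finite (pverts G)" unfolding f(2) using assms(3) by simp
    show "inj_on g (pverts G)" unfolding f(2) using gf by (auto intro!: inj_onI)
    show "parcs G \<subseteq> pverts G \<times> pverts G" unfolding f(2,3) using attE_sub(1) by fastforce
  qed
  then show ?thesis unfolding gV gE .
qed

text \<open>
  The symmetry \<open>p\<close> of the core sorts the attachments into the order in which the list gives them.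
\<close>

lemma modelled_iso:
  assumes G: "pair_graph G" and emb: "modelled G (pverts B) (parcs B) k m"
    and B: "pair_graph B" "{1..length ps} \<subseteq> pverts B"
    and p: "inj_on p (pverts B)" "p ` pverts B = pverts B" "map_prod p p ` parcs B = parcs B"
    and km: "\<And>i. i \<in> pverts B \<Longrightarrow> k (p i) = leaf_count ps i \<and> m (p i) = triangle_count ps i"
  shows "digraph_iso (with_proj G) (with_proj (attach_blocks B ps))"
proof -
  interpret B: pair_graph B by fact
  have subB: "parcs B \<subseteq> pverts B \<times> pverts B" using B.wellformed' by auto
  have symB: "sym (parcs B)" using B.arcs_symmetric by (auto intro: symI)
  obtain f where f: "inj_on f (attV (pverts B) k m)" "pverts G = f ` attV (pverts B) k m"
    "parcs G = map_prod f f ` attE (parcs B) (pverts B) k m"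
    using emb unfolding modelled_def by blast
  let ?A = "attach_blocks B ps"
  have eqs: "attV (pverts B) (k \<circ> p) (m \<circ> p) = pverts ?A" "attE (parcs B) (pverts B) (k \<circ> p) (m \<circ> p) = parcs ?A"
    unfolding pverts_attach_blocks[OF B(2)] parcs_attach_blocks[OF B(2) subB symB]
    by (rule attV_cong, simp add: km)+
  note r = rename_att(1)[OF p(1), of k m, unfolded eqs p(2)] rename_att(2)[OF p(1), of k m, unfolded eqs p(2)]
  have rE: "map_prod (rename p) (rename p) ` parcs ?A = attE (parcs B) (pverts B) k m"
    using rename_att(3)[OF p(1) subB, of k m] unfolding eqs p(2,3) .
  have gA: "pair_graph ?A" by (rule pair_graph_attach_blocks[OF B])
  have "digraph_iso (with_proj ?A) (with_proj G)"
    unfolding digraph_iso_pair_iff[OF gA G]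
  proof (intro exI conjI)
    show "inj_on (f \<circ> rename p) (pverts ?A)" using r(1) f(1) unfolding r(2)[symmetric] by (rule comp_inj_on)
    show "pverts G = (f \<circ> rename p) ` pverts ?A" unfolding f(2) image_comp[symmetric] r(2) ..
    show "parcs G = map_prod (f \<circ> rename p) (f \<circ> rename p) ` parcs ?A"
      unfolding f(3) rE[symmetric] image_image by (rule image_cong) auto
  qed
  interpret A: pair_graph ?A by (rule gA)
  show ?thesis by (rule digraph_iso_swap[OF A.wf_digraph]) fact
qed

lemma parcs_small:
  "pverts (path_graph 2) = {1, 2}" "parcs (path_graph 2) = compl {1, 2}"
  "pverts (cycle_graph 3) = {1, 2, 3}" "parcs (cycle_graph 3) = compl {1, 2, 3}"
  "pverts (cycle_graph 4) = {1, 2, 3, 4}" "parcs (cycle_graph 4) = cyc4"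
  "pverts (cycle_graph 5) = {1, 2, 3, 4, 5}" "parcs (cycle_graph 5) = cyc5"
proof -
  show "pverts (path_graph 2) = {1, 2}" "pverts (cycle_graph 3) = {1, 2, 3}"
    "pverts (cycle_graph 4) = {1, 2, 3, 4}" "pverts (cycle_graph 5) = {1, 2, 3, 4, 5}"
    by (auto simp: path_graph_def cycle_graph_def)
  have e2: "{(i, i + 1) | i. 1 \<le> i \<and> i < (2::nat)} = {(1, 2)}" by (auto simp: eval_nat_numeral less_Suc_eq)
  have e3: "{(i, i + 1) | i. 1 \<le> i \<and> i < (3::nat)} = {(1, 2), (2, 3)}" by (auto simp: eval_nat_numeral less_Suc_eq)
  have e4: "{(i, i + 1) | i. 1 \<le> i \<and> i < (4::nat)} = {(1, 2), (2, 3), (3, 4)}" by (auto simp: eval_nat_numeral less_Suc_eq)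
  have e5: "{(i, i + 1) | i. 1 \<le> i \<and> i < (5::nat)} = {(1, 2), (2, 3), (3, 4), (4, 5)}" by (auto simp: eval_nat_numeral less_Suc_eq)
  show "parcs (path_graph 2) = compl {1, 2}"
    unfolding path_graph_def pair_pre_digraph.simps e2 by (auto simp: symcl_def compl_def)
  show "parcs (cycle_graph 3) = compl {1, 2, 3}"
    unfolding cycle_graph_def pair_pre_digraph.simps e3 by (auto simp: symcl_def compl_def)
  show "parcs (cycle_graph 4) = cyc4"
    unfolding cycle_graph_def pair_pre_digraph.simps e4 by (auto simp: symcl_def cyc4_def)
  show "parcs (cycle_graph 5) = cyc5"
    unfolding cycle_graph_def pair_pre_digraph.simps e5 by (auto simp: symcl_def cyc5_def)
qed

text \<open>
  The path on four vertices is an edge with a leaf at either end, which brings it under the complete cores.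
\<close>

lemma path_graph_4_iso: "digraph_iso (with_proj (path_graph 4)) (with_proj (cactus_H (1, 0) (1, 0)))"
proof -
  have gH: "pair_graph (cactus_H (1, 0) (1, 0))"
    unfolding cactus_H_def by (rule pair_graph_attach_blocks[OF pair_graph_path_graph]) (auto simp: path_graph_def)
  define f where "f i = (if i = 1 then Leaf 1 1 else if i = 2 then Core 1 else if i = 3 then Core 2 else Leaf 2 1)" for i :: nat
  have V: "pverts (path_graph 4) = {1, 2, 3, 4}" by (auto simp: path_graph_def)
  have e4: "{(i, i + 1) | i. 1 \<le> i \<and> i < (4::nat)} = {(1, 2), (2, 3), (3, 4)}" by (auto simp: eval_nat_numeral less_Suc_eq)
  have E: "parcs (path_graph 4) = {(1, 2), (2, 3), (3, 4), (2, 1), (3, 2), (4, 3)}"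
    unfolding path_graph_def pair_pre_digraph.simps e4 by (auto simp: symcl_def)
  have H: "pverts (cactus_H (1, 0) (1, 0)) = {Core 1, Core 2, Leaf 1 1, Leaf 2 1}"
    "parcs (cactus_H (1, 0) (1, 0)) = {(Leaf 1 1, Core 1), (Core 1, Core 2), (Core 2, Leaf 2 1), (Core 1, Leaf 1 1), (Core 2, Core 1), (Leaf 2 1, Core 2)}"
  proof -
    have L: "{(i, j). i \<in> {1..length [(1::nat, 0::nat), (1, 0)]} \<and> j \<in> {1..fst ([(1::nat, 0::nat), (1, 0)] ! (i - 1))}} = {(1, 1), (2, 1)}"
      by (auto simp: nth_Cons' less_Suc_eq_le split: if_splits)
    have T: "{(i, j). i \<in> {1..length [(1::nat, 0::nat), (1, 0)]} \<and> j \<in> {1..snd ([(1::nat, 0::nat), (1, 0)] ! (i - 1))}} = {}"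
      by (auto simp: nth_Cons' split: if_splits)
    show "pverts (cactus_H (1, 0) (1, 0)) = {Core 1, Core 2, Leaf 1 1, Leaf 2 1}"
      unfolding cactus_H_def attach_blocks_def L T Let_def parcs_small pair_pre_digraph.simps by auto
    show "parcs (cactus_H (1, 0) (1, 0)) = {(Leaf 1 1, Core 1), (Core 1, Core 2), (Core 2, Leaf 2 1), (Core 1, Leaf 1 1), (Core 2, Core 1), (Leaf 2 1, Core 2)}"
      unfolding cactus_H_def attach_blocks_def L T Let_def parcs_small pair_pre_digraph.simps
      by (auto simp: symcl_def compl_def)
  qed
  show ?thesis
    unfolding digraph_iso_pair_iff[OF pair_graph_path_graph gH]
    by (rule exI[of _ f], unfold V E H) (auto simp: f_def inj_on_def)
qed

lemma leaf_count_Cons [simp]: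
  "leaf_count [] i = 0" "leaf_count (p # ps) i = (if i = 1 then fst p else leaf_count ps (i - 1))"
  by (auto simp: leaf_count_def nth_Cons')

lemma triangle_count_Cons [simp]:
  "triangle_count [] i = 0" "triangle_count (p # ps) i = (if i = 1 then snd p else triangle_count ps (i - 1))"
  by (auto simp: triangle_count_def nth_Cons')

lemma packing_critical_attach_blocks:
  assumes B: "pair_graph B" "{1..length ps} \<subseteq> pverts B"
    and crit: "crit (attV (pverts B) (leaf_count ps) (triangle_count ps)) (attE (parcs B) (pverts B) (leaf_count ps) (triangle_count ps))"
  shows "packing_critical (with_proj (attach_blocks B ps))"
proof -
  interpret B: pair_graph B by fact
  have "parcs B \<subseteq> pverts B \<times> pverts B" "sym (parcs B)" using B.wellformed' B.arcs_symmetric by (auto intro: symI)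
  note eqs = pverts_attach_blocks[OF B(2)] parcs_attach_blocks[OF B(2) this]
  show ?thesis using crit unfolding packing_critical_iff_crit[OF pair_graph_attach_blocks[OF B]] eqs .
qed

lemma critical_H:
  assumes types: "\<And>p. p \<in> {p1, p2} \<Longrightarrow> p = (2, 0) \<or> fst p = 0 \<and> snd p \<ge> 1"
    and "snd p2 \<ge> 1 \<or> snd p1 \<ge> 1" "snd p1 \<noteq> 1 \<or> snd p2 = 0" "snd p2 \<noteq> 1 \<or> snd p1 = 0"
  shows "packing_critical (with_proj (cactus_H p1 p2))"
  unfolding cactus_H_def
proof (rule packing_critical_attach_blocks[OF pair_graph_path_graph])
  let ?k = "leaf_count [p1, p2]" and ?m = "triangle_count [p1, p2]"
  have v: "leaf_count [p1, p2] 1 = fst p1" "triangle_count [p1, p2] 1 = snd p1" "leaf_count [p1, p2] 2 = fst p2" "triangle_count [p1, p2] 2 = snd p2"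
    by simp_all
  have t: "fst p1 = 2 \<and> snd p1 = 0 \<or> fst p1 = 0 \<and> snd p1 \<ge> 1" "fst p2 = 2 \<and> snd p2 = 0 \<or> fst p2 = 0 \<and> snd p2 \<ge> 1"
    using types[of p1] types[of p2] by auto
  obtain i1 where i1: "i1 \<in> {1, 2}" "?m i1 \<ge> 1" using assms(2) v by (metis insertI1 insertI2)
  have "crit (attV {1, 2} ?k ?m) (attE (compl {1, 2}) {1, 2} ?k ?m)"
  proof (rule crit_complete_core)
    show "i1 \<in> {1, 2}" "?m i1 \<ge> 1" by (fact i1)+
    show "?k i = 2 \<and> ?m i = 0 \<or> ?k i = 0 \<and> ?m i \<ge> 1" if "i \<in> {1, 2}" for i
      using that t v by (elim insertE emptyE) simp_all
    show "i = i'" if "i \<in> {1, 2}" "i' \<in> {1, 2}" "?m i = 1" "?m i' \<ge> 1" for i i'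
      using that(1,2) that(3,4) v assms(3-) by (elim insertE emptyE) simp_all
  qed simp_all
  then show "crit (attV (pverts (path_graph 2)) (leaf_count [p1, p2]) (triangle_count [p1, p2]))
    (attE (parcs (path_graph 2)) (pverts (path_graph 2)) (leaf_count [p1, p2]) (triangle_count [p1, p2]))"
    unfolding parcs_small .
qed (auto simp: path_graph_def)

lemma critical_triangle:
  assumes types: "\<And>p. p \<in> {p1, p2, p3} \<Longrightarrow> p = (2, 0) \<or> fst p = 0 \<and> snd p \<ge> 1"
    and "snd p3 \<ge> 1 \<or> snd p1 \<ge> 1" "snd p1 \<noteq> 1 \<or> snd p2 = 0 \<and> snd p3 = 0"
      "snd p2 \<noteq> 1 \<or> snd p1 = 0 \<and> snd p3 = 0" "snd p3 \<noteq> 1 \<or> snd p1 = 0 \<and> snd p2 = 0"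
  shows "packing_critical (with_proj (cactus_G 3 [p1, p2, p3]))"
  unfolding cactus_G_def
proof (rule packing_critical_attach_blocks[OF pair_graph_cycle_graph])
  let ?k = "leaf_count [p1, p2, p3]" and ?m = "triangle_count [p1, p2, p3]"
  have v: "leaf_count [p1, p2, p3] 1 = fst p1" "triangle_count [p1, p2, p3] 1 = snd p1" "leaf_count [p1, p2, p3] 2 = fst p2"
    "triangle_count [p1, p2, p3] 2 = snd p2" "leaf_count [p1, p2, p3] 3 = fst p3" "triangle_count [p1, p2, p3] 3 = snd p3"
    by simp_all
  have t: "fst p1 = 2 \<and> snd p1 = 0 \<or> fst p1 = 0 \<and> snd p1 \<ge> 1"
    "fst p2 = 2 \<and> snd p2 = 0 \<or> fst p2 = 0 \<and> snd p2 \<ge> 1" "fst p3 = 2 \<and> snd p3 = 0 \<or> fst p3 = 0 \<and> snd p3 \<ge> 1"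
    using types[of p1] types[of p2] types[of p3] by auto
  obtain i1 where i1: "i1 \<in> {1, 2, 3}" "?m i1 \<ge> 1" using assms(2) v by (metis insertI1 insertI2)
  have "crit (attV {1, 2, 3} ?k ?m) (attE (compl {1, 2, 3}) {1, 2, 3} ?k ?m)"
  proof (rule crit_complete_core)
    show "i1 \<in> {1, 2, 3}" "?m i1 \<ge> 1" by (fact i1)+
    show "?k i = 2 \<and> ?m i = 0 \<or> ?k i = 0 \<and> ?m i \<ge> 1" if "i \<in> {1, 2, 3}" for i
      using that t v by (elim insertE emptyE) simp_all
    show "i = i'" if "i \<in> {1, 2, 3}" "i' \<in> {1, 2, 3}" "?m i = 1" "?m i' \<ge> 1" for i i'
      using that(1,2) that(3,4) v assms(3-) by (elim insertE emptyE) simp_all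
  qed simp_all
  then show "crit (attV (pverts (cycle_graph 3)) (leaf_count [p1, p2, p3]) (triangle_count [p1, p2, p3]))
    (attE (parcs (cycle_graph 3)) (pverts (cycle_graph 3)) (leaf_count [p1, p2, p3]) (triangle_count [p1, p2, p3]))"
    unfolding parcs_small .
qed (auto simp: cycle_graph_def)

lemma critical_path4: "packing_critical (with_proj (cactus_H (1, 0) (1, 0)))"
  unfolding cactus_H_def
proof (rule packing_critical_attach_blocks[OF pair_graph_path_graph])
  have *: "leaf_count [(1, 0), (1, 0)] i = 1 \<and> triangle_count [(1, 0), (1, 0)] i = 0" if "i \<in> {1, 2}" for i
    using that by auto
  have eqs: "attV {1, 2} (leaf_count [(1, 0), (1, 0)]) (triangle_count [(1, 0), (1, 0)]) = attV {1, 2} (\<lambda>_. 1) (\<lambda>_. 0)"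
    "attE (compl {1, 2}) {1, 2} (leaf_count [(1, 0), (1, 0)]) (triangle_count [(1, 0), (1, 0)]) = attE (compl {1, 2}) {1, 2} (\<lambda>_. 1) (\<lambda>_. 0)"
    by (rule attV_cong, erule *)+
  have "crit (attV {1, 2} (\<lambda>_. 1) (\<lambda>_. 0)) (attE (compl {1, 2}) {1, 2} (\<lambda>_. 1) (\<lambda>_. 0))"
    by (rule crit_complete_core_leaves) (use lower_path4[of 1 2] in \<open>simp_all add: eval_nat_numeral\<close>)
  then show "crit (attV (pverts (path_graph 2)) (leaf_count [(1, 0), (1, 0)]) (triangle_count [(1, 0), (1, 0)]))
    (attE (parcs (path_graph 2)) (pverts (path_graph 2)) (leaf_count [(1, 0), (1, 0)]) (triangle_count [(1, 0), (1, 0)]))"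
    unfolding parcs_small eqs .
qed (auto simp: path_graph_def)

lemma critical_net: "packing_critical (with_proj (cactus_G 3 [(1, 0), (1, 0), (1, 0)]))"
  unfolding cactus_G_def
proof (rule packing_critical_attach_blocks[OF pair_graph_cycle_graph])
  have *: "leaf_count [(1, 0), (1, 0), (1, 0)] i = 1 \<and> triangle_count [(1, 0), (1, 0), (1, 0)] i = 0" if "i \<in> {1, 2, 3}" for i
    using that by auto
  have eqs: "attV {1, 2, 3} (leaf_count [(1, 0), (1, 0), (1, 0)]) (triangle_count [(1, 0), (1, 0), (1, 0)]) = attV {1, 2, 3} (\<lambda>_. 1) (\<lambda>_. 0)"
    "attE (compl {1, 2, 3}) {1, 2, 3} (leaf_count [(1, 0), (1, 0), (1, 0)]) (triangle_count [(1, 0), (1, 0), (1, 0)]) = attE (compl {1, 2, 3}) {1, 2, 3} (\<lambda>_. 1) (\<lambda>_. 0)"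
    by (rule attV_cong, erule *)+
  have "crit (attV {1, 2, 3} (\<lambda>_. 1) (\<lambda>_. 0)) (attE (compl {1, 2, 3}) {1, 2, 3} (\<lambda>_. 1) (\<lambda>_. 0))"
    by (rule crit_complete_core_leaves) (use lower_net in \<open>simp_all add: eval_nat_numeral\<close>)
  then show "crit (attV (pverts (cycle_graph 3)) (leaf_count [(1, 0), (1, 0), (1, 0)]) (triangle_count [(1, 0), (1, 0), (1, 0)]))
    (attE (parcs (cycle_graph 3)) (pverts (cycle_graph 3)) (leaf_count [(1, 0), (1, 0), (1, 0)]) (triangle_count [(1, 0), (1, 0), (1, 0)]))"
    unfolding parcs_small eqs .
qed (auto simp: cycle_graph_def)

lemma critical_cyc4:
  "packing_critical (with_proj (cactus_G 4 [(1, 0), (1, 0)]))"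
  "m1 \<ge> 1 \<Longrightarrow> m2 \<ge> 1 \<Longrightarrow> packing_critical (with_proj (cactus_G 4 [(0, m1), (0, m2)]))"
proof -
  have *: "packing_critical (with_proj (cactus_G 4 [p1, p2]))"
    if "crit (attV {1, 2, 3, 4} (leaf_count [p1, p2]) (triangle_count [p1, p2]))
      (attE cyc4 {1, 2, 3, 4} (leaf_count [p1, p2]) (triangle_count [p1, p2]))" for p1 p2
    unfolding cactus_G_def
  proof (rule packing_critical_attach_blocks[OF pair_graph_cycle_graph])
    show "crit (attV (pverts (cycle_graph 4)) (leaf_count [p1, p2]) (triangle_count [p1, p2]))
      (attE (parcs (cycle_graph 4)) (pverts (cycle_graph 4)) (leaf_count [p1, p2]) (triangle_count [p1, p2]))"
      unfolding parcs_small by (rule that)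
  qed (auto simp: cycle_graph_def)
  show "packing_critical (with_proj (cactus_G 4 [(1, 0), (1, 0)]))"
    by (rule *, rule crit_cyc4_leaves) auto
  show "packing_critical (with_proj (cactus_G 4 [(0, m1), (0, m2)]))" if "m1 \<ge> 1" "m2 \<ge> 1"
    by (rule *, rule crit_cyc4_triangles) (use that in auto)
qed

lemma critical_cyc5:
  assumes "m1 \<ge> 2" shows "packing_critical (with_proj (cactus_G 5 [(0, m1)]))"
  unfolding cactus_G_def
proof (rule packing_critical_attach_blocks[OF pair_graph_cycle_graph])
  have "crit (attV {1, 2, 3, 4, 5} (leaf_count [(0, m1)]) (triangle_count [(0, m1)]))
    (attE cyc5 {1, 2, 3, 4, 5} (leaf_count [(0, m1)]) (triangle_count [(0, m1)]))"
    by (rule crit_cyc5_triangles) (use assms in auto)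
  then show "crit (attV (pverts (cycle_graph 5)) (leaf_count [(0, m1)]) (triangle_count [(0, m1)]))
    (attE (parcs (cycle_graph 5)) (pverts (cycle_graph 5)) (leaf_count [(0, m1)]) (triangle_count [(0, m1)]))"
    unfolding parcs_small .
qed (auto simp: cycle_graph_def)

lemma pair_graph_families:
  "pair_graph (cactus_H p1 p2)" "pair_graph (cactus_G 3 [p1, p2, p3])"
  "pair_graph (cactus_G 4 [p1, p2])" "pair_graph (cactus_G 5 [p1])"
proof -
  show "pair_graph (cactus_H p1 p2)"
    unfolding cactus_H_def by (rule pair_graph_attach_blocks[OF pair_graph_path_graph]) (auto simp: path_graph_def)
  have "pair_graph (cactus_G r ps)" if "r \<ge> 3" "length ps \<le> r" for r ps
    unfolding cactus_G_def
    by (rule pair_graph_attach_blocks[OF pair_graph_cycle_graph]) (use that in \<open>auto simp: cycle_graph_def\<close>)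
  then show "pair_graph (cactus_G 3 [p1, p2, p3])" "pair_graph (cactus_G 4 [p1, p2])" "pair_graph (cactus_G 5 [p1])"
    by simp_all
qed

section \<open>The characterization\<close>

text \<open>
  A centre, with the bounds on distances that the radius and the diameter express.
\<close>

lemma rad_diam_near:
  assumes "pair_graph G" "Digraph_Component.connected (with_proj G)" "rad (with_proj G) = 2" "diam (with_proj G) = 3"
  obtains c where "c \<in> pverts G" "\<And>v. v \<in> pverts G \<Longrightarrow> near (parcs G) 2 c v"
    "\<And>u. u \<in> pverts G \<Longrightarrow> \<exists>v\<in>pverts G. \<not> near (parcs G) 1 u v"
    "\<And>u v. u \<in> pverts G \<Longrightarrow> v \<in> pverts G \<Longrightarrow> near (parcs G) 3 u v"
    "\<exists>u\<in>pverts G. \<exists>v\<in>pverts G. \<not> near (parcs G) 2 u v"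
proof -
  interpret pair_graph G by fact
  let ?G = "with_proj G" and ?V = "pverts G"
  have V: "finite ?V" "?V \<noteq> {}"
    using assms(2) pair_finite_verts by (auto simp: connected_def strongly_connected_def)
  have dist: "graph_dist ?G u v > ereal (real i) \<longleftrightarrow> \<not> near (parcs G) i u v" if "u \<in> ?V" for u v i
    using graph_dist_greater_iff[of ?G u i v] wf_digraph that by (simp add: arcs_ends_conv)
  have ecc: "eccentricity ?G u > ereal (real i) \<longleftrightarrow> (\<exists>v\<in>?V. \<not> near (parcs G) i u v)" if "u \<in> ?V" for u i
    unfolding eccentricity_def using V dist[OF that] by (simp add: Max_gr_iff)
  let ?ecc = "eccentricity ?G ` ?V"
  have E: "finite ?ecc" "?ecc \<noteq> {}" using V by auto
  have "Min ?ecc = 2" "Max ?ecc = 3" using assms(3,4) unfolding rad_def diam_def by simp_all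
  then have "2 \<in> ?ecc" "3 \<in> ?ecc" and ge: "\<And>u. u \<in> ?V \<Longrightarrow> 2 \<le> eccentricity ?G u"
    and le: "\<And>u. u \<in> ?V \<Longrightarrow> eccentricity ?G u \<le> 3"
    using Min_in[OF E] Max_in[OF E] Min_le[OF E(1) imageI] Max_ge[OF E(1) imageI] by simp_all
  then obtain c d where c: "c \<in> ?V" "eccentricity ?G c = 2" and d: "d \<in> ?V" "eccentricity ?G d = 3" by (metis imageE)
  show thesis
  proof (rule that)
    show "c \<in> ?V" by (rule c(1))
    show "near (parcs G) 2 c v" if "v \<in> ?V" for v using ecc[OF c(1), of 2] c(2) that by auto
    show "\<exists>v\<in>?V. \<not> near (parcs G) 1 u v" if "u \<in> ?V" for u
    proof -
      have "ereal (real 1) < 2" by simp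
      then show ?thesis using ecc[OF that, of 1] ge[OF that] less_le_trans by blast
    qed
    show "near (parcs G) 3 u v" if "u \<in> ?V" "v \<in> ?V" for u v using ecc[OF that(1), of 3] le[OF that(1)] that(2) by auto
    show "\<exists>u\<in>?V. \<exists>v\<in>?V. \<not> near (parcs G) 2 u v" using ecc[OF d(1), of 2] d by auto
  qed
qed

lemma rename_compl:
  assumes "inj_on p C" "p ` C = C"
  shows "map_prod p p ` compl C = compl C"
proof (intro subset_antisym subsetI)
  fix e assume "e \<in> map_prod p p ` compl C"
  then obtain i j where "(i, j) \<in> compl C" "e = (p i, p j)" by auto
  moreover then have "i \<in> C" "j \<in> C" "i \<noteq> j" by auto
  moreover then have "p i \<in> C" "p j \<in> C" "p i \<noteq> p j" using assms inj_onD by fastforce+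
  ultimately show "e \<in> compl C" by simp
next
  fix e assume "e \<in> compl C"
  then obtain i j where e: "e = (i, j)" "i \<in> C" "j \<in> C" "i \<noteq> j" by (cases e) auto
  then obtain i' j' where "i' \<in> C" "j' \<in> C" "i = p i'" "j = p j'" using assms(2) by (metis imageE)
  then show "e \<in> map_prod p p ` compl C" using e by (intro image_eqI[of _ _ "(i', j')"]) auto
qed

lemma modelled_H:
  assumes "pair_graph G" "modelled G {1, 2} (compl {1, 2}) k m" "{a, b} = {1, 2 :: nat}" "a \<noteq> b"
  shows "digraph_iso (with_proj G) (with_proj (cactus_H (k a, m a) (k b, m b)))"
proof -
  define p where "p i = (if i = 1 then a else b)" for i :: nat
  have p: "p 1 = a" "p 2 = b" by (simp_all add: p_def)
  have inj: "inj_on p {1, 2}" "p ` {1, 2} = {1, 2}" using assms(3,4) p by (simp_all add: inj_on_def)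
  show ?thesis
    unfolding cactus_H_def
  proof (rule modelled_iso[OF assms(1) _ pair_graph_path_graph])
    show "modelled G (pverts (path_graph 2)) (parcs (path_graph 2)) k m" unfolding parcs_small by (rule assms(2))
    show "{1..length [(k a, m a), (k b, m b)]} \<subseteq> pverts (path_graph 2)" by (auto simp: path_graph_def)
    show "inj_on p (pverts (path_graph 2))" "p ` pverts (path_graph 2) = pverts (path_graph 2)"
      "map_prod p p ` parcs (path_graph 2) = parcs (path_graph 2)"
      unfolding parcs_small using inj rename_compl[OF inj] by simp_all
    show "k (p i) = leaf_count [(k a, m a), (k b, m b)] i \<and> m (p i) = triangle_count [(k a, m a), (k b, m b)] i"
      if "i \<in> pverts (path_graph 2)" for i
      using that p unfolding parcs_small by (elim insertE emptyE) simp_all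
  qed
qed

lemma modelled_triangle:
  assumes "pair_graph G" "modelled G {1, 2, 3} (compl {1, 2, 3}) k m" "{a, b, c} = {1, 2, 3 :: nat}" "a \<noteq> b" "a \<noteq> c" "b \<noteq> c"
  shows "digraph_iso (with_proj G) (with_proj (cactus_G 3 [(k a, m a), (k b, m b), (k c, m c)]))"
proof -
  let ?ps = "[(k a, m a), (k b, m b), (k c, m c)]"
  define p where "p i = (if i = 1 then a else if i = 2 then b else c)" for i :: nat
  have p: "p 1 = a" "p 2 = b" "p 3 = c" by (simp_all add: p_def)
  have inj: "inj_on p {1, 2, 3}" "p ` {1, 2, 3} = {1, 2, 3}" using assms(3-6) p by (simp_all add: inj_on_def)
  show ?thesis
    unfolding cactus_G_def
  proof (rule modelled_iso[OF assms(1) _ pair_graph_cycle_graph])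
    show "modelled G (pverts (cycle_graph 3)) (parcs (cycle_graph 3)) k m" unfolding parcs_small by (rule assms(2))
    show "{1..length ?ps} \<subseteq> pverts (cycle_graph 3)" by (auto simp: cycle_graph_def)
    show "inj_on p (pverts (cycle_graph 3))" "p ` pverts (cycle_graph 3) = pverts (cycle_graph 3)"
      "map_prod p p ` parcs (cycle_graph 3) = parcs (cycle_graph 3)"
      unfolding parcs_small using inj rename_compl[OF inj] by simp_all
    show "k (p i) = leaf_count ?ps i \<and> m (p i) = triangle_count ?ps i" if "i \<in> pverts (cycle_graph 3)" for i
      using that p unfolding parcs_small by (elim insertE emptyE) simp_all
  qed simp
qed

lemma modelled_cyc4:
  assumes "pair_graph G" "modelled G {1, 2, 3, 4} cyc4 k m" "k 3 = 0" "k 4 = 0" "m 3 = 0" "m 4 = 0"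
  shows "digraph_iso (with_proj G) (with_proj (cactus_G 4 [(k 1, m 1), (k 2, m 2)]))"
  unfolding cactus_G_def
proof (rule modelled_iso[OF assms(1) _ pair_graph_cycle_graph, where p = id])
  let ?ps = "[(k 1, m 1), (k 2, m 2)]"
  show "modelled G (pverts (cycle_graph 4)) (parcs (cycle_graph 4)) k m" unfolding parcs_small by (rule assms(2))
  show "{1..length ?ps} \<subseteq> pverts (cycle_graph 4)" by (auto simp: cycle_graph_def)
  show "k (id i) = leaf_count ?ps i \<and> m (id i) = triangle_count ?ps i" if "i \<in> pverts (cycle_graph 4)" for i
    using that assms(3-) unfolding parcs_small by (elim insertE emptyE) simp_all
qed (simp_all add: map_prod.id)

lemma modelled_cyc5:
  assumes G: "pair_graph G" "modelled G {1, 2, 3, 4, 5} cyc5 k m"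
    and ab: "a = 1 \<and> b = 2 \<or> a = 2 \<and> b = 1" and km: "\<And>i. i \<noteq> a \<Longrightarrow> k i = 0 \<and> m i = 0" "k a = 0"
  shows "digraph_iso (with_proj G) (with_proj (cactus_G 5 [(0, m a)]))"
proof -
  \<comment> \<open>The reflection of the 5-cycle that exchanges its vertices 1 and 2.\<close>
  define r where "r i = (if i = 1 then 2 else if i = 2 then 1 else if i = 3 then 5 else if i = 5 then 3 else i)" for i :: nat
  define p where "p = (if a = 1 then id else r)"
  have r: "inj_on r {1, 2, 3, 4, 5}" "r ` {1, 2, 3, 4, 5} = {1, 2, 3, 4, 5}" "map_prod r r ` cyc5 = cyc5"
    by (auto simp: r_def inj_on_def cyc5_def)
  have pa: "p i = a \<longleftrightarrow> i = 1" for i using ab by (auto simp: p_def r_def)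
  show ?thesis
    unfolding cactus_G_def
  proof (rule modelled_iso[OF G(1) _ pair_graph_cycle_graph])
    show "modelled G (pverts (cycle_graph 5)) (parcs (cycle_graph 5)) k m" unfolding parcs_small by (rule G(2))
    show "{1..length [(0, m a)]} \<subseteq> pverts (cycle_graph 5)" by (auto simp: cycle_graph_def)
    show "inj_on p (pverts (cycle_graph 5))" "p ` pverts (cycle_graph 5) = pverts (cycle_graph 5)"
      "map_prod p p ` parcs (cycle_graph 5) = parcs (cycle_graph 5)"
      unfolding parcs_small p_def using r by (simp_all add: map_prod.id)
    show "k (p i) = leaf_count [(0, m a)] i \<and> m (p i) = triangle_count [(0, m a)] i" for i
      using km(1)[of "p i"] km(2) pa[of i] by (cases "i = 1") simp_all
  qed simp
qed

text \<open>
  Without triangles the graph is a double star, which is critical only as a path. With a triangle at \<open>a\<close>, the types of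
  the attachments are those of \<open>complete_core_crit_types\<close>.
\<close>

lemma edge_core_critical:
  assumes G: "pair_graph G" "modelled G {1, 2} (compl {1, 2}) k m" and crit: "packing_critical (with_proj G)"
    and att: "\<And>i. i \<in> {1, 2} \<Longrightarrow> k i \<ge> 1 \<or> m i \<ge> 1"
  shows "digraph_iso G (path_graph 4) \<or> digraph_iso G (cactus_H (2, 0) (0, 1))
    \<or> (\<exists>m1\<ge>2. \<exists>m2\<ge>2. digraph_iso G (cactus_H (0, m1) (0, m2)))
    \<or> (\<exists>m1\<ge>2. digraph_iso G (cactus_H (0, m1) (2, 0)))"
proof -
  have c: "crit (attV {1, 2} k m) (attE (compl {1, 2}) {1, 2} k m)"
    using modelled_crit[OF G(2)] crit unfolding packing_critical_iff_crit[OF G(1)] by simp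
  show ?thesis
  proof (cases "m 1 = 0 \<and> m 2 = 0")
    case True
    have "k i = 1" if "i \<in> {1, 2}" for i
    proof (rule complete_core_leaves_crit[OF _ _ _ _ c that])
      show "k i \<ge> 1 \<and> m i = 0" if "i \<in> {1, 2}" for i using att[OF that] that True by auto
      show "1 + card {1, 2 :: nat} \<le> pchi (attV {1, 2} (\<lambda>_. 1) (\<lambda>_. 0)) (attE (compl {1, 2}) {1, 2} (\<lambda>_. 1) (\<lambda>_. 0))"
        using lower_path4[of 1 2] by simp
    qed simp_all
    then have "digraph_iso G (cactus_H (1, 0) (1, 0))" using modelled_H[OF G, of 1 2] True by simp
    moreover interpret P: pair_graph "path_graph 4" by (rule pair_graph_path_graph)
    have "digraph_iso (cactus_H (1, 0) (1, 0)) (path_graph 4)"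
      by (rule digraph_iso_swap[OF P.wf_digraph path_graph_4_iso])
    ultimately show ?thesis using digraph_iso_trans by blast
  next
    case False
    then obtain a b where ab: "{a, b} = {1, 2 :: nat}" "a \<noteq> b" and ma: "m a \<ge> 1"
    proof -
      from False consider "m 1 \<ge> 1" | "m 2 \<ge> 1" by linarith
      then show thesis using that[of 1 2] that[OF insert_commute[of 2 1 "{}"]] by cases simp_all
    qed
    have c': "crit (attV {a, b} k m) (attE (compl {a, b}) {a, b} k m)" unfolding ab(1) by (rule c)
    have "k b \<ge> 2 \<or> m b \<ge> 1"
    proof (rule ccontr)
      assume "\<not> (k b \<ge> 2 \<or> m b \<ge> 1)"
      then show False using complete_core_gain_not_crit[of "{a, b}" b k m a] c' ma ab(2) by auto
    qed
    then have gain: "k i \<ge> 2 \<or> m i \<ge> 1" if "i \<in> {a, b}" for i using that ma by auto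
    note t = complete_core_crit_types(1)[OF _ gain _ ma c'] complete_core_crit_types(2)[OF _ gain _ ma c', of a b]
      complete_core_crit_types(2)[OF _ gain _ ma c', of b a]
    have ta: "k a = 0" using t(1)[of a] ma by simp
    have tb: "k b = 2 \<and> m b = 0 \<or> k b = 0 \<and> m b \<ge> 1" using t(1)[of b] by simp
    have one: "m a = 1 \<or> m b = 1 \<Longrightarrow> m b = 0" using t(2,3) ab(2) ma by fastforce
    show ?thesis
    proof (cases "m b = 0")
      case True
      then have kb: "k b = 2" using tb by simp
      show ?thesis
      proof (cases "m a = 1")
        case ma1: True
        have "digraph_iso G (cactus_H (k b, m b) (k a, m a))"
          by (rule modelled_H[OF G]) (use ab in auto)
        then show ?thesis using kb True ma1 ta by simp
      next
        case False
        then have "m a \<ge> 2" using ma by simp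
        then show ?thesis using modelled_H[OF G ab] kb True ta by auto
      qed
    next
      case False
      then have "k b = 0" "m b \<ge> 2" "m a \<ge> 2" using tb one ma by force+
      then show ?thesis using modelled_H[OF G ab] ta by auto
    qed
  qed
qed

text \<open>
  Without triangles attached, all three core vertices must carry exactly one leaf. With a triangle at \<open>a\<close>, neither of
  the other two core vertices can have fewer than two leaves and no triangle, and the types of the attachments are
  those of \<open>complete_core_crit_types\<close>.
\<close>

lemma triangle_core_critical:
  assumes G: "pair_graph G" "modelled G {1, 2, 3} (compl {1, 2, 3}) k m" and crit: "packing_critical (with_proj G)"
    and att: "k 1 + m 1 \<noteq> 0 \<and> k 2 + m 2 \<noteq> 0 \<or> k 1 + m 1 \<noteq> 0 \<and> k 3 + m 3 \<noteq> 0 \<or> k 2 + m 2 \<noteq> 0 \<and> k 3 + m 3 \<noteq> 0"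
  shows "digraph_iso G (cactus_G 3 [(1, 0), (1, 0), (1, 0)])
    \<or> digraph_iso G (cactus_G 3 [(2, 0), (2, 0), (0, 1)])
    \<or> (\<exists>m1\<ge>2. \<exists>m2\<ge>2. \<exists>m3\<ge>2. digraph_iso G (cactus_G 3 [(0, m1), (0, m2), (0, m3)]))
    \<or> (\<exists>m1\<ge>2. \<exists>m2\<ge>2. digraph_iso G (cactus_G 3 [(0, m1), (0, m2), (2, 0)]))
    \<or> (\<exists>m1\<ge>2. digraph_iso G (cactus_G 3 [(0, m1), (2, 0), (2, 0)]))"
proof -
  have c: "crit (attV {1, 2, 3} k m) (attE (compl {1, 2, 3}) {1, 2, 3} k m)"
    using modelled_crit[OF G(2)] crit unfolding packing_critical_iff_crit[OF G(1)] by simp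
  have crit_abc: "crit (attV {a, b, c} k m) (attE (compl {a, b, c}) {a, b, c} k m)" if "{a, b, c} = {1, 2, 3}" for a b c
    unfolding that by (rule c)
  show ?thesis
  proof (cases "m 1 = 0 \<and> m 2 = 0 \<and> m 3 = 0")
    case True
    have pos: "k 1 \<ge> 1 \<and> k 2 \<ge> 1 \<and> k 3 \<ge> 1"
    proof (rule ccontr)
      assume no: "\<not> ?thesis"
      have s: "{2, 3, 1} = {1, 2, 3 :: nat}" "{1, 3, 2} = {1, 2, 3 :: nat}" by auto
      from no consider "k 1 = 0" | "k 2 = 0" | "k 3 = 0" by linarith
      then show False
      proof cases
        case 1 then show ?thesis using triangle_two_attached_not_crit[of 2 3 1 m k] crit_abc[OF s(1)] att True by auto
      next
        case 2 then show ?thesis using triangle_two_attached_not_crit[of 1 3 2 m k] crit_abc[OF s(2)] att True by auto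
      next
        case 3 then show ?thesis using triangle_two_attached_not_crit[of 1 2 3 m k] crit_abc[OF refl] att True by auto
      qed
    qed
    have "k i = 1" if "i \<in> {1, 2, 3}" for i
    proof (rule complete_core_leaves_crit[OF _ _ _ _ c that])
      show "k i \<ge> 1 \<and> m i = 0" if "i \<in> {1, 2, 3}" for i using pos that True by auto
      show "1 + card {1, 2, 3 :: nat} \<le> pchi (attV {1, 2, 3} (\<lambda>_. 1) (\<lambda>_. 0)) (attE (compl {1, 2, 3}) {1, 2, 3} (\<lambda>_. 1) (\<lambda>_. 0))"
        using lower_net by simp
    qed simp_all
    then have "digraph_iso G (cactus_G 3 [(1, 0), (1, 0), (1, 0)])" using modelled_triangle[OF G, of 1 2 3] True by simp
    then show ?thesis by simp
  next
    case False
    then obtain a b c where abc: "{a, b, c} = {1, 2, 3 :: nat}" "a \<noteq> b" "a \<noteq> c" "b \<noteq> c" and ma: "m a \<ge> 1"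
    proof -
      have s: "{2, 1, 3} = {1, 2, 3 :: nat}" "{3, 1, 2} = {1, 2, 3 :: nat}" by auto
      from False consider "m 1 \<ge> 1" | "m 2 \<ge> 1" | "m 3 \<ge> 1" by linarith
      then show thesis
        using that[of 1 2 3] that[OF s(1)] that[OF s(2)] by cases simp_all
    qed
    note c' = crit_abc[OF abc(1)]
    have other: "k b + m b \<noteq> 0 \<or> k c + m c \<noteq> 0"
    proof (rule ccontr)
      assume "\<not> ?thesis"
      then have "k i + m i = 0" if "i \<in> {a, b, c}" "i \<noteq> a" for i using that by auto
      then have z: "k i + m i = 0" if "i \<in> {1, 2, 3}" "i \<noteq> a" for i using that abc(1) by simp
      show False using att z[of 1] z[of 2] z[of 3] by (cases "a = 1"; cases "a = 2") auto
    qed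
    have gain: "(k b \<ge> 2 \<or> m b \<ge> 1) \<and> (k c \<ge> 2 \<or> m c \<ge> 1)"
    proof (rule ccontr)
      assume "\<not> ?thesis"
      then consider "k b \<le> 1 \<and> m b = 0" "k c \<le> 1 \<and> m c = 0" | "k b \<le> 1 \<and> m b = 0" "k c \<ge> 2 \<or> m c \<ge> 1"
        | "k c \<le> 1 \<and> m c = 0" "k b \<ge> 2 \<or> m b \<ge> 1" by linarith
      then show False
      proof cases
        case 1
        then show ?thesis using triangle_one_triangle_not_crit[OF abc(2-4), of m k] ma other c' by auto
      next
        case 2
        then show ?thesis using complete_core_gain_not_crit[of "{a, b, c}" b k m a] c' ma abc(2-4) by auto
      next
        case 3
        then show ?thesis using complete_core_gain_not_crit[of "{a, b, c}" c k m a] c' ma abc(2-4) by auto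
      qed
    qed
    then have gain: "k i \<ge> 2 \<or> m i \<ge> 1" if "i \<in> {a, b, c}" for i using that ma by auto
    note t1 = complete_core_crit_types(1)[OF _ gain _ ma c'] and t2 = complete_core_crit_types(2)[OF _ gain _ ma c']
    have ta: "k a = 0" using t1[of a] ma by simp
    have tb: "k b = 2 \<and> m b = 0 \<or> k b = 0 \<and> m b \<ge> 1" and tc: "k c = 2 \<and> m c = 0 \<or> k c = 0 \<and> m c \<ge> 1"
      using t1[of b] t1[of c] by simp_all
    have two: "m i \<ge> 2 \<and> m j \<ge> 2" if "i \<in> {a, b, c}" "j \<in> {a, b, c}" "i \<noteq> j" "m i \<ge> 1" "m j \<ge> 1" for i j
    proof -
      have "m i \<noteq> 1" "m j \<noteq> 1" using t2[of i j] t2[of j i] that by auto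
      then show ?thesis using that(4,5) by simp
    qed
    have bca: "{b, c, a} = {1, 2, 3}" and acb: "{a, c, b} = {1, 2, 3}" using abc(1) by auto
    note iso = modelled_triangle[OF G abc] modelled_triangle[OF G bca abc(4) abc(2)[symmetric] abc(3)[symmetric]]
      modelled_triangle[OF G acb abc(3,2) abc(4)[symmetric]]
    from tb tc show ?thesis
    proof (elim disjE)
      assume "k b = 2 \<and> m b = 0" "k c = 2 \<and> m c = 0"
      then show ?thesis using iso(1,2) ta ma by (cases "m a = 1") auto
    next
      assume *: "k b = 2 \<and> m b = 0" "k c = 0 \<and> 1 \<le> m c"
      then have "m a \<ge> 2 \<and> m c \<ge> 2" using two[of a c] abc(3) ma by simp
      then show ?thesis using iso(3) ta * by auto
    next
      assume *: "k b = 0 \<and> 1 \<le> m b" "k c = 2 \<and> m c = 0"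
      then have "m a \<ge> 2 \<and> m b \<ge> 2" using two[of a b] abc(2) ma by simp
      then show ?thesis using iso(1) ta * by auto
    next
      assume *: "k b = 0 \<and> 1 \<le> m b" "k c = 0 \<and> 1 \<le> m c"
      then have "m a \<ge> 2 \<and> m b \<ge> 2" "m c \<ge> 2" using two[of a b] two[of a c] abc(2,3) ma by simp_all
      then show ?thesis using iso(1) ta * by auto
    qed
  qed
qed

lemma cactus_modelled:
  assumes "pair_graph G" "cactus (with_proj G)" "rad (with_proj G) = 2" "diam (with_proj G) = 3"
  obtains k m where "modelled G {1, 2} (compl {1, 2}) k m" "\<And>i. i \<in> {1, 2} \<Longrightarrow> k i \<ge> 1 \<or> m i \<ge> 1"
  | k m where "modelled G {1, 2, 3} (compl {1, 2, 3}) k m"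
      "k 1 + m 1 \<noteq> 0 \<and> k 2 + m 2 \<noteq> 0 \<or> k 1 + m 1 \<noteq> 0 \<and> k 3 + m 3 \<noteq> 0 \<or> k 2 + m 2 \<noteq> 0 \<and> k 3 + m 3 \<noteq> 0"
  | k m where "modelled G {1, 2, 3, 4} cyc4 k m" "k 3 = 0" "k 4 = 0" "m 3 = 0" "m 4 = 0"
  | k m where "modelled G {1, 2, 3, 4, 5} cyc5 k m" "\<And>i. i \<notin> {1, 2} \<Longrightarrow> k i = 0 \<and> m i = 0"
    "k 1 + m 1 \<noteq> 0 \<or> k 2 + m 2 \<noteq> 0"
proof -
  interpret pair_graph G by fact
  let ?V = "pverts G" and ?E = "parcs G"
  have E: "?E \<subseteq> ?V \<times> ?V" "sym ?E" using wellformed' arcs_symmetric by (auto intro: symI)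
  have irr: "(v, v) \<notin> ?E" for v using no_loops' by blast
  have conn: "Digraph_Component.connected (with_proj G)" using assms(2) unfolding cactus_def by simp
  show thesis
  proof (rule rad_diam_near[OF assms(1) conn assms(3,4)])
    fix c assume c: "c \<in> ?V" "\<And>v. v \<in> ?V \<Longrightarrow> near ?E 2 c v"
      and dom: "\<And>u. u \<in> ?V \<Longrightarrow> \<exists>v\<in>?V. \<not> near ?E 1 u v"
      and near3: "\<And>u v. u \<in> ?V \<Longrightarrow> v \<in> ?V \<Longrightarrow> near ?E 3 u v"
      and far: "\<exists>u\<in>?V. \<exists>v\<in>?V. \<not> near ?E 2 u v"
    interpret center ?V ?E c
    proof
      fix u x y z
      assume *: "(u, x) \<in> ?E" "(u, y) \<in> ?E" "(u, z) \<in> ?E" "x \<noteq> y" "x \<noteq> z" "y \<noteq> z"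
        "(x, y) \<in> rtrancl_on (?V - {u}) ?E" "(x, z) \<in> rtrancl_on (?V - {u}) ?E"
      have "(z, x) \<in> rtrancl_on (?V - {u}) ?E" using rtrancl_on_sym[OF E(2)] *(8) by (rule symD)
      then show False by (rule cactus_three_neighbours[OF assms(1,2) *(1-7)])
    qed (rule E irr c near3; assumption?)+
    have emb: "\<exists>k m. modelled G C B k m \<and> (\<forall>i. i \<notin> C \<longrightarrow> k i = 0 \<and> m i = 0) \<and> (\<forall>i\<in>C. A i = {} \<longleftrightarrow> k i = 0 \<and> m i = 0)"
      if "shape ?V ?E B C cs A" "sym B" "\<And>i. (i, i) \<notin> B" for B C cs A
    proof -
      note iso = shape_iso[OF that(1) pair_finite_verts E(2) irr that(2,3) E(1)]
      obtain k m f where "\<forall>i. i \<notin> C \<longrightarrow> k i = 0 \<and> m i = 0"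
        "\<forall>i\<in>C. A i = {} \<longleftrightarrow> k i = 0 \<and> m i = 0"
        "inj_on f (attV C k m)" "?V = f ` attV C k m" "?E = map_prod f f ` attE B C k m"
        using iso by metis
      then show ?thesis
        unfolding modelled_def by (intro exI[of _ k] exI[of _ m] exI[of _ f] conjI)
    qed
    show thesis
    proof (rule shapes)
      show "\<exists>v\<in>?V. \<not> near ?E 1 u v" if "u \<in> ?V" for u by (rule dom[OF that])
      show "\<exists>u\<in>?V. \<exists>v\<in>?V. \<not> near ?E 2 u v" by (rule far)
    next
      fix cs A assume sh: "shape ?V ?E (compl {1, 2}) {1, 2} cs A" "A 1 \<noteq> {}" "A 2 \<noteq> {}"
      have "\<exists>k m. modelled G {1, 2} (compl {1, 2}) k m \<and> (\<forall>i. i \<notin> {1, 2} \<longrightarrow> k i = 0 \<and> m i = 0) \<and> (\<forall>i\<in>{1, 2}. A i = {} \<longleftrightarrow> k i = 0 \<and> m i = 0)"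
        by (rule emb[OF sh(1) sym_compl]) simp
      then obtain k m where km: "modelled G {1, 2} (compl {1, 2}) k m" "\<forall>i. i \<notin> {1, 2} \<longrightarrow> k i = 0 \<and> m i = 0"
        "\<forall>i\<in>{1, 2}. A i = {} \<longleftrightarrow> k i = 0 \<and> m i = 0" by blast
      have "k i \<ge> 1 \<or> m i \<ge> 1" if "i \<in> {1, 2}" for i using that km(3) sh(2,3) by (elim insertE emptyE) auto
      then show thesis by (rule that(1)[OF km(1)])
    next
      fix cs A assume sh: "shape ?V ?E (compl {1, 2, 3}) {1, 2, 3} cs A"
        "A 1 \<noteq> {} \<and> A 2 \<noteq> {} \<or> A 1 \<noteq> {} \<and> A 3 \<noteq> {} \<or> A 2 \<noteq> {} \<and> A 3 \<noteq> {}"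
      have "\<exists>k m. modelled G {1, 2, 3} (compl {1, 2, 3}) k m \<and> (\<forall>i. i \<notin> {1, 2, 3} \<longrightarrow> k i = 0 \<and> m i = 0) \<and> (\<forall>i\<in>{1, 2, 3}. A i = {} \<longleftrightarrow> k i = 0 \<and> m i = 0)"
        by (rule emb[OF sh(1) sym_compl]) simp
      then obtain k m where km: "modelled G {1, 2, 3} (compl {1, 2, 3}) k m"
        "\<forall>i. i \<notin> {1, 2, 3} \<longrightarrow> k i = 0 \<and> m i = 0"
        "\<forall>i\<in>{1, 2, 3}. A i = {} \<longleftrightarrow> k i = 0 \<and> m i = 0" by blast
      show thesis by (rule that(2)[OF km(1)]) (use km(3) sh(2) in simp)
    next
      fix cs A assume sh: "shape ?V ?E cyc4 {1, 2, 3, 4} cs A" "A 3 = {}" "A 4 = {}"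
      have "\<exists>k m. modelled G {1, 2, 3, 4} cyc4 k m \<and> (\<forall>i. i \<notin> {1, 2, 3, 4} \<longrightarrow> k i = 0 \<and> m i = 0) \<and> (\<forall>i\<in>{1, 2, 3, 4}. A i = {} \<longleftrightarrow> k i = 0 \<and> m i = 0)"
        by (rule emb[OF sh(1) sym_cyc4]) (rule cyc4_core(3))
      then obtain k m where km: "modelled G {1, 2, 3, 4} cyc4 k m" "\<forall>i. i \<notin> {1, 2, 3, 4} \<longrightarrow> k i = 0 \<and> m i = 0"
        "\<forall>i\<in>{1, 2, 3, 4}. A i = {} \<longleftrightarrow> k i = 0 \<and> m i = 0" by blast
      show thesis by (rule that(3)[OF km(1)]) (use km(3) sh(2,3) in simp_all)
    next
      fix cs A assume sh: "shape ?V ?E cyc5 {1, 2, 3, 4, 5} cs A" "A 3 = {}" "A 4 = {}" "A 5 = {}" "A 1 \<noteq> {} \<or> A 2 \<noteq> {}"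
      have "\<exists>k m. modelled G {1, 2, 3, 4, 5} cyc5 k m \<and> (\<forall>i. i \<notin> {1, 2, 3, 4, 5} \<longrightarrow> k i = 0 \<and> m i = 0) \<and> (\<forall>i\<in>{1, 2, 3, 4, 5}. A i = {} \<longleftrightarrow> k i = 0 \<and> m i = 0)"
        by (rule emb[OF sh(1) sym_cyc5]) (rule cyc5_core(3))
      then obtain k m where km: "modelled G {1, 2, 3, 4, 5} cyc5 k m"
        "\<forall>i. i \<notin> {1, 2, 3, 4, 5} \<longrightarrow> k i = 0 \<and> m i = 0"
        "\<forall>i\<in>{1, 2, 3, 4, 5}. A i = {} \<longleftrightarrow> k i = 0 \<and> m i = 0" by blast
      have "k i = 0 \<and> m i = 0" if "i \<notin> {1, 2}" for i
      proof (cases "i \<in> {3, 4, 5}")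
        case True then show ?thesis using km(3) sh(2-4) by (elim insertE emptyE) simp_all
      next
        case False then show ?thesis using km(2) that by simp
      qed
      moreover have "k 1 + m 1 \<noteq> 0 \<or> k 2 + m 2 \<noteq> 0" using km(3) sh(5) by simp
      ultimately show thesis by (rule that(4)[OF km(1)])
    qed
  qed
qed

theorem theorem5p1:
  fixes G :: "'a pair_pre_digraph"
  assumes "pair_graph G"
    and "cactus G"
    and "rad G = 2"
    and "diam G = 3"
  shows "packing_critical G \<longleftrightarrow>
      digraph_iso G (path_graph 4)
    \<or> (\<exists>m\<^sub>1\<ge>2. digraph_iso G (cactus_G 5 [(0, m\<^sub>1)]))
    \<or> digraph_iso G (cactus_G 4 [(1, 0), (1, 0)])
    \<or> (\<exists>m\<^sub>1\<ge>1. \<exists>m\<^sub>2\<ge>1. digraph_iso G (cactus_G 4 [(0, m\<^sub>1), (0, m\<^sub>2)]))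
    \<or> digraph_iso G (cactus_G 3 [(1, 0), (1, 0), (1, 0)])
    \<or> digraph_iso G (cactus_G 3 [(2, 0), (2, 0), (0, 1)])
    \<or> (\<exists>m\<^sub>1\<ge>2. \<exists>m\<^sub>2\<ge>2. \<exists>m\<^sub>3\<ge>2.
          digraph_iso G (cactus_G 3 [(0, m\<^sub>1), (0, m\<^sub>2), (0, m\<^sub>3)]))
    \<or> (\<exists>m\<^sub>1\<ge>2. \<exists>m\<^sub>2\<ge>2.
          digraph_iso G (cactus_G 3 [(0, m\<^sub>1), (0, m\<^sub>2), (2, 0)]))
    \<or> (\<exists>m\<^sub>1\<ge>2. digraph_iso G (cactus_G 3 [(0, m\<^sub>1), (2, 0), (2, 0)]))
    \<or> digraph_iso G (cactus_H (2, 0) (0, 1))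
    \<or> (\<exists>m\<^sub>1\<ge>2. \<exists>m\<^sub>2\<ge>2. digraph_iso G (cactus_H (0, m\<^sub>1) (0, m\<^sub>2)))
    \<or> (\<exists>m\<^sub>1\<ge>2. digraph_iso G (cactus_H (0, m\<^sub>1) (2, 0)))"
    (is "_ \<longleftrightarrow> ?families")
proof
  assume crit: "packing_critical G"
  show ?families
  proof (cases rule: cactus_modelled[OF assms])
    case (1 k m)
    from edge_core_critical[OF assms(1) 1(1) crit 1(2)] show ?thesis by blast
  next
    case (2 k m)
    from triangle_core_critical[OF assms(1) 2(1) crit 2(2)] show ?thesis by blast
  next
    case (3 k m)
    have "crit (attV {1, 2, 3, 4} k m) (attE cyc4 {1, 2, 3, 4} k m)"
      using modelled_crit[OF 3(1)] crit unfolding packing_critical_iff_crit[OF assms(1)] by simp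
    from cyc4_crit_types[OF 3(2-5) this] have types: "k 1 = 1 \<and> k 2 = 1 \<and> m 1 = 0 \<and> m 2 = 0 \<or> k 1 = 0 \<and> k 2 = 0 \<and> m 1 \<ge> 1 \<and> m 2 \<ge> 1" .
    note iso = modelled_cyc4[OF assms(1) 3]
    from types show ?thesis
    proof
      assume "k 1 = 1 \<and> k 2 = 1 \<and> m 1 = 0 \<and> m 2 = 0"
      then show ?thesis using iso by simp
    next
      assume "k 1 = 0 \<and> k 2 = 0 \<and> m 1 \<ge> 1 \<and> m 2 \<ge> 1"
      then have "\<exists>m\<^sub>1\<ge>1. \<exists>m\<^sub>2\<ge>1. digraph_iso G (cactus_G 4 [(0, m\<^sub>1), (0, m\<^sub>2)])" using iso by auto
      then show ?thesis by blast
    qed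
  next
    case (4 k m)
    have "crit (attV {1, 2, 3, 4, 5} k m) (attE cyc5 {1, 2, 3, 4, 5} k m)"
      using modelled_crit[OF 4(1)] crit unfolding packing_critical_iff_crit[OF assms(1)] by simp
    note types = cyc5_crit_types[OF 4(2) this]
    then have "m 1 \<ge> 2 \<and> m 2 = 0 \<or> m 2 \<ge> 2 \<and> m 1 = 0" using 4(3) by auto
    then have "\<exists>a b. (a = 1 \<and> b = 2 \<or> a = 2 \<and> b = 1) \<and> m a \<ge> 2 \<and> m b = 0" by blast
    then obtain a b where ab: "a = 1 \<and> b = 2 \<or> a = 2 \<and> b = 1" "m a \<ge> 2" "m b = 0" by blast
    have z: "k i = 0 \<and> m i = 0" if "i \<noteq> a" for i using 4(2)[of i] types ab that by (cases "i = b") auto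
    have "k a = 0" using types ab(1) by auto
    then have "digraph_iso G (cactus_G 5 [(0, m a)])" using modelled_cyc5[OF assms(1) 4(1) ab(1)] z by blast
    then show ?thesis using ab(2) by blast
  qed
next
  have transfer: "packing_critical G" if "digraph_iso G H" "pair_graph H" "packing_critical H" for H :: "cactus_vertex pair_pre_digraph"
    using packing_critical_iso[OF assms(1) that(2,1)] that(3) by simp
  assume ?families
  then show "packing_critical G"
  proof (elim disjE exE conjE)
    assume "digraph_iso G (path_graph 4)"
    then have "digraph_iso G (cactus_H (1, 0) (1, 0))" using path_graph_4_iso by (rule digraph_iso_trans)
    then show ?thesis using pair_graph_families(1) critical_path4 by (rule transfer)
  next
    fix m1 :: nat assume "m1 \<ge> 2" "digraph_iso G (cactus_G 5 [(0, m1)])"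
    then show ?thesis using transfer[OF _ pair_graph_families(4)] critical_cyc5 by blast
  next
    assume "digraph_iso G (cactus_G 4 [(1, 0), (1, 0)])"
    then show ?thesis using pair_graph_families(3) critical_cyc4(1) by (rule transfer)
  next
    fix m1 m2 :: nat assume "m1 \<ge> 1" "m2 \<ge> 1" "digraph_iso G (cactus_G 4 [(0, m1), (0, m2)])"
    then show ?thesis using transfer[OF _ pair_graph_families(3)] critical_cyc4(2) by blast
  next
    assume "digraph_iso G (cactus_G 3 [(1, 0), (1, 0), (1, 0)])"
    then show ?thesis using pair_graph_families(2) critical_net by (rule transfer)
  next
    assume "digraph_iso G (cactus_G 3 [(2, 0), (2, 0), (0, 1)])"
    then show ?thesis by (rule transfer[OF _ pair_graph_families(2) critical_triangle]) auto
  next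
    fix m1 m2 m3 :: nat
    assume "m1 \<ge> 2" "m2 \<ge> 2" "m3 \<ge> 2" and iso: "digraph_iso G (cactus_G 3 [(0, m1), (0, m2), (0, m3)])"
    then show ?thesis by (intro transfer[OF iso pair_graph_families(2) critical_triangle]) auto
  next
    fix m1 m2 :: nat
    assume "m1 \<ge> 2" "m2 \<ge> 2" and iso: "digraph_iso G (cactus_G 3 [(0, m1), (0, m2), (2, 0)])"
    then show ?thesis by (intro transfer[OF iso pair_graph_families(2) critical_triangle]) auto
  next
    fix m1 :: nat assume "m1 \<ge> 2" and iso: "digraph_iso G (cactus_G 3 [(0, m1), (2, 0), (2, 0)])"
    then show ?thesis by (intro transfer[OF iso pair_graph_families(2) critical_triangle]) auto
  next
    assume "digraph_iso G (cactus_H (2, 0) (0, 1))"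
    then show ?thesis by (rule transfer[OF _ pair_graph_families(1) critical_H]) auto
  next
    fix m1 m2 :: nat
    assume "m1 \<ge> 2" "m2 \<ge> 2" and iso: "digraph_iso G (cactus_H (0, m1) (0, m2))"
    then show ?thesis by (intro transfer[OF iso pair_graph_families(1) critical_H]) auto
  next
    fix m1 :: nat assume "m1 \<ge> 2" and iso: "digraph_iso G (cactus_H (0, m1) (2, 0))"
    then show ?thesis by (intro transfer[OF iso pair_graph_families(1) critical_H]) auto
  qed
qed

end
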